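(* Let $f:\mathbb{R}^2\to\mathbb{R}$ be a Borel function with $\mathbb{E}|f(S_T,I_T)|^2<\infty$ satisfying $$|f(x,y_1)-f(x,y_2)|\le C(1+|x|^p+|y_1|^p+|y_2|^p)|y_1-y_2|\qquad\text{for all }x,y_1,y_2,$$ for some constants $C,p>0$. Assume that $\mathbb{P}((S_T,I_T)\notin\mathscr{D}_f)=0$, with $\mathscr{D}_f:=\{(x,y)\in\mathbb{R}^+\times\mathbb{R}^+ : \partial_2f(x,y)\text{ exists}\}$, where $\partial_2f$ denotes the partial derivative of $f$ with respect to its second variable. Let $\beta\in(0,1)$, $\gamma_1=2$, $\gamma_2=2-2\beta$, and set $$E_n=\frac{1}{n^{\gamma_1}}\sum_{i=1}^{n^{\gamma_1}}f\big(\hat S_{T,i},\hat I^{n^\beta}_{T,i}\big)+\frac{1}{n^{\gamma_2}}\sum_{i=1}^{n^{\gamma_2}}\Big(f\big(S_{T,i},I^n_{T,i}\big)-f\big(S_{T,i},I^{n^\beta}_{T,i}\big)\Big).$$ Then, as $n\to\infty$, in distribution, $$n\big(E_n-\mathbb{E}f(S_T,I_T)\big)\Longrightarrow\hat\sigma_2\hat G+\hat{\mathbb{E}}\big(\partial_2f(S_T,I_T)\chi_T\big),$$ where $\hat\sigma_2^2=\mathrm{Var}(f(S_T,I_T))+\widehat{\mathrm{Var}}(\partial_2f(S_T,I_T)\chi_T)$ and $\hat G$ is a standard normal random variable.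
   Context: $T>0$, $S_0>0$, and $\sigma>0$, $r$ are real constants. $(W_t)_{t\in[0,T]}$ is a standard Brownian motion on a stochastic basis $\mathcal{B}$, and $S_t=S_0\exp((r-\sigma^2/2)t+\sigma W_t)$. $I_T=\frac1T\int_0^TS_u\,du$. The trapezoidal scheme with $n$ steps is $$I^n_T=\frac{\delta}{T}\sum_{k=1}^nS_{t_{k-1}}\Big(1+\frac{r\delta}{2}+\sigma\frac{W_{t_k}-W_{t_{k-1}}}{2}\Big),\qquad\delta=\frac Tn,\ t_k=k\delta.$$ $\chi_T=\frac{\sigma}{2\sqrt3}\int_0^TS_s\,dB'_s$, where $B'$ is a standard Brownian motion independent of $W$ on an extension $\hat{\mathcal{B}}$ of $\mathcal{B}$; $\hat{\mathbb{E}}$, $\widehat{\mathrm{Var}}$ are expectation and variance on the extension. Sampling: non-integer powers $n^\beta$, $n^{\gamma_2}$ used as numbers of steps or samples are understood as their integer parts. $(S_{T,i},I^n_{T,i},I^{n^\beta}_{T,i})_{i\ge1}$ are independent copies of $(S_T,I^n_T,I^{n^\beta}_T)$, the three components of each copy being built from the same Brownian path; $(\hat S_{T,i},\hat I^{n^\beta}_{T,i})_{i\ge1}$ are independent copies of $(S_T,I^{n^\beta}_T)$, independent of the former. *)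

theory Defs
  imports "HOL-Probability.Probability"
begin

section \<open>Stochastic bases and Brownian motion on a finite horizon\<close>

definition stochastic_basis :: "'a measure \<Rightarrow> (real \<Rightarrow> 'a measure) \<Rightarrow> real \<Rightarrow> bool" where
  "stochastic_basis M F T \<longleftrightarrow> prob_space M \<and>
     (\<forall>t\<in>{0..T}. subalgebra M (F t)) \<and>
     (\<forall>s\<in>{0..T}. \<forall>t\<in>{s..T}. subalgebra (F t) (F s))"

definition standard_brownian_motion ::
    "'a measure \<Rightarrow> (real \<Rightarrow> 'a measure) \<Rightarrow> real \<Rightarrow> (real \<Rightarrow> 'a \<Rightarrow> real) \<Rightarrow> bool" where
  "standard_brownian_motion M F T W \<longleftrightarrow>
     (\<forall>t\<in>{0..T}. W t \<in> borel_measurable (F t)) \<and>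
     (AE \<omega> in M. W 0 \<omega> = 0) \<and>
     (\<forall>\<omega>\<in>space M. continuous_on {0..T} (\<lambda>t. W t \<omega>)) \<and>
     (\<forall>s t. 0 \<le> s \<and> s < t \<and> t \<le> T \<longrightarrow>
        distributed M lborel (\<lambda>\<omega>. W t \<omega> - W s \<omega>) (normal_density 0 (sqrt (t - s))) \<and>
        prob_space.indep_set M (sets (F s))
          {(\<lambda>\<omega>. W t \<omega> - W s \<omega>) -` A \<inter> space M | A. A \<in> sets borel})"

text \<open>An extension is a second basis together with a filtration-compatible, measure-preserving
  projection \<open>\<pi>\<close> onto the first one; random variables are lifted by composition with \<open>\<pi>\<close>. For the
  usual product construction, \<open>\<pi>\<close> is \<^const>\<open>fst\<close>.\<close>

definition basis_extension ::
    "'a measure \<Rightarrow> (real \<Rightarrow> 'a measure) \<Rightarrow> 'b measure \<Rightarrow> (real \<Rightarrow> 'b measure) \<Rightarrow> real \<Rightarrow> ('b \<Rightarrow> 'a) \<Rightarrow> bool"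
  where
  "basis_extension M F Mh Fh T \<pi> \<longleftrightarrow>
     stochastic_basis M F T \<and> stochastic_basis Mh Fh T \<and>
     \<pi> \<in> measurable Mh M \<and> distr Mh M \<pi> = M \<and>
     (\<forall>t\<in>{0..T}. \<pi> \<in> measurable (Fh t) (F t))"

text \<open>Independence of two processes: independence of their restrictions to \<open>I\<close>, seen as random
  elements of the product space \<open>\<real>\<^sup>I\<close> with its cylinder \<open>\<sigma>\<close>-algebra.\<close>

definition indep_processes ::
    "'a measure \<Rightarrow> 'i set \<Rightarrow> ('i \<Rightarrow> 'a \<Rightarrow> 'x::topological_space) \<Rightarrow> ('i \<Rightarrow> 'a \<Rightarrow> 'y::topological_space) \<Rightarrow> bool"
  where
  "indep_processes M I X Y \<longleftrightarrow>
     prob_space.indep_set M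
       (sets (vimage_algebra (space M) (\<lambda>\<omega>. \<lambda>i\<in>I. X i \<omega>) (PiM I (\<lambda>_. borel))))
       (sets (vimage_algebra (space M) (\<lambda>\<omega>. \<lambda>i\<in>I. Y i \<omega>) (PiM I (\<lambda>_. borel))))"

section \<open>The Ito integral over $[0,T]$\<close>

text \<open>The simple process given by \<open>k\<close>, \<open>\<tau>\<close>, \<open>\<xi>\<close> is
  \<open>\<Sum>j<k. \<xi>\<^sub>j 1\<^bsub>(\<tau>\<^sub>j, \<tau>\<^sub>j\<^sub>+\<^sub>1]\<^esub>\<close>.\<close>

definition simple_integrand ::
    "(real \<Rightarrow> 'a measure) \<Rightarrow> real \<Rightarrow> nat \<Rightarrow> (nat \<Rightarrow> real) \<Rightarrow> (nat \<Rightarrow> 'a \<Rightarrow> real) \<Rightarrow> bool" where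
  "simple_integrand F T k \<tau> \<xi> \<longleftrightarrow>
     0 \<le> \<tau> 0 \<and> \<tau> k \<le> T \<and> (\<forall>j<k. \<tau> j \<le> \<tau> (Suc j)) \<and>
     (\<forall>j<k. \<xi> j \<in> borel_measurable (F (\<tau> j)) \<and>
        (\<exists>b. \<forall>\<omega>\<in>space (F (\<tau> j)). \<bar>\<xi> j \<omega>\<bar> \<le> b))"

definition simple_process ::
    "nat \<Rightarrow> (nat \<Rightarrow> real) \<Rightarrow> (nat \<Rightarrow> 'a \<Rightarrow> real) \<Rightarrow> real \<Rightarrow> 'a \<Rightarrow> real" where
  "simple_process k \<tau> \<xi> t \<omega> = (\<Sum>j<k. \<xi> j \<omega> * indicator {\<tau> j<..\<tau> (Suc j)} t)"

definition simple_ito_integral ::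
    "nat \<Rightarrow> (nat \<Rightarrow> real) \<Rightarrow> (nat \<Rightarrow> 'a \<Rightarrow> real) \<Rightarrow> (real \<Rightarrow> 'a \<Rightarrow> real) \<Rightarrow> 'a \<Rightarrow> real" where
  "simple_ito_integral k \<tau> \<xi> B \<omega> = (\<Sum>j<k. \<xi> j \<omega> * (B (\<tau> (Suc j)) \<omega> - B (\<tau> j) \<omega>))"

text \<open>\<open>J\<close> is a version of \<open>\<integral>\<^sub>0\<^sup>T H\<^sub>s dB\<^sub>s\<close>, the \<open>L\<^sup>2\<close> extension of the elementary integral.
  By the Ito isometry \<open>J\<close> is determined almost surely and does not depend on the
  approximating sequence.\<close>

definition has_ito_integral ::
    "'a measure \<Rightarrow> (real \<Rightarrow> 'a measure) \<Rightarrow> real \<Rightarrow> (real \<Rightarrow> 'a \<Rightarrow> real) \<Rightarrow> (real \<Rightarrow> 'a \<Rightarrow> real) \<Rightarrow> ('a \<Rightarrow> real) \<Rightarrow> bool"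
  where
  "has_ito_integral M F T B H J \<longleftrightarrow> J \<in> borel_measurable M \<and>
     (\<exists>k \<tau> \<xi>. (\<forall>m. simple_integrand F T (k m) (\<tau> m) (\<xi> m)) \<and>
        (\<lambda>m. \<integral>\<^sup>+\<omega>. (\<integral>\<^sup>+t\<in>{0..T}. ennreal ((simple_process (k m) (\<tau> m) (\<xi> m) t \<omega> - H t \<omega>)\<^sup>2) \<partial>lborel) \<partial>M)
          \<longlonglongrightarrow> 0 \<and>
        (\<lambda>m. \<integral>\<^sup>+\<omega>. ennreal ((simple_ito_integral (k m) (\<tau> m) (\<xi> m) B \<omega> - J \<omega>)\<^sup>2) \<partial>M)
          \<longlonglongrightarrow> 0)"

section \<open>The Black--Scholes model and the trapezoidal scheme\<close>

definition asset_price ::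
    "real \<Rightarrow> real \<Rightarrow> real \<Rightarrow> (real \<Rightarrow> 'a \<Rightarrow> real) \<Rightarrow> real \<Rightarrow> 'a \<Rightarrow> real" where
  "asset_price S0 r \<sigma> W t \<omega> = S0 * exp ((r - \<sigma>\<^sup>2 / 2) * t + \<sigma> * W t \<omega>)"

definition average_price ::
    "real \<Rightarrow> real \<Rightarrow> real \<Rightarrow> real \<Rightarrow> (real \<Rightarrow> 'a \<Rightarrow> real) \<Rightarrow> 'a \<Rightarrow> real" where
  "average_price T S0 r \<sigma> W \<omega> = 1 / T * (LINT u:{0..T}|lborel. asset_price S0 r \<sigma> W u \<omega>)"

definition trapezoidal_scheme ::
    "real \<Rightarrow> real \<Rightarrow> real \<Rightarrow> real \<Rightarrow> (real \<Rightarrow> 'a \<Rightarrow> real) \<Rightarrow> nat \<Rightarrow> 'a \<Rightarrow> real" where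
  "trapezoidal_scheme T S0 r \<sigma> W n \<omega> =
     (let \<delta> = T / real n; t = (\<lambda>k. real k * \<delta>) in
      \<delta> / T * (\<Sum>k=1..n. asset_price S0 r \<sigma> W (t (k - 1)) \<omega> *
        (1 + r * \<delta> / 2 + \<sigma> * ((W (t k) \<omega> - W (t (k - 1)) \<omega>) / 2))))"

section \<open>Partial derivative in the second variable\<close>

definition partial2 :: "(real \<times> real \<Rightarrow> real) \<Rightarrow> real \<times> real \<Rightarrow> real" where
  "partial2 f z = deriv (\<lambda>y. f (fst z, y)) (snd z)"

definition partial2_domain :: "(real \<times> real \<Rightarrow> real) \<Rightarrow> (real \<times> real) set" where
  "partial2_domain f =
     {(x, y). 0 \<le> x \<and> 0 \<le> y \<and> (\<lambda>y'. f (x, y')) field_differentiable (at y)}"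

section \<open>Independent copies and the two-level estimator\<close>

definition iid_copies ::
    "'c measure \<Rightarrow> (nat \<Rightarrow> 'c \<Rightarrow> 'x::topological_space) \<Rightarrow> 'a measure \<Rightarrow> ('a \<Rightarrow> 'x) \<Rightarrow> bool" where
  "iid_copies N X M Z \<longleftrightarrow>
     prob_space.indep_vars N (\<lambda>_. borel) X {1..} \<and>
     (\<forall>i\<ge>1. distr N borel (X i) = distr M borel Z)"

definition floor_powr :: "nat \<Rightarrow> real \<Rightarrow> nat" where
  "floor_powr n a = nat \<lfloor>real n powr a\<rfloor>"

text \<open>\<open>Y i\<close> is the \<open>i\<close>-th coarse pair, and \<open>X i\<close> the \<open>i\<close>-th triple whose last two components are the
  fine and the coarse average.\<close>

definition two_level_estimator ::
    "(real \<times> real \<Rightarrow> real) \<Rightarrow> nat \<Rightarrow> nat \<Rightarrow>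
     (nat \<Rightarrow> 'c \<Rightarrow> real \<times> real) \<Rightarrow> (nat \<Rightarrow> 'c \<Rightarrow> real \<times> real \<times> real) \<Rightarrow> 'c \<Rightarrow> real" where
  "two_level_estimator f N1 N2 Y X \<omega> =
     1 / real N1 * (\<Sum>i=1..N1. f (Y i \<omega>)) +
     1 / real N2 * (\<Sum>i=1..N2. case X i \<omega> of (x, y1, y2) \<Rightarrow> f (x, y1) - f (x, y2))"

end

theory Submission
  imports Defs
begin

text \<open>Up to a term that vanishes in \<open>L\<^sup>2\<close>, the normalised error \<open>n (I\<^sup>n - I)\<close> is \<open>-\<sigma>\<close> times a sum over
  the \<open>n\<close> steps of the price at the left end point times the area under a discrete Brownian bridge,
  taken on a mesh that refines the step. Reversing the order of the increments inside one step
  preserves the joint law and all values on the coarse grid, but changes the sign of that bridge.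
  Hence, weighted by a function of \<open>(S\<^sub>T, I\<^sub>T)\<close>, the normalised error has mean tending to \<open>0\<close> and second
  moment tending to the weighted mean of \<open>\<sigma>\<^sup>2 / 12 \<integral> S\<^sub>u\<^sup>2 du\<close>; by the Ito isometry, the moments of
  \<open>chi\<close> given \<open>W\<close> are the same. No more is needed of the stable convergence to \<open>chi\<close>, because the
  summands enter a central limit theorem only through their first two moments and a Lindeberg
  condition: the characteristic function of \<open>n (E\<^sub>n - E f(S\<^sub>T, I\<^sub>T))\<close> is the product of one factor for
  the coarse level, where the summands tend to \<open>f (S\<^sub>T, I\<^sub>T)\<close>, one factor for the corrections, where
  the coarse error dominates and \<open>n\<^sup>2 / n\<^bsup>\<gamma>2\<^esup>\<close> compensates \<open>n\<^bsup>2\<beta>\<^esup>\<close>, and one for the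
  bias, which vanishes like \<open>E (\<partial>\<^sub>2f chi) = 0\<close>.\<close>

section \<open>Families with uniformly bounded moments\<close>

text \<open>Two obstacles shape the proof: the derivative of the payoff is merely a Borel function,
  and I_T is not a function of the coarse grid. The reversal argument is exact for weights in (S_T,
  I^n); for a continuous weight, pathwise convergence of I^n moves it to (S_T, I_T). Square
  integrable Borel weights are then reached by weak convergence in L^2, because the weights against
  which an L^2-bounded sequence tends to 0 form a closed space that contains all indicators as soon
  as it contains the bounded continuous functions. The square of the normalised error is treated as
  such a sequence too, so its fourth moment must be bounded; this is done by a discrete Gronwall
  argument. The mesh is refined separately for every n, so far that its Riemann sum differs from I_T
  by an amount that stays negligible after multiplication by n. The scheme and the leading error
  term are then functions of finitely many independent Gaussian increments. The constant 1/12 is the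
  integral of (1/2 - u)^2 over [0,1], the variance of the area under a standard Brownian
  bridge.\<close>

lemma power_mean_le:
  fixes a :: "nat \<Rightarrow> real"
  assumes "m > 0" "\<And>k. k < m \<Longrightarrow> 0 \<le> a k"
  shows "((\<Sum>k<m. a k) / real m) ^ q \<le> (\<Sum>k<m. a k ^ q) / real m"
proof -
  have cv: "convex_on {0::real..} (\<lambda>x. x^q)"
  proof (cases "even q")
    case True
    then show ?thesis using convex_power_even convex_on_subset by blast
  next
    case False
    then show ?thesis using convex_power_odd by blast
  qed
  have "(\<Sum>k<m. (1 / real m) *\<^sub>R a k) ^ q \<le> (\<Sum>k<m. (1 / real m) * a k ^ q)"
    using assms by (intro convex_on_sum[OF _ _ cv]) (auto simp: lessThan_empty_iff)
  then show ?thesis by (simp add: sum_divide_distrib)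
qed

lemma power_add_le: "\<bar>x + y :: real\<bar> ^ q \<le> 2 ^ q * (\<bar>x\<bar> ^ q + \<bar>y\<bar> ^ q)"
proof -
  let ?m = "max \<bar>x\<bar> \<bar>y\<bar>"
  have "\<bar>x + y\<bar> ^ q \<le> (2 * ?m) ^ q" by (intro power_mono) auto
  also have "\<dots> = 2 ^ q * ?m ^ q" by (simp add: power_mult_distrib)
  also have "?m ^ q \<le> \<bar>x\<bar> ^ q + \<bar>y\<bar> ^ q" by (auto simp: max_def)
  finally show ?thesis by simp
qed

lemma abs_mult_le_squares: "\<bar>x * y :: real\<bar> \<le> x\<^sup>2 + y\<^sup>2"
proof -
  have "2 * (\<bar>x\<bar> * \<bar>y\<bar>) \<le> x\<^sup>2 + y\<^sup>2" using sum_squares_bound[of "\<bar>x\<bar>" "\<bar>y\<bar>"] by simp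
  moreover have "0 \<le> \<bar>x\<bar> * \<bar>y\<bar>" by simp
  ultimately show ?thesis unfolding abs_mult by linarith
qed

text \<open>Replaces the real exponent \<open>p\<close> of the growth condition by an integer one,
  so that only moments of integer order have to be tracked.\<close>

lemma powr_le_power:
  assumes "p > 0"
  shows "\<bar>x::real\<bar> powr p \<le> 1 + \<bar>x\<bar> ^ nat \<lceil>p\<rceil>"
proof (cases "\<bar>x\<bar> \<le> 1")
  case True
  then have "\<bar>x\<bar> powr p \<le> 1" using assms powr_le1[of p "\<bar>x\<bar>"] by simp
  also have "1 \<le> 1 + \<bar>x\<bar> ^ nat \<lceil>p\<rceil>" by simp
  finally show ?thesis .
next
  case False
  have "p \<le> real (nat \<lceil>p\<rceil>)" by linarith
  then have "\<bar>x\<bar> powr p \<le> \<bar>x\<bar> powr (real (nat \<lceil>p\<rceil>))"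
    using False by (intro powr_mono) auto
  also have "\<dots> = \<bar>x\<bar> ^ nat \<lceil>p\<rceil>" using False by (intro powr_realpow) auto
  finally show ?thesis by simp
qed

context prob_space
begin

text \<open>Moments of all integer orders are demanded at once because this makes the class closed
  under sums, products, powers and averages; integrability goals then reduce to the shape of the
  expression. The bound may depend on the order but not on the index.\<close>

definition bounded_moments :: "'i set \<Rightarrow> ('i \<Rightarrow> 'a \<Rightarrow> real) \<Rightarrow> bool" where
  "bounded_moments A U \<longleftrightarrow> (\<forall>i\<in>A. U i \<in> borel_measurable M) \<and>
     (\<forall>q::nat. \<exists>B. \<forall>i\<in>A. integrable M (\<lambda>w. \<bar>U i w\<bar> ^ q) \<and> expectation (\<lambda>w. \<bar>U i w\<bar> ^ q) \<le> B)"

text \<open>A single variable is a family indexed by \<open>unit\<close>, so the closure rules for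
  families apply to it unchanged.\<close>

abbreviation all_moments :: "('a \<Rightarrow> real) \<Rightarrow> bool" where
  "all_moments X \<equiv> bounded_moments UNIV (\<lambda>_::unit. X)"

lemma bounded_moments_measurable: "bounded_moments A U \<Longrightarrow> i \<in> A \<Longrightarrow> U i \<in> borel_measurable M"
  by (auto simp: bounded_moments_def)

lemma bounded_moments_integrable_abs_power:
  "bounded_moments A U \<Longrightarrow> i \<in> A \<Longrightarrow> integrable M (\<lambda>w. \<bar>U i w\<bar> ^ q)"
  unfolding bounded_moments_def by meson

lemma bounded_moments_integrable_power:
  "bounded_moments A U \<Longrightarrow> i \<in> A \<Longrightarrow> integrable M (\<lambda>w. U i w ^ q)"
  by (rule Bochner_Integration.integrable_bound[OF bounded_moments_integrable_abs_power[where q=q]])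
     (auto simp: power_abs bounded_moments_def)

lemma bounded_moments_bound:
  assumes "bounded_moments A U"
  obtains B where "B > 0" "\<And>i. i \<in> A \<Longrightarrow> expectation (\<lambda>w. \<bar>U i w\<bar> ^ q) \<le> B"
proof -
  obtain B where "\<forall>i\<in>A. expectation (\<lambda>w. \<bar>U i w\<bar> ^ q) \<le> B"
    using assms unfolding bounded_moments_def by meson
  then show ?thesis by (intro that[of "max B 1"]) (auto simp: le_max_iff_disj)
qed

lemma all_moments_measurable: "all_moments X \<Longrightarrow> X \<in> borel_measurable M"
  by (auto simp: bounded_moments_def)

lemma all_moments_integrable: "all_moments X \<Longrightarrow> integrable M X"
  using bounded_moments_integrable_power[of UNIV "\<lambda>_. X" "()" 1] by simp

lemma bounded_moments_subfamily:
  "bounded_moments A U \<Longrightarrow> (\<And>j. j \<in> B \<Longrightarrow> g j \<in> A) \<Longrightarrow> bounded_moments B (\<lambda>j. U (g j))"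
  unfolding bounded_moments_def by meson

lemma bounded_moments_member: "bounded_moments A U \<Longrightarrow> i \<in> A \<Longrightarrow> all_moments (U i)"
  by (rule bounded_moments_subfamily[where g="\<lambda>_. i"]) auto

lemma bounded_momentsI:
  assumes "\<And>i. i \<in> A \<Longrightarrow> U i \<in> borel_measurable M"
    and "\<And>q. \<exists>B. \<forall>i\<in>A. \<exists>V. integrable M V \<and> (AE w in M. \<bar>U i w\<bar> ^ q \<le> V w) \<and> expectation V \<le> B"
  shows "bounded_moments A U"
  unfolding bounded_moments_def
proof (intro conjI allI ballI)
  fix q
  obtain B where B: "\<And>i. i \<in> A \<Longrightarrow> \<exists>V. integrable M V \<and> (AE w in M. \<bar>U i w\<bar> ^ q \<le> V w) \<and> expectation V \<le> B"
    using assms(2)[of q] by auto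
  show "\<exists>B. \<forall>i\<in>A. integrable M (\<lambda>w. \<bar>U i w\<bar> ^ q) \<and> expectation (\<lambda>w. \<bar>U i w\<bar> ^ q) \<le> B"
  proof (intro exI ballI conjI)
    fix i assume i: "i \<in> A"
    note [measurable] = assms(1)[OF i]
    obtain V where V: "integrable M V" "AE w in M. \<bar>U i w\<bar> ^ q \<le> V w" "expectation V \<le> B"
      using B[OF i] by auto
    show int: "integrable M (\<lambda>w. \<bar>U i w\<bar> ^ q)"
      by (rule Bochner_Integration.integrable_bound[OF V(1)]) (use V(2) in auto)
    show "expectation (\<lambda>w. \<bar>U i w\<bar> ^ q) \<le> B"
      using integral_mono_AE[OF int V(1,2)] V(3) by simp
  qed
qed (use assms(1) in auto)

lemma bounded_moments_mono:
  assumes "bounded_moments A U" "\<And>i. i \<in> A \<Longrightarrow> V i \<in> borel_measurable M"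
    "\<And>i. i \<in> A \<Longrightarrow> AE w in M. \<bar>V i w\<bar> \<le> \<bar>U i w\<bar>"
  shows "bounded_moments A V"
proof (rule bounded_momentsI)
  fix q
  obtain B where B: "\<And>i. i \<in> A \<Longrightarrow> expectation (\<lambda>w. \<bar>U i w\<bar> ^ q) \<le> B"
    using bounded_moments_bound[OF assms(1)] by metis
  show "\<exists>B. \<forall>i\<in>A. \<exists>W. integrable M W \<and> (AE w in M. \<bar>V i w\<bar> ^ q \<le> W w) \<and> expectation W \<le> B"
  proof (intro exI[of _ B] ballI)
    fix i assume i: "i \<in> A"
    show "\<exists>W. integrable M W \<and> (AE w in M. \<bar>V i w\<bar> ^ q \<le> W w) \<and> expectation W \<le> B"
      using assms(3)[OF i] B[OF i] bounded_moments_integrable_abs_power[OF assms(1) i]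
      by (intro exI[of _ "\<lambda>w. \<bar>U i w\<bar> ^ q"]) (auto elim!: eventually_mono intro: power_mono)
  qed
qed (use assms in auto)

lemma bounded_moments_add:
  assumes U: "bounded_moments A U" and V: "bounded_moments A V"
  shows "bounded_moments A (\<lambda>i w. U i w + V i w)"
proof (rule bounded_momentsI)
  fix q
  obtain B where B: "\<And>i. i \<in> A \<Longrightarrow> expectation (\<lambda>w. \<bar>U i w\<bar> ^ q) \<le> B"
    using bounded_moments_bound[OF U] by metis
  obtain B' where B': "\<And>i. i \<in> A \<Longrightarrow> expectation (\<lambda>w. \<bar>V i w\<bar> ^ q) \<le> B'"
    using bounded_moments_bound[OF V] by metis
  show "\<exists>B. \<forall>i\<in>A. \<exists>W. integrable M W \<and> (AE w in M. \<bar>U i w + V i w\<bar> ^ q \<le> W w) \<and> expectation W \<le> B"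
  proof (intro exI[of _ "2 ^ q * (B + B')"] ballI)
    fix i assume i: "i \<in> A"
    note I = bounded_moments_integrable_abs_power[OF U i, of q] bounded_moments_integrable_abs_power[OF V i, of q]
    show "\<exists>W. integrable M W \<and> (AE w in M. \<bar>U i w + V i w\<bar> ^ q \<le> W w) \<and> expectation W \<le> 2 ^ q * (B + B')"
      using I B[OF i] B'[OF i]
      by (intro exI[of _ "\<lambda>w. 2 ^ q * (\<bar>U i w\<bar> ^ q + \<bar>V i w\<bar> ^ q)"])
         (auto intro!: power_add_le add_mono)
  qed
qed (use U V in \<open>auto simp: bounded_moments_def intro!: borel_measurable_add borel_measurable_times\<close>)

text \<open>Order \<open>q\<close> of the product is paid for with order \<open>q * 2\<close> of the
  factors, which is the reason for controlling all orders together.\<close>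

lemma bounded_moments_mult:
  assumes U: "bounded_moments A U" and V: "bounded_moments A V"
  shows "bounded_moments A (\<lambda>i w. U i w * V i w)"
proof (rule bounded_momentsI)
  fix q
  obtain B where B: "\<And>i. i \<in> A \<Longrightarrow> expectation (\<lambda>w. \<bar>U i w\<bar> ^ (q * 2)) \<le> B"
    using bounded_moments_bound[OF U] by metis
  obtain B' where B': "\<And>i. i \<in> A \<Longrightarrow> expectation (\<lambda>w. \<bar>V i w\<bar> ^ (q * 2)) \<le> B'"
    using bounded_moments_bound[OF V] by metis
  have le: "\<bar>u * v\<bar> ^ q \<le> \<bar>u\<bar> ^ (q * 2) + \<bar>v\<bar> ^ (q * 2)" for u v :: real
    using abs_mult_le_squares[of "\<bar>u\<bar> ^ q" "\<bar>v\<bar> ^ q"]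
    by (simp add: abs_mult power_mult_distrib power_mult power_abs)
  show "\<exists>B. \<forall>i\<in>A. \<exists>W. integrable M W \<and> (AE w in M. \<bar>U i w * V i w\<bar> ^ q \<le> W w) \<and> expectation W \<le> B"
  proof (intro exI[of _ "B + B'"] ballI)
    fix i assume i: "i \<in> A"
    note I = bounded_moments_integrable_abs_power[OF U i, of "q*2"] bounded_moments_integrable_abs_power[OF V i, of "q*2"]
    show "\<exists>W. integrable M W \<and> (AE w in M. \<bar>U i w * V i w\<bar> ^ q \<le> W w) \<and> expectation W \<le> B + B'"
      using I B[OF i] B'[OF i]
      by (intro exI[of _ "\<lambda>w. \<bar>U i w\<bar> ^ (q*2) + \<bar>V i w\<bar> ^ (q*2)"])
         (auto intro!: le add_mono)
  qed
qed (use U V in \<open>auto simp: bounded_moments_def intro!: borel_measurable_add borel_measurable_times\<close>)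

lemma bounded_moments_const: "bounded_moments A (\<lambda>i w. c)"
  by (auto simp: bounded_moments_def prob_space)

lemma bounded_moments_bounded:
  assumes "\<And>i. i \<in> A \<Longrightarrow> U i \<in> borel_measurable M"
    and "\<And>i w. i \<in> A \<Longrightarrow> w \<in> space M \<Longrightarrow> \<bar>U i w\<bar> \<le> c"
  shows "bounded_moments A U"
  by (rule bounded_moments_mono[OF bounded_moments_const[of A c]])
     (use assms in \<open>auto intro!: AE_I2 order_trans[OF assms(2)]\<close>)

lemma bounded_moments_uminus: "bounded_moments A U \<Longrightarrow> bounded_moments A (\<lambda>i w. - U i w)"
  by (rule bounded_moments_mono[of A U]) (auto simp: bounded_moments_def intro!: borel_measurable_uminus borel_measurable_abs)

lemma bounded_moments_abs: "bounded_moments A U \<Longrightarrow> bounded_moments A (\<lambda>i w. \<bar>U i w\<bar>)"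
  by (rule bounded_moments_mono[of A U]) (auto simp: bounded_moments_def intro!: borel_measurable_uminus borel_measurable_abs)

lemma bounded_moments_diff:
  "bounded_moments A U \<Longrightarrow> bounded_moments A V \<Longrightarrow> bounded_moments A (\<lambda>i w. U i w - V i w)"
  using bounded_moments_add[OF _ bounded_moments_uminus, of A U V] by simp

lemma bounded_moments_divide:
  "bounded_moments A U \<Longrightarrow> bounded_moments A (\<lambda>i w. U i w / c)"
  using bounded_moments_mult[OF _ bounded_moments_const, of A U "1 / c"] by simp

lemma bounded_moments_power: "bounded_moments A U \<Longrightarrow> bounded_moments A (\<lambda>i w. U i w ^ k)"
  by (induction k) (auto intro: bounded_moments_mult bounded_moments_const)

lemma bounded_moments_sum:
  "(\<And>k. k \<in> K \<Longrightarrow> bounded_moments A (\<lambda>i. U i k)) \<Longrightarrow> bounded_moments A (\<lambda>i w. \<Sum>k\<in>K. U i k w)"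
  by (induction K rule: infinite_finite_induct) (auto intro: bounded_moments_add bounded_moments_const)

lemmas bounded_moments_intros = bounded_moments_add bounded_moments_mult bounded_moments_const
  bounded_moments_uminus bounded_moments_abs bounded_moments_diff bounded_moments_divide
  bounded_moments_power bounded_moments_sum

lemma bounded_moments_powr:
  assumes U: "bounded_moments A U" and p: "p > 0"
  shows "bounded_moments A (\<lambda>i w. \<bar>U i w\<bar> powr p)"
proof (rule bounded_moments_mono)
  show "bounded_moments A (\<lambda>i w. 1 + \<bar>U i w\<bar> ^ nat \<lceil>p\<rceil>)" 
    by (intro bounded_moments_add bounded_moments_const bounded_moments_power bounded_moments_abs U)
  fix i assume "i \<in> A"
  then have [measurable]: "U i \<in> borel_measurable M" using U by (simp add: bounded_moments_def)
  show "(\<lambda>w. \<bar>U i w\<bar> powr p) \<in> borel_measurable M" by measurable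
qed (use p in \<open>auto intro!: order_trans[OF powr_le_power]\<close>)

text \<open>By Jensen's inequality the bound of the terms is also one for their average, whatever
  the number \<open>m i\<close> of terms. The terms are indexed by pairs, so that uniformity in both
  indices is a single hypothesis.\<close>

lemma bounded_moments_average:
  assumes U: "bounded_moments (Sigma A (\<lambda>i. {..<m i})) (\<lambda>(i, k). U i k)"
    and m: "\<And>i. i \<in> A \<Longrightarrow> m i > 0"
  shows "bounded_moments A (\<lambda>i w. (\<Sum>k<m i. U i k w) / real (m i))"
proof (rule bounded_momentsI)
  have *[measurable]: "U i k \<in> borel_measurable M" if "i \<in> A" "k < m i" for i k
    using bounded_moments_measurable[OF U, of "(i,k)"] that by auto
  fix q
  obtain B where B: "\<And>i. i \<in> Sigma A (\<lambda>i. {..<m i}) \<Longrightarrow> expectation (\<lambda>w. \<bar>(case i of (i, k) \<Rightarrow> U i k) w\<bar> ^ q) \<le> B"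
    using bounded_moments_bound[OF U] by metis
  show "\<exists>B. \<forall>i\<in>A. \<exists>W. integrable M W \<and> (AE w in M. \<bar>(\<Sum>k<m i. U i k w) / real (m i)\<bar> ^ q \<le> W w) \<and> expectation W \<le> B"
  proof (intro exI[of _ B] ballI)
    fix i assume i: "i \<in> A"
    have I: "integrable M (\<lambda>w. \<bar>U i k w\<bar> ^ q)" if "k < m i" for k
      using bounded_moments_integrable_abs_power[OF U, of "(i,k)"] i that by auto
    have le: "\<bar>(\<Sum>k<m i. U i k w) / real (m i)\<bar> ^ q \<le> (\<Sum>k<m i. \<bar>U i k w\<bar> ^ q) / real (m i)" for w
    proof -
      have "\<bar>(\<Sum>k<m i. U i k w) / real (m i)\<bar> ^ q \<le> ((\<Sum>k<m i. \<bar>U i k w\<bar>) / real (m i)) ^ q"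
        by (intro power_mono) (auto intro!: divide_right_mono)
      also have "\<dots> \<le> (\<Sum>k<m i. \<bar>U i k w\<bar> ^ q) / real (m i)"
        by (rule power_mean_le) (use m[OF i] in auto)
      finally show ?thesis .
    qed
    have "expectation (\<lambda>w. (\<Sum>k<m i. \<bar>U i k w\<bar> ^ q) / real (m i)) = (\<Sum>k<m i. expectation (\<lambda>w. \<bar>U i k w\<bar> ^ q)) / real (m i)"
      using I by (simp add: Bochner_Integration.integral_sum)
    also have "\<dots> \<le> (\<Sum>k<m i. B) / real (m i)"
      using B[of "(i,_)"] i by (intro divide_right_mono sum_mono) auto
    also have "\<dots> = B" using m[OF i] by simp
    finally have E: "expectation (\<lambda>w. (\<Sum>k<m i. \<bar>U i k w\<bar> ^ q) / real (m i)) \<le> B" .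
    show "\<exists>W. integrable M W \<and> (AE w in M. \<bar>(\<Sum>k<m i. U i k w) / real (m i)\<bar> ^ q \<le> W w) \<and> expectation W \<le> B"
      by (intro exI[of _ "\<lambda>w. (\<Sum>k<m i. \<bar>U i k w\<bar> ^ q) / real (m i)"] conjI E AE_I2 le
          integrable_divide Bochner_Integration.integrable_sum I) auto
  qed
next
  fix i assume "i \<in> A"
  then show "(\<lambda>w. (\<Sum>k<m i. U i k w) / real (m i)) \<in> borel_measurable M"
    using bounded_moments_measurable[OF U, of "(i,_)"] by (intro borel_measurable_divide borel_measurable_sum) auto
qed

subsection \<open>Convergence in mean\<close>

text \<open>Truncation at a level \<open>K\<close> takes the place of uniform integrability: the
  truncated part converges by domination, and the excess over \<open>K\<close> is at most
  \<open>B / K\<close> in mean.\<close>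

lemma tendsto_L1_of_L2_bounded:
  assumes [measurable]: "\<And>n. U n \<in> borel_measurable M"
    and I: "\<And>n. integrable M (\<lambda>w. (U n w)\<^sup>2)" and B: "\<And>n. expectation (\<lambda>w. (U n w)\<^sup>2) \<le> B"
    and lim: "AE w in M. (\<lambda>n. U n w) \<longlonglongrightarrow> (0::real)"
  shows "(\<lambda>n. expectation (\<lambda>w. \<bar>U n w\<bar>)) \<longlonglongrightarrow> 0"
proof (rule LIMSEQ_I)
  fix e :: real assume e: "e > 0"
  have "0 \<le> B" using order_trans[OF _ B[of 0]] by simp
  define K where "K = 2 * (B + 1) / e"
  have K: "K > 0" "B / K < e / 2" using e \<open>0 \<le> B\<close> by (auto simp: K_def field_simps add_pos_nonneg)
  have int: "integrable M (U n)" for n by (rule square_integrable_imp_integrable[OF _ I]) simp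
  have "(\<lambda>n. expectation (\<lambda>w. min \<bar>U n w\<bar> K)) \<longlonglongrightarrow> expectation (\<lambda>w. 0)"
  proof (rule integral_dominated_convergence[where w="\<lambda>_. K"])
    show "AE w in M. (\<lambda>n. min \<bar>U n w\<bar> K) \<longlonglongrightarrow> 0"
      using lim
    proof eventually_elim
      case (elim w)
      have "(\<lambda>n. min \<bar>U n w\<bar> K) \<longlonglongrightarrow> min \<bar>0\<bar> K"
        by (intro tendsto_min tendsto_rabs elim tendsto_const)
      then show ?case using K by simp
    qed
  qed (use K in \<open>auto\<close>)
  then have "\<forall>\<^sub>F n in sequentially. expectation (\<lambda>w. min \<bar>U n w\<bar> K) < e / 2"
    using e by (intro order_tendstoD) auto
  then obtain n0 where n0: "\<And>n. n \<ge> n0 \<Longrightarrow> expectation (\<lambda>w. min \<bar>U n w\<bar> K) < e / 2"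
    by (auto simp: eventually_sequentially)
  show "\<exists>n0. \<forall>n\<ge>n0. norm (expectation (\<lambda>w. \<bar>U n w\<bar>) - 0) < e"
  proof (intro exI allI impI)
    fix n assume n: "n \<ge> n0"
    have im: "integrable M (\<lambda>w. min \<bar>U n w\<bar> K)"
      by (rule Bochner_Integration.integrable_bound[OF integrable_abs[OF int[of n]]]) (use K in auto)
    have "\<bar>u\<bar> \<le> min \<bar>u\<bar> K + u\<^sup>2 / K" for u :: real
    proof (cases "\<bar>u\<bar> \<le> K")
      case False
      then have "\<bar>u\<bar> * K \<le> \<bar>u\<bar> * \<bar>u\<bar>" by (intro mult_left_mono) auto
      then have "\<bar>u\<bar> \<le> u\<^sup>2 / K" using K by (simp add: field_simps power2_eq_square abs_mult_self_eq)
      then show ?thesis using K by auto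
    qed (use K in auto)
    then have "expectation (\<lambda>w. \<bar>U n w\<bar>) \<le> expectation (\<lambda>w. min \<bar>U n w\<bar> K + (U n w)\<^sup>2 / K)"
      by (intro integral_mono) (use int I im in auto)
    also have "\<dots> = expectation (\<lambda>w. min \<bar>U n w\<bar> K) + expectation (\<lambda>w. (U n w)\<^sup>2) / K"
      using im I by simp
    also have "\<dots> \<le> expectation (\<lambda>w. min \<bar>U n w\<bar> K) + B / K"
      using B K by (intro add_mono divide_right_mono) auto
    also have "\<dots> < e / 2 + e / 2" using n0[OF n] K(2) by (rule add_strict_mono)
    finally show "norm (expectation (\<lambda>w. \<bar>U n w\<bar>) - 0) < e"
      by simp
  qed
qed

text \<open>The moments of order \<open>q * 2\<close> bound the \<open>q\<close>-th powers in L^2,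
  so almost sure convergence upgrades to convergence in mean.\<close>

lemma bounded_moments_tendsto:
  assumes U: "bounded_moments UNIV U" and lim: "AE w in M. (\<lambda>n::nat. U n w) \<longlonglongrightarrow> 0" and q: "q > 0"
  shows "(\<lambda>n. expectation (\<lambda>w. \<bar>U n w\<bar> ^ q)) \<longlonglongrightarrow> 0"
proof -
  have [measurable]: "U n \<in> borel_measurable M" for n using bounded_moments_measurable[OF U] by simp
  obtain B where B: "\<And>n. expectation (\<lambda>w. \<bar>U n w\<bar> ^ (q * 2)) \<le> B"
    using bounded_moments_bound[OF U, of "q * 2"] by auto
  have "(\<lambda>n. expectation (\<lambda>w. \<bar>\<bar>U n w\<bar> ^ q\<bar>)) \<longlonglongrightarrow> 0"
  proof (rule tendsto_L1_of_L2_bounded[where B=B])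
    show "integrable M (\<lambda>w. (\<bar>U n w\<bar> ^ q)\<^sup>2)" for n
      using bounded_moments_integrable_abs_power[OF U, of n "q*2"] by (simp add: power_mult)
    show "expectation (\<lambda>w. (\<bar>U n w\<bar> ^ q)\<^sup>2) \<le> B" for n
      using B[of n] by (simp add: power_mult)
    show "AE w in M. (\<lambda>n. \<bar>U n w\<bar> ^ q) \<longlonglongrightarrow> 0"
      using lim
    proof eventually_elim
      case (elim w)
      have "(\<lambda>n. \<bar>U n w\<bar> ^ q) \<longlonglongrightarrow> \<bar>0\<bar> ^ q" by (intro tendsto_power tendsto_rabs elim)
      also have "\<bar>0\<bar> ^ q = (0::real)" using q by simp
      finally show ?case .
    qed
  qed auto
  then show ?thesis by simp
qed

lemma integrable_mult_of_squares:
  assumes [measurable]: "X \<in> borel_measurable M" "Y \<in> borel_measurable M"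
    and "integrable M (\<lambda>w. (X w)\<^sup>2)" "integrable M (\<lambda>w. (Y w)\<^sup>2 :: real)"
  shows "integrable M (\<lambda>w. X w * Y w)"
  by (rule Bochner_Integration.integrable_bound[OF Bochner_Integration.integrable_add[OF assms(3,4)]])
     (auto intro!: AE_I2 order_trans[OF abs_mult_le_squares])

text \<open>Young's inequality with a free weight \<open>t\<close> does the work of Cauchy-Schwarz:
  a large \<open>t\<close> makes the contribution of a merely bounded factor small before the
  vanishing factor is used.\<close>

lemma expectation_mult_le:
  assumes [measurable]: "X \<in> borel_measurable M" "Y \<in> borel_measurable M"
    and I: "integrable M (\<lambda>w. (X w)\<^sup>2)" "integrable M (\<lambda>w. (Y w)\<^sup>2 :: real)" and t: "t > 0"
  shows "expectation (\<lambda>w. \<bar>X w * Y w\<bar>) \<le> t * expectation (\<lambda>w. (X w)\<^sup>2) + expectation (\<lambda>w. (Y w)\<^sup>2) / t"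
proof -
  have le: "\<bar>x * y\<bar> \<le> t * x\<^sup>2 + y\<^sup>2 / t" for x y :: real
    using abs_mult_le_squares[of "sqrt t * x" "y / sqrt t"] t
    by (simp add: power_mult_distrib power_divide)
  have "expectation (\<lambda>w. \<bar>X w * Y w\<bar>) \<le> expectation (\<lambda>w. t * (X w)\<^sup>2 + (Y w)\<^sup>2 / t)"
    by (intro integral_mono integrable_abs integrable_mult_of_squares le) (use I in auto)
  also have "\<dots> = t * expectation (\<lambda>w. (X w)\<^sup>2) + expectation (\<lambda>w. (Y w)\<^sup>2) / t" using I by simp
  finally show ?thesis .
qed

lemma tendsto_expectation_mult:
  assumes [measurable]: "\<And>n. X n \<in> borel_measurable M" "\<And>n. Y n \<in> borel_measurable M"
    and I: "\<And>n. integrable M (\<lambda>w. (X n w)\<^sup>2)" "\<And>n. integrable M (\<lambda>w. (Y n w)\<^sup>2 :: real)"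
    and X: "(\<lambda>n. expectation (\<lambda>w. (X n w)\<^sup>2)) \<longlonglongrightarrow> 0"
    and Y: "\<And>n. expectation (\<lambda>w. (Y n w)\<^sup>2) \<le> B"
  shows "(\<lambda>n. expectation (\<lambda>w. \<bar>X n w * Y n w\<bar>)) \<longlonglongrightarrow> 0"
    and "(\<lambda>n. expectation (\<lambda>w. X n w * Y n w)) \<longlonglongrightarrow> 0"
proof -
  show *: "(\<lambda>n. expectation (\<lambda>w. \<bar>X n w * Y n w\<bar>)) \<longlonglongrightarrow> 0"
  proof (rule LIMSEQ_I)
    fix e :: real assume e: "e > 0"
    have "0 \<le> B" using order_trans[OF _ Y[of 0]] by simp
    define t where "t = 2 * (B + 1) / e"
    have t: "t > 0" "B / t < e / 2" using e \<open>0 \<le> B\<close> by (auto simp: t_def field_simps)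
    have "\<forall>\<^sub>F n in sequentially. expectation (\<lambda>w. (X n w)\<^sup>2) < e / (2 * t)"
      using e t by (intro order_tendstoD[OF X]) auto
    then obtain n0 where n0: "\<And>n. n \<ge> n0 \<Longrightarrow> expectation (\<lambda>w. (X n w)\<^sup>2) < e / (2 * t)"
      by (auto simp: eventually_sequentially)
    show "\<exists>n0. \<forall>n\<ge>n0. norm (expectation (\<lambda>w. \<bar>X n w * Y n w\<bar>) - 0) < e"
    proof (intro exI allI impI)
      fix n assume n: "n \<ge> n0"
      have "expectation (\<lambda>w. \<bar>X n w * Y n w\<bar>) \<le> t * expectation (\<lambda>w. (X n w)\<^sup>2) + expectation (\<lambda>w. (Y n w)\<^sup>2) / t"
        by (rule expectation_mult_le) (use I t in auto)
      also have "t * expectation (\<lambda>w. (X n w)\<^sup>2) < e / 2" using n0[OF n] t by (simp add: field_simps)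
      also have "expectation (\<lambda>w. (Y n w)\<^sup>2) / t \<le> B / t" using Y t by (intro divide_right_mono) auto
      also have "e / 2 + B / t < e / 2 + e / 2" using t(2) by (rule add_strict_left_mono)
      finally show "norm (expectation (\<lambda>w. \<bar>X n w * Y n w\<bar>) - 0) < e" by simp
    qed
  qed
  show "(\<lambda>n. expectation (\<lambda>w. X n w * Y n w)) \<longlonglongrightarrow> 0"
    by (rule Lim_null_comparison[OF _ *]) (auto intro!: always_eventually integral_abs_bound)
qed


subsection \<open>Weak convergence in $L^2$\<close>

text \<open>Pairings with an L^2-bounded sequence are uniformly continuous in the weight, so the
  weights with vanishing pairing are closed under limits in L^2.\<close>

lemma weak_L2_tendsto_closure:
  fixes h :: "'a \<Rightarrow> real"
  assumes [measurable]: "\<And>n. U n \<in> borel_measurable M" "h \<in> borel_measurable M"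
    "\<And>i. H i \<in> borel_measurable M"
    and U: "\<And>n. integrable M (\<lambda>w. (U n w)\<^sup>2)" "\<And>n. expectation (\<lambda>w. (U n w)\<^sup>2) \<le> B"
    and h: "integrable M (\<lambda>w. (h w)\<^sup>2)"
    and H: "\<And>i::nat. integrable M (\<lambda>w. (H i w)\<^sup>2)"
      "\<And>i. (\<lambda>n. expectation (\<lambda>w. H i w * U n w)) \<longlonglongrightarrow> 0"
    and lim: "(\<lambda>i. expectation (\<lambda>w. (h w - H i w)\<^sup>2)) \<longlonglongrightarrow> 0"
  shows "(\<lambda>n::nat. expectation (\<lambda>w. h w * U n w)) \<longlonglongrightarrow> 0"
proof (rule LIMSEQ_I)
  fix e :: real assume e: "e > 0"
  have "0 \<le> B" using order_trans[OF _ U(2)[of 0]] by simp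
  \<comment> \<open>Error budget: e/4 for the bounded factor through \<open>B / t\<close>, e/4 for
    the distance from \<open>h\<close> to \<open>H i\<close>, and e/2 for the pairing with
    \<open>H i\<close>. The \<open>+ 1\<close> keeps \<open>t\<close> positive.\<close>
  define t where "t = 4 * (B + 1) / e"
  have t: "t > 0" "B / t < e / 4" using e \<open>0 \<le> B\<close> by (auto simp: t_def field_simps add_pos_nonneg)
  have "\<forall>\<^sub>F i in sequentially. expectation (\<lambda>w. (h w - H i w)\<^sup>2) < e / (4 * t)"
    using e t by (intro order_tendstoD[OF lim]) auto
  then obtain i where i: "expectation (\<lambda>w. (h w - H i w)\<^sup>2) < e / (4 * t)"
    by (auto simp: eventually_sequentially)
  have d: "integrable M (\<lambda>w. (h w - H i w)\<^sup>2)"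
  proof (rule Bochner_Integration.integrable_bound)
    show "integrable M (\<lambda>w. 2 * (h w)\<^sup>2 + 2 * (H i w)\<^sup>2)" using h H(1) by auto
    have "(x - y)\<^sup>2 \<le> 2 * x\<^sup>2 + 2 * y\<^sup>2" for x y :: real
      using zero_le_power2[of "x + y"] by (simp add: power2_eq_square algebra_simps)
    then show "AE w in M. norm ((h w - H i w)\<^sup>2) \<le> norm (2 * (h w)\<^sup>2 + 2 * (H i w)\<^sup>2)" by simp
  qed auto
  obtain n0 where n0: "\<And>n. n \<ge> n0 \<Longrightarrow> \<bar>expectation (\<lambda>w. H i w * U n w)\<bar> < e / 2"
    using LIMSEQ_D[OF H(2)[of i], of "e / 2"] e by auto
  show "\<exists>n0. \<forall>n\<ge>n0. norm (expectation (\<lambda>w. h w * U n w) - 0) < e"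
  proof (intro exI allI impI)
    fix n assume n: "n \<ge> n0"
    have I: "integrable M (\<lambda>w. (h w - H i w) * U n w)" "integrable M (\<lambda>w. H i w * U n w)"
      by (intro integrable_mult_of_squares d U H; measurable)+
    have "expectation (\<lambda>w. h w * U n w) = expectation (\<lambda>w. (h w - H i w) * U n w + H i w * U n w)"
      by (simp add: algebra_simps)
    also have "\<dots> = expectation (\<lambda>w. (h w - H i w) * U n w) + expectation (\<lambda>w. H i w * U n w)"
      using I by (rule Bochner_Integration.integral_add)
    finally have "\<bar>expectation (\<lambda>w. h w * U n w)\<bar> \<le> expectation (\<lambda>w. \<bar>(h w - H i w) * U n w\<bar>) + \<bar>expectation (\<lambda>w. H i w * U n w)\<bar>"
      using integral_abs_bound[of M "\<lambda>w. (h w - H i w) * U n w"] by linarith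
    also have "expectation (\<lambda>w. \<bar>(h w - H i w) * U n w\<bar>) \<le> t * expectation (\<lambda>w. (h w - H i w)\<^sup>2) + expectation (\<lambda>w. (U n w)\<^sup>2) / t"
      by (rule expectation_mult_le) (use d U t in auto)
    also have "t * expectation (\<lambda>w. (h w - H i w)\<^sup>2) < e / 4" using i t by (simp add: field_simps)
    also have "expectation (\<lambda>w. (U n w)\<^sup>2) / t \<le> B / t" using U t by (intro divide_right_mono) auto
    finally show "norm (expectation (\<lambda>w. h w * U n w) - 0) < e"
      using t(2) n0[OF n] unfolding real_norm_def diff_0_right by linarith
  qed
qed

text \<open>The sets whose indicators pair to 0 form a Dynkin system, and the closed sets are an
  intersection stable generator of the Borel sets. The indicator of a closed set is the decreasing
  limit of continuous cut-offs built from the distance; complements use the constant test function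
  1, disjoint unions the closure in L^2.\<close>

lemma weak_L2_tendsto_indicator:
  fixes Z :: "'a \<Rightarrow> 'z::metric_space" and U :: "nat \<Rightarrow> 'a \<Rightarrow> real"
  assumes [measurable]: "\<And>n. U n \<in> borel_measurable M" "Z \<in> measurable M borel"
    and U: "\<And>n. integrable M (\<lambda>w. (U n w)\<^sup>2)" "\<And>n. expectation (\<lambda>w. (U n w)\<^sup>2) \<le> B"
    and test: "\<And>h. continuous_on UNIV h \<Longrightarrow> (\<And>z. \<bar>h z\<bar> \<le> 1) \<Longrightarrow>
      (\<lambda>n. expectation (\<lambda>w. h (Z w) * U n w)) \<longlonglongrightarrow> 0"
    and A: "A \<in> sets borel"
  shows "(\<lambda>n::nat. expectation (\<lambda>w. indicator A (Z w) * U n w)) \<longlonglongrightarrow> 0"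
proof -
  have iU: "integrable M (U n)" for n by (rule square_integrable_imp_integrable[OF _ U(1)]) simp
  have iA: "integrable M (\<lambda>w. indicator A (Z w) * U n w)" if "A \<in> sets borel" for A n
  proof -
    note [measurable] = that
    show ?thesis by (rule Bochner_Integration.integrable_bound[OF iU[of n]]) (auto simp: indicator_def)
  qed
  have A': "A \<in> sigma_sets UNIV (Collect closed)" using A by (simp add: borel_eq_closed)
  have bor: "X \<in> sets borel" if "X \<in> sigma_sets UNIV (Collect closed)" for X :: "'z set"
    using that by (simp add: borel_eq_closed)
  have "Int_stable (Collect closed :: 'z set set)" by (auto simp: Int_stable_def)
  from this subset_UNIV[of "Collect closed", folded Pow_UNIV] A' show ?thesis
  proof (induction rule: sigma_sets_induct_disjoint)
    case (basic C)
    then have [measurable]: "closed C" "C \<in> sets borel" by auto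
    \<comment> \<open>The distance to the empty set is 0 by convention, so the cut-offs below would
      be constantly 1; that set is treated separately.\<close>
    show ?case
    proof (cases "C = {}")
      case False
      define H where "H i z = max 0 (1 - real i * infdist z C)" for i :: nat and z
      have cH: "continuous_on UNIV (H i)" for i unfolding H_def by (intro continuous_intros)
      have [measurable]: "H i \<in> borel_measurable borel" for i
        by (rule borel_measurable_continuous_onI[OF cH])
      have H01: "0 \<le> H i z" "H i z \<le> 1" for i z by (auto simp: H_def infdist_nonneg)
      have Hin: "H i z = 1" if "z \<in> C" for i z using that by (simp add: H_def)
      have lim: "(\<lambda>i. H i z) \<longlonglongrightarrow> indicator C z" for z
      proof (cases "z \<in> C")
        case False
        then have pos: "infdist z C > 0"
          using in_closed_iff_infdist_zero[OF \<open>closed C\<close> \<open>C \<noteq> {}\<close>] infdist_nonneg[of z C] by fastforce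
        obtain k where k: "1 < real k * infdist z C" using pos by (metis ex_less_of_nat_mult)
        have "\<forall>\<^sub>F i in sequentially. H i z = 0"
          using eventually_ge_at_top[of k]
        proof eventually_elim
          case (elim i)
          have "real k * infdist z C \<le> real i * infdist z C" using elim pos by simp
          then show ?case using k by (simp add: H_def)
        qed
        then show ?thesis using False by (auto intro: tendsto_eventually)
      qed (simp add: Hin)
      show ?thesis
      proof (rule weak_L2_tendsto_closure[where H="\<lambda>i w. H i (Z w)" and B=B])
        show "(\<lambda>i. expectation (\<lambda>w. (indicator C (Z w) - H i (Z w))\<^sup>2)) \<longlonglongrightarrow> 0"
        proof -
          have "(\<lambda>i. expectation (\<lambda>w. (indicator C (Z w) - H i (Z w))\<^sup>2)) \<longlonglongrightarrow> expectation (\<lambda>w. 0)"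
          proof (rule integral_dominated_convergence[where w="\<lambda>_. 1"])
            have "(\<lambda>i. (indicator C z - H i z)\<^sup>2) \<longlonglongrightarrow> (indicator C z - indicator C z)\<^sup>2" for z
              by (intro tendsto_intros lim)
            then show "AE w in M. (\<lambda>i. (indicator C (Z w) - H i (Z w))\<^sup>2) \<longlonglongrightarrow> 0" by simp
            have "\<bar>indicator C z - H i z\<bar> \<le> 1" for i z using H01[of i z] by (auto simp: indicator_def)
            then show "AE w in M. norm ((indicator C (Z w) - H i (Z w))\<^sup>2) \<le> 1" for i
              by (simp add: abs_square_le_1)
          qed auto
          then show ?thesis by simp
        qed
        show "integrable M (\<lambda>w. (H i (Z w))\<^sup>2)" for i
          using H01[of i] by (intro integrable_const_bound[where B=1]) (auto simp: abs_square_le_1)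
        show "integrable M (\<lambda>w. (indicator C (Z w) :: real)\<^sup>2)"
          by (intro integrable_const_bound[where B=1]) (auto simp: indicator_def)
        show "(\<lambda>n. expectation (\<lambda>w. H i (Z w) * U n w)) \<longlonglongrightarrow> 0" for i
          using H01[of i] by (intro test cH) auto
      qed (use U in auto)
    qed simp
  next
    case empty
    then show ?case by simp
  next
    case (compl X)
    have X: "X \<in> sets borel" using compl bor by simp
    have "(\<lambda>n. expectation (\<lambda>w. 1 * U n w)) \<longlonglongrightarrow> 0" by (rule test) auto
    from tendsto_diff[OF this compl.IH]
    have "(\<lambda>n. expectation (\<lambda>w. 1 * U n w) - expectation (\<lambda>w. indicator X (Z w) * U n w)) \<longlonglongrightarrow> 0" by simp
    also have "(\<lambda>n. expectation (\<lambda>w. 1 * U n w) - expectation (\<lambda>w. indicator X (Z w) * U n w))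
      = (\<lambda>n. expectation (\<lambda>w. 1 * U n w - indicator X (Z w) * U n w))"
      using iU iA[OF X] by (intro ext Bochner_Integration.integral_diff[symmetric]) auto
    finally show ?case by (simp add: indicator_diff left_diff_distrib)
  next
    case (union X)
    have X[measurable]: "X i \<in> sets borel" for i using union bor by auto
    have [measurable]: "(\<Union>i. X i) \<in> sets borel" by (intro sets.countable_UN) auto
    define H :: "nat \<Rightarrow> 'z \<Rightarrow> real" where "H i z = indicator (\<Union>j<i. X j) z" for i z
    have sumH: "H i z = (\<Sum>j<i. indicator (X j) z)" for i z
      unfolding H_def using union(1) by (intro indicator_UN_disjoint) (auto simp: disjoint_family_on_def)
    show ?case
    proof (rule weak_L2_tendsto_closure[where H="\<lambda>i w. H i (Z w)" and B=B])
      have lim: "(\<lambda>i. H i z) \<longlonglongrightarrow> indicator (\<Union>i. X i) z" for z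
        unfolding H_def by (rule LIMSEQ_indicator_UN)
      have [measurable]: "H i \<in> borel_measurable borel" for i unfolding H_def by measurable
      show "(\<lambda>i. expectation (\<lambda>w. (indicator (\<Union>i. X i) (Z w) - H i (Z w))\<^sup>2)) \<longlonglongrightarrow> 0"
      proof -
        have "(\<lambda>i. expectation (\<lambda>w. (indicator (\<Union>i. X i) (Z w) - H i (Z w))\<^sup>2)) \<longlonglongrightarrow> expectation (\<lambda>w. 0)"
        proof (rule integral_dominated_convergence[where w="\<lambda>_. 1"])
          have "(\<lambda>i. (indicator (\<Union>i. X i) z - H i z)\<^sup>2) \<longlonglongrightarrow> (indicator (\<Union>i. X i) z - indicator (\<Union>i. X i) z)\<^sup>2" for z
            by (intro tendsto_intros lim)
          then show "AE w in M. (\<lambda>i. (indicator (\<Union>i. X i) (Z w) - H i (Z w))\<^sup>2) \<longlonglongrightarrow> 0" by simp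
          show "AE w in M. norm ((indicator (\<Union>i. X i) (Z w) - H i (Z w))\<^sup>2) \<le> 1" for i
            by (intro AE_I2) (auto simp: H_def indicator_def)
        qed auto
        then show ?thesis by simp
      qed
      show "(\<lambda>w. H i (Z w)) \<in> borel_measurable M" for i by measurable
      show "integrable M (\<lambda>w. (H i (Z w))\<^sup>2)" for i
        by (intro integrable_const_bound[where B=1]) (auto simp: H_def indicator_def)
      show "integrable M (\<lambda>w. (indicator (\<Union>i. X i) (Z w) :: real)\<^sup>2)"
        by (intro integrable_const_bound[where B=1]) (auto simp: indicator_def)
      show "(\<lambda>n. expectation (\<lambda>w. H i (Z w) * U n w)) \<longlonglongrightarrow> 0" for i
      proof -
        have "expectation (\<lambda>w. H i (Z w) * U n w) = (\<Sum>j<i. expectation (\<lambda>w. indicator (X j) (Z w) * U n w))" for n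
          unfolding sumH sum_distrib_right by (intro Bochner_Integration.integral_sum iA X)
        moreover have "(\<lambda>n. \<Sum>j<i. expectation (\<lambda>w. indicator (X j) (Z w) * U n w)) \<longlonglongrightarrow> (\<Sum>j<i. 0)"
          by (intro tendsto_sum union.IH)
        ultimately show ?thesis by simp
      qed
    qed (use U in auto)
  qed
qed

text \<open>From indicators, the standard induction over simple functions and monotone limits
  reaches every nonnegative Borel weight that is square integrable along \<open>Z\<close>; a signed
  weight is split into its positive and negative part.\<close>

proposition weak_L2_tendsto:
  fixes Z :: "'a \<Rightarrow> 'z::metric_space" and U :: "nat \<Rightarrow> 'a \<Rightarrow> real"
  assumes mU: "\<And>n. U n \<in> borel_measurable M" and Z[measurable]: "Z \<in> measurable M borel"
    and U: "\<And>n. integrable M (\<lambda>w. (U n w)\<^sup>2)" "\<And>n. expectation (\<lambda>w. (U n w)\<^sup>2) \<le> B"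
    and test: "\<And>h. continuous_on UNIV h \<Longrightarrow> (\<And>z. \<bar>h z\<bar> \<le> 1) \<Longrightarrow>
      (\<lambda>n. expectation (\<lambda>w. h (Z w) * U n w)) \<longlonglongrightarrow> 0"
    and h: "h \<in> borel_measurable borel" "integrable M (\<lambda>w. (h (Z w))\<^sup>2)"
  shows "(\<lambda>n::nat. expectation (\<lambda>w. h (Z w) * U n w)) \<longlonglongrightarrow> 0"
proof -
  note [measurable] = mU
  \<comment> \<open>Integrability stands as a premise inside the induction formula, so that summands
    and approximating functions inherit it from the larger function.\<close>
  have pos: "integrable M (\<lambda>w. (u (Z w))\<^sup>2) \<longrightarrow> (\<lambda>n. expectation (\<lambda>w. u (Z w) * U n w)) \<longlonglongrightarrow> 0"
    if "u \<in> borel_measurable borel" "\<And>z. 0 \<le> u z" for u :: "'z \<Rightarrow> real"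
    using that
  proof (induction rule: borel_measurable_induct_real)
    case (set A)
    then show ?case
      using weak_L2_tendsto_indicator[OF mU Z U test] by blast
  next
    case (mult u c)
    have "(\<lambda>n. c * expectation (\<lambda>w. u (Z w) * U n w)) \<longlonglongrightarrow> c * 0"
      if "integrable M (\<lambda>w. (c * u (Z w))\<^sup>2)" "c \<noteq> 0"
      using mult that by (intro tendsto_mult tendsto_const) (auto simp: power_mult_distrib)
    \<comment> \<open>For \<open>c = 0\<close> the premise says nothing about \<open>u\<close>, but
      then the pairing is 0 anyway.\<close>
    then show ?case by (cases "c = 0") (auto simp: mult.assoc)
  next
    case (add u v)
    note [measurable] = \<open>u \<in> borel_measurable borel\<close> \<open>v \<in> borel_measurable borel\<close>
    show ?case
    proof
      assume I: "integrable M (\<lambda>w. (v (Z w) + u (Z w))\<^sup>2)"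
      have u: "integrable M (\<lambda>w. (u (Z w))\<^sup>2)"
        by (rule Bochner_Integration.integrable_bound[OF I]) (use add in \<open>auto intro!: power_mono\<close>)
      have v: "integrable M (\<lambda>w. (v (Z w))\<^sup>2)"
        by (rule Bochner_Integration.integrable_bound[OF I]) (use add in \<open>auto intro!: power_mono\<close>)
      have "(\<lambda>n. expectation (\<lambda>w. v (Z w) * U n w) + expectation (\<lambda>w. u (Z w) * U n w)) \<longlonglongrightarrow> 0 + 0"
        using add u v by (intro tendsto_add) auto
      also have "(\<lambda>n. expectation (\<lambda>w. v (Z w) * U n w) + expectation (\<lambda>w. u (Z w) * U n w))
        = (\<lambda>n. expectation (\<lambda>w. v (Z w) * U n w + u (Z w) * U n w))"
        by (intro ext Bochner_Integration.integral_add[symmetric] integrable_mult_of_squares u v U) auto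
      finally show "(\<lambda>n. expectation (\<lambda>w. (v (Z w) + u (Z w)) * U n w)) \<longlonglongrightarrow> 0" by (simp add: ring_distribs)
    qed
  next
    case (seq V)
    note [measurable] = seq(1)
    have mu[measurable]: "u \<in> borel_measurable borel"
      by (rule borel_measurable_LIMSEQ_real[OF seq(4)]) auto
    have le: "V i z \<le> u z" for i z
      using seq(3,4) by (intro incseq_le) (auto simp: incseq_def le_fun_def)
    show ?case
    proof
      assume I: "integrable M (\<lambda>w. (u (Z w))\<^sup>2)"
      have IV: "integrable M (\<lambda>w. (V i (Z w))\<^sup>2)" for i
        by (rule Bochner_Integration.integrable_bound[OF I]) (use seq(2) le in \<open>auto intro!: power_mono\<close>)
      show "(\<lambda>n. expectation (\<lambda>w. u (Z w) * U n w)) \<longlonglongrightarrow> 0"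
      proof (rule weak_L2_tendsto_closure[where H="\<lambda>i w. V i (Z w)" and B=B])
        have "(\<lambda>i. expectation (\<lambda>w. (u (Z w) - V i (Z w))\<^sup>2)) \<longlonglongrightarrow> expectation (\<lambda>w. 0)"
        proof (rule integral_dominated_convergence[where w="\<lambda>w. (u (Z w))\<^sup>2"])
          have "(\<lambda>i. (u z - V i z)\<^sup>2) \<longlonglongrightarrow> (u z - u z)\<^sup>2" for z
            by (intro tendsto_intros seq) simp
          then show "AE w in M. (\<lambda>i. (u (Z w) - V i (Z w))\<^sup>2) \<longlonglongrightarrow> 0" by simp
          show "AE w in M. norm ((u (Z w) - V i (Z w))\<^sup>2) \<le> (u (Z w))\<^sup>2" for i
            using seq(2) le by (auto intro!: power_mono)
        qed (use I in auto)
        then show "(\<lambda>i. expectation (\<lambda>w. (u (Z w) - V i (Z w))\<^sup>2)) \<longlonglongrightarrow> 0" by simp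
      qed (use U I IV seq(5) in auto)
    qed
  qed
  note [measurable] = h(1)
  have "integrable M (\<lambda>w. (max 0 (h (Z w)))\<^sup>2)" "integrable M (\<lambda>w. (max 0 (- h (Z w)))\<^sup>2)"
    by (rule Bochner_Integration.integrable_bound[OF h(2)]; auto simp: max_def)+
  note I = this
  have "(\<lambda>n. expectation (\<lambda>w. max 0 (h (Z w)) * U n w) - expectation (\<lambda>w. max 0 (- h (Z w)) * U n w)) \<longlonglongrightarrow> 0 - 0"
    using pos[of "\<lambda>z. max 0 (h z)"] pos[of "\<lambda>z. max 0 (- h z)"] I by (intro tendsto_diff) auto
  also have "(\<lambda>n. expectation (\<lambda>w. max 0 (h (Z w)) * U n w) - expectation (\<lambda>w. max 0 (- h (Z w)) * U n w))
    = (\<lambda>n. expectation (\<lambda>w. max 0 (h (Z w)) * U n w - max 0 (- h (Z w)) * U n w))"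
    by (intro ext Bochner_Integration.integral_diff[symmetric] integrable_mult_of_squares I U) auto
  also have "\<dots> = (\<lambda>n. expectation (\<lambda>w. h (Z w) * U n w))"
    by (intro ext Bochner_Integration.integral_cong) (auto simp: max_def)
  finally show ?thesis by simp
qed

subsection \<open>A central limit theorem for triangular arrays with identically distributed rows\<close>

text \<open>The characteristic function of \<open>U n\<close> at \<open>t / sqrt (r n)\<close>
  agrees with \<open>1 - t\<^sup>2 * s / (2 * r n)\<close> up to a term that is small compared with
  \<open>1 / r n\<close>, and raising two numbers of modulus at most 1 to the power
  \<open>r n\<close> enlarges their distance at most \<open>r n\<close> times. The hypothesis
  \<open>lind\<close> has the shape of the remainder in the second order expansion of a
  characteristic function.\<close>

lemma char_power_tendsto:
  fixes U :: "nat \<Rightarrow> 'a \<Rightarrow> real" and r :: "nat \<Rightarrow> nat"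
  assumes [measurable]: "\<And>n. U n \<in> borel_measurable M"
    and I: "\<And>n. integrable M (\<lambda>w. (U n w)\<^sup>2)"
    and mean: "\<And>n. expectation (U n) = 0"
    and var: "(\<lambda>n. expectation (\<lambda>w. (U n w)\<^sup>2)) \<longlonglongrightarrow> s"
    and r: "filterlim r at_top sequentially"
    and lind: "(\<lambda>n. expectation (\<lambda>w. min (6 * (U n w)\<^sup>2) (\<bar>t / sqrt (r n)\<bar> * \<bar>U n w\<bar> ^ 3))) \<longlonglongrightarrow> 0"
  shows "(\<lambda>n. char (distr M borel (U n)) (t / sqrt (r n)) ^ r n) \<longlonglongrightarrow> exp (- (t\<^sup>2 * s / 2))"
proof -
  define v where "v n = expectation (\<lambda>w. (U n w)\<^sup>2)" for n
  have int: "integrable M (U n)" for n by (rule square_integrable_imp_integrable[OF _ I]) simp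
  have v0: "0 \<le> v n" for n by (simp add: v_def)
  have s0: "0 \<le> s" using LIMSEQ_le_const[OF var] v0 by (auto simp: v_def)
  have vlim: "v \<longlonglongrightarrow> s" using var unfolding v_def .
  obtain B where B: "\<And>n. v n \<le> B"
    using convergent_imp_bounded[OF vlim] by (auto simp: bounded_iff intro: order_trans[OF abs_ge_self])
  have sB: "s \<le> B" using LIMSEQ_le_const2[OF vlim] B by auto
  define a where "a n = 1 - t\<^sup>2 * s / 2 / real (r n)" for n
  \<comment> \<open>Beyond this index \<open>r n\<close> dominates \<open>t\<^sup>2 * B\<close>,
    which keeps \<open>a n\<close> in [-1, 1] as the comparison of powers requires.\<close>
  have ev: "\<forall>\<^sub>F n in sequentially. 1 \<le> r n \<and> t\<^sup>2 * B \<le> real (r n)"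
  proof -
    have "\<forall>\<^sub>F n in sequentially. max 1 (nat \<lceil>t\<^sup>2 * B\<rceil>) \<le> r n"
      using r unfolding filterlim_at_top by blast
    then show ?thesis
    proof eventually_elim
      case (elim n)
      then show ?case by (auto simp: nat_le_iff ceiling_le_iff)
    qed
  qed
  have main: "\<forall>\<^sub>F n in sequentially. cmod (char (distr M borel (U n)) (t / sqrt (r n)) ^ r n - complex_of_real (a n ^ r n))
      \<le> t\<^sup>2 / 6 * expectation (\<lambda>w. min (6 * (U n w)\<^sup>2) (\<bar>t / sqrt (r n)\<bar> * \<bar>U n w\<bar> ^ 3)) + t\<^sup>2 / 2 * \<bar>v n - s\<bar>"
    using ev
  proof eventually_elim
    case (elim n)
    then have rn: "real (r n) > 0" by auto
    interpret D: real_distribution "distr M borel (U n)" by (rule real_distribution_distr) simp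
    let ?t = "t / sqrt (r n)"
    let ?E = "expectation (\<lambda>w. min (6 * (U n w)\<^sup>2) (\<bar>?t\<bar> * \<bar>U n w\<bar> ^ 3))"
    have t2: "?t\<^sup>2 = t\<^sup>2 / real (r n)" using rn by (simp add: power_divide)
    have 1: "cmod (char (distr M borel (U n)) ?t - (1 - ?t\<^sup>2 * v n / 2)) \<le> ?t\<^sup>2 / 6 * ?E"
      by (rule char_approx3') (use I int mean in \<open>auto simp: v_def\<close>)
    have 2: "cmod (complex_of_real (1 - ?t\<^sup>2 * v n / 2) - complex_of_real (a n)) = t\<^sup>2 / 2 / real (r n) * \<bar>v n - s\<bar>"
    proof -
      have "(1 - ?t\<^sup>2 * v n / 2) - a n = t\<^sup>2 / 2 / real (r n) * (s - v n)"
        unfolding a_def t2 using rn by (simp add: field_simps)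
      then show ?thesis unfolding of_real_diff[symmetric] norm_of_real
        by (simp add: abs_mult abs_minus_commute)
    qed
    have "0 \<le> t\<^sup>2 * s" "t\<^sup>2 * s \<le> t\<^sup>2 * B" using s0 sB by (auto intro: mult_left_mono)
    then have "0 \<le> t\<^sup>2 * s / 2 / real (r n)" "t\<^sup>2 * s / 2 / real (r n) \<le> 2" using elim rn by (auto simp: field_simps)
    then have an: "\<bar>a n\<bar> \<le> 1" unfolding a_def by linarith
    have "cmod (char (distr M borel (U n)) ?t ^ r n - complex_of_real (a n) ^ r n)
       \<le> real (r n) * cmod (char (distr M borel (U n)) ?t - complex_of_real (a n))"
      by (rule norm_power_diff) (use an D.cmod_char_le_1 in auto)
    also have "cmod (char (distr M borel (U n)) ?t - complex_of_real (a n)) \<le> ?t\<^sup>2 / 6 * ?E + t\<^sup>2 / 2 / real (r n) * \<bar>v n - s\<bar>"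
      using norm_triangle_ineq[of "char (distr M borel (U n)) ?t - (1 - ?t\<^sup>2 * v n / 2)" "complex_of_real (1 - ?t\<^sup>2 * v n / 2) - complex_of_real (a n)"] 1 2
      by simp
    finally have "cmod (char (distr M borel (U n)) ?t ^ r n - complex_of_real (a n) ^ r n)
       \<le> real (r n) * (?t\<^sup>2 / 6 * ?E + t\<^sup>2 / 2 / real (r n) * \<bar>v n - s\<bar>)" using rn by simp
    also have "\<dots> = t\<^sup>2 / 6 * ?E + t\<^sup>2 / 2 * \<bar>v n - s\<bar>"
      unfolding t2 using rn by (simp add: field_simps)
    finally show ?case by simp
  qed
  have "(\<lambda>n. t\<^sup>2 / 6 * expectation (\<lambda>w. min (6 * (U n w)\<^sup>2) (\<bar>t / sqrt (r n)\<bar> * \<bar>U n w\<bar> ^ 3)) + t\<^sup>2 / 2 * \<bar>v n - s\<bar>)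
     \<longlonglongrightarrow> t\<^sup>2 / 6 * 0 + t\<^sup>2 / 2 * \<bar>s - s\<bar>"
    by (intro tendsto_intros lind vlim)
  then have "(\<lambda>n. char (distr M borel (U n)) (t / sqrt (r n)) ^ r n - complex_of_real (a n ^ r n)) \<longlonglongrightarrow> 0"
    by (intro Lim_null_comparison[OF main]) simp
  moreover have "(\<lambda>n. complex_of_real (a n ^ r n)) \<longlonglongrightarrow> complex_of_real (exp (- (t\<^sup>2 * s / 2)))"
  proof (rule tendsto_of_real)
    have "(\<lambda>m. (1 + (- (t\<^sup>2 * s / 2)) / real m) ^ m) \<longlonglongrightarrow> exp (- (t\<^sup>2 * s / 2))"
      by (rule tendsto_exp_limit_sequentially)
    from filterlim_compose[OF this r] show "(\<lambda>n. a n ^ r n) \<longlonglongrightarrow> exp (- (t\<^sup>2 * s / 2))"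
      by (simp add: a_def)
  qed
  ultimately show ?thesis
    using tendsto_add by fastforce
qed

end

section \<open>Gaussian increments\<close>

lemma abs_exp_minus_one_le: "\<bar>exp y - 1\<bar> \<le> \<bar>y\<bar> * exp \<bar>y :: real\<bar>"
proof (cases "y \<ge> 0")
  case True
  have "1 - y \<le> exp (- y)" using exp_ge_add_one_self[of "-y"] by simp
  then have "(1 - y) * exp y \<le> exp (- y) * exp y" by (intro mult_right_mono) auto
  then have "exp y - 1 \<le> y * exp y" by (simp add: algebra_simps exp_minus_inverse flip: exp_add)
  then show ?thesis using True by simp
next
  case False
  have "1 - exp y \<le> - y" using exp_ge_add_one_self[of y] by linarith
  also have "- y \<le> - y * exp (- y)" using False by (simp add: mult_le_cancel_left1)
  finally show ?thesis using False by simp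
qed

lemma abs_exp_minus_one_minus_le: "\<bar>exp y - 1 - y\<bar> \<le> y\<^sup>2 * exp \<bar>y :: real\<bar>"
proof (cases "y \<ge> 0")
  case True
  have 1: "exp y - 1 \<le> y * exp y" using abs_exp_minus_one_le[of y] True by simp
  have "y * (exp y - 1) \<le> y * (y * exp y)" using True by (intro mult_left_mono 1)
  then show ?thesis using True 1 exp_ge_add_one_self[of y] by (simp add: power2_eq_square algebra_simps)
next
  case False
  define u where "u = - y"
  have u: "u > 0" using False by (simp add: u_def)
  have "exp (- u) \<le> 1 / (1 + u)"
    using exp_ge_add_one_self[of u] u by (simp add: exp_minus field_simps)
  also have "\<dots> \<le> 1 - u + u\<^sup>2"
    using u by (simp add: field_simps power2_eq_square)
  finally have "exp (- u) - 1 + u \<le> u\<^sup>2" by simp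
  also have "u\<^sup>2 \<le> u\<^sup>2 * exp u" using u by (simp add: mult_le_cancel_left1)
  finally have "exp (- u) - 1 + u \<le> u\<^sup>2 * exp u" .
  moreover have "0 \<le> exp (- u) - 1 + u" using exp_ge_add_one_self[of "-u"] by linarith
  ultimately have "\<bar>exp (- u) - 1 + u\<bar> \<le> u\<^sup>2 * exp u" by linarith
  then show ?thesis using False by (simp add: u_def)
qed

lemma power_le_fact_exp:
  assumes "0 \<le> (x::real)"
  shows "x ^ n \<le> fact n * exp x"
proof -
  have "(\<Sum>k\<in>{n}. x ^ k /\<^sub>R fact k) \<le> (\<Sum>k. x ^ k /\<^sub>R fact k)"
    by (rule sum_le_suminf[OF summable_exp_generic]) (use assms in auto)
  then have "x ^ n / fact n \<le> exp x" by (simp add: exp_def divide_inverse_commute)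
  then show ?thesis by (simp add: field_simps)
qed

interpretation std_normal: prob_space std_normal_distribution
  by (rule prob_space_normal_density) simp

text \<open>Completing the square turns the exponential factor into a shift of the mean to
  \<open>b\<close>, with total mass \<open>exp (b\<^sup>2 / 2)\<close>.\<close>

lemma std_normal_exp:
  shows integrable_std_normal_exp: "integrable std_normal_distribution (\<lambda>z. exp (b * z))"
    and integral_std_normal_exp: "integral\<^sup>L std_normal_distribution (\<lambda>z. exp (b * z)) = exp (b\<^sup>2 / 2)"
proof -
  have eq: "std_normal_density z * exp (b * z) = exp (b\<^sup>2 / 2) * normal_density b 1 z" for z
    by (simp add: normal_density_def exp_add[symmetric] power2_eq_square field_simps)
  show "integrable std_normal_distribution (\<lambda>z. exp (b * z))"
    by (subst integrable_density) (auto simp: eq)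
  show "integral\<^sup>L std_normal_distribution (\<lambda>z. exp (b * z)) = exp (b\<^sup>2 / 2)"
    by (subst integral_density) (auto simp: eq)
qed

lemma integrable_std_normal_exp_abs: "integrable std_normal_distribution (\<lambda>z. exp (b * \<bar>z\<bar>))"
proof (rule Bochner_Integration.integrable_bound)
  show "integrable std_normal_distribution (\<lambda>z. exp (b * z) + exp (- b * z))"
    by (intro Bochner_Integration.integrable_add integrable_std_normal_exp)
  have "norm (exp (b * \<bar>z\<bar>)) \<le> norm (exp (b * z) + exp (- b * z))" for z
  proof -
    have "0 < exp (b * z)" "0 < exp (- b * z)" by auto
    moreover have "exp (b * \<bar>z\<bar>) = exp (b * z) \<or> exp (b * \<bar>z\<bar>) = exp (- b * z)" by (simp add: abs_if)
    ultimately have "exp (b * \<bar>z\<bar>) \<le> exp (b * z) + exp (- b * z)" by linarith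
    then show ?thesis unfolding real_norm_def by (metis abs_ge_self abs_exp_cancel order_trans)
  qed
  then show "AE z in std_normal_distribution. norm (exp (b * \<bar>z\<bar>)) \<le> norm (exp (b * z) + exp (- b * z))"
    by simp
qed simp

lemma std_normal_distr_scale:
  assumes "c > 0"
  shows "distr std_normal_distribution borel (\<lambda>z. c * z) = density lborel (normal_density 0 c)"
proof -
  have "distributed std_normal_distribution lborel (\<lambda>z. z) (normal_density 0 1)"
    by (auto simp: distributed_def distr_id2)
  from std_normal.normal_density_affine[OF this, of c 0]
  have "distributed std_normal_distribution lborel (\<lambda>z. c * z) (normal_density 0 c)" using assms by simp
  then show ?thesis by (simp add: distributed_def cong: distr_cong)
qed

section \<open>Laws, moments and independence of Brownian increments\<close>

locale brownian = prob_space M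
  for M :: "'a measure" and F :: "real \<Rightarrow> 'a measure" and T :: real and W :: "real \<Rightarrow> 'a \<Rightarrow> real" +
  assumes T_pos: "T > 0" and basis: "stochastic_basis M F T" and bm: "standard_brownian_motion M F T W"
begin

lemma space_F: "t \<in> {0..T} \<Longrightarrow> space (F t) = space M"
  using basis by (auto simp: stochastic_basis_def subalgebra_def)

lemma measurable_F_M: "X \<in> measurable (F t) N \<Longrightarrow> t \<in> {0..T} \<Longrightarrow> X \<in> measurable M N"
  using basis by (auto simp: stochastic_basis_def intro: measurable_from_subalg)

lemma measurable_F_mono: "X \<in> measurable (F s) N \<Longrightarrow> 0 \<le> s \<Longrightarrow> s \<le> t \<Longrightarrow> t \<le> T \<Longrightarrow> X \<in> measurable (F t) N"
  using basis unfolding stochastic_basis_def by (intro measurable_from_subalg[of "F t" "F s"]) auto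

lemma W_measurable_F:
  assumes "0 \<le> s" "s \<le> t" "t \<le> T"
  shows "W s \<in> borel_measurable (F t)"
proof (rule measurable_F_mono)
  show "W s \<in> borel_measurable (F s)" using bm assms by (simp add: standard_brownian_motion_def)
qed (use assms in auto)

lemma W_measurable: "t \<in> {0..T} \<Longrightarrow> W t \<in> borel_measurable M"
  using W_measurable_F[of t t] measurable_F_M by auto

lemma W_continuous: "w \<in> space M \<Longrightarrow> continuous_on {0..T} (\<lambda>t. W t w)"
  using bm by (auto simp: standard_brownian_motion_def)

lemma W_zero: "AE w in M. W 0 w = 0"
  using bm by (auto simp: standard_brownian_motion_def)

lemma increment_measurable:
  "0 \<le> s \<Longrightarrow> s \<le> t \<Longrightarrow> t \<le> T \<Longrightarrow> (\<lambda>w. W t w - W s w) \<in> borel_measurable M"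
  using W_measurable[of s] W_measurable[of t] by auto

text \<open>Written as the law of a scaled standard normal variable, the statement also covers
  \<open>s = t\<close>, where there is no density.\<close>

lemma increment_distr:
  assumes "0 \<le> s" "s \<le> t" "t \<le> T"
  shows "distr M borel (\<lambda>w. W t w - W s w) = distr std_normal_distribution borel (\<lambda>z. sqrt (t - s) * z)"
proof (cases "s = t")
  case True
  have "distr M borel (\<lambda>w. 0 :: real) = return borel 0" by (intro distr_const) auto
  moreover have "distr std_normal_distribution borel (\<lambda>w. 0 :: real) = return borel 0"
    by (intro std_normal.distr_const) auto
  ultimately show ?thesis using True by simp
next
  case False
  then have "distributed M lborel (\<lambda>w. W t w - W s w) (normal_density 0 (sqrt (t - s)))"
    using bm assms by (auto simp: standard_brownian_motion_def)
  moreover have "distr M borel (\<lambda>w. W t w - W s w) = distr M lborel (\<lambda>w. W t w - W s w)"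
    by (intro distr_cong) auto
  ultimately show ?thesis using False assms by (simp add: distributed_def std_normal_distr_scale)
qed

lemma increment_integral:
  fixes \<phi> :: "real \<Rightarrow> real"
  assumes "0 \<le> s" "s \<le> t" "t \<le> T" and [measurable]: "\<phi> \<in> borel_measurable borel"
  shows "expectation (\<lambda>w. \<phi> (W t w - W s w)) = integral\<^sup>L std_normal_distribution (\<lambda>z. \<phi> (sqrt (t - s) * z))"
    and "integrable M (\<lambda>w. \<phi> (W t w - W s w)) \<longleftrightarrow> integrable std_normal_distribution (\<lambda>z. \<phi> (sqrt (t - s) * z))"
proof -
  note [measurable] = increment_measurable[OF assms(1-3)]
  have "expectation (\<lambda>w. \<phi> (W t w - W s w)) = integral\<^sup>L (distr M borel (\<lambda>w. W t w - W s w)) \<phi>"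
    by (simp add: integral_distr)
  also have "\<dots> = integral\<^sup>L std_normal_distribution (\<lambda>z. \<phi> (sqrt (t - s) * z))"
    unfolding increment_distr[OF assms(1-3)] by (simp add: integral_distr)
  finally show "expectation (\<lambda>w. \<phi> (W t w - W s w)) = integral\<^sup>L std_normal_distribution (\<lambda>z. \<phi> (sqrt (t - s) * z))" .
  have "integrable M (\<lambda>w. \<phi> (W t w - W s w)) \<longleftrightarrow> integrable (distr M borel (\<lambda>w. W t w - W s w)) \<phi>"
    by (simp add: integrable_distr_eq)
  also have "\<dots> \<longleftrightarrow> integrable std_normal_distribution (\<lambda>z. \<phi> (sqrt (t - s) * z))"
    unfolding increment_distr[OF assms(1-3)] by (simp add: integrable_distr_eq)
  finally show "integrable M (\<lambda>w. \<phi> (W t w - W s w)) \<longleftrightarrow> integrable std_normal_distribution (\<lambda>z. \<phi> (sqrt (t - s) * z))" .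
qed

lemma increment_indep_set:
  assumes "0 \<le> s" "s < t" "t \<le> T"
  shows "indep_set (sets (F s)) {(\<lambda>w. W t w - W s w) -` A \<inter> space M | A. A \<in> sets borel}"
  using bm assms by (auto simp: standard_brownian_motion_def)

text \<open>Conditioning on time \<open>s\<close> is expressed by this product rule: a function of
  the increment factors out of an expectation against anything known at time \<open>s\<close>.
  Independence is granted for \<open>s < t\<close> only; for \<open>s = t\<close> the increment is
  constant and the rule is immediate.\<close>

lemma increment_product:
  fixes P :: "'a \<Rightarrow> real" and \<phi> :: "real \<Rightarrow> real"
  assumes st: "0 \<le> s" "s \<le> t" "t \<le> T" and P: "P \<in> borel_measurable (F s)" "integrable M P"
    and [measurable]: "\<phi> \<in> borel_measurable borel" and \<phi>: "integrable M (\<lambda>w. \<phi> (W t w - W s w))"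
  shows "integrable M (\<lambda>w. P w * \<phi> (W t w - W s w))"
    and "expectation (\<lambda>w. P w * \<phi> (W t w - W s w)) = expectation P * expectation (\<lambda>w. \<phi> (W t w - W s w))"
proof -
  have sT: "s \<in> {0..T}" using st by auto
  note [measurable] = increment_measurable[OF st]
  have "indep_var borel P borel (\<lambda>w. \<phi> (W t w - W s w))" if "s < t"
    unfolding indep_var_eq
  proof (intro conjI)
    show "random_variable borel P" by (rule measurable_F_M[OF P(1) sT])
    have 1: "sigma_sets (space M) {P -` A \<inter> space M |A. A \<in> sets borel} \<subseteq> sets (F s)"
      using measurable_sets[OF P(1)] unfolding space_F[OF sT, symmetric] by (intro sets.sigma_sets_subset) auto
    \<comment> \<open>The preimages in the independence hypothesis already form a sigma-algebra, and
      this structure gives it a name; the sigma-algebra generated by \<open>\<phi>\<close> of the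
      increment therefore stays inside it.\<close>
    define V where "V = vimage_algebra (space M) (\<lambda>w. W t w - W s w) (borel :: real measure)"
    have setsV: "sets V = {(\<lambda>w. W t w - W s w) -` A \<inter> space M | A. A \<in> sets borel}"
      unfolding V_def by (rule sets_vimage_algebra2) auto
    have spV: "space V = space M" by (simp add: V_def)
    have 2: "sigma_sets (space M) {(\<lambda>w. \<phi> (W t w - W s w)) -` A \<inter> space M |A. A \<in> sets borel}
      \<subseteq> {(\<lambda>w. W t w - W s w) -` A \<inter> space M | A. A \<in> sets borel}"
      unfolding setsV[symmetric] unfolding spV[symmetric]
    proof (rule sets.sigma_sets_subset, safe)
      fix A :: "real set" assume "A \<in> sets borel"
      then have "\<phi> -` A \<in> sets borel" using measurable_sets_borel[OF assms(6)] by auto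
      then show "(\<lambda>w. \<phi> (W t w - W s w)) -` A \<inter> space V \<in> sets V"
        unfolding setsV spV by (auto intro!: exI[of _ "\<phi> -` A"])
    qed
    show "indep_set (sigma_sets (space M) {P -` A \<inter> space M |A. A \<in> sets borel})
        (sigma_sets (space M) {(\<lambda>w. \<phi> (W t w - W s w)) -` A \<inter> space M |A. A \<in> sets borel})"
      using increment_indep_set[OF st(1) that st(3)] 1 2
      unfolding indep_sets2_eq by (meson subset_eq)
  qed simp
  note ind = this
  show "integrable M (\<lambda>w. P w * \<phi> (W t w - W s w))"
    using indep_var_integrable[OF ind P(2) \<phi>] P(2) st by (cases "s = t") auto
  show "expectation (\<lambda>w. P w * \<phi> (W t w - W s w)) = expectation P * expectation (\<lambda>w. \<phi> (W t w - W s w))"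
    using indep_var_lebesgue_integral[OF ind P(2) \<phi>] P(2) st by (cases "s = t") (auto simp: prob_space)
qed

definition time_pairs :: "(real \<times> real) set" where
  "time_pairs = {(s, t). 0 \<le> s \<and> s \<le> t \<and> t \<le> T}"

text \<open>The increment is \<open>sqrt (t - s)\<close> times a standard normal variable, and
  \<open>sqrt (t - s)\<close> is at most \<open>sqrt T\<close>; one Gaussian exponential moment thus
  dominates all pairs of times.\<close>

lemma bounded_moments_exp_increment:
  "bounded_moments time_pairs (\<lambda>(s, t) w. exp (a * \<bar>W t w - W s w\<bar>))"
proof (rule bounded_momentsI)
  fix q :: nat
  define b where "b = real q * \<bar>a\<bar> * sqrt T"
  show "\<exists>B. \<forall>i\<in>time_pairs. \<exists>V. integrable M V \<and> (AE w in M. \<bar>(case i of (s, t) \<Rightarrow> \<lambda>w. exp (a * \<bar>W t w - W s w\<bar>)) w\<bar> ^ q \<le> V w) \<and> expectation V \<le> B"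
  proof (intro exI[of _ "integral\<^sup>L std_normal_distribution (\<lambda>z. exp (b * \<bar>z\<bar>))"] ballI)
    fix i assume "i \<in> time_pairs"
    then obtain s t where i: "i = (s, t)" and st: "0 \<le> s" "s \<le> t" "t \<le> T" by (auto simp: time_pairs_def)
    let ?V = "\<lambda>x::real. exp (real q * \<bar>a\<bar> * \<bar>x\<bar>)"
    have le: "?V (sqrt (t - s) * z) \<le> exp (b * \<bar>z\<bar>)" for z
    proof -
      have "sqrt (t - s) \<le> sqrt T" using st by simp
      then have "(real q * \<bar>a\<bar> * \<bar>z\<bar>) * sqrt (t - s) \<le> (real q * \<bar>a\<bar> * \<bar>z\<bar>) * sqrt T"
        by (intro mult_left_mono) auto
      then show ?thesis using st by (simp add: b_def abs_mult algebra_simps)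
    qed
    have int: "integrable std_normal_distribution (\<lambda>z. ?V (sqrt (t - s) * z))"
      by (rule Bochner_Integration.integrable_bound[OF integrable_std_normal_exp_abs[of b]]) (use le in auto)
    have "expectation (\<lambda>w. ?V (W t w - W s w)) \<le> integral\<^sup>L std_normal_distribution (\<lambda>z. exp (b * \<bar>z\<bar>))"
      by (subst increment_integral[OF st]) (auto intro!: integral_mono int integrable_std_normal_exp_abs le)
    moreover have "integrable M (\<lambda>w. ?V (W t w - W s w))"
      by (subst increment_integral[OF st]) (auto intro!: int)
    moreover have "\<bar>exp (a * \<bar>x\<bar>)\<bar> ^ q \<le> ?V x" for x
      by (auto simp: exp_of_nat_mult[symmetric] mult.assoc intro!: mult_left_mono mult_right_mono)
    ultimately show "\<exists>V. integrable M V \<and> (AE w in M. \<bar>(case i of (s, t) \<Rightarrow> \<lambda>w. exp (a * \<bar>W t w - W s w\<bar>)) w\<bar> ^ q \<le> V w)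
       \<and> expectation V \<le> integral\<^sup>L std_normal_distribution (\<lambda>z. exp (b * \<bar>z\<bar>))"
      by (intro exI[of _ "\<lambda>w. ?V (W t w - W s w)"]) (auto simp: i)
  qed
next
  fix i assume "i \<in> time_pairs"
  then show "(case i of (s, t) \<Rightarrow> \<lambda>w. exp (a * \<bar>W t w - W s w\<bar>)) \<in> borel_measurable M"
    using increment_measurable by (auto simp: time_pairs_def)
qed

lemma bounded_moments_increment: "bounded_moments time_pairs (\<lambda>(s, t) w. W t w - W s w)"
proof (rule bounded_moments_mono[OF bounded_moments_exp_increment[of 1]])
  fix i assume "i \<in> time_pairs"
  have "\<bar>x\<bar> \<le> exp \<bar>x\<bar>" for x :: real using exp_ge_add_one_self[of "\<bar>x\<bar>"] by linarith
  then show "AE w in M. \<bar>(case i of (s, t) \<Rightarrow> \<lambda>w. W t w - W s w) w\<bar> \<le> \<bar>(case i of (s, t) \<Rightarrow> \<lambda>w. exp (1 * \<bar>W t w - W s w\<bar>)) w\<bar>"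
    by (auto split: prod.split)
  show "(case i of (s, t) \<Rightarrow> \<lambda>w. W t w - W s w) \<in> borel_measurable M"
    using \<open>i \<in> time_pairs\<close> increment_measurable by (auto simp: time_pairs_def)
qed

lemma all_moments_increment:
  "0 \<le> s \<Longrightarrow> s \<le> t \<Longrightarrow> t \<le> T \<Longrightarrow> all_moments (\<lambda>w. W t w - W s w)"
  using bounded_moments_member[OF bounded_moments_increment, of "(s, t)"] by (simp add: time_pairs_def)

lemma increment_mean:
  assumes "0 \<le> s" "s \<le> t" "t \<le> T"
  shows "expectation (\<lambda>w. W t w - W s w) = 0"
  using integral_std_normal_distribution_moment_odd[of 1]
  by (subst increment_integral[OF assms]) auto

lemma increment_square:
  assumes "0 \<le> s" "s \<le> t" "t \<le> T"
  shows "expectation (\<lambda>w. (W t w - W s w)\<^sup>2) = t - s"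
  using assms std_normal_distribution_even_moments(1)[of 1]
  by (subst increment_integral[OF assms]) (auto simp: power_mult_distrib)

lemma increment_fourth:
  assumes "0 \<le> s" "s \<le> t" "t \<le> T"
  shows "expectation (\<lambda>w. (W t w - W s w) ^ 4) = 3 * (t - s)\<^sup>2"
proof -
  have "sqrt (t - s) ^ 4 = (sqrt (t - s) ^ 2)\<^sup>2" by (simp flip: power_mult)
  then have "sqrt (t - s) ^ 4 = (t - s)\<^sup>2" using assms by simp
  then show ?thesis using assms std_normal_distribution_even_moments(1)[of 2]
    by (subst increment_integral[OF assms]) (auto simp: power_mult_distrib fact_numeral)
qed

lemma increment_product_mean:
  assumes "0 \<le> s" "s \<le> t" "t \<le> T" "P \<in> borel_measurable (F s)" "integrable M P"
  shows "integrable M (\<lambda>w. P w * (W t w - W s w))" "expectation (\<lambda>w. P w * (W t w - W s w)) = 0"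
  using increment_product[OF assms, of "\<lambda>x. x"] increment_mean[OF assms(1-3)]
    all_moments_integrable[OF all_moments_increment[OF assms(1-3)]] by auto

lemma increment_product_square:
  assumes "0 \<le> s" "s \<le> t" "t \<le> T" "P \<in> borel_measurable (F s)" "integrable M P"
  shows "integrable M (\<lambda>w. P w * (W t w - W s w)\<^sup>2)"
    "expectation (\<lambda>w. P w * (W t w - W s w)\<^sup>2) = expectation P * (t - s)"
  using increment_product[OF assms, of "\<lambda>x. x\<^sup>2"] increment_square[OF assms(1-3)]
    all_moments_integrable[OF bounded_moments_power[OF all_moments_increment[OF assms(1-3)], of 2]] by auto

end

section \<open>Geometric Brownian motion\<close>

locale black_scholes = brownian M F T W
  for M :: "'a measure" and F :: "real \<Rightarrow> 'a measure" and T :: real and W :: "real \<Rightarrow> 'a \<Rightarrow> real" +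
  fixes S0 r \<sigma> :: real
begin

definition drift :: real where "drift = r - \<sigma>\<^sup>2 / 2"

abbreviation S :: "real \<Rightarrow> 'a \<Rightarrow> real" where "S \<equiv> asset_price S0 r \<sigma> W"

lemma S_measurable_F: "0 \<le> s \<Longrightarrow> s \<le> t \<Longrightarrow> t \<le> T \<Longrightarrow> S s \<in> borel_measurable (F t)"
  using W_measurable_F[of s t] unfolding asset_price_def by measurable

lemma S_measurable: "t \<in> {0..T} \<Longrightarrow> S t \<in> borel_measurable M"
  using W_measurable[of t] unfolding asset_price_def by measurable

lemma S_continuous: "w \<in> space M \<Longrightarrow> continuous_on {0..T} (\<lambda>t. S t w)"
  unfolding asset_price_def by (intro continuous_intros W_continuous)

lemma S_increment: "S t w = S s w * exp (drift * (t - s) + \<sigma> * (W t w - W s w))"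
proof -
  have "(r - \<sigma>\<^sup>2 / 2) * t + \<sigma> * W t w = ((r - \<sigma>\<^sup>2 / 2) * s + \<sigma> * W s w) + (drift * (t - s) + \<sigma> * (W t w - W s w))"
    unfolding drift_def by (simp only: right_diff_distrib)
  then show ?thesis by (simp only: asset_price_def exp_add mult.assoc)
qed

lemma bounded_moments_S: "bounded_moments {0..T} S"
proof (rule bounded_moments_mono)
  show "bounded_moments {0..T} (\<lambda>t w. (S0 * exp (\<bar>drift\<bar> * T)) * exp (\<bar>\<sigma>\<bar> * \<bar>W t w - W 0 w\<bar>))"
    using bounded_moments_subfamily[OF bounded_moments_exp_increment[of "\<bar>\<sigma>\<bar>"], where g="\<lambda>t. (0, t)" and B="{0..T}"]
    by (intro bounded_moments_mult bounded_moments_const) (auto simp: time_pairs_def)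
  fix t assume t: "t \<in> {0..T}"
  show "AE w in M. \<bar>S t w\<bar> \<le> \<bar>(S0 * exp (\<bar>drift\<bar> * T)) * exp (\<bar>\<sigma>\<bar> * \<bar>W t w - W 0 w\<bar>)\<bar>"
    using W_zero
  proof eventually_elim
    case (elim w)
    have "drift * t \<le> \<bar>drift\<bar> * T" using t by (intro order_trans[OF mult_right_mono mult_left_mono]) auto
    moreover have "\<sigma> * W t w \<le> \<bar>\<sigma>\<bar> * \<bar>W t w\<bar>" by (metis abs_ge_self abs_mult)
    ultimately have "exp (drift * t + \<sigma> * W t w) \<le> exp (\<bar>drift\<bar> * T) * exp (\<bar>\<sigma>\<bar> * \<bar>W t w\<bar>)"
      by (simp flip: exp_add)
    then have "\<bar>S0\<bar> * exp (drift * t + \<sigma> * W t w) \<le> \<bar>S0\<bar> * (exp (\<bar>drift\<bar> * T) * exp (\<bar>\<sigma>\<bar> * \<bar>W t w\<bar>))"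
      by (rule mult_left_mono) simp
    then show ?case using elim by (simp add: asset_price_def drift_def abs_mult mult.assoc)
  qed
qed (rule S_measurable)

lemma all_moments_S: "t \<in> {0..T} \<Longrightarrow> all_moments (S t)"
  by (rule bounded_moments_member[OF bounded_moments_S])

lemma bounded_moments_exp_growth:
  "bounded_moments time_pairs (\<lambda>(s, t) w. exp (drift * (t - s) + \<sigma> * (W t w - W s w)))"
proof (rule bounded_moments_mono)
  show "bounded_moments time_pairs (\<lambda>i w. exp (\<bar>drift\<bar> * T) * (case i of (s, t) \<Rightarrow> \<lambda>w. exp (\<bar>\<sigma>\<bar> * \<bar>W t w - W s w\<bar>)) w)"
    by (intro bounded_moments_mult bounded_moments_const bounded_moments_exp_increment)
  fix i assume "i \<in> time_pairs"
  then obtain s t where i: "i = (s, t)" and st: "0 \<le> s" "s \<le> t" "t \<le> T" by (auto simp: time_pairs_def)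
  have 1: "drift * (t - s) \<le> \<bar>drift\<bar> * T" using st by (intro order_trans[OF mult_right_mono mult_left_mono]) auto
  have "\<sigma> * x \<le> \<bar>\<sigma>\<bar> * \<bar>x\<bar>" for x by (metis abs_ge_self abs_mult)
  then have "drift * (t - s) + \<sigma> * x \<le> \<bar>drift\<bar> * T + \<bar>\<sigma>\<bar> * \<bar>x\<bar>" for x using 1 by (intro add_mono)
  then show "AE w in M. \<bar>(case i of (s, t) \<Rightarrow> \<lambda>w. exp (drift * (t - s) + \<sigma> * (W t w - W s w))) w\<bar>
     \<le> \<bar>exp (\<bar>drift\<bar> * T) * (case i of (s, t) \<Rightarrow> \<lambda>w. exp (\<bar>\<sigma>\<bar> * \<bar>W t w - W s w\<bar>)) w\<bar>"
    by (simp add: i flip: exp_add)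
  note [measurable] = increment_measurable[OF st]
  show "(case i of (s, t) \<Rightarrow> \<lambda>w. exp (drift * (t - s) + \<sigma> * (W t w - W s w))) \<in> borel_measurable M"
    by (simp add: i)
qed

lemma growth_mean:
  assumes "0 \<le> s" "s \<le> t" "t \<le> T"
  shows "expectation (\<lambda>w. exp (drift * (t - s) + \<sigma> * (W t w - W s w))) = exp (r * (t - s))"
proof -
  have "expectation (\<lambda>w. exp (drift * (t - s) + \<sigma> * (W t w - W s w)))
    = integral\<^sup>L std_normal_distribution (\<lambda>z. exp (drift * (t - s)) * exp ((\<sigma> * sqrt (t - s)) * z))"
    by (subst increment_integral[OF assms]) (auto simp: exp_add mult.assoc)
  also have "\<dots> = exp (drift * (t - s)) * exp ((\<sigma> * sqrt (t - s))\<^sup>2 / 2)"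
    by (simp add: integral_std_normal_exp)
  also have "\<dots> = exp (r * (t - s))"
    using assms by (simp add: power_mult_distrib drift_def flip: exp_add) (simp add: field_simps)
  finally show ?thesis .
qed

text \<open>Scaling by \<open>sqrt h\<close> turns an increment over a time \<open>h \<le> T\<close> into a standard normal variable,
  which leaves a Gaussian exponential moment that does not depend on \<open>h\<close>.\<close>

lemma growth_estimates:
  obtains C where "C > 0"
    "\<And>s t. 0 \<le> s \<Longrightarrow> s \<le> t \<Longrightarrow> t \<le> T \<Longrightarrow>
      expectation (\<lambda>w. (exp (drift * (t - s) + \<sigma> * (W t w - W s w)) - 1)\<^sup>2) \<le> C * (t - s)"
    "\<And>s t. 0 \<le> s \<Longrightarrow> s \<le> t \<Longrightarrow> t \<le> T \<Longrightarrow>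
      expectation (\<lambda>w. (exp (drift * (t - s) + \<sigma> * (W t w - W s w)) - 1) ^ 4) \<le> C * (t - s)\<^sup>2"
    "\<And>s t. 0 \<le> s \<Longrightarrow> s \<le> t \<Longrightarrow> t \<le> T \<Longrightarrow>
      expectation (\<lambda>w. (exp (drift * (t - s) + \<sigma> * (W t w - W s w)) - 1 - \<sigma> * (W t w - W s w))\<^sup>2) \<le> C * (t - s)\<^sup>2"
proof -
  \<comment> \<open>\<open>sqrt h * A z\<close> dominates the exponent over a time
    \<open>h \<le> T\<close>: of the two factors \<open>sqrt h\<close> in the drift part one is
    given up to \<open>sqrt T\<close>.\<close>
  define A where "A z = \<bar>drift\<bar> * sqrt T + \<bar>\<sigma>\<bar> * \<bar>z\<bar>" for z
  have A0: "A z \<ge> 0" for z using T_pos by (simp add: A_def)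
  have intA: "integrable std_normal_distribution (\<lambda>z. exp (b * A z))" for b
  proof -
    have "(\<lambda>z. exp (b * A z)) = (\<lambda>z. exp (b * \<bar>drift\<bar> * sqrt T) * exp ((b * \<bar>\<sigma>\<bar>) * \<bar>z\<bar>))"
      by (auto simp: A_def algebra_simps simp flip: exp_add)
    then show ?thesis using integrable_std_normal_exp_abs by simp
  qed
  \<comment> \<open>In the exponent the summand 1 pays for a power of \<open>A z\<close> through
    \<open>power_le_fact_exp\<close>, and \<open>4 * sqrt T\<close> pays for a factor
    \<open>exp (4 * \<bar>y\<bar>)\<close>, the largest that occurs.\<close>
  define K where "K = integral\<^sup>L std_normal_distribution (\<lambda>z. exp ((1 + 4 * sqrt T) * A z))"
  have K0: "K \<ge> 0" by (auto simp: K_def)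
  have key: "\<bar>drift * h + \<sigma> * (sqrt h * z)\<bar> \<le> sqrt h * A z" if "0 \<le> h" "h \<le> T" for h z
  proof -
    have "\<bar>drift * h + \<sigma> * (sqrt h * z)\<bar> \<le> \<bar>drift\<bar> * h + \<bar>\<sigma>\<bar> * (sqrt h * \<bar>z\<bar>)"
      using that by (intro order_trans[OF abs_triangle_ineq]) (simp add: abs_mult)
    also have "\<bar>drift\<bar> * h = \<bar>drift\<bar> * (sqrt h * sqrt h)" using that by simp
    also have "\<dots> \<le> \<bar>drift\<bar> * (sqrt h * sqrt T)"
      using that by (intro mult_left_mono) auto
    finally show ?thesis by (simp add: A_def algebra_simps)
  qed
  have gen: "\<bar>y\<bar> ^ k * exp (real k' * \<bar>y\<bar>) \<le> sqrt h ^ k * (fact k * exp ((1 + 4 * sqrt T) * A z))"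
    if "0 \<le> h" "h \<le> T" "k' \<le> 4" "y = drift * h + \<sigma> * (sqrt h * z)" for h z y k k'
  proof -
    have y: "\<bar>y\<bar> \<le> sqrt h * A z" using key[OF that(1,2)] that(4) by simp
    also have "\<dots> \<le> sqrt T * A z" using that A0 by (intro mult_right_mono) auto
    finally have y': "\<bar>y\<bar> \<le> sqrt T * A z" .
    have "\<bar>y\<bar> ^ k \<le> (sqrt h * A z) ^ k" by (rule power_mono[OF y]) simp
    also have "\<dots> \<le> sqrt h ^ k * (fact k * exp (A z))"
      unfolding power_mult_distrib using that A0 by (intro mult_left_mono power_le_fact_exp) auto
    finally have 1: "\<bar>y\<bar> ^ k \<le> sqrt h ^ k * (fact k * exp (A z))" .
    have "real k' * \<bar>y\<bar> \<le> 4 * (sqrt T * A z)" using that y' by (intro mult_mono) auto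
    then have "\<bar>y\<bar> ^ k * exp (real k' * \<bar>y\<bar>) \<le> (sqrt h ^ k * (fact k * exp (A z))) * exp (4 * (sqrt T * A z))"
      using 1 that by (intro mult_mono) auto
    then show ?thesis by (simp add: algebra_simps exp_add)
  qed
  \<comment> \<open>The three bounds need 2!, 4! and 2 * 4! times \<open>K\<close>. The last one
    also carries \<open>2 * drift\<^sup>2\<close>, because its difference removes only the Brownian
    part of the exponent and leaves the drift.\<close>
  define C where "C = 48 * K + 2 * drift\<^sup>2 + 1"
  have C: "C > 0" "2 * K \<le> C" "24 * K \<le> C" "48 * K + 2 * drift\<^sup>2 \<le> C" using K0 by (auto simp: C_def intro: add_nonneg_pos)
  show thesis
  proof (rule that[OF C(1)])
    fix s t :: real assume st: "0 \<le> s" "s \<le> t" "t \<le> T"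
    define h where "h = t - s"
    have h: "0 \<le> h" "h \<le> T" using st by (auto simp: h_def)
    define y where "y z = drift * h + \<sigma> * (sqrt h * z)" for z
    have [measurable]: "y \<in> borel_measurable borel" unfolding y_def[abs_def] by measurable
    have s4: "sqrt h ^ 4 = h\<^sup>2"
    proof -
      have "sqrt h ^ 4 = (sqrt h ^ 2)\<^sup>2" by (simp flip: power_mult)
      then show ?thesis using h by simp
    qed
    note I = intA[of "1 + 4 * sqrt T"]
    have p2: "(exp (y z) - 1)\<^sup>2 \<le> h * (2 * exp ((1 + 4 * sqrt T) * A z))" for z
    proof -
      have "(exp (y z) - 1)\<^sup>2 \<le> (\<bar>y z\<bar> * exp \<bar>y z\<bar>)\<^sup>2"
        using abs_exp_minus_one_le[of "y z"] by (intro power2_le_iff_abs_le[THEN iffD2]) auto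
      also have "\<dots> = \<bar>y z\<bar> ^ 2 * exp (real 2 * \<bar>y z\<bar>)" by (simp add: power_mult_distrib exp_double)
      also have "\<dots> \<le> sqrt h ^ 2 * (fact 2 * exp ((1 + 4 * sqrt T) * A z))"
        by (rule gen[OF h _ y_def]) simp
      finally show ?thesis using h by simp
    qed
    have p4: "(exp (y z) - 1) ^ 4 \<le> h\<^sup>2 * (24 * exp ((1 + 4 * sqrt T) * A z))" for z
    proof -
      have "(exp (y z) - 1) ^ 4 = \<bar>exp (y z) - 1\<bar> ^ 4" by simp
      also have "\<dots> \<le> (\<bar>y z\<bar> * exp \<bar>y z\<bar>) ^ 4"
        by (intro power_mono abs_exp_minus_one_le) auto
      also have "\<dots> = \<bar>y z\<bar> ^ 4 * exp (real 4 * \<bar>y z\<bar>)" by (simp add: power_mult_distrib flip: exp_of_nat_mult)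
      also have "\<dots> \<le> sqrt h ^ 4 * (fact 4 * exp ((1 + 4 * sqrt T) * A z))"
        by (rule gen[OF h _ y_def]) simp
      finally show ?thesis by (simp add: s4 fact_numeral)
    qed
    have q2: "(exp (y z) - 1 - \<sigma> * (sqrt h * z))\<^sup>2 \<le> h\<^sup>2 * (48 * exp ((1 + 4 * sqrt T) * A z) + 2 * drift\<^sup>2)" for z
    proof -
      have sq: "(a + b)\<^sup>2 \<le> 2 * a\<^sup>2 + 2 * b\<^sup>2" for a b :: real
        using zero_le_power2[of "a - b"] by (simp add: power2_eq_square algebra_simps)
      have "(exp (y z) - 1 - \<sigma> * (sqrt h * z))\<^sup>2 = ((exp (y z) - 1 - y z) + drift * h)\<^sup>2"
        by (intro arg_cong[of _ _ "\<lambda>x. x\<^sup>2"]) (simp add: y_def)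
      also have "\<dots> \<le> 2 * (exp (y z) - 1 - y z)\<^sup>2 + 2 * (drift * h)\<^sup>2" by (rule sq)
      also have "(exp (y z) - 1 - y z)\<^sup>2 \<le> ((y z)\<^sup>2 * exp \<bar>y z\<bar>)\<^sup>2"
        using abs_exp_minus_one_minus_le[of "y z"] by (intro power2_le_iff_abs_le[THEN iffD2]) auto
      also have "\<dots> = \<bar>y z\<bar> ^ 4 * exp (real 2 * \<bar>y z\<bar>)" by (simp add: power_mult_distrib exp_double flip: power_mult)
      also have "\<dots> \<le> sqrt h ^ 4 * (fact 4 * exp ((1 + 4 * sqrt T) * A z))"
        by (rule gen[OF h _ y_def]) simp
      finally show ?thesis by (simp add: s4 fact_numeral power_mult_distrib algebra_simps)
    qed
    have "expectation (\<lambda>w. (exp (drift * h + \<sigma> * (W t w - W s w)) - 1)\<^sup>2) = integral\<^sup>L std_normal_distribution (\<lambda>z. (exp (y z) - 1)\<^sup>2)"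
      by (subst increment_integral(1)[OF st]) (auto simp: y_def h_def)
    also have "\<dots> \<le> integral\<^sup>L std_normal_distribution (\<lambda>z. h * (2 * exp ((1 + 4 * sqrt T) * A z)))"
      by (intro integral_mono' p2) (use I h in auto)
    also have "\<dots> = h * (2 * K)" by (simp add: K_def)
    also have "\<dots> \<le> h * C" using h C by (intro mult_left_mono)
    finally show "expectation (\<lambda>w. (exp (drift * (t - s) + \<sigma> * (W t w - W s w)) - 1)\<^sup>2) \<le> C * (t - s)"
      by (simp add: h_def mult.commute)
    have "expectation (\<lambda>w. (exp (drift * h + \<sigma> * (W t w - W s w)) - 1) ^ 4) = integral\<^sup>L std_normal_distribution (\<lambda>z. (exp (y z) - 1) ^ 4)"
      by (subst increment_integral(1)[OF st]) (auto simp: y_def h_def)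
    also have "\<dots> \<le> integral\<^sup>L std_normal_distribution (\<lambda>z. h\<^sup>2 * (24 * exp ((1 + 4 * sqrt T) * A z)))"
      by (intro integral_mono' p4) (use I h in auto)
    also have "\<dots> = h\<^sup>2 * (24 * K)" by (simp add: K_def)
    also have "\<dots> \<le> h\<^sup>2 * C" using h C by (intro mult_left_mono) auto
    finally show "expectation (\<lambda>w. (exp (drift * (t - s) + \<sigma> * (W t w - W s w)) - 1) ^ 4) \<le> C * (t - s)\<^sup>2"
      by (simp add: h_def mult.commute)
    have "expectation (\<lambda>w. (exp (drift * h + \<sigma> * (W t w - W s w)) - 1 - \<sigma> * (W t w - W s w))\<^sup>2)
        = integral\<^sup>L std_normal_distribution (\<lambda>z. (exp (y z) - 1 - \<sigma> * (sqrt h * z))\<^sup>2)"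
      by (subst increment_integral(1)[OF st]) (auto simp: y_def h_def)
    also have "\<dots> \<le> integral\<^sup>L std_normal_distribution (\<lambda>z. h\<^sup>2 * (48 * exp ((1 + 4 * sqrt T) * A z) + 2 * drift\<^sup>2))"
      by (intro integral_mono' q2) (use I in auto)
    also have "\<dots> = h\<^sup>2 * (48 * K + 2 * drift\<^sup>2)"
    proof -
      have "measure std_normal_distribution (space std_normal_distribution) = 1" by (rule std_normal.prob_space)
      then show ?thesis using I by (simp add: K_def)
    qed
    also have "\<dots> \<le> h\<^sup>2 * C" using h C by (intro mult_left_mono) auto
    finally show "expectation (\<lambda>w. (exp (drift * (t - s) + \<sigma> * (W t w - W s w)) - 1 - \<sigma> * (W t w - W s w))\<^sup>2) \<le> C * (t - s)\<^sup>2"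
      by (simp add: h_def mult.commute)
  qed
qed

end

section \<open>Discretisation error on a fine mesh\<close>

lemma power2_sum3_le: "(a + b + c :: real)\<^sup>2 \<le> 3 * (a\<^sup>2 + b\<^sup>2 + c\<^sup>2)"
  using zero_le_power2[of "a - b"] zero_le_power2[of "b - c"] zero_le_power2[of "a - c"]
  by (simp add: power2_eq_square algebra_simps)

lemma power4_sum3_le: "(a + b + c :: real) ^ 4 \<le> 27 * (a ^ 4 + b ^ 4 + c ^ 4)"
proof -
  have p4: "x ^ 4 = (x\<^sup>2)\<^sup>2" for x :: real by (simp flip: power_mult)
  have "((a + b + c)\<^sup>2)\<^sup>2 \<le> (3 * (a\<^sup>2 + b\<^sup>2 + c\<^sup>2))\<^sup>2"
    by (intro power_mono power2_sum3_le) auto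
  also have "\<dots> = 9 * (a\<^sup>2 + b\<^sup>2 + c\<^sup>2)\<^sup>2" 
  proof -
    have "(3::real)\<^sup>2 = 9" by simp
    then show ?thesis by (simp only: power_mult_distrib)
  qed
  also have "\<dots> \<le> 9 * (3 * ((a\<^sup>2)\<^sup>2 + (b\<^sup>2)\<^sup>2 + (c\<^sup>2)\<^sup>2))"
    by (intro mult_left_mono power2_sum3_le) auto
  finally show ?thesis unfolding p4 by linarith
qed

lemma power_mean_even_le:
  fixes a :: "nat \<Rightarrow> real"
  assumes "m > 0" "even q"
  shows "((\<Sum>k<m. a k) / real m) ^ q \<le> (\<Sum>k<m. a k ^ q) / real m"
proof -
  have "((\<Sum>k<m. a k) / real m) ^ q = \<bar>(\<Sum>k<m. a k) / real m\<bar> ^ q"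
    by (rule power_even_abs[OF assms(2), symmetric])
  also have "\<dots> \<le> ((\<Sum>k<m. \<bar>a k\<bar>) / real m) ^ q"
    by (intro power_mono) (auto intro!: divide_right_mono)
  also have "\<dots> \<le> (\<Sum>k<m. \<bar>a k\<bar> ^ q) / real m" by (rule power_mean_le) (use assms in auto)
  finally show ?thesis using assms by (simp add: power_even_abs)
qed

lemma average_le:
  fixes a :: "nat \<Rightarrow> real"
  assumes "m > 0" "\<And>k. k < m \<Longrightarrow> a k \<le> b"
  shows "(\<Sum>k<m. a k) / real m \<le> b"
  using sum_mono[of "{..<m}" a "\<lambda>_. b"] assms by (simp add: field_simps)

lemma discrete_gronwall:
  fixes x :: "nat \<Rightarrow> real"
  assumes "\<And>k. k < n \<Longrightarrow> x (Suc k) \<le> x k * (1 + c)" "x 0 \<le> K" "c \<ge> 0" "K \<ge> 0" "k \<le> n"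
  shows "x k \<le> K * exp (c * real k)"
  using \<open>k \<le> n\<close>
proof (induction k)
  case (Suc k)
  have "x (Suc k) \<le> x k * (1 + c)" using assms(1) Suc by auto
  also have "\<dots> \<le> (K * exp (c * real k)) * exp c"
    using Suc assms by (intro mult_mono) (auto simp: exp_ge_add_one_self)
  finally show ?case by (simp add: algebra_simps exp_add)
qed (use assms in auto)

section \<open>The two nested grids and conditional bounds over one coarse step\<close>

context brownian
begin

lemma expectation_average:
  assumes "\<And>j. j < N \<Longrightarrow> integrable M (f j)"
  shows "integrable M (\<lambda>w. (\<Sum>j<N. f j w) / real N)"
    "expectation (\<lambda>w. (\<Sum>j<N. f j w) / real N) = (\<Sum>j<N. expectation (f j)) / real N"
  by (intro integrable_divide Bochner_Integration.integrable_sum; use assms in simp)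
     (use assms in \<open>simp add: Bochner_Integration.integral_sum\<close>)

definition grid :: "nat \<Rightarrow> nat \<Rightarrow> real" where "grid n k = real k * (T / real n)"

lemma grid_nonneg: "0 \<le> grid n k" using T_pos by (simp add: grid_def)

lemma grid_le_T: "k \<le> n \<Longrightarrow> grid n k \<le> T"
  using T_pos by (cases "n = 0") (auto simp: grid_def field_simps)

lemma grid_mono: "k \<le> l \<Longrightarrow> grid n k \<le> grid n l"
  unfolding grid_def by (intro mult_right_mono) (use T_pos in auto)

lemma grid_in: "k \<le> n \<Longrightarrow> grid n k \<in> {0..T}"
  using grid_nonneg grid_le_T by auto

lemma grid_refine: "N > 0 \<Longrightarrow> grid (n * N) (k * N) = grid n k"
  by (simp add: grid_def)

lemma grid_0: "grid n 0 = 0" by (simp add: grid_def)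

lemma grid_n: "n > 0 \<Longrightarrow> grid n n = T" by (simp add: grid_def)

text \<open>Besides the fine nodes \<open>j < N\<close> of the step, \<open>j = N\<close> is allowed
  and gives the increment over the whole coarse step.\<close>

definition block_incr :: "nat \<Rightarrow> nat \<Rightarrow> nat \<Rightarrow> nat \<Rightarrow> 'a \<Rightarrow> real" where
  "block_incr n N k j w = W (grid (n * N) (k * N + j)) w - W (grid n k) w"

lemma block_index:
  fixes k n j N :: nat
  assumes "k < n" "j \<le> N"
  shows "k * N + j \<le> n * N"
proof -
  have "k * N + j \<le> Suc k * N" using assms by simp
  also have "\<dots> \<le> n * N" using \<open>k < n\<close> by (intro mult_le_mono1) auto
  finally show ?thesis .
qed

lemma block_times:
  assumes "k < n" "j \<le> N" "N > 0"
  shows "0 \<le> grid n k" "grid n k \<le> grid (n * N) (k * N + j)" "grid (n * N) (k * N + j) \<le> T"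
    "grid (n * N) (k * N + j) \<le> grid n (Suc k)"
    "grid (n * N) (k * N + j) - grid n k = real j * (T / real (n * N))"
proof -
  show "grid (n * N) (k * N + j) \<le> T" using assms by (intro grid_le_T block_index)
  show "grid n k \<le> grid (n * N) (k * N + j)"
    unfolding grid_refine[OF assms(3), of n k, symmetric] by (intro grid_mono) simp
  show "grid (n * N) (k * N + j) \<le> grid n (Suc k)"
    unfolding grid_refine[OF assms(3), of n "Suc k", symmetric] using assms by (intro grid_mono) simp
  show "grid (n * N) (k * N + j) - grid n k = real j * (T / real (n * N))"
    unfolding grid_refine[OF assms(3), of n k, symmetric] by (simp add: grid_def algebra_simps)
qed (rule grid_nonneg)

lemma block_incr_measurable_F:
  assumes "k < n" "j \<le> N" "N > 0"
  shows "block_incr n N k j \<in> borel_measurable (F (grid n (Suc k)))"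
proof -
  note b = block_times[OF assms]
  have "W (grid (n * N) (k * N + j)) \<in> borel_measurable (F (grid n (Suc k)))"
    using b assms grid_nonneg by (intro W_measurable_F grid_le_T) auto
  moreover have "W (grid n k) \<in> borel_measurable (F (grid n (Suc k)))"
    using assms by (intro W_measurable_F grid_le_T grid_nonneg grid_mono) auto
  ultimately show ?thesis unfolding block_incr_def[abs_def] by measurable
qed

lemma all_moments_block_incr: "k < n \<Longrightarrow> j \<le> N \<Longrightarrow> N > 0 \<Longrightarrow> all_moments (block_incr n N k j)"
  using all_moments_increment[OF block_times(1-3)] unfolding block_incr_def[abs_def] by blast

lemma block_product:
  fixes P :: "'a \<Rightarrow> real" and \<phi> :: "real \<Rightarrow> real"
  assumes "k < n" "j \<le> N" "N > 0" "P \<in> borel_measurable (F (grid n k))" "integrable M P"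
    "\<phi> \<in> borel_measurable borel" "integrable M (\<lambda>w. \<phi> (block_incr n N k j w))"
  shows "integrable M (\<lambda>w. P w * \<phi> (block_incr n N k j w))"
    and "expectation (\<lambda>w. P w * \<phi> (block_incr n N k j w)) = expectation P * expectation (\<lambda>w. \<phi> (block_incr n N k j w))"
  using increment_product[OF block_times(1-3)[OF assms(1-3)] assms(4-6)] assms(7)
  unfolding block_incr_def by auto

lemma block_square_moment:
  "k < n \<Longrightarrow> j \<le> N \<Longrightarrow> N > 0 \<Longrightarrow> expectation (\<lambda>w. (block_incr n N k j w)\<^sup>2) = real j * (T / real (n * N))"
  using increment_square[OF block_times(1-3)] block_times(5) unfolding block_incr_def by simp

lemma block_fourth_moment:
  "k < n \<Longrightarrow> j \<le> N \<Longrightarrow> N > 0 \<Longrightarrow> expectation (\<lambda>w. (block_incr n N k j w) ^ 4) = 3 * (real j * (T / real (n * N)))\<^sup>2"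
  using increment_fourth[OF block_times(1-3)] block_times(5) unfolding block_incr_def by simp

lemma block_length_le:
  assumes "j \<le> N" "N > 0"
  shows "0 \<le> real j * (T / real (n * N))" "real j * (T / real (n * N)) \<le> T / real n"
proof -
  show "0 \<le> real j * (T / real (n * N))" using T_pos by simp
  have "real j * (T / real (n * N)) \<le> real N * (T / real (n * N))"
    using assms T_pos by (intro mult_right_mono) auto
  also have "\<dots> = T / real n" using assms by simp
  finally show "real j * (T / real (n * N)) \<le> T / real n" .
qed

text \<open>All second and fourth moment bounds over one mesh block reduce, through Jensen's inequality,
  to bounds for single increments.\<close>

lemma block_power_bound:
  fixes P Z :: "'a \<Rightarrow> real"
  assumes k: "k < n" "N > 0" and P: "P \<in> borel_measurable (F (grid n k))" "integrable M P" "\<And>w. 0 \<le> P w"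
    and Z[measurable]: "Z \<in> borel_measurable M" and Z0: "\<And>w. 0 \<le> Z w"
    and le: "\<And>w. Z w \<le> (\<Sum>j<N. \<phi> j (block_incr n N k j w)) / real N + \<psi> (block_incr n N k N w)"
    and \<phi>: "\<And>j. j < N \<Longrightarrow> \<phi> j \<in> borel_measurable borel" "\<And>j. j < N \<Longrightarrow> integrable M (\<lambda>w. \<phi> j (block_incr n N k j w))"
      "\<And>j. j < N \<Longrightarrow> expectation (\<lambda>w. \<phi> j (block_incr n N k j w)) \<le> a"
    and \<psi>: "\<psi> \<in> borel_measurable borel" "integrable M (\<lambda>w. \<psi> (block_incr n N k N w))"
      "expectation (\<lambda>w. \<psi> (block_incr n N k N w)) \<le> b"
  shows "expectation (\<lambda>w. P w * Z w) \<le> (a + b) * expectation P"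
proof -
  have [measurable]: "P \<in> borel_measurable M" using P(2) by auto
  have EP: "0 \<le> expectation P" using P(3) by simp
  have i1: "integrable M (\<lambda>w. P w * \<phi> j (block_incr n N k j w))"
    "expectation (\<lambda>w. P w * \<phi> j (block_incr n N k j w)) = expectation P * expectation (\<lambda>w. \<phi> j (block_incr n N k j w))"
    if "j < N" for j
    using block_product[OF k(1) less_imp_le[OF that] k(2) P(1,2) \<phi>(1,2)[OF that]] by auto
  note i2 = block_product[OF k(1) order_refl k(2) P(1,2) \<psi>(1,2)]
  let ?R = "\<lambda>w. (\<Sum>j<N. P w * \<phi> j (block_incr n N k j w)) / real N + P w * \<psi> (block_incr n N k N w)"
  have iR: "integrable M ?R"
    by (intro Bochner_Integration.integrable_add integrable_divide Bochner_Integration.integrable_sum i1(1) i2(1)) simp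
  have leR: "P w * Z w \<le> ?R w" for w
    using mult_left_mono[OF le P(3)] by (simp add: distrib_left sum_distrib_left)
  have "0 \<le> ?R w" for w using leR[of w] mult_nonneg_nonneg[OF P(3) Z0, of w w] by linarith
  then have "expectation (\<lambda>w. P w * Z w) \<le> expectation ?R"
    by (intro integral_mono' iR leR)
  also have "\<dots> = (\<Sum>j<N. expectation P * expectation (\<lambda>w. \<phi> j (block_incr n N k j w))) / real N
     + expectation P * expectation (\<lambda>w. \<psi> (block_incr n N k N w))"
    using expectation_average[OF i1(1)] i1(2) i2 by (simp add: Bochner_Integration.integral_add)
  also have "\<dots> \<le> expectation P * a + expectation P * b"
    using \<phi>(3) \<psi>(3) EP k by (intro add_mono average_le mult_left_mono) auto
  finally show ?thesis by (simp add: algebra_simps)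
qed

text \<open>Encodes that the conditional expectation of \<open>Z\<close> given time \<open>s\<close>
  is at most \<open>b\<close>, by testing against nonnegative weights known at that time.\<close>

definition weighted_bound :: "real \<Rightarrow> ('a \<Rightarrow> real) \<Rightarrow> real \<Rightarrow> bool" where
  "weighted_bound s Z b \<longleftrightarrow> (\<forall>P\<in>borel_measurable (F s). integrable M P \<longrightarrow> (\<forall>w. 0 \<le> P w) \<longrightarrow>
     expectation (\<lambda>w. P w * Z w) \<le> b * expectation P)"

lemma weighted_boundD:
  "weighted_bound s Z b \<Longrightarrow> P \<in> borel_measurable (F s) \<Longrightarrow> integrable M P \<Longrightarrow> (\<And>w. 0 \<le> P w) \<Longrightarrow>
    expectation (\<lambda>w. P w * Z w) \<le> b * expectation P"
  by (auto simp: weighted_bound_def)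

end

section \<open>Relative quadrature error of one coarse step\<close>

context black_scholes
begin

definition growth :: "nat \<Rightarrow> nat \<Rightarrow> nat \<Rightarrow> nat \<Rightarrow> 'a \<Rightarrow> real" where
  "growth n N k j w = exp (drift * (real j * (T / real (n * N))) + \<sigma> * block_incr n N k j w)"

text \<open>The average growth factor over the fine nodes minus the trapezoidal weight of the step,
  that is, the quadrature error of one step relative to the price at its left end. The sign is fine
  Riemann sum minus scheme.\<close>

definition block_err :: "nat \<Rightarrow> nat \<Rightarrow> nat \<Rightarrow> 'a \<Rightarrow> real" where
  "block_err n N k w = (\<Sum>j<N. growth n N k j w - 1) / real N - r * (T / real n) / 2 - \<sigma> * block_incr n N k N w / 2"

text \<open>The leading part of \<open>block_err\<close>, up to the factor \<open>\<sigma>\<close>: a discrete Brownian bridge area. The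
  term \<open>block_incr n N k N w / (2 * N)\<close> makes it exactly antisymmetric under reversal of the block.\<close>

definition bridge :: "nat \<Rightarrow> nat \<Rightarrow> nat \<Rightarrow> 'a \<Rightarrow> real" where
  "bridge n N k w = (\<Sum>j<N. block_incr n N k j w) / real N - block_incr n N k N w / 2 + block_incr n N k N w / (2 * real N)"

definition block_rem :: "nat \<Rightarrow> nat \<Rightarrow> nat \<Rightarrow> 'a \<Rightarrow> real" where
  "block_rem n N k w = block_err n N k w - \<sigma> * bridge n N k w"

lemma block_rem_eq:
  "block_rem n N k w = (\<Sum>j<N. growth n N k j w - 1 - \<sigma> * block_incr n N k j w) / real N
     - r * (T / real n) / 2 - \<sigma> * block_incr n N k N w / (2 * real N)"
proof -
  have "(\<Sum>j<N. growth n N k j w - 1 - \<sigma> * block_incr n N k j w)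
    = (\<Sum>j<N. growth n N k j w - 1) - \<sigma> * (\<Sum>j<N. block_incr n N k j w)"
    by (simp only: sum_subtractf sum_distrib_left)
  then show ?thesis
    unfolding block_rem_def block_err_def bridge_def by (simp only: diff_divide_distrib) (simp add: algebra_simps)
qed

lemma S_block:
  assumes "k < n" "j \<le> N" "N > 0"
  shows "S (grid (n * N) (k * N + j)) w = S (grid n k) w * growth n N k j w"
  unfolding S_increment[of "grid (n * N) (k * N + j)" w "grid n k"] growth_def block_incr_def
    block_times(5)[OF assms] ..

lemma all_moments_growth:
  assumes "k < n" "j \<le> N" "N > 0"
  shows "all_moments (growth n N k j)"
proof -
  have "(grid n k, grid (n * N) (k * N + j)) \<in> time_pairs"
    using block_times[OF assms] by (auto simp: time_pairs_def)
  from bounded_moments_member[OF bounded_moments_exp_growth this] show ?thesis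
    unfolding growth_def[abs_def] block_incr_def prod.case block_times(5)[OF assms] .
qed

lemma growth_measurable_F:
  assumes "k < n" "j \<le> N" "N > 0"
  shows "growth n N k j \<in> borel_measurable (F (grid n (Suc k)))"
  using block_incr_measurable_F[OF assms] unfolding growth_def[abs_def] by measurable

lemma bridge_measurable_F:
  "k < n \<Longrightarrow> N > 0 \<Longrightarrow> bridge n N k \<in> borel_measurable (F (grid n (Suc k)))"
  using block_incr_measurable_F unfolding bridge_def[abs_def]
  by (intro borel_measurable_add borel_measurable_diff borel_measurable_divide borel_measurable_sum borel_measurable_const) auto

lemma block_err_measurable_F:
  "k < n \<Longrightarrow> N > 0 \<Longrightarrow> block_err n N k \<in> borel_measurable (F (grid n (Suc k)))"
  using block_incr_measurable_F growth_measurable_F unfolding block_err_def[abs_def]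
  by (intro borel_measurable_times borel_measurable_diff borel_measurable_divide borel_measurable_sum borel_measurable_const) auto

lemma block_rem_measurable_F:
  "k < n \<Longrightarrow> N > 0 \<Longrightarrow> block_rem n N k \<in> borel_measurable (F (grid n (Suc k)))"
  using block_err_measurable_F bridge_measurable_F unfolding block_rem_def[abs_def]
  by (intro borel_measurable_times borel_measurable_diff borel_measurable_const) auto

lemma all_moments_bridge: "k < n \<Longrightarrow> N > 0 \<Longrightarrow> all_moments (bridge n N k)"
  unfolding bridge_def[abs_def] by (intro bounded_moments_intros all_moments_block_incr) auto

lemma all_moments_block_err: "k < n \<Longrightarrow> N > 0 \<Longrightarrow> all_moments (block_err n N k)"
  unfolding block_err_def[abs_def] by (intro bounded_moments_intros all_moments_block_incr all_moments_growth) auto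

lemma all_moments_block_rem: "k < n \<Longrightarrow> N > 0 \<Longrightarrow> all_moments (block_rem n N k)"
  unfolding block_rem_def[abs_def] by (intro bounded_moments_intros all_moments_block_err all_moments_bridge) auto

text \<open>The conditional mean of \<open>block_err\<close> at the start of the step: over a time
  \<open>h\<close> the growth factor has mean \<open>exp (r * h)\<close>, and the Brownian term is
  centred.\<close>

definition block_bias :: "nat \<Rightarrow> nat \<Rightarrow> real" where
  "block_bias n N = (\<Sum>j<N. exp (r * (real j * (T / real (n * N)))) - 1) / real N - r * (T / real n) / 2"

text \<open>The fine nodes have mean position \<open>(N - 1) / (2 * N)\<close> in the step, so the
  linear part of the exponentials cancels \<open>r * (T / n) / 2\<close> up to
  \<open>r * T / (2 * n * N)\<close>. With \<open>n \<le> N\<close> this and the quadratic remainder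
  are both of order \<open>n^-2\<close>.\<close>

lemma block_bias_bound:
  obtains C where "C > 0" "\<And>n N. 1 \<le> n \<Longrightarrow> n \<le> N \<Longrightarrow> \<bar>block_bias n N\<bar> \<le> C / (real n)\<^sup>2"
proof
  let ?C = "r\<^sup>2 * T\<^sup>2 * exp (\<bar>r\<bar> * T) + \<bar>r\<bar> * T / 2 + 1"
  show "?C > 0" using T_pos by (intro add_nonneg_pos) auto
  fix n N :: nat assume n: "1 \<le> n" "n \<le> N"
  define x where "x j = r * (real j * (T / real (n * N)))" for j
  have xb: "\<bar>x j\<bar> \<le> \<bar>r\<bar> * (T / real n)" if "j < N" for j
    unfolding x_def abs_mult using block_length_le[of j N n] that by (intro mult_left_mono) auto
  have e: "\<bar>exp (x j) - 1 - x j\<bar> \<le> (r\<^sup>2 * T\<^sup>2 * exp (\<bar>r\<bar> * T)) / (real n)\<^sup>2" if "j < N" for j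
  proof -
    have "\<bar>exp (x j) - 1 - x j\<bar> \<le> \<bar>x j\<bar>\<^sup>2 * exp \<bar>x j\<bar>" using abs_exp_minus_one_minus_le[of "x j"] by simp
    also have "\<dots> \<le> (\<bar>r\<bar> * (T / real n))\<^sup>2 * exp (\<bar>r\<bar> * T)"
    proof (intro mult_mono power_mono xb that)
      have "T / real n \<le> T" using n T_pos by (simp add: field_simps)
      then have "\<bar>r\<bar> * (T / real n) \<le> \<bar>r\<bar> * T" by (intro mult_left_mono) auto
      then show "exp \<bar>x j\<bar> \<le> exp (\<bar>r\<bar> * T)" using xb[OF that] by simp
    qed auto
    also have "\<dots> = (r\<^sup>2 * T\<^sup>2 * exp (\<bar>r\<bar> * T)) / (real n)\<^sup>2" by (simp add: power_mult_distrib power_divide)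
    finally show ?thesis .
  qed
  have sumj: "(\<Sum>j<N. real j) = real N * (real N - 1) / 2"
    by (induction N) (auto simp: field_simps)
  have "(\<Sum>j<N. x j) = r * ((real N * (real N - 1) / 2) * (T / real (n * N)))"
    unfolding x_def sum_distrib_left[symmetric] sum_distrib_right[symmetric] sumj ..
  then have "(\<Sum>j<N. x j) / real N = r * T / real n * ((real N - 1) / (2 * real N))"
    using n by (simp add: mult_ac)
  then have avx: "(\<Sum>j<N. x j) / real N - r * (T / real n) / 2 = - (r * T / (2 * real n * real N))"
    using n by (simp add: diff_divide_distrib right_diff_distrib)
  have "block_bias n N = (\<Sum>j<N. exp (x j) - 1 - x j) / real N + ((\<Sum>j<N. x j) / real N - r * (T / real n) / 2)"
    unfolding block_bias_def x_def[symmetric] by (simp add: sum_subtractf diff_divide_distrib)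
  also have "\<bar>\<dots>\<bar> \<le> \<bar>(\<Sum>j<N. exp (x j) - 1 - x j) / real N\<bar> + \<bar>r * T / (2 * real n * real N)\<bar>"
    unfolding avx by linarith
  also have "\<bar>(\<Sum>j<N. exp (x j) - 1 - x j) / real N\<bar> \<le> (\<Sum>j<N. \<bar>exp (x j) - 1 - x j\<bar>) / real N"
    by (auto intro!: divide_right_mono)
  also have "\<dots> \<le> (r\<^sup>2 * T\<^sup>2 * exp (\<bar>r\<bar> * T)) / (real n)\<^sup>2"
    using n by (intro average_le e) auto
  also have "\<bar>r * T / (2 * real n * real N)\<bar> \<le> (\<bar>r\<bar> * T / 2) / (real n)\<^sup>2"
  proof -
    have "\<bar>r * T / (2 * real n * real N)\<bar> = (\<bar>r\<bar> * T / 2) / (real n * real N)" using T_pos by (simp add: abs_mult)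
    also have "\<dots> \<le> (\<bar>r\<bar> * T / 2) / (real n * real n)" using n T_pos by (intro divide_left_mono mult_left_mono) auto
    finally show ?thesis by (simp add: power2_eq_square)
  qed
  finally have "\<bar>block_bias n N\<bar> \<le> (r\<^sup>2 * T\<^sup>2 * exp (\<bar>r\<bar> * T) + \<bar>r\<bar> * T / 2) / (real n)\<^sup>2"
    by (simp add: add_divide_distrib)
  also have "\<dots> \<le> ?C / (real n)\<^sup>2" by (intro divide_right_mono) auto
  finally show "\<bar>block_bias n N\<bar> \<le> ?C / (real n)\<^sup>2" .
qed

lemma block_err_mean:
  assumes k: "k < n" "N > 0" and P: "P \<in> borel_measurable (F (grid n k))" "integrable M P"
  shows "expectation (\<lambda>w. P w * block_err n N k w) = block_bias n N * expectation P"
proof -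
  have g: "integrable M (\<lambda>w. P w * (growth n N k j w - 1))"
     "expectation (\<lambda>w. P w * (growth n N k j w - 1)) = expectation P * (exp (r * (real j * (T / real (n * N)))) - 1)"
     if "j < N" for j
  proof -
    note j = k(1) less_imp_le[OF that] k(2)
    have ig: "integrable M (growth n N k j)" by (rule all_moments_integrable[OF all_moments_growth[OF j]])
    have "expectation (growth n N k j) = exp (r * (real j * (T / real (n * N))))"
      using growth_mean[OF block_times(1-3)[OF j]] unfolding growth_def[abs_def] block_incr_def block_times(5)[OF j] .
    then show "integrable M (\<lambda>w. P w * (growth n N k j w - 1))"
     "expectation (\<lambda>w. P w * (growth n N k j w - 1)) = expectation P * (exp (r * (real j * (T / real (n * N)))) - 1)"
      using block_product[OF j P, of "\<lambda>x. exp (drift * (real j * (T / real (n * N))) + \<sigma> * x) - 1"] ig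
      unfolding growth_def[abs_def] by (auto simp: prob_space)
  qed
  have w: "integrable M (\<lambda>w. P w * block_incr n N k N w)" "expectation (\<lambda>w. P w * block_incr n N k N w) = 0"
    using increment_product_mean[OF block_times(1-3)[OF k(1) order_refl k(2)] P] unfolding block_incr_def by auto
  have "expectation (\<lambda>w. P w * block_err n N k w) = expectation (\<lambda>w. (\<Sum>j<N. P w * (growth n N k j w - 1)) / real N
      - P w * (r * (T / real n) / 2) - (\<sigma> / 2) * (P w * block_incr n N k N w))"
    unfolding block_err_def by (simp add: algebra_simps sum_distrib_left)
  also have "\<dots> = (\<Sum>j<N. expectation P * (exp (r * (real j * (T / real (n * N)))) - 1)) / real N
      - expectation P * (r * (T / real n) / 2) - (\<sigma> / 2) * 0"
  proof -
    have 1: "integrable M (\<lambda>w. (\<Sum>j<N. P w * (growth n N k j w - 1)) / real N)"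
      by (intro integrable_divide Bochner_Integration.integrable_sum g) simp
    have 2: "integrable M (\<lambda>w. P w * (r * (T / real n) / 2))" using P(2) by (intro integrable_mult_left)
    have 3: "integrable M (\<lambda>w. (\<sigma> / 2) * (P w * block_incr n N k N w))" using w by (intro integrable_mult_right)
    have 4: "expectation (\<lambda>w. \<Sum>j<N. P w * (growth n N k j w - 1))
        = (\<Sum>j<N. expectation P * (exp (r * (real j * (T / real (n * N)))) - 1))"
      using g by (subst Bochner_Integration.integral_sum) (auto intro!: sum.cong)
    show ?thesis
      unfolding Bochner_Integration.integral_diff[OF Bochner_Integration.integrable_diff[OF 1 2] 3]
        Bochner_Integration.integral_diff[OF 1 2] integral_divide_zero 4 integral_mult_left_zero integral_mult_right_zero w(2) ..
  qed
  also have "\<dots> = block_bias n N * expectation P"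
    unfolding block_bias_def sum_distrib_left[symmetric] by (simp add: algebra_simps)
  finally show ?thesis .
qed

lemma bridge_mean:
  assumes k: "k < n" "N > 0" and P: "P \<in> borel_measurable (F (grid n k))" "integrable M P"
  shows "integrable M (\<lambda>w. P w * bridge n N k w)" "expectation (\<lambda>w. P w * bridge n N k w) = 0"
proof -
  have w: "integrable M (\<lambda>w. P w * block_incr n N k j w)" "expectation (\<lambda>w. P w * block_incr n N k j w) = 0"
    if "j \<le> N" for j
    using increment_product_mean[OF block_times(1-3)[OF k(1) that k(2)] P] unfolding block_incr_def by auto
  have eq: "P w * bridge n N k w = (\<Sum>j<N. P w * block_incr n N k j w) / real N
      - (P w * block_incr n N k N w) / 2 + (P w * block_incr n N k N w) / (2 * real N)" for w
    unfolding bridge_def by (simp add: algebra_simps sum_distrib_left)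
  show "integrable M (\<lambda>w. P w * bridge n N k w)" "expectation (\<lambda>w. P w * bridge n N k w) = 0"
    unfolding eq using expectation_average[OF w(1)] w by simp_all
qed

lemma block_rem_mean:
  assumes k: "k < n" "N > 0" and P: "P \<in> borel_measurable (F (grid n k))" "all_moments P"
  shows "expectation (\<lambda>w. P w * block_rem n N k w) = block_bias n N * expectation P"
proof -
  note iP = all_moments_integrable[OF P(2)]
  have 1: "integrable M (\<lambda>w. P w * block_err n N k w)"
    by (intro all_moments_integrable bounded_moments_mult P all_moments_block_err k)
  note 2 = bridge_mean[OF k P(1) iP]
  have "expectation (\<lambda>w. P w * block_rem n N k w) = expectation (\<lambda>w. P w * block_err n N k w - \<sigma> * (P w * bridge n N k w))"
    unfolding block_rem_def by (simp add: algebra_simps)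
  also have "\<dots> = block_bias n N * expectation P"
    using 1 2 block_err_mean[OF k P(1) iP] by simp
  finally show ?thesis .
qed

text \<open>A Brownian increment over a step has size \<open>n^(-1/2)\<close>, hence the orders
  \<open>1/n\<close> and \<open>1/n^2\<close> for the conditional second and fourth moments of
  \<open>block_err\<close>. Removing the bridge leaves terms quadratic in the increments, terms of
  the size of the step length, and the correction \<open>block_incr n N k N w / (2 * N)\<close>,
  which is small because \<open>n \<le> N\<close>; so the square of \<open>block_rem\<close> gains a
  factor \<open>1/n\<close>.\<close>

lemma block_moment_bounds:
  "\<exists>C>0. \<forall>n N k. 1 \<le> n \<longrightarrow> n \<le> N \<longrightarrow> k < n \<longrightarrow>
     weighted_bound (grid n k) (\<lambda>w. (block_err n N k w)\<^sup>2) (C / real n) \<and>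
     weighted_bound (grid n k) (\<lambda>w. (block_err n N k w) ^ 4) (C / (real n)\<^sup>2) \<and>
     weighted_bound (grid n k) (\<lambda>w. (block_rem n N k w)\<^sup>2) (C / (real n)\<^sup>2) \<and>
     weighted_bound (grid n k) (\<lambda>w. (bridge n N k w) ^ 4) (C / (real n)\<^sup>2)"
proof -
  obtain C0 where C0: "C0 > 0"
    "\<And>s t. 0 \<le> s \<Longrightarrow> s \<le> t \<Longrightarrow> t \<le> T \<Longrightarrow>
      expectation (\<lambda>w. (exp (drift * (t - s) + \<sigma> * (W t w - W s w)) - 1)\<^sup>2) \<le> C0 * (t - s)"
    "\<And>s t. 0 \<le> s \<Longrightarrow> s \<le> t \<Longrightarrow> t \<le> T \<Longrightarrow>
      expectation (\<lambda>w. (exp (drift * (t - s) + \<sigma> * (W t w - W s w)) - 1) ^ 4) \<le> C0 * (t - s)\<^sup>2"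
    "\<And>s t. 0 \<le> s \<Longrightarrow> s \<le> t \<Longrightarrow> t \<le> T \<Longrightarrow>
      expectation (\<lambda>w. (exp (drift * (t - s) + \<sigma> * (W t w - W s w)) - 1 - \<sigma> * (W t w - W s w))\<^sup>2) \<le> C0 * (t - s)\<^sup>2"
    by (rule growth_estimates, rule that, assumption+)
  \<comment> \<open>\<open>R / n\<close> is the size of the deterministic term
    \<open>r * (T / n) / 2\<close>.\<close>
  define R where "R = \<bar>r\<bar> * T / 2"
  have R0: "R \<ge> 0" using T_pos by (simp add: R_def)
  \<comment> \<open>The factors 3 and 27 come from splitting the square and the fourth power of
    three summands, the factor \<open>3 * T\<^sup>2\<close> from the Gaussian fourth moment.\<close>
  define C1 where "C1 = 3 * C0 * T + (3 * R\<^sup>2 + 3 * \<sigma>\<^sup>2 * T / 4)"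
  define C2 where "C2 = 27 * C0 * T\<^sup>2 + (27 * R ^ 4 + 27 * \<sigma> ^ 4 / 16 * (3 * T\<^sup>2))"
  define C3 where "C3 = 3 * C0 * T\<^sup>2 + (3 * R\<^sup>2 + 3 * \<sigma>\<^sup>2 * T / 4)"
  define C4 where "C4 = 81 * T\<^sup>2 + (27 / 16 * (3 * T\<^sup>2) + 27 / 16 * (3 * T\<^sup>2))"
  have pos: "0 \<le> C1" "0 \<le> C2" "0 \<le> C3" "0 \<le> C4"
  proof -
    have "0 \<le> R ^ 4" "0 \<le> \<sigma> ^ 4" by auto
    then show "0 \<le> C1" "0 \<le> C2" "0 \<le> C3" "0 \<le> C4"
      unfolding C1_def C2_def C3_def C4_def
      by (intro add_nonneg_nonneg mult_nonneg_nonneg divide_nonneg_nonneg; use T_pos C0(1) in simp)+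
  qed
  define C where "C = C1 + C2 + C3 + C4 + 1"
  have C: "C > 0" "C1 \<le> C" "C2 \<le> C" "C3 \<le> C" "C4 \<le> C" using pos by (auto simp: C_def)
  have bounds: "expectation (\<lambda>w. P w * (block_err n N k w)\<^sup>2) \<le> C / real n * expectation P"
    "expectation (\<lambda>w. P w * (block_err n N k w) ^ 4) \<le> C / (real n)\<^sup>2 * expectation P"
    "expectation (\<lambda>w. P w * (block_rem n N k w)\<^sup>2) \<le> C / (real n)\<^sup>2 * expectation P"
    "expectation (\<lambda>w. P w * (bridge n N k w) ^ 4) \<le> C / (real n)\<^sup>2 * expectation P"
    if n: "1 \<le> n" "n \<le> N" and k: "k < n"
      and P: "P \<in> borel_measurable (F (grid n k))" "integrable M P" "\<And>w. 0 \<le> P w"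
    for n N k :: nat and P :: "'a \<Rightarrow> real"
  proof -
    have N: "N > 0" using n by simp
    have EP: "0 \<le> expectation P" using P(3) by simp
    let ?w = "block_incr n N k"
    define e where "e = T / real (n * N)"
    have gd: "exp (drift * (real j * e) + \<sigma> * ?w j w) = growth n N k j w" for j w
      by (simp add: growth_def e_def)
    have rd: "\<bar>r * (T / real n) / 2\<bar> = R / real n" using T_pos by (simp add: R_def abs_mult)
    have rd2: "(r * (T / real n) / 2)\<^sup>2 = R\<^sup>2 / (real n)\<^sup>2"
    proof -
      have "(r * (T / real n) / 2)\<^sup>2 = \<bar>r * (T / real n) / 2\<bar>\<^sup>2" by (rule power2_abs[symmetric])
      then show ?thesis by (simp only: rd) (simp only: power_divide)
    qed
    have rd4: "(r * (T / real n) / 2) ^ 4 = R ^ 4 / (real n) ^ 4"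
    proof -
      have "(r * (T / real n) / 2) ^ 4 = \<bar>r * (T / real n) / 2\<bar> ^ 4" by (rule power_even_abs[symmetric]) simp
      then show ?thesis by (simp only: rd) (simp only: power_divide)
    qed
    have n21: "1 / (real n)\<^sup>2 \<le> 1 / real n" using n by (simp add: power2_eq_square field_simps)
    have n42: "1 / (real n) ^ 4 \<le> 1 / (real n)\<^sup>2" using n by (intro divide_left_mono power_increasing) auto
    have len: "real j * e \<le> T / real n" "0 \<le> real j * e" if "j \<le> N" for j
      using block_length_le[OF that N] unfolding e_def by auto
    have len2: "(real j * e)\<^sup>2 \<le> T\<^sup>2 / (real n)\<^sup>2" if "j \<le> N" for j
      using power_mono[OF len[OF that], of 2] by (simp add: power_divide)
    have am: "all_moments (?w j)" "all_moments (growth n N k j)" if "j \<le> N" for j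
      using all_moments_block_incr all_moments_growth that k N by auto
    have [measurable]: "block_err n N k \<in> borel_measurable M" "bridge n N k \<in> borel_measurable M" "block_rem n N k \<in> borel_measurable M"
      by (intro all_moments_measurable all_moments_block_err all_moments_bridge all_moments_block_rem k N)+
    have g2: "expectation (\<lambda>w. (growth n N k j w - 1)\<^sup>2) \<le> C0 * (T / real n)" if "j \<le> N" for j
    proof -
      have "expectation (\<lambda>w. (growth n N k j w - 1)\<^sup>2) \<le> C0 * (real j * e)"
        using C0(2)[OF block_times(1-3)[OF k that N]] unfolding growth_def block_incr_def e_def block_times(5)[OF k that N] .
      also have "\<dots> \<le> C0 * (T / real n)" using len[OF that] C0 by (intro mult_left_mono) auto
      finally show ?thesis .
    qed
    have g4: "expectation (\<lambda>w. (growth n N k j w - 1) ^ 4) \<le> C0 * (T\<^sup>2 / (real n)\<^sup>2)" if "j \<le> N" for j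
    proof -
      have "expectation (\<lambda>w. (growth n N k j w - 1) ^ 4) \<le> C0 * (real j * e)\<^sup>2"
        using C0(3)[OF block_times(1-3)[OF k that N]] unfolding growth_def block_incr_def e_def block_times(5)[OF k that N] .
      also have "\<dots> \<le> C0 * (T\<^sup>2 / (real n)\<^sup>2)" using len2[OF that] C0 by (intro mult_left_mono) auto
      finally show ?thesis .
    qed
    have h2: "expectation (\<lambda>w. (growth n N k j w - 1 - \<sigma> * ?w j w)\<^sup>2) \<le> C0 * (T\<^sup>2 / (real n)\<^sup>2)" if "j \<le> N" for j
    proof -
      have "expectation (\<lambda>w. (growth n N k j w - 1 - \<sigma> * ?w j w)\<^sup>2) \<le> C0 * (real j * e)\<^sup>2"
        using C0(4)[OF block_times(1-3)[OF k that N]] unfolding growth_def block_incr_def e_def block_times(5)[OF k that N] .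
      also have "\<dots> \<le> C0 * (T\<^sup>2 / (real n)\<^sup>2)" using len2[OF that] C0 by (intro mult_left_mono) auto
      finally show ?thesis .
    qed
    have w4: "expectation (\<lambda>w. (?w j w) ^ 4) \<le> 3 * (T\<^sup>2 / (real n)\<^sup>2)" if "j \<le> N" for j
      unfolding block_fourth_moment[OF k that N] e_def[symmetric] using len2[OF that] by simp
    have w2: "expectation (\<lambda>w. (?w N w)\<^sup>2) = T / real n"
      unfolding block_square_moment[OF k order_refl N] using N by simp
    have sc: "c * x \<le> c * y" if "x \<le> y" "0 \<le> c" for c x y :: real using that by (rule mult_left_mono)
    have i2: "integrable M (\<lambda>w. (growth n N k j w - 1)\<^sup>2)" "integrable M (\<lambda>w. (growth n N k j w - 1) ^ 4)"
      "integrable M (\<lambda>w. (growth n N k j w - 1 - \<sigma> * ?w j w)\<^sup>2)"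
      "integrable M (\<lambda>w. (?w j w) ^ 4)" "integrable M (\<lambda>w. (?w j w)\<^sup>2)" if "j \<le> N" for j
      by (intro all_moments_integrable bounded_moments_intros am that)+
    have "expectation (\<lambda>w. P w * (block_err n N k w)\<^sup>2) \<le> (3 * (C0 * (T / real n)) + (3 * R\<^sup>2 / (real n)\<^sup>2 + 3 * \<sigma>\<^sup>2 / 4 * (T / real n))) * expectation P"
    proof (rule block_power_bound[OF k N P,
          where \<phi>="\<lambda>j x. 3 * (exp (drift * (real j * e) + \<sigma> * x) - 1)\<^sup>2" and \<psi>="\<lambda>x. 3 * R\<^sup>2 / (real n)\<^sup>2 + 3 * \<sigma>\<^sup>2 / 4 * x\<^sup>2"])
      fix w
      have "(block_err n N k w)\<^sup>2 = ((\<Sum>j<N. growth n N k j w - 1) / real N + (- (r * (T / real n) / 2)) + (- (\<sigma> * ?w N w / 2)))\<^sup>2"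
        by (simp add: block_err_def)
      also have "\<dots> \<le> 3 * (((\<Sum>j<N. growth n N k j w - 1) / real N)\<^sup>2 + (- (r * (T / real n) / 2))\<^sup>2 + (- (\<sigma> * ?w N w / 2))\<^sup>2)"
        by (rule power2_sum3_le)
      also have "\<dots> = 3 * ((\<Sum>j<N. growth n N k j w - 1) / real N)\<^sup>2 + (3 * R\<^sup>2 / (real n)\<^sup>2 + 3 * \<sigma>\<^sup>2 / 4 * (?w N w)\<^sup>2)"
        unfolding power2_minus rd2 by (simp add: power_mult_distrib power_divide algebra_simps)
      also have "((\<Sum>j<N. growth n N k j w - 1) / real N)\<^sup>2 \<le> (\<Sum>j<N. (growth n N k j w - 1)\<^sup>2) / real N"
        by (rule power_mean_even_le) (use N in auto)
      finally show "(block_err n N k w)\<^sup>2 \<le> (\<Sum>j<N. 3 * (exp (drift * (real j * e) + \<sigma> * ?w j w) - 1)\<^sup>2) / real N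
          + (3 * R\<^sup>2 / (real n)\<^sup>2 + 3 * \<sigma>\<^sup>2 / 4 * (?w N w)\<^sup>2)"
        by (simp add: gd sum_distrib_left[symmetric])
    qed (use i2 sc[OF g2, of _ 3] w2 in \<open>auto simp: gd prob_space\<close>)
    also have "\<dots> \<le> C / real n * expectation P"
    proof (intro mult_right_mono EP)
      have "3 * R\<^sup>2 / (real n)\<^sup>2 \<le> 3 * R\<^sup>2 / real n" using n21 mult_left_mono[of "1 / (real n)\<^sup>2" "1 / real n" "3 * R\<^sup>2"] by simp
      then have "3 * (C0 * (T / real n)) + (3 * R\<^sup>2 / (real n)\<^sup>2 + 3 * \<sigma>\<^sup>2 / 4 * (T / real n)) \<le> C1 / real n"
        by (simp add: C1_def add_divide_distrib algebra_simps)
      also have "\<dots> \<le> C / real n" using C by (intro divide_right_mono) auto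
      finally show "3 * (C0 * (T / real n)) + (3 * R\<^sup>2 / (real n)\<^sup>2 + 3 * \<sigma>\<^sup>2 / 4 * (T / real n)) \<le> C / real n" .
    qed
    finally show "expectation (\<lambda>w. P w * (block_err n N k w)\<^sup>2) \<le> C / real n * expectation P" .

    have "expectation (\<lambda>w. P w * (block_err n N k w) ^ 4) \<le> (27 * (C0 * (T\<^sup>2 / (real n)\<^sup>2)) + (27 * R ^ 4 / (real n) ^ 4 + 27 * \<sigma> ^ 4 / 16 * (3 * (T\<^sup>2 / (real n)\<^sup>2)))) * expectation P"
    proof (rule block_power_bound[OF k N P,
          where \<phi>="\<lambda>j x. 27 * (exp (drift * (real j * e) + \<sigma> * x) - 1) ^ 4" and \<psi>="\<lambda>x. 27 * R ^ 4 / (real n) ^ 4 + 27 * \<sigma> ^ 4 / 16 * x ^ 4"])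
      fix w
      have m4: "(- x) ^ 4 = x ^ 4" for x :: real by simp
      have "(block_err n N k w) ^ 4 = ((\<Sum>j<N. growth n N k j w - 1) / real N + (- (r * (T / real n) / 2)) + (- (\<sigma> * ?w N w / 2))) ^ 4"
        by (simp add: block_err_def)
      also have "\<dots> \<le> 27 * (((\<Sum>j<N. growth n N k j w - 1) / real N) ^ 4 + (- (r * (T / real n) / 2)) ^ 4 + (- (\<sigma> * ?w N w / 2)) ^ 4)"
        by (rule power4_sum3_le)
      also have "\<dots> = 27 * ((\<Sum>j<N. growth n N k j w - 1) / real N) ^ 4 + (27 * R ^ 4 / (real n) ^ 4 + 27 * \<sigma> ^ 4 / 16 * (?w N w) ^ 4)"
        unfolding m4 rd4 by (simp add: power_mult_distrib power_divide algebra_simps)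
      also have "((\<Sum>j<N. growth n N k j w - 1) / real N) ^ 4 \<le> (\<Sum>j<N. (growth n N k j w - 1) ^ 4) / real N"
        by (rule power_mean_even_le) (use N in auto)
      finally show "(block_err n N k w) ^ 4 \<le> (\<Sum>j<N. 27 * (exp (drift * (real j * e) + \<sigma> * ?w j w) - 1) ^ 4) / real N
          + (27 * R ^ 4 / (real n) ^ 4 + 27 * \<sigma> ^ 4 / 16 * (?w N w) ^ 4)"
        by (simp add: gd sum_distrib_left[symmetric])
    next
      show "expectation (\<lambda>w. 27 * R ^ 4 / (real n) ^ 4 + 27 * \<sigma> ^ 4 / 16 * (?w N w) ^ 4) \<le> 27 * R ^ 4 / (real n) ^ 4 + 27 * \<sigma> ^ 4 / 16 * (3 * (T\<^sup>2 / (real n)\<^sup>2))"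
        using w4[OF order_refl] i2[OF order_refl] mult_left_mono[OF w4[OF order_refl], of "27 * \<sigma> ^ 4 / 16"] by (simp add: prob_space)
    qed (use i2 sc[OF g4, of _ 27] in \<open>auto simp: gd\<close>)
    also have "\<dots> \<le> C / (real n)\<^sup>2 * expectation P"
    proof (intro mult_right_mono EP)
      have "27 * R ^ 4 / (real n) ^ 4 \<le> 27 * R ^ 4 / (real n)\<^sup>2" using n42 mult_left_mono[of "1 / (real n) ^ 4" "1 / (real n)\<^sup>2" "27 * R ^ 4"] R0 by simp
      then have "27 * (C0 * (T\<^sup>2 / (real n)\<^sup>2)) + (27 * R ^ 4 / (real n) ^ 4 + 27 * \<sigma> ^ 4 / 16 * (3 * (T\<^sup>2 / (real n)\<^sup>2))) \<le> C2 / (real n)\<^sup>2"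
        by (simp add: C2_def add_divide_distrib algebra_simps)
      also have "\<dots> \<le> C / (real n)\<^sup>2" using C by (intro divide_right_mono) auto
      finally show "27 * (C0 * (T\<^sup>2 / (real n)\<^sup>2)) + (27 * R ^ 4 / (real n) ^ 4 + 27 * \<sigma> ^ 4 / 16 * (3 * (T\<^sup>2 / (real n)\<^sup>2))) \<le> C / (real n)\<^sup>2" .
    qed
    finally show "expectation (\<lambda>w. P w * (block_err n N k w) ^ 4) \<le> C / (real n)\<^sup>2 * expectation P" .

    have "expectation (\<lambda>w. P w * (block_rem n N k w)\<^sup>2) \<le> (3 * (C0 * (T\<^sup>2 / (real n)\<^sup>2)) + (3 * R\<^sup>2 / (real n)\<^sup>2 + 3 * \<sigma>\<^sup>2 / (4 * (real N)\<^sup>2) * (T / real n))) * expectation P"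
    proof (rule block_power_bound[OF k N P,
          where \<phi>="\<lambda>j x. 3 * (exp (drift * (real j * e) + \<sigma> * x) - 1 - \<sigma> * x)\<^sup>2" and \<psi>="\<lambda>x. 3 * R\<^sup>2 / (real n)\<^sup>2 + 3 * \<sigma>\<^sup>2 / (4 * (real N)\<^sup>2) * x\<^sup>2"])
      fix w
      have "(block_rem n N k w)\<^sup>2 = ((\<Sum>j<N. growth n N k j w - 1 - \<sigma> * ?w j w) / real N + (- (r * (T / real n) / 2)) + (- (\<sigma> * ?w N w / (2 * real N))))\<^sup>2"
        by (simp add: block_rem_eq)
      also have "\<dots> \<le> 3 * (((\<Sum>j<N. growth n N k j w - 1 - \<sigma> * ?w j w) / real N)\<^sup>2 + (- (r * (T / real n) / 2))\<^sup>2 + (- (\<sigma> * ?w N w / (2 * real N)))\<^sup>2)"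
        by (rule power2_sum3_le)
      also have "\<dots> = 3 * ((\<Sum>j<N. growth n N k j w - 1 - \<sigma> * ?w j w) / real N)\<^sup>2 + (3 * R\<^sup>2 / (real n)\<^sup>2 + 3 * \<sigma>\<^sup>2 / (4 * (real N)\<^sup>2) * (?w N w)\<^sup>2)"
        unfolding power2_minus rd2 by (simp add: power_mult_distrib power_divide algebra_simps)
      also have "((\<Sum>j<N. growth n N k j w - 1 - \<sigma> * ?w j w) / real N)\<^sup>2 \<le> (\<Sum>j<N. (growth n N k j w - 1 - \<sigma> * ?w j w)\<^sup>2) / real N"
        by (rule power_mean_even_le) (use N in auto)
      finally show "(block_rem n N k w)\<^sup>2 \<le> (\<Sum>j<N. 3 * (exp (drift * (real j * e) + \<sigma> * ?w j w) - 1 - \<sigma> * ?w j w)\<^sup>2) / real N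
          + (3 * R\<^sup>2 / (real n)\<^sup>2 + 3 * \<sigma>\<^sup>2 / (4 * (real N)\<^sup>2) * (?w N w)\<^sup>2)"
        by (simp add: gd sum_distrib_left[symmetric])
    next
      show "expectation (\<lambda>w. 3 * R\<^sup>2 / (real n)\<^sup>2 + 3 * \<sigma>\<^sup>2 / (4 * (real N)\<^sup>2) * (?w N w)\<^sup>2) \<le> 3 * R\<^sup>2 / (real n)\<^sup>2 + 3 * \<sigma>\<^sup>2 / (4 * (real N)\<^sup>2) * (T / real n)"
        using w2 i2[OF order_refl] by (simp add: prob_space mult.commute[of "real n"])
    qed (use i2 sc[OF h2, of _ 3] in \<open>auto simp: gd prob_space\<close>)
    also have "\<dots> \<le> C / (real n)\<^sup>2 * expectation P"
    proof (intro mult_right_mono EP)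
      have "3 * \<sigma>\<^sup>2 / (4 * (real N)\<^sup>2) * (T / real n) \<le> 3 * \<sigma>\<^sup>2 / (4 * (real n)\<^sup>2) * T"
        using n T_pos by (intro mult_mono divide_left_mono mult_left_mono power_mono) (auto simp: field_simps)
      then have "3 * (C0 * (T\<^sup>2 / (real n)\<^sup>2)) + (3 * R\<^sup>2 / (real n)\<^sup>2 + 3 * \<sigma>\<^sup>2 / (4 * (real N)\<^sup>2) * (T / real n)) \<le> C3 / (real n)\<^sup>2"
        by (simp add: C3_def add_divide_distrib algebra_simps)
      also have "\<dots> \<le> C / (real n)\<^sup>2" using C by (intro divide_right_mono) auto
      finally show "3 * (C0 * (T\<^sup>2 / (real n)\<^sup>2)) + (3 * R\<^sup>2 / (real n)\<^sup>2 + 3 * \<sigma>\<^sup>2 / (4 * (real N)\<^sup>2) * (T / real n)) \<le> C / (real n)\<^sup>2" .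
    qed
    finally show "expectation (\<lambda>w. P w * (block_rem n N k w)\<^sup>2) \<le> C / (real n)\<^sup>2 * expectation P" .

    have "expectation (\<lambda>w. P w * (bridge n N k w) ^ 4) \<le> (27 * (3 * (T\<^sup>2 / (real n)\<^sup>2)) + (27 / 8 * (3 * (T\<^sup>2 / (real n)\<^sup>2)))) * expectation P"
    proof (rule block_power_bound[OF k N P,
          where \<phi>="\<lambda>j x. 27 * x ^ 4" and \<psi>="\<lambda>x. 27 / 8 * x ^ 4"])
      fix w
      have "(bridge n N k w) ^ 4 = ((\<Sum>j<N. ?w j w) / real N + (- (?w N w / 2)) + (?w N w / (2 * real N))) ^ 4"
        by (simp add: bridge_def)
      also have "\<dots> \<le> 27 * (((\<Sum>j<N. ?w j w) / real N) ^ 4 + (- (?w N w / 2)) ^ 4 + (?w N w / (2 * real N)) ^ 4)"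
        by (rule power4_sum3_le)
      also have "(?w N w / (2 * real N)) ^ 4 \<le> (?w N w) ^ 4 / 16"
      proof -
        have "(1::real) ^ 4 \<le> real N ^ 4" using N by (intro power_mono) auto
        then have "(?w N w) ^ 4 / (16 * real N ^ 4) \<le> (?w N w) ^ 4 / (16 * 1)"
            using N by (intro divide_left_mono mult_left_mono) auto
        then show ?thesis by (simp add: power_divide power_mult_distrib)
      qed
      also have "((\<Sum>j<N. ?w j w) / real N) ^ 4 \<le> (\<Sum>j<N. (?w j w) ^ 4) / real N"
        by (rule power_mean_even_le) (use N in auto)
      finally show "(bridge n N k w) ^ 4 \<le> (\<Sum>j<N. 27 * (?w j w) ^ 4) / real N + 27 / 8 * (?w N w) ^ 4"
        by (simp add: sum_distrib_left[symmetric] power_divide)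
    qed (use i2 sc[OF w4, of _ 27] sc[OF w4, of _ \<open>27/8\<close>] in auto)
    also have "\<dots> \<le> C / (real n)\<^sup>2 * expectation P"
    proof (intro mult_right_mono EP)
      have "27 * (3 * (T\<^sup>2 / (real n)\<^sup>2)) + (27 / 8 * (3 * (T\<^sup>2 / (real n)\<^sup>2))) = C4 / (real n)\<^sup>2"
        by (simp add: C4_def add_divide_distrib)
      also have "\<dots> \<le> C / (real n)\<^sup>2" using C by (intro divide_right_mono) auto
      finally show "27 * (3 * (T\<^sup>2 / (real n)\<^sup>2)) + (27 / 8 * (3 * (T\<^sup>2 / (real n)\<^sup>2))) \<le> C / (real n)\<^sup>2" .
    qed
    finally show "expectation (\<lambda>w. P w * (bridge n N k w) ^ 4) \<le> C / (real n)\<^sup>2 * expectation P" .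
  qed
  show ?thesis
    by (intro exI[of _ C] conjI allI impI C(1); unfold weighted_bound_def; intro ballI impI;
        rule bounds(1) bounds(2) bounds(3) bounds(4); simp)
qed

end

section \<open>The bridge area as a weighted sum of fine increments\<close>

context brownian
begin

definition fine_incr :: "nat \<Rightarrow> nat \<Rightarrow> 'a \<Rightarrow> real" where
  "fine_incr K i w = W (grid K (Suc i)) w - W (grid K i) w"

lemma block_incr_sum: "N > 0 \<Longrightarrow> block_incr n N k j w = (\<Sum>i<j. fine_incr (n * N) (k * N + i) w)"
proof (induction j)
  case 0
  then show ?case by (simp add: block_incr_def grid_refine)
next
  case (Suc j)
  then show ?case by (simp add: block_incr_def fine_incr_def)
qed

lemma fine_incr_product:
  assumes "i < K" "P \<in> borel_measurable (F (grid K i))" "integrable M P"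
  shows "expectation (\<lambda>w. P w * fine_incr K i w) = 0"
    "expectation (\<lambda>w. P w * (fine_incr K i w)\<^sup>2) = expectation P * (T / real K)"
proof -
  have *: "0 \<le> grid K i" "grid K i \<le> grid K (Suc i)" "grid K (Suc i) \<le> T"
    using assms by (auto intro: grid_nonneg grid_mono grid_le_T)
  have "grid K (Suc i) - grid K i = T / real K" by (simp add: grid_def distrib_right add_divide_distrib)
  then show "expectation (\<lambda>w. P w * fine_incr K i w) = 0"
    "expectation (\<lambda>w. P w * (fine_incr K i w)\<^sup>2) = expectation P * (T / real K)"
    using increment_product_mean(2)[OF * assms(2,3)] increment_product_square(2)[OF * assms(2,3)]
    unfolding fine_incr_def by auto
qed

lemma all_moments_fine_incr: "i < K \<Longrightarrow> all_moments (fine_incr K i)"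
  unfolding fine_incr_def[abs_def] by (intro all_moments_increment grid_nonneg grid_mono grid_le_T) auto

lemma fine_incr_measurable_F: "i < j \<Longrightarrow> j \<le> K \<Longrightarrow> fine_incr K i \<in> borel_measurable (F (grid K j))"
  unfolding fine_incr_def[abs_def]
  by (intro borel_measurable_diff W_measurable_F grid_nonneg grid_mono grid_le_T) auto

end

text \<open>Weight of the \<open>i\<close>-th fine increment in the bridge. It is odd under the
  reflection of \<open>i\<close> to \<open>N - 1 - i\<close>; without the correction term in
  \<open>bridge\<close> the numerator would be \<open>N - 2 - 2 * i\<close>, which is odd only up to
  a shift.\<close>

definition bridge_coeff :: "nat \<Rightarrow> nat \<Rightarrow> real" where
  "bridge_coeff N i = (real N - 1 - 2 * real i) / (2 * real N)"

text \<open>The term \<open>x i\<close> occurs in the partial sums with \<open>j > i\<close>, of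
  which there are \<open>N - 1 - i\<close>.\<close>

lemma sum_partial_sums:
  fixes x :: "nat \<Rightarrow> real"
  shows "(\<Sum>j<N. \<Sum>i<j. x i) = (\<Sum>i<N. (real N - 1 - real i) * x i)"
proof (induction N)
  case (Suc N)
  have "(\<Sum>j<Suc N. \<Sum>i<j. x i) = (\<Sum>i<N. (real N - 1 - real i) * x i + x i)"
    using Suc by (simp add: sum.distrib)
  also have "\<dots> = (\<Sum>i<Suc N. (real (Suc N) - 1 - real i) * x i)"
    by (simp add: algebra_simps)
  finally show ?case .
qed simp

text \<open>The origin of the constant 12: divided by \<open>N\<close>, the sum is a discrete form
  of the integral of \<open>(1/2 - u)^2\<close> over the unit interval.\<close>

lemma sum_bridge_coeff_square:
  assumes "N > 0"
  shows "(\<Sum>i<N. (bridge_coeff N i)\<^sup>2) = ((real N)\<^sup>2 - 1) / (12 * real N)"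
proof -
  have s: "(\<Sum>i<m. (a - 2 * real i)\<^sup>2) = real m * a\<^sup>2 - 2 * a * real m * (real m - 1) + 2 / 3 * real m * (real m - 1) * (2 * real m - 1)"
    for m a by (induction m) (auto simp: field_simps power2_eq_square)
  have "(\<Sum>i<N. (bridge_coeff N i)\<^sup>2) = (\<Sum>i<N. ((real N - 1) - 2 * real i)\<^sup>2) / (2 * real N)\<^sup>2"
    unfolding bridge_coeff_def power_divide by (simp add: sum_divide_distrib)
  also have "\<dots> = ((real N)\<^sup>2 - 1) / (12 * real N)"
    unfolding s using assms by (simp add: field_simps power2_eq_square)
  finally show ?thesis .
qed

context black_scholes
begin

lemma bridge_eq_sum:
  assumes "N > 0"
  shows "bridge n N k w = (\<Sum>i<N. bridge_coeff N i * fine_incr (n * N) (k * N + i) w)"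
proof -
  let ?x = "\<lambda>i. fine_incr (n * N) (k * N + i) w"
  have "bridge n N k w = (\<Sum>i<N. (real N - 1 - real i) * ?x i) / real N - (\<Sum>i<N. ?x i) / 2 + (\<Sum>i<N. ?x i) / (2 * real N)"
    unfolding bridge_def block_incr_sum[OF assms] sum_partial_sums ..
  also have "\<dots> = (\<Sum>i<N. (real N - 1 - real i) * ?x i / real N - ?x i / 2 + ?x i / (2 * real N))"
    by (simp only: sum_divide_distrib sum_subtractf sum.distrib)
  also have "\<dots> = (\<Sum>i<N. bridge_coeff N i * ?x i)"
    using assms by (intro sum.cong) (auto simp: bridge_coeff_def field_simps)
  finally show ?thesis .
qed

text \<open>The variance \<open>T / (n * N)\<close> of a fine increment times the sum of the squared
  weights.\<close>

definition bridge_var :: "nat \<Rightarrow> nat \<Rightarrow> real" where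
  "bridge_var n N = T * ((real N)\<^sup>2 - 1) / (12 * real n * (real N)\<^sup>2)"

text \<open>The weighted sum is built up one fine increment at a time. A fresh increment is centred
  and independent of the past, so the mixed term drops out and only a variance is added. The weight
  \<open>P\<close> makes this a statement on the conditional second moment.\<close>

lemma bridge_square_mean:
  assumes k: "k < n" "N > 0" and P: "P \<in> borel_measurable (F (grid n k))" "all_moments P"
  shows "expectation (\<lambda>w. P w * (bridge n N k w)\<^sup>2) = bridge_var n N * expectation P"
proof -
  let ?x = "\<lambda>i. fine_incr (n * N) (k * N + i)"
  let ?Z = "\<lambda>m w. \<Sum>i<m. bridge_coeff N i * ?x i w"
  have idx: "k * N + i < n * N" if "i < N" for i
    using block_index[OF k(1), of "Suc i" N] that by simp
  have main: "expectation (\<lambda>w. P w * (?Z m w)\<^sup>2) = expectation P * ((T / real (n * N)) * (\<Sum>i<m. (bridge_coeff N i)\<^sup>2))"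
    if "m \<le> N" for m
    using that
  proof (induction m)
    case (Suc m)
    have m: "m < N" using Suc by simp
    let ?c = "bridge_coeff N m"
    have xm: "all_moments (?x i)" if "i \<le> m" for i
      using that m by (intro all_moments_fine_incr idx) auto
    have Zm: "all_moments (?Z m)"
      using xm by (intro bounded_moments_intros) auto
    have gk: "grid n k \<le> grid (n * N) (k * N + m)" "grid (n * N) (k * N + m) \<le> T"
      using block_times[OF k(1) less_imp_le[OF m] k(2)] by auto
    have PF: "P \<in> borel_measurable (F (grid (n * N) (k * N + m)))"
      using gk by (intro measurable_F_mono[OF P(1) grid_nonneg]) auto
    have ZF: "?Z m \<in> borel_measurable (F (grid (n * N) (k * N + m)))"
      using idx[OF m] by (intro borel_measurable_sum borel_measurable_times borel_measurable_const fine_incr_measurable_F) auto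
    have 1: "integrable M (\<lambda>w. P w * (?Z m w)\<^sup>2)" "integrable M (\<lambda>w. (P w * ?Z m w) * ?x m w)"
      "integrable M (\<lambda>w. P w * (?x m w)\<^sup>2)" "integrable M (\<lambda>w. P w * ?Z m w)"
      by (intro all_moments_integrable bounded_moments_mult bounded_moments_power P Zm xm order_refl)+
    have "expectation (\<lambda>w. P w * (?Z (Suc m) w)\<^sup>2)
        = expectation (\<lambda>w. P w * (?Z m w)\<^sup>2 + 2 * ?c * ((P w * ?Z m w) * ?x m w) + ?c\<^sup>2 * (P w * (?x m w)\<^sup>2))"
      by (intro Bochner_Integration.integral_cong) (auto simp: power2_eq_square algebra_simps)
    also have "\<dots> = expectation (\<lambda>w. P w * (?Z m w)\<^sup>2) + 2 * ?c * expectation (\<lambda>w. (P w * ?Z m w) * ?x m w)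
        + ?c\<^sup>2 * expectation (\<lambda>w. P w * (?x m w)\<^sup>2)"
      using 1 by simp
    also have "expectation (\<lambda>w. (P w * ?Z m w) * ?x m w) = 0"
      using 1 PF ZF by (intro fine_incr_product idx m) auto
    also have "expectation (\<lambda>w. P w * (?x m w)\<^sup>2) = expectation P * (T / real (n * N))"
      using all_moments_integrable[OF P(2)] by (intro fine_incr_product idx m PF) auto
    also have "expectation (\<lambda>w. P w * (?Z m w)\<^sup>2) = expectation P * ((T / real (n * N)) * (\<Sum>i<m. (bridge_coeff N i)\<^sup>2))"
      using Suc by simp
    finally show ?case by (simp add: algebra_simps)
  qed simp
  show ?thesis
    unfolding bridge_eq_sum[OF k(2)] main[OF order_refl] sum_bridge_coeff_square[OF k(2)] bridge_var_def
    using k by (simp add: field_simps power2_eq_square)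
qed

section \<open>Accumulated errors over all coarse steps\<close>

lemma S_grid_measurable_F: "j \<le> k \<Longrightarrow> k \<le> n \<Longrightarrow> S (grid n j) \<in> borel_measurable (F (grid n k))"
  by (intro S_measurable_F grid_nonneg grid_mono grid_le_T) auto

lemma all_moments_S_grid: "k \<le> n \<Longrightarrow> all_moments (S (grid n k))"
  by (intro all_moments_S grid_in)

lemma S_power_bound:
  obtains K where "K > 0" "\<And>n k. k \<le> n \<Longrightarrow> expectation (\<lambda>w. (S (grid n k) w) ^ q) \<le> K"
proof -
  obtain K where K: "K > 0" "\<And>t. t \<in> {0..T} \<Longrightarrow> expectation (\<lambda>w. \<bar>S t w\<bar> ^ q) \<le> K"
    using bounded_moments_bound[OF bounded_moments_S, of q] by blast
  show thesis
  proof (rule that[OF K(1)])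
    fix n k :: nat assume k: "k \<le> n"
    have "expectation (\<lambda>w. (S (grid n k) w) ^ q) \<le> expectation (\<lambda>w. \<bar>S (grid n k) w\<bar> ^ q)"
      using bounded_moments_integrable_power[OF bounded_moments_S grid_in[OF k]]
        bounded_moments_integrable_abs_power[OF bounded_moments_S grid_in[OF k]]
      by (intro integral_mono) (auto simp: power_abs[symmetric])
    then show "expectation (\<lambda>w. (S (grid n k) w) ^ q) \<le> K" using K(2)[OF grid_in[OF k]] by simp
  qed
qed

definition err_sum :: "nat \<Rightarrow> nat \<Rightarrow> nat \<Rightarrow> 'a \<Rightarrow> real" where
  "err_sum n N k w = (\<Sum>j<k. S (grid n j) w * block_err n N j w)"

definition rem_sum :: "nat \<Rightarrow> nat \<Rightarrow> nat \<Rightarrow> 'a \<Rightarrow> real" where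
  "rem_sum n N k w = (\<Sum>j<k. S (grid n j) w * block_rem n N j w)"

definition bridge_sum :: "nat \<Rightarrow> nat \<Rightarrow> nat \<Rightarrow> 'a \<Rightarrow> real" where
  "bridge_sum n N k w = (\<Sum>j<k. S (grid n j) w * bridge n N j w)"

text \<open>Sum of the squared terms of \<open>bridge_sum\<close> minus its compensator. As a
  process in \<open>k\<close> it is a martingale, and it measures the distance of the quadratic
  variation from a functional of the coarse prices.\<close>

definition qv_err :: "nat \<Rightarrow> nat \<Rightarrow> nat \<Rightarrow> 'a \<Rightarrow> real" where
  "qv_err n N k w = (\<Sum>j<k. (S (grid n j) w)\<^sup>2 * ((bridge n N j w)\<^sup>2 - bridge_var n N))"

lemma err_sum_split: "err_sum n N k w = \<sigma> * bridge_sum n N k w + rem_sum n N k w"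
  unfolding err_sum_def rem_sum_def bridge_sum_def block_rem_def
  by (simp add: sum_distrib_left sum.distrib[symmetric] algebra_simps)

lemma sums_all_moments:
  assumes "k \<le> n" "N > 0"
  shows "all_moments (err_sum n N k)" "all_moments (rem_sum n N k)" "all_moments (bridge_sum n N k)"
    "all_moments (qv_err n N k)"
  unfolding err_sum_def[abs_def] rem_sum_def[abs_def] bridge_sum_def[abs_def] qv_err_def[abs_def]
  using assms
  by (intro bounded_moments_sum bounded_moments_mult bounded_moments_diff bounded_moments_const bounded_moments_power
      all_moments_S_grid all_moments_block_err all_moments_block_rem all_moments_bridge; simp)+

lemma measurable_F_grid_mono: "X \<in> borel_measurable (F (grid n j)) \<Longrightarrow> j \<le> k \<Longrightarrow> k \<le> n \<Longrightarrow> X \<in> borel_measurable (F (grid n k))"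
  by (erule measurable_F_mono) (auto intro: grid_nonneg grid_mono grid_le_T)

lemma sums_measurable_F:
  assumes "k \<le> n" "N > 0"
  shows "err_sum n N k \<in> borel_measurable (F (grid n k))" "rem_sum n N k \<in> borel_measurable (F (grid n k))"
    "qv_err n N k \<in> borel_measurable (F (grid n k))"
proof -
  have *: "block_err n N j \<in> borel_measurable (F (grid n k))" "block_rem n N j \<in> borel_measurable (F (grid n k))"
     "bridge n N j \<in> borel_measurable (F (grid n k))" if "j < k" for j
    using that assms measurable_F_grid_mono[OF block_err_measurable_F, of j n N k]
      measurable_F_grid_mono[OF block_rem_measurable_F, of j n N k]
      measurable_F_grid_mono[OF bridge_measurable_F, of j n N k] by auto
  show "err_sum n N k \<in> borel_measurable (F (grid n k))" "rem_sum n N k \<in> borel_measurable (F (grid n k))"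
    "qv_err n N k \<in> borel_measurable (F (grid n k))"
    unfolding err_sum_def[abs_def] rem_sum_def[abs_def] qv_err_def[abs_def]
    by (intro borel_measurable_sum borel_measurable_times borel_measurable_diff borel_measurable_power
        borel_measurable_const S_grid_measurable_F *; use assms in simp)+
qed

text \<open>Adding one summand changes the fourth power by a linear term, which conditioning reduces
  to the bias, and by terms with the second and the fourth power of \<open>block_err\<close>; each
  costs at most \<open>1 / n\<close> times the current moment plus a constant. Over \<open>n\<close>
  steps Gronwall's inequality gives a bound that does not depend on \<open>n\<close>.\<close>

lemma err_sum_fourth_moment:
  obtains C where "C > 0" "\<And>n N. 1 \<le> n \<Longrightarrow> n \<le> N \<Longrightarrow> expectation (\<lambda>w. (err_sum n N n w) ^ 4) \<le> C"
proof -
  obtain Cb where Cb: "Cb > 0" "\<And>n N. 1 \<le> n \<Longrightarrow> n \<le> N \<Longrightarrow> \<bar>block_bias n N\<bar> \<le> Cb / (real n)\<^sup>2"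
    using block_bias_bound by blast
  obtain Cm where Cm: "Cm > 0"
    "\<And>n N k. 1 \<le> n \<Longrightarrow> n \<le> N \<Longrightarrow> k < n \<Longrightarrow> weighted_bound (grid n k) (\<lambda>w. (block_err n N k w)\<^sup>2) (Cm / real n)"
    "\<And>n N k. 1 \<le> n \<Longrightarrow> n \<le> N \<Longrightarrow> k < n \<Longrightarrow> weighted_bound (grid n k) (\<lambda>w. (block_err n N k w) ^ 4) (Cm / (real n)\<^sup>2)"
    using block_moment_bounds by blast
  obtain K where K: "K > 0" "\<And>n k. k \<le> n \<Longrightarrow> expectation (\<lambda>w. (S (grid n k) w) ^ 4) \<le> K"
    using S_power_bound[of 4] by blast
  \<comment> \<open>The linear, quadratic and quartic terms of the expansion below have the weights
    4, 8 and 3; 11 is 8 + 3.\<close>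
  define C where "C = 4 * Cb + 11 * Cm"
  have C0: "C > 0" using Cb Cm by (simp add: C_def)
  show thesis
  proof (rule that)
    show "K * exp C > 0" using K by simp
    fix n N :: nat assume n: "1 \<le> n" "n \<le> N"
    then have N: "N > 0" by simp
    define a where "a k = expectation (\<lambda>w. (err_sum n N k w) ^ 4)" for k
    have a0: "0 \<le> a k" for k by (simp add: a_def)
    have n2: "1 / (real n)\<^sup>2 \<le> 1 / real n" using n by (simp add: power2_eq_square field_simps)
    have "a n + K \<le> K * exp (C / real n * real n)"
    proof (rule discrete_gronwall[where x="\<lambda>k. a k + K"])
      fix k assume k: "k < n"
      let ?A = "err_sum n N k" and ?S = "S (grid n k)" and ?e = "block_err n N k"
      note A = sums_all_moments(1)[OF less_imp_le[OF k] N] and s = all_moments_S_grid[OF less_imp_le[OF k]] and e = all_moments_block_err[OF k N]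
      note AF = sums_measurable_F(1)[OF less_imp_le[OF k] N] and SF = S_grid_measurable_F[OF order_refl less_imp_le[OF k]]
      \<comment> \<open>No conditional third moment is at hand for the term
        \<open>4 * x * y ^ 3\<close>; it is divided between its neighbours, which raises their
        coefficients from 6 to 8 and from 1 to 3.\<close>
      have le: "(x + y) ^ 4 \<le> x ^ 4 + 4 * (x ^ 3 * y) + 8 * (x\<^sup>2 * y\<^sup>2) + 3 * y ^ 4" for x y :: real
      proof -
        have "(x + y) ^ 4 = x ^ 4 + 4 * (x ^ 3 * y) + 6 * (x\<^sup>2 * y\<^sup>2) + 4 * (x * y) * y\<^sup>2 + y ^ 4"
          by (simp add: power2_eq_square power4_eq_xxxx power3_eq_cube algebra_simps)
        moreover have "4 * (x * y) * y\<^sup>2 \<le> (2 * x\<^sup>2 + 2 * y\<^sup>2) * y\<^sup>2"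
          using sum_squares_bound[of x y] by (intro mult_right_mono) auto
        moreover have "(2 * x\<^sup>2 + 2 * y\<^sup>2) * y\<^sup>2 = 2 * (x\<^sup>2 * y\<^sup>2) + 2 * y ^ 4"
          by (simp add: power2_eq_square power4_eq_xxxx algebra_simps)
        ultimately show ?thesis by linarith
      qed
      have I: "integrable M (\<lambda>w. (?A w) ^ 4)" "integrable M (\<lambda>w. ((?A w) ^ 3 * ?S w) * ?e w)"
        "integrable M (\<lambda>w. ((?A w)\<^sup>2 * (?S w)\<^sup>2) * (?e w)\<^sup>2)" "integrable M (\<lambda>w. (?S w) ^ 4 * (?e w) ^ 4)"
        "integrable M (\<lambda>w. (err_sum n N (Suc k) w) ^ 4)" "integrable M (\<lambda>w. (?A w) ^ 3 * ?S w)"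
        "integrable M (\<lambda>w. (?A w)\<^sup>2 * (?S w)\<^sup>2)" "integrable M (\<lambda>w. (?S w) ^ 4)"
        using k N
        by (intro all_moments_integrable bounded_moments_mult bounded_moments_power A s e sums_all_moments(1); simp)+
      have ES: "expectation (\<lambda>w. (?S w) ^ 4) \<le> K" using K(2) k by simp
      have aS: "expectation (\<lambda>w. (?A w) ^ 4 + (?S w) ^ 4) \<le> a k + K" using I ES by (simp add: a_def)
      have "a (Suc k) \<le> expectation (\<lambda>w. (?A w) ^ 4 + 4 * (((?A w) ^ 3 * ?S w) * ?e w) + 8 * (((?A w)\<^sup>2 * (?S w)\<^sup>2) * (?e w)\<^sup>2)
          + 3 * ((?S w) ^ 4 * (?e w) ^ 4))"
        unfolding a_def
      proof (rule integral_mono[OF I(5)])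
        show "integrable M (\<lambda>w. (?A w) ^ 4 + 4 * (((?A w) ^ 3 * ?S w) * ?e w) + 8 * (((?A w)\<^sup>2 * (?S w)\<^sup>2) * (?e w)\<^sup>2)
          + 3 * ((?S w) ^ 4 * (?e w) ^ 4))" using I by simp
        fix w
        have "err_sum n N (Suc k) w = ?A w + ?S w * ?e w" by (simp add: err_sum_def)
        then show "(err_sum n N (Suc k) w) ^ 4 \<le> (?A w) ^ 4 + 4 * (((?A w) ^ 3 * ?S w) * ?e w) + 8 * (((?A w)\<^sup>2 * (?S w)\<^sup>2) * (?e w)\<^sup>2)
          + 3 * ((?S w) ^ 4 * (?e w) ^ 4)"
          using le[of "?A w" "?S w * ?e w"] by (simp add: power_mult_distrib mult.assoc)
      qed
      also have "\<dots> = a k + 4 * expectation (\<lambda>w. ((?A w) ^ 3 * ?S w) * ?e w)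
          + 8 * expectation (\<lambda>w. ((?A w)\<^sup>2 * (?S w)\<^sup>2) * (?e w)\<^sup>2) + 3 * expectation (\<lambda>w. (?S w) ^ 4 * (?e w) ^ 4)"
        using I by (simp add: a_def)
      also have "expectation (\<lambda>w. ((?A w) ^ 3 * ?S w) * ?e w) \<le> Cb / real n * (a k + K)"
      proof -
        have b: "\<bar>x ^ 3 * y\<bar> \<le> x ^ 4 + y ^ 4" for x y :: real
        proof (cases "\<bar>x\<bar> \<le> \<bar>y\<bar>")
          case True
          then have "\<bar>x\<bar> ^ 3 * \<bar>y\<bar> \<le> \<bar>y\<bar> ^ 3 * \<bar>y\<bar>" by (intro mult_right_mono power_mono) auto
          also have "\<dots> = y ^ 4" by (simp add: power3_eq_cube power4_eq_xxxx abs_mult[symmetric])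
          finally show ?thesis by (simp add: abs_mult power_abs add_increasing)
        next
          case False
          then have "\<bar>x\<bar> ^ 3 * \<bar>y\<bar> \<le> \<bar>x\<bar> ^ 3 * \<bar>x\<bar>" by (intro mult_left_mono) auto
          also have "\<dots> = x ^ 4" by (simp add: power3_eq_cube power4_eq_xxxx abs_mult[symmetric])
          finally show ?thesis by (simp add: abs_mult power_abs add_increasing2)
        qed
        have "expectation (\<lambda>w. ((?A w) ^ 3 * ?S w) * ?e w) = block_bias n N * expectation (\<lambda>w. (?A w) ^ 3 * ?S w)"
          using AF SF by (intro block_err_mean k N I(6)) measurable
        also have "\<dots> \<le> \<bar>block_bias n N\<bar> * \<bar>expectation (\<lambda>w. (?A w) ^ 3 * ?S w)\<bar>"
          unfolding abs_mult[symmetric] by (rule abs_ge_self)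
        also have "\<bar>expectation (\<lambda>w. (?A w) ^ 3 * ?S w)\<bar> \<le> expectation (\<lambda>w. (?A w) ^ 4 + (?S w) ^ 4)"
        proof (rule order_trans[OF integral_abs_bound])
          show "expectation (\<lambda>w. \<bar>(?A w) ^ 3 * ?S w\<bar>) \<le> expectation (\<lambda>w. (?A w) ^ 4 + (?S w) ^ 4)"
            by (intro integral_mono b integrable_abs Bochner_Integration.integrable_add I)
        qed
        also note aS
        also have "\<bar>block_bias n N\<bar> \<le> Cb / real n"
          using Cb(2)[OF n] mult_left_mono[OF n2, of Cb] Cb(1) by simp
        finally show ?thesis using a0[of k] K(1) by (simp add: mult_left_mono mult_right_mono)
      qed
      also have "expectation (\<lambda>w. ((?A w)\<^sup>2 * (?S w)\<^sup>2) * (?e w)\<^sup>2) \<le> Cm / real n * (a k + K)"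
      proof -
        have b: "x\<^sup>2 * y\<^sup>2 \<le> x ^ 4 + y ^ 4" for x y :: real
          using abs_mult_le_squares[of "x\<^sup>2" "y\<^sup>2"] by (simp flip: power_mult)
        have "expectation (\<lambda>w. ((?A w)\<^sup>2 * (?S w)\<^sup>2) * (?e w)\<^sup>2) \<le> Cm / real n * expectation (\<lambda>w. (?A w)\<^sup>2 * (?S w)\<^sup>2)"
          using AF SF by (intro weighted_boundD[OF Cm(2)] n k I(7)) (measurable, auto)
        also have "expectation (\<lambda>w. (?A w)\<^sup>2 * (?S w)\<^sup>2) \<le> expectation (\<lambda>w. (?A w) ^ 4 + (?S w) ^ 4)"
          using I by (intro integral_mono b) auto
        also note aS
        finally show ?thesis using Cm(1) by (simp add: mult_left_mono divide_right_mono)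
      qed
      also have "expectation (\<lambda>w. (?S w) ^ 4 * (?e w) ^ 4) \<le> Cm / real n * (a k + K)"
      proof -
        have "expectation (\<lambda>w. (?S w) ^ 4 * (?e w) ^ 4) \<le> Cm / (real n)\<^sup>2 * expectation (\<lambda>w. (?S w) ^ 4)"
          using SF by (intro weighted_boundD[OF Cm(3)] n k I(8)) (measurable, auto)
        also have "\<dots> \<le> Cm / real n * (a k + K)"
          using mult_left_mono[OF n2, of Cm] Cm(1) ES a0[of k] K(1) by (intro mult_mono) auto
        finally show ?thesis .
      qed
      finally have "a (Suc k) \<le> a k + 4 * (Cb / real n * (a k + K)) + 8 * (Cm / real n * (a k + K)) + 3 * (Cm / real n * (a k + K))"
        by simp
      also have "\<dots> = a k + C / real n * (a k + K)"
        by (simp add: C_def add_divide_distrib algebra_simps)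
      finally show "a (Suc k) + K \<le> (a k + K) * (1 + C / real n)" by (simp add: algebra_simps)
    qed (use C0 K in \<open>auto simp: a_def err_sum_def\<close>)
    then show "expectation (\<lambda>w. (err_sum n N n w) ^ 4) \<le> K * exp C"
      using n K(1) by (simp add: a_def)
  qed
qed

text \<open>The mixed term only sees the bias, of order \<open>n^-2\<close>, and the squares are of
  the same order, so the Gronwall exponent over \<open>n\<close> steps is \<open>C / n\<close>. The
  constant \<open>K\<close> added for the recursion is subtracted again at the end, hence the factor
  \<open>exp (C / n) - 1\<close>, which tends to 0.\<close>

lemma rem_sum_second_moment:
  obtains C K where "C > 0" "K > 0" "\<And>n N. 1 \<le> n \<Longrightarrow> n \<le> N \<Longrightarrow> expectation (\<lambda>w. (rem_sum n N n w)\<^sup>2) \<le> K * (exp (C / real n) - 1)"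
proof -
  obtain Cb where Cb: "Cb > 0" "\<And>n N. 1 \<le> n \<Longrightarrow> n \<le> N \<Longrightarrow> \<bar>block_bias n N\<bar> \<le> Cb / (real n)\<^sup>2"
    using block_bias_bound by blast
  obtain Cm where Cm: "Cm > 0"
    "\<And>n N k. 1 \<le> n \<Longrightarrow> n \<le> N \<Longrightarrow> k < n \<Longrightarrow> weighted_bound (grid n k) (\<lambda>w. (block_rem n N k w)\<^sup>2) (Cm / (real n)\<^sup>2)"
    using block_moment_bounds by blast
  obtain K where K: "K > 0" "\<And>n k. k \<le> n \<Longrightarrow> expectation (\<lambda>w. (S (grid n k) w)\<^sup>2) \<le> K"
    using S_power_bound[of 2] by blast
  define C where "C = 2 * Cb + Cm"
  have C0: "C > 0" using Cb Cm by (simp add: C_def)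
  show thesis
  proof (rule that[OF C0 K(1)])
    fix n N :: nat assume n: "1 \<le> n" "n \<le> N"
    then have N: "N > 0" by simp
    define a where "a k = expectation (\<lambda>w. (rem_sum n N k w)\<^sup>2)" for k
    have a0: "0 \<le> a k" for k by (simp add: a_def)
    have "a n + K \<le> K * exp (C / (real n)\<^sup>2 * real n)"
    proof (rule discrete_gronwall[where x="\<lambda>k. a k + K"])
      fix k assume k: "k < n"
      let ?A = "rem_sum n N k" and ?S = "S (grid n k)" and ?e = "block_rem n N k"
      note A = sums_all_moments(2)[OF less_imp_le[OF k] N] and s = all_moments_S_grid[OF less_imp_le[OF k]] and e = all_moments_block_rem[OF k N]
      note AF = sums_measurable_F(2)[OF less_imp_le[OF k] N] and SF = S_grid_measurable_F[OF order_refl less_imp_le[OF k]]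
      have I: "integrable M (\<lambda>w. (?A w)\<^sup>2)" "integrable M (\<lambda>w. (?A w * ?S w) * ?e w)"
        "integrable M (\<lambda>w. (?S w)\<^sup>2 * (?e w)\<^sup>2)" "integrable M (\<lambda>w. ?A w * ?S w)" "integrable M (\<lambda>w. (?S w)\<^sup>2)"
        by (intro all_moments_integrable bounded_moments_mult bounded_moments_power A s e; simp)+
      have ES: "expectation (\<lambda>w. (?S w)\<^sup>2) \<le> K" using K(2) k by simp
      have aS: "expectation (\<lambda>w. (?A w)\<^sup>2 + (?S w)\<^sup>2) \<le> a k + K" using I ES by (simp add: a_def)
      have "a (Suc k) = expectation (\<lambda>w. (?A w)\<^sup>2 + 2 * ((?A w * ?S w) * ?e w) + (?S w)\<^sup>2 * (?e w)\<^sup>2)"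
        unfolding a_def
        by (intro Bochner_Integration.integral_cong) (auto simp: rem_sum_def power2_eq_square algebra_simps)
      also have "\<dots> = a k + 2 * expectation (\<lambda>w. (?A w * ?S w) * ?e w) + expectation (\<lambda>w. (?S w)\<^sup>2 * (?e w)\<^sup>2)"
        using I by (simp add: a_def)
      also have "expectation (\<lambda>w. (?A w * ?S w) * ?e w) \<le> Cb / (real n)\<^sup>2 * (a k + K)"
      proof -
        have "expectation (\<lambda>w. (?A w * ?S w) * ?e w) = block_bias n N * expectation (\<lambda>w. ?A w * ?S w)"
          using AF SF by (intro block_rem_mean k N bounded_moments_mult A s) measurable
        also have "\<dots> \<le> \<bar>block_bias n N\<bar> * \<bar>expectation (\<lambda>w. ?A w * ?S w)\<bar>"
          unfolding abs_mult[symmetric] by (rule abs_ge_self)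
        also have "\<bar>expectation (\<lambda>w. ?A w * ?S w)\<bar> \<le> expectation (\<lambda>w. (?A w)\<^sup>2 + (?S w)\<^sup>2)"
        proof (rule order_trans[OF integral_abs_bound])
          show "expectation (\<lambda>w. \<bar>?A w * ?S w\<bar>) \<le> expectation (\<lambda>w. (?A w)\<^sup>2 + (?S w)\<^sup>2)"
            by (intro integral_mono abs_mult_le_squares integrable_abs Bochner_Integration.integrable_add I)
        qed
        also note aS
        also note Cb(2)[OF n]
        finally show ?thesis using a0[of k] K(1) by (simp add: mult_left_mono mult_right_mono)
      qed
      also have "expectation (\<lambda>w. (?S w)\<^sup>2 * (?e w)\<^sup>2) \<le> Cm / (real n)\<^sup>2 * (a k + K)"
      proof -
        have "expectation (\<lambda>w. (?S w)\<^sup>2 * (?e w)\<^sup>2) \<le> Cm / (real n)\<^sup>2 * expectation (\<lambda>w. (?S w)\<^sup>2)"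
          using SF by (intro weighted_boundD[OF Cm(2)] n k I(5)) (measurable, auto)
        also have "\<dots> \<le> Cm / (real n)\<^sup>2 * (a k + K)"
          using Cm(1) ES a0[of k] by (intro mult_left_mono) auto
        finally show ?thesis .
      qed
      finally have "a (Suc k) \<le> a k + 2 * (Cb / (real n)\<^sup>2 * (a k + K)) + Cm / (real n)\<^sup>2 * (a k + K)"
        by simp
      also have "\<dots> = a k + C / (real n)\<^sup>2 * (a k + K)"
        by (simp add: C_def add_divide_distrib algebra_simps)
      finally show "a (Suc k) + K \<le> (a k + K) * (1 + C / (real n)\<^sup>2)" by (simp add: algebra_simps)
    qed (use C0 K in \<open>auto simp: a_def rem_sum_def\<close>)
    also have "C / (real n)\<^sup>2 * real n = C / real n" using n by (simp add: power2_eq_square)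
    finally show "expectation (\<lambda>w. (rem_sum n N n w)\<^sup>2) \<le> K * (exp (C / real n) - 1)"
      by (simp add: a_def algebra_simps)
  qed
qed

lemma bridge_var_bound:
  assumes "1 \<le> n" "N > 0"
  shows "0 \<le> bridge_var n N" "bridge_var n N \<le> T / real n"
proof -
  have N: "1 \<le> (real N)\<^sup>2" using assms by simp
  then show "0 \<le> bridge_var n N" unfolding bridge_var_def using T_pos by (intro divide_nonneg_nonneg) auto
  have "bridge_var n N \<le> T * (real N)\<^sup>2 / (12 * real n * (real N)\<^sup>2)"
    unfolding bridge_var_def using T_pos by (intro divide_right_mono mult_left_mono) auto
  also have "\<dots> = T / (12 * real n)" using assms by simp
  also have "\<dots> \<le> T / real n" using assms T_pos by (simp add: field_simps)
  finally show "bridge_var n N \<le> T / real n" .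
qed

text \<open>\<open>bridge_var\<close> is the exact conditional mean of the squared bridge, so the
  increments of \<open>qv_err\<close> are orthogonal; each of the \<open>n\<close> increments has a
  second moment of order \<open>n^-2\<close>.\<close>

lemma qv_err_second_moment:
  obtains C where "C > 0" "\<And>n N. 1 \<le> n \<Longrightarrow> n \<le> N \<Longrightarrow> expectation (\<lambda>w. (qv_err n N n w)\<^sup>2) \<le> C / real n"
proof -
  obtain Cm where Cm: "Cm > 0"
    "\<And>n N k. 1 \<le> n \<Longrightarrow> n \<le> N \<Longrightarrow> k < n \<Longrightarrow> weighted_bound (grid n k) (\<lambda>w. (bridge n N k w) ^ 4) (Cm / (real n)\<^sup>2)"
    using block_moment_bounds by blast
  obtain K where K: "K > 0" "\<And>n k. k \<le> n \<Longrightarrow> expectation (\<lambda>w. (S (grid n k) w) ^ 4) \<le> K"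
    using S_power_bound[of 4] by blast
  define C where "C = (2 * Cm + 2 * T\<^sup>2) * K"
  have C0: "C > 0" using Cm K T_pos by (simp add: C_def add_pos_nonneg)
  show thesis
  proof (rule that[OF C0])
    fix n N :: nat assume n: "1 \<le> n" "n \<le> N"
    then have N: "N > 0" by simp
    let ?v = "bridge_var n N"
    define a where "a k = expectation (\<lambda>w. (qv_err n N k w)\<^sup>2)" for k
    have "a k \<le> real k * (C / (real n)\<^sup>2)" if "k \<le> n" for k
      using that
    proof (induction k)
      case (Suc k)
      then have k: "k < n" by simp
      let ?A = "qv_err n N k" and ?S = "S (grid n k)" and ?e = "bridge n N k"
      note A = sums_all_moments(4)[OF less_imp_le[OF k] N] and s = all_moments_S_grid[OF less_imp_le[OF k]] and e = all_moments_bridge[OF k N]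
      note AF = sums_measurable_F(3)[OF less_imp_le[OF k] N] and SF = S_grid_measurable_F[OF order_refl less_imp_le[OF k]]
      have I: "integrable M (\<lambda>w. (?A w)\<^sup>2)" "integrable M (\<lambda>w. (?A w * (?S w)\<^sup>2) * (?e w)\<^sup>2)" "integrable M (\<lambda>w. ?A w * (?S w)\<^sup>2)"
        "integrable M (\<lambda>w. (?S w) ^ 4 * ((?e w)\<^sup>2 - ?v)\<^sup>2)" "integrable M (\<lambda>w. (?S w) ^ 4)" "integrable M (\<lambda>w. (?S w) ^ 4 * (?e w) ^ 4)"
        by (intro all_moments_integrable bounded_moments_mult bounded_moments_power bounded_moments_diff bounded_moments_const A s e)+
      have ES: "expectation (\<lambda>w. (?S w) ^ 4) \<le> K" using K(2) k by simp
      have "a (Suc k) = expectation (\<lambda>w. (?A w)\<^sup>2 + 2 * ((?A w * (?S w)\<^sup>2) * (?e w)\<^sup>2) - 2 * ?v * (?A w * (?S w)\<^sup>2) + (?S w) ^ 4 * ((?e w)\<^sup>2 - ?v)\<^sup>2)"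
        unfolding a_def
        by (intro Bochner_Integration.integral_cong) (auto simp: qv_err_def power2_eq_square power4_eq_xxxx algebra_simps)
      also have "\<dots> = a k + 2 * expectation (\<lambda>w. (?A w * (?S w)\<^sup>2) * (?e w)\<^sup>2) - 2 * ?v * expectation (\<lambda>w. ?A w * (?S w)\<^sup>2)
          + expectation (\<lambda>w. (?S w) ^ 4 * ((?e w)\<^sup>2 - ?v)\<^sup>2)"
        using I by (simp add: a_def)
      also have "expectation (\<lambda>w. (?A w * (?S w)\<^sup>2) * (?e w)\<^sup>2) = ?v * expectation (\<lambda>w. ?A w * (?S w)\<^sup>2)"
        using AF SF by (intro bridge_square_mean k N bounded_moments_mult bounded_moments_power A s borel_measurable_times borel_measurable_power) auto
      also have "expectation (\<lambda>w. (?S w) ^ 4 * ((?e w)\<^sup>2 - ?v)\<^sup>2) \<le> C / (real n)\<^sup>2"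
      proof -
        have sq: "(x - y)\<^sup>2 \<le> 2 * x\<^sup>2 + 2 * y\<^sup>2" for x y :: real
          using zero_le_power2[of "x + y"] by (simp add: power2_eq_square algebra_simps)
        have "(?S w) ^ 4 * ((?e w)\<^sup>2 - ?v)\<^sup>2 \<le> 2 * ((?S w) ^ 4 * (?e w) ^ 4) + 2 * ?v\<^sup>2 * (?S w) ^ 4" for w
          using mult_left_mono[OF sq[of "(?e w)\<^sup>2" ?v], of "(?S w) ^ 4"] by (simp add: algebra_simps flip: power_mult)
        then have "expectation (\<lambda>w. (?S w) ^ 4 * ((?e w)\<^sup>2 - ?v)\<^sup>2) \<le> expectation (\<lambda>w. 2 * ((?S w) ^ 4 * (?e w) ^ 4) + 2 * ?v\<^sup>2 * (?S w) ^ 4)"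
          using I by (intro integral_mono) auto
        also have "\<dots> = 2 * expectation (\<lambda>w. (?S w) ^ 4 * (?e w) ^ 4) + 2 * ?v\<^sup>2 * expectation (\<lambda>w. (?S w) ^ 4)"
          using I by simp
        also have "expectation (\<lambda>w. (?S w) ^ 4 * (?e w) ^ 4) \<le> Cm / (real n)\<^sup>2 * expectation (\<lambda>w. (?S w) ^ 4)"
          using SF by (intro weighted_boundD[OF Cm(2)] n k I(5)) (measurable, auto)
        also have "2 * (Cm / (real n)\<^sup>2 * expectation (\<lambda>w. (?S w) ^ 4)) + 2 * ?v\<^sup>2 * expectation (\<lambda>w. (?S w) ^ 4)
            = (2 * (Cm / (real n)\<^sup>2) + 2 * ?v\<^sup>2) * expectation (\<lambda>w. (?S w) ^ 4)" by (simp add: algebra_simps)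
        also have "\<dots> \<le> (2 * (Cm / (real n)\<^sup>2) + 2 * (T / real n)\<^sup>2) * K"
          using bridge_var_bound[OF n(1) N] Cm(1) ES K(1) by (intro mult_mono add_mono power_mono) auto
        also have "\<dots> = C / (real n)\<^sup>2" by (simp add: C_def power_divide algebra_simps add_divide_distrib)
        finally show ?thesis by simp
      qed
      finally show ?case using Suc by (simp add: algebra_simps add_divide_distrib)
    qed (simp add: a_def qv_err_def)
    from this[of n] show "expectation (\<lambda>w. (qv_err n N n w)\<^sup>2) \<le> C / real n"
      using n by (simp add: a_def power2_eq_square)
  qed
qed

end

section \<open>Riemann sums\<close>

lemma sum_lessThan_add:
  fixes f :: "nat \<Rightarrow> 'x::comm_monoid_add"
  shows "(\<Sum>i<a + b. f i) = (\<Sum>i<a. f i) + (\<Sum>j<b. f (a + j))"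
  by (induction b) (auto simp: add.assoc)

lemma sum_blocks:
  fixes f :: "nat \<Rightarrow> 'x::comm_monoid_add"
  shows "(\<Sum>i<n * N. f i) = (\<Sum>k<n. \<Sum>j<N. f (k * N + j))"
proof (induction n)
  case (Suc n)
  have "(\<Sum>i<Suc n * N. f i) = (\<Sum>i<n * N + N. f i)" by (simp add: add.commute)
  then show ?case unfolding sum_lessThan_add using Suc by simp
qed simp

lemma riemann_sum_tendsto:
  fixes \<phi> :: "real \<Rightarrow> real"
  assumes T: "T > 0" and \<phi>: "continuous_on {0..T} \<phi>"
  shows "(\<lambda>n. (\<Sum>k<n. \<phi> (real k * (T / real n))) / real n) \<longlonglongrightarrow> (1 / T) * (LINT u:{0..T}|lborel. \<phi> u)"
proof -
  have si: "set_integrable lborel {0..T} \<phi>" by (rule borel_integrable_atLeastAtMost'[OF \<phi>])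
  have eq: "(LINT u:{0..T}|lborel. \<phi> u) = integral {0..T} \<phi>"
    using set_borel_integral_eq_integral(2)[OF si] by simp
  have "(\<lambda>n. T * ((\<Sum>k<n. \<phi> (real k * (T / real n))) / real n)) \<longlonglongrightarrow> integral {0..T} \<phi>"
  proof (rule LIMSEQ_I)
    fix e :: real assume e: "e > 0"
    have "uniformly_continuous_on {0..T} \<phi>" by (rule compact_uniformly_continuous[OF \<phi>]) simp
    then obtain d where d: "d > 0" "\<And>x y. x \<in> {0..T} \<Longrightarrow> y \<in> {0..T} \<Longrightarrow> \<bar>y - x\<bar> < d \<Longrightarrow> \<bar>\<phi> y - \<phi> x\<bar> < e / (2 * T)"
      using e T unfolding uniformly_continuous_on_def dist_real_def by (metis divide_pos_pos mult_pos_pos zero_less_numeral)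
    obtain n0 where n0: "T / d < real n0" using reals_Archimedean2 by blast
    show "\<exists>n0. \<forall>n\<ge>n0. norm (T * ((\<Sum>k<n. \<phi> (real k * (T / real n))) / real n) - integral {0..T} \<phi>) < e"
    proof (intro exI allI impI)
      fix n assume n: "n \<ge> max n0 1"
      then have np: "real n > 0" by simp
      have "T / d < real n" using n n0 by simp
      then have Tn: "T / real n < d" using np d(1) T by (simp add: field_simps)
      define g where "g k = real k * (T / real n)" for k
      have gS: "g (Suc k) = g k + T / real n" for k by (simp add: g_def algebra_simps add_divide_distrib)
      have g0: "0 \<le> g k" for k using T by (simp add: g_def)
      have gT: "g k \<le> T" if "k \<le> n" for k using that T np by (simp add: g_def field_simps)
      have int: "\<phi> integrable_on {a..b}" if "0 \<le> a" "b \<le> T" for a b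
        by (rule integrable_continuous_real, rule continuous_on_subset[OF \<phi>]) (use that in auto)
      have split: "integral {0..g k} \<phi> = (\<Sum>j<k. integral {g j..g (Suc j)} \<phi>)" if "k \<le> n" for k
        using that
      proof (induction k)
        case (Suc k)
        have "integral {0..g k} \<phi> + integral {g k..g (Suc k)} \<phi> = integral {0..g (Suc k)} \<phi>"
          using T gT[OF Suc.prems] by (intro Henstock_Kurzweil_Integration.integral_combine int g0) (auto simp: gS)
        then show ?case using Suc by simp
      qed (simp add: g_def)
      have gn: "g n = T" using np by (simp add: g_def)
      have bd: "\<bar>\<phi> (g j) * (T / real n) - integral {g j..g (Suc j)} \<phi>\<bar> \<le> e / (2 * T) * (T / real n)" if "j < n" for j
      proof -
        have "((\<lambda>x. \<phi> (g j) - \<phi> x) has_integral (\<phi> (g j) * (T / real n) - integral {g j..g (Suc j)} \<phi>)) (cbox (g j) (g (Suc j)))"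
        proof -
          have "((\<lambda>x. \<phi> (g j)) has_integral \<phi> (g j) * (T / real n)) {g j..g (Suc j)}"
            using has_integral_const_real[of "\<phi> (g j)" "g j" "g (Suc j)"] T by (simp add: gS mult.commute)
          moreover have "(\<phi> has_integral integral {g j..g (Suc j)} \<phi>) {g j..g (Suc j)}"
            using gT[of "Suc j"] that by (intro integrable_integral int g0) auto
          ultimately show ?thesis by (simp add: has_integral_diff)
        qed
        then have "norm (\<phi> (g j) * (T / real n) - integral {g j..g (Suc j)} \<phi>) \<le> e / (2 * T) * measure lborel (cbox (g j) (g (Suc j)))"
        proof (rule has_integral_bound[rotated])
          fix x assume "x \<in> cbox (g j) (g (Suc j))"
          then have "g j \<le> x" "x \<le> g (Suc j)" by auto
          then show "norm (\<phi> (g j) - \<phi> x) \<le> e / (2 * T)"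
            using d(2)[of x "g j"] g0[of j] gT[of j] gT[of "Suc j"] that Tn gS[of j] by (simp add: less_imp_le)
        qed (use e T in auto)
        then show ?thesis using T by (simp add: gS)
      qed
      have "T * ((\<Sum>k<n. \<phi> (g k)) / real n) - integral {0..T} \<phi> = (\<Sum>j<n. \<phi> (g j) * (T / real n) - integral {g j..g (Suc j)} \<phi>)"
        using split[of n] unfolding gn sum_subtractf sum_distrib_right[symmetric] by simp
      also have "\<bar>\<dots>\<bar> \<le> (\<Sum>j<n. e / (2 * T) * (T / real n))"
        by (rule order_trans[OF sum_abs sum_mono]) (use bd in auto)
      also have "\<dots> = e / 2" using np T by simp
      finally show "norm (T * ((\<Sum>k<n. \<phi> (real k * (T / real n))) / real n) - integral {0..T} \<phi>) < e"
        using e by (simp add: g_def)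
    qed
  qed
  then have "(\<lambda>n. (1 / T) * (T * ((\<Sum>k<n. \<phi> (real k * (T / real n))) / real n))) \<longlonglongrightarrow> (1 / T) * integral {0..T} \<phi>"
    by (intro tendsto_mult tendsto_const)
  then show ?thesis using T by (simp add: eq)
qed

section \<open>Moment bounds for limits and for added indices\<close>

context prob_space
begin

text \<open>Fatou's lemma carries the uniform moment bounds over to the limit.\<close>

lemma all_moments_limit:
  assumes U: "bounded_moments UNIV U" and [measurable]: "X \<in> borel_measurable M"
    and lim: "AE w in M. (\<lambda>n::nat. U n w) \<longlonglongrightarrow> X w"
  shows "all_moments X"
proof (rule bounded_momentsI)
  fix q
  have [measurable]: "U n \<in> borel_measurable M" for n using bounded_moments_measurable[OF U] by simp
  obtain B where B: "B > 0" "\<And>n. expectation (\<lambda>w. \<bar>U n w\<bar> ^ q) \<le> B"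
    using bounded_moments_bound[OF U, of q] by auto
  have "(\<integral>\<^sup>+w. ennreal (\<bar>X w\<bar> ^ q) \<partial>M) = (\<integral>\<^sup>+w. liminf (\<lambda>n. ennreal (\<bar>U n w\<bar> ^ q)) \<partial>M)"
  proof (rule nn_integral_cong_AE)
    show "AE w in M. ennreal (\<bar>X w\<bar> ^ q) = liminf (\<lambda>n. ennreal (\<bar>U n w\<bar> ^ q))"
      using lim
    proof eventually_elim
      case (elim w)
      have "(\<lambda>n. ennreal (\<bar>U n w\<bar> ^ q)) \<longlonglongrightarrow> ennreal (\<bar>X w\<bar> ^ q)"
        by (intro tendsto_ennrealI tendsto_power tendsto_rabs elim)
      then show ?case by (intro lim_imp_Liminf[symmetric]) simp_all
    qed
  qed
  also have "\<dots> \<le> liminf (\<lambda>n. \<integral>\<^sup>+w. ennreal (\<bar>U n w\<bar> ^ q) \<partial>M)"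
    by (rule nn_integral_liminf) simp
  also have "\<dots> \<le> liminf (\<lambda>n. ennreal B)"
  proof (intro Liminf_mono always_eventually allI)
    fix n
    show "(\<integral>\<^sup>+w. ennreal (\<bar>U n w\<bar> ^ q) \<partial>M) \<le> ennreal B"
      using B by (subst nn_integral_eq_integral)
        (auto intro!: bounded_moments_integrable_abs_power[OF U] ennreal_leI)
  qed
  also have "\<dots> = ennreal B" by (simp add: Liminf_const)
  finally have le: "(\<integral>\<^sup>+w. ennreal (\<bar>X w\<bar> ^ q) \<partial>M) \<le> ennreal B" .
  then have int: "integrable M (\<lambda>w. \<bar>X w\<bar> ^ q)"
    by (intro integrableI_bounded) (auto intro: le_less_trans)
  have "expectation (\<lambda>w. \<bar>X w\<bar> ^ q) \<le> B"
    using le B(1) by (subst (asm) nn_integral_eq_integral[OF int]) auto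
  with int show "\<exists>B. \<forall>i\<in>UNIV. \<exists>V. integrable M V \<and> (AE w in M. \<bar>X w\<bar> ^ q \<le> V w) \<and> expectation V \<le> B"
    by (intro exI[of _ B]) auto
qed auto

text \<open>Serves to add the index 0, where a division by \<open>n\<close> yields 0, to families
  that are controlled for \<open>n \<ge> 1\<close>.\<close>

lemma bounded_moments_insert:
  assumes A: "bounded_moments A U" and i: "all_moments (U i)"
  shows "bounded_moments (insert i A) U"
proof (rule bounded_momentsI)
  fix q
  obtain B where B: "\<And>i. i \<in> A \<Longrightarrow> expectation (\<lambda>w. \<bar>U i w\<bar> ^ q) \<le> B"
    using bounded_moments_bound[OF A] by metis
  show "\<exists>B. \<forall>j\<in>insert i A. \<exists>V. integrable M V \<and> (AE w in M. \<bar>U j w\<bar> ^ q \<le> V w) \<and> expectation V \<le> B"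
  proof (intro exI[of _ "max B (expectation (\<lambda>w. \<bar>U i w\<bar> ^ q))"] ballI)
    fix j assume "j \<in> insert i A"
    then show "\<exists>V. integrable M V \<and> (AE w in M. \<bar>U j w\<bar> ^ q \<le> V w) \<and> expectation V \<le> max B (expectation (\<lambda>w. \<bar>U i w\<bar> ^ q))"
      using B[of j] bounded_moments_integrable_abs_power[OF A, of j q] bounded_moments_integrable_abs_power[OF i, of "()" q]
      by (intro exI[of _ "\<lambda>w. \<bar>U j w\<bar> ^ q"]) auto
  qed
qed (use A i in \<open>auto simp: bounded_moments_def\<close>)

end

section \<open>The error of the trapezoidal scheme\<close>

context black_scholes
begin

definition riemann :: "nat \<Rightarrow> 'a \<Rightarrow> real" where
  "riemann n w = (\<Sum>k<n. S (grid n k) w) / real n"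

abbreviation trap :: "nat \<Rightarrow> 'a \<Rightarrow> real" where "trap \<equiv> trapezoidal_scheme T S0 r \<sigma> W"
abbreviation avg :: "'a \<Rightarrow> real" where "avg \<equiv> average_price T S0 r \<sigma> W"

lemma trap_eq:
  "trap n w = (\<Sum>k<n. S (grid n k) w * (1 + r * (T / real n) / 2 + \<sigma> * (W (grid n (Suc k)) w - W (grid n k) w) / 2)) / real n"
proof -
  have "trap n w = T / real n / T * (\<Sum>k = 1..n. S (grid n (k - 1)) w * (1 + r * (T / real n) / 2 + \<sigma> * ((W (grid n k) w - W (grid n (k - 1)) w) / 2)))"
    unfolding trapezoidal_scheme_def Let_def grid_def ..
  also have "(\<Sum>k = 1..n. S (grid n (k - 1)) w * (1 + r * (T / real n) / 2 + \<sigma> * ((W (grid n k) w - W (grid n (k - 1)) w) / 2)))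
     = (\<Sum>k<n. S (grid n k) w * (1 + r * (T / real n) / 2 + \<sigma> * ((W (grid n (Suc k)) w - W (grid n k) w) / 2)))"
    by (rule sum.reindex_bij_witness[of _ Suc "\<lambda>k. k - 1"]) auto
  also have "T / real n / T = 1 / real n" using T_pos by simp
  finally show ?thesis by simp
qed

text \<open>An exact identity, since the scheme is compared with a Riemann sum on a refinement and
  not with the integral: within a block the fine prices are the price at the left end times
  \<open>growth\<close>.\<close>

lemma trap_minus_riemann:
  assumes n: "1 \<le> n" "N > 0"
  shows "trap n w - riemann (n * N) w = - (err_sum n N n w / real n)"
proof -
  have "riemann (n * N) w = (\<Sum>k<n. \<Sum>j<N. S (grid (n * N) (k * N + j)) w) / real (n * N)"
    unfolding riemann_def sum_blocks ..
  also have "(\<Sum>k<n. \<Sum>j<N. S (grid (n * N) (k * N + j)) w) = (\<Sum>k<n. S (grid n k) w * (\<Sum>j<N. growth n N k j w))"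
    unfolding sum_distrib_left using S_block n by (intro sum.cong) auto
  also have "\<dots> / real (n * N) = (\<Sum>k<n. S (grid n k) w * ((\<Sum>j<N. growth n N k j w) / real N)) / real n"
    by (simp add: sum_divide_distrib[symmetric] mult.commute)
  finally have R: "riemann (n * N) w = (\<Sum>k<n. S (grid n k) w * ((\<Sum>j<N. growth n N k j w) / real N)) / real n" .
  have b: "block_err n N k w = (\<Sum>j<N. growth n N k j w) / real N - (1 + r * (T / real n) / 2 + \<sigma> * (W (grid n (Suc k)) w - W (grid n k) w) / 2)" for k
  proof -
    have "grid (n * N) (k * N + N) = grid n (Suc k)"
      using grid_refine[OF n(2), of n "Suc k"] by (simp add: add.commute)
    then show ?thesis using n unfolding block_err_def block_incr_def
      by (simp add: sum_subtractf diff_divide_distrib)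
  qed
  show ?thesis unfolding trap_eq R err_sum_def b
    by (simp only: diff_divide_distrib[symmetric] sum_subtractf[symmetric] right_diff_distrib minus_divide_left minus_diff_eq sum_negf[symmetric])
qed

lemma riemann_tendsto: "w \<in> space M \<Longrightarrow> (\<lambda>n. riemann n w) \<longlonglongrightarrow> avg w"
  using riemann_sum_tendsto[OF T_pos S_continuous, of w] unfolding riemann_def average_price_def grid_def .

lemma riemann_square_tendsto:
  "w \<in> space M \<Longrightarrow> (\<lambda>n. (\<Sum>k<n. (S (grid n k) w)\<^sup>2) / real n) \<longlonglongrightarrow> (1 / T) * (LINT u:{0..T}|lborel. (S u w)\<^sup>2)"
  using riemann_sum_tendsto[OF T_pos continuous_on_power[OF S_continuous], of w 2] unfolding grid_def .

text \<open>A pathwise argument: up to a factor tending to 1 the scheme is a left Riemann sum, plus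
  a term that uniform continuity of the Brownian path makes small.\<close>

lemma trap_tendsto:
  assumes w: "w \<in> space M"
  shows "(\<lambda>n. trap n w) \<longlonglongrightarrow> avg w"
proof -
  let ?D = "\<lambda>n k. W (grid n (Suc k)) w - W (grid n k) w"
  have eq: "trap n w = riemann n w * (1 + r * (T / real n) / 2) + (\<sigma> / 2) * ((\<Sum>k<n. S (grid n k) w * ?D n k) / real n)" for n
  proof -
    have "(\<Sum>k<n. S (grid n k) w * (1 + r * (T / real n) / 2 + \<sigma> * ?D n k / 2))
      = (\<Sum>k<n. S (grid n k) w * (1 + r * (T / real n) / 2) + (\<sigma> / 2) * (S (grid n k) w * ?D n k))"
      by (intro sum.cong) (auto simp: distrib_left)
    also have "\<dots> = (\<Sum>k<n. S (grid n k) w) * (1 + r * (T / real n) / 2) + (\<sigma> / 2) * (\<Sum>k<n. S (grid n k) w * ?D n k)"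
      by (simp only: sum.distrib sum_distrib_left sum_distrib_right)
    finally show ?thesis unfolding trap_eq riemann_def by (simp add: add_divide_distrib)
  qed
  have "bounded ((\<lambda>t. S t w) ` {0..T})"
    by (intro compact_imp_bounded compact_continuous_image S_continuous w) simp
  then obtain B where B: "B > 0" "\<And>t. t \<in> {0..T} \<Longrightarrow> \<bar>S t w\<bar> \<le> B" by (auto simp: bounded_pos)
  have "(\<lambda>n. (\<Sum>k<n. S (grid n k) w * ?D n k) / real n) \<longlonglongrightarrow> 0"
  proof (rule LIMSEQ_I)
    fix e :: real assume e: "e > 0"
    have "uniformly_continuous_on {0..T} (\<lambda>t. W t w)" by (rule compact_uniformly_continuous[OF W_continuous[OF w]]) simp
    then obtain d where d: "d > 0" "\<And>x y. x \<in> {0..T} \<Longrightarrow> y \<in> {0..T} \<Longrightarrow> \<bar>y - x\<bar> < d \<Longrightarrow> \<bar>W y w - W x w\<bar> < e / (2 * B)"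
      using e B(1) unfolding uniformly_continuous_on_def dist_real_def by (metis divide_pos_pos mult_pos_pos zero_less_numeral)
    obtain n0 where n0: "T / d < real n0" using reals_Archimedean2 by blast
    show "\<exists>n0. \<forall>n\<ge>n0. norm ((\<Sum>k<n. S (grid n k) w * ?D n k) / real n - 0) < e"
    proof (intro exI allI impI)
      fix n assume n: "n \<ge> max n0 1"
      then have np: "real n > 0" by simp
      have "T / d < real n" using n n0 by simp
      then have Tn: "T / real n < d" using np d(1) T_pos by (simp add: field_simps)
      have le: "\<bar>S (grid n k) w * ?D n k\<bar> \<le> e / 2" if "k < n" for k
      proof -
        have "grid n (Suc k) - grid n k = T / real n" by (simp add: grid_def algebra_simps add_divide_distrib)
        then have "\<bar>?D n k\<bar> < e / (2 * B)" using grid_in[of k n] grid_in[of "Suc k" n] that Tn T_pos by (intro d(2)) auto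
        then have "\<bar>S (grid n k) w\<bar> * \<bar>?D n k\<bar> \<le> B * (e / (2 * B))"
          using B grid_in[of k n] that by (intro mult_mono) auto
        then show ?thesis using B(1) by (simp add: abs_mult)
      qed
      have "\<bar>(\<Sum>k<n. S (grid n k) w * ?D n k) / real n\<bar> \<le> (\<Sum>k<n. \<bar>S (grid n k) w * ?D n k\<bar>) / real n"
        by (auto intro!: divide_right_mono)
      also have "\<dots> \<le> e / 2" using np by (intro average_le le) auto
      also have "e / 2 < e" using e by simp
      finally show "norm ((\<Sum>k<n. S (grid n k) w * ?D n k) / real n - 0) < e" by simp
    qed
  qed
  moreover have "(\<lambda>n. 1 + r * (T / real n) / 2) \<longlonglongrightarrow> 1 + r * 0 / 2"
    by (intro tendsto_add tendsto_divide tendsto_mult tendsto_const lim_const_over_n) simp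
  ultimately have "(\<lambda>n. riemann n w * (1 + r * (T / real n) / 2) + (\<sigma> / 2) * ((\<Sum>k<n. S (grid n k) w * ?D n k) / real n))
      \<longlonglongrightarrow> avg w * (1 + r * 0 / 2) + (\<sigma> / 2) * 0"
    by (intro tendsto_add[OF tendsto_mult[OF riemann_tendsto[OF w]] tendsto_mult[OF tendsto_const]])
  then show ?thesis unfolding eq by simp
qed

lemma riemann_measurable: "riemann n \<in> borel_measurable M"
  unfolding riemann_def[abs_def]
  by (intro borel_measurable_divide borel_measurable_sum S_measurable grid_in borel_measurable_const) auto

lemma avg_measurable: "avg \<in> borel_measurable M"
  by (rule borel_measurable_LIMSEQ_real[OF riemann_tendsto riemann_measurable])

lemma bounded_moments_riemann: "bounded_moments {1..} riemann"
  unfolding riemann_def[abs_def]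
proof (rule bounded_moments_average)
  have "bounded_moments (Sigma {1..} (\<lambda>n. {..<n})) (\<lambda>p. S (grid (fst p) (snd p)))"
    by (rule bounded_moments_subfamily[OF bounded_moments_S]) (auto intro: grid_nonneg grid_le_T)
  then show "bounded_moments (Sigma {1..} (\<lambda>n. {..<n})) (\<lambda>(n, k). S (grid n k))"
    by (simp add: case_prod_unfold)
qed auto

lemma bounded_moments_trap: "bounded_moments UNIV trap"
proof -
  have "bounded_moments {1..} (\<lambda>n w. (\<Sum>k<n. S (grid n k) w * (1 + r * (T / real n) / 2 + \<sigma> * (W (grid n (Suc k)) w - W (grid n k) w) / 2)) / real n)"
  proof (rule bounded_moments_average)
    let ?A = "Sigma {1..} (\<lambda>n::nat. {..<n})"
    have 1: "bounded_moments ?A (\<lambda>p. S (grid (fst p) (snd p)))"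
      by (rule bounded_moments_subfamily[OF bounded_moments_S]) (auto intro: grid_nonneg grid_le_T)
    have 2: "bounded_moments ?A (\<lambda>p w. W (grid (fst p) (Suc (snd p))) w - W (grid (fst p) (snd p)) w)"
    proof -
      have "bounded_moments ?A (\<lambda>p. (\<lambda>(s, t) w. W t w - W s w) (grid (fst p) (snd p), grid (fst p) (Suc (snd p))))"
        by (rule bounded_moments_subfamily[OF bounded_moments_increment])
           (auto simp: time_pairs_def intro: grid_nonneg grid_le_T grid_mono)
      then show ?thesis by simp
    qed
    have 3: "bounded_moments ?A (\<lambda>p w. r * (T / real (fst p)) / 2)"
    proof (rule bounded_moments_bounded)
      fix p :: "nat \<times> nat" assume "p \<in> ?A"
      then have "1 \<le> fst p" by auto
      then have "T / real (fst p) \<le> T" using T_pos by (simp add: field_simps)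
      then have "\<bar>r\<bar> * (T / real (fst p)) \<le> \<bar>r\<bar> * T" by (intro mult_left_mono) auto
      then show "\<bar>r * (T / real (fst p)) / 2\<bar> \<le> \<bar>r\<bar> * T / 2" using T_pos by (simp add: abs_mult)
    qed simp
    have "bounded_moments ?A (\<lambda>p w. S (grid (fst p) (snd p)) w * (1 + r * (T / real (fst p)) / 2
        + \<sigma> * (W (grid (fst p) (Suc (snd p))) w - W (grid (fst p) (snd p)) w) / 2))"
      by (intro bounded_moments_mult bounded_moments_add bounded_moments_divide bounded_moments_const 1 2 3[unfolded times_divide_eq_right] 3)
    then show "bounded_moments ?A (\<lambda>(n, k) w. S (grid n k) w * (1 + r * (T / real n) / 2 + \<sigma> * (W (grid n (Suc k)) w - W (grid n k) w) / 2))"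
      by (simp add: case_prod_unfold)
  qed auto
  then have 1: "bounded_moments {1..} trap" by (simp add: trap_eq[abs_def])
  have "trap 0 = (\<lambda>w. 0)" by (simp add: trap_eq[abs_def])
  then have "all_moments (trap 0)" using bounded_moments_const by simp
  from bounded_moments_insert[OF 1 this] show ?thesis
    by (rule bounded_moments_subfamily[where g="\<lambda>n. n"]) (auto simp: Suc_le_eq)
qed

lemma trap_measurable: "trap n \<in> borel_measurable M"
  using bounded_moments_measurable[OF bounded_moments_trap] by simp

lemma all_moments_avg: "all_moments avg"
  by (rule all_moments_limit[OF bounded_moments_trap avg_measurable]) (auto intro: trap_tendsto)

text \<open>With \<open>n\<close> fixed the fine Riemann sums converge to the integral in L^4. The
  rate \<open>n^-8\<close> is an arbitrary choice that beats the powers of \<open>n\<close> brought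
  in by the normalisation; \<open>n \<le> N\<close> is what the bounds over one step
  require.\<close>

lemma exists_fine_mesh:
  assumes "1 \<le> n"
  shows "\<exists>N\<ge>n. expectation (\<lambda>w. (riemann (n * N) w - avg w) ^ 4) \<le> 1 / real n ^ 8"
proof -
  \<comment> \<open>\<open>Suc\<close> avoids the empty Riemann sum, since the uniform bounds are
    available from index 1 on.\<close>
  have "bounded_moments UNIV (\<lambda>N. riemann (n * Suc N))"
    by (rule bounded_moments_subfamily[OF bounded_moments_riemann]) (use assms in auto)
  then have b: "bounded_moments UNIV (\<lambda>N w. riemann (n * Suc N) w - avg w)"
    by (intro bounded_moments_diff bounded_moments_subfamily[OF all_moments_avg, where g="\<lambda>_. ()"]) auto
  have "(\<lambda>N. expectation (\<lambda>w. \<bar>riemann (n * Suc N) w - avg w\<bar> ^ 4)) \<longlonglongrightarrow> 0"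
  proof (rule bounded_moments_tendsto[OF b])
    have "filterlim (\<lambda>N. n * Suc N) sequentially sequentially"
      by (rule filterlim_subseq) (use assms in \<open>auto simp: strict_mono_def\<close>)
    then have "(\<lambda>N. riemann (n * Suc N) w - avg w) \<longlonglongrightarrow> avg w - avg w" if "w \<in> space M" for w
      by (intro tendsto_diff tendsto_const filterlim_compose[OF riemann_tendsto[OF that]])
    then show "AE w in M. (\<lambda>N. riemann (n * Suc N) w - avg w) \<longlonglongrightarrow> 0" by simp
  qed simp
  then have "\<forall>\<^sub>F N in sequentially. expectation (\<lambda>w. \<bar>riemann (n * Suc N) w - avg w\<bar> ^ 4) < 1 / real n ^ 8"
    using assms by (intro order_tendstoD) auto
  then have "\<forall>\<^sub>F N in sequentially. expectation (\<lambda>w. \<bar>riemann (n * Suc N) w - avg w\<bar> ^ 4) < 1 / real n ^ 8 \<and> N \<ge> n"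
    by (intro eventually_conj eventually_ge_at_top)
  then obtain N where "N \<ge> n" "expectation (\<lambda>w. \<bar>riemann (n * Suc N) w - avg w\<bar> ^ 4) < 1 / real n ^ 8"
    by (auto simp: eventually_sequentially)
  then show ?thesis by (intro exI[of _ "Suc N"]) auto
qed

definition refinement :: "nat \<Rightarrow> nat" where
  "refinement n = (SOME N. N \<ge> n \<and> expectation (\<lambda>w. (riemann (n * N) w - avg w) ^ 4) \<le> 1 / real n ^ 8)"

lemma refinement:
  assumes "1 \<le> n"
  shows "n \<le> refinement n" "expectation (\<lambda>w. (riemann (n * refinement n) w - avg w) ^ 4) \<le> 1 / real n ^ 8"
proof -
  from exists_fine_mesh[OF assms]
  have "\<exists>N. N \<ge> n \<and> expectation (\<lambda>w. (riemann (n * N) w - avg w) ^ 4) \<le> 1 / real n ^ 8" by blast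
  from someI_ex[OF this] show "n \<le> refinement n" "expectation (\<lambda>w. (riemann (n * refinement n) w - avg w) ^ 4) \<le> 1 / real n ^ 8"
    unfolding refinement_def by auto
qed

section \<open>The normalised error and its leading term\<close>

definition nerr :: "nat \<Rightarrow> 'a \<Rightarrow> real" where
  "nerr n w = real n * (trap n w - avg w)"

lemma nerr_eq:
  assumes "1 \<le> n"
  shows "nerr n w = - err_sum n (refinement n) n w + real n * (riemann (n * refinement n) w - avg w)"
proof -
  have "refinement n > 0" using refinement(1)[OF assms] assms by simp
  from trap_minus_riemann[OF assms this, of w]
  have t: "trap n w = riemann (n * refinement n) w - err_sum n (refinement n) n w / real n" by simp
  show ?thesis using assms unfolding nerr_def t by (simp add: algebra_simps)
qed

lemma all_moments_nerr: "all_moments (nerr n)"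
  unfolding nerr_def[abs_def]
  by (intro bounded_moments_intros all_moments_avg bounded_moments_member[OF bounded_moments_trap]) auto

lemma all_moments_riemann: "1 \<le> n \<Longrightarrow> all_moments (riemann n)"
  by (rule bounded_moments_member[OF bounded_moments_riemann]) auto

lemma nerr_fourth_moment:
  obtains B where "B > 0" "\<And>n. expectation (\<lambda>w. (nerr n w) ^ 4) \<le> B"
proof -
  obtain C where C: "C > 0" "\<And>n N. 1 \<le> n \<Longrightarrow> n \<le> N \<Longrightarrow> expectation (\<lambda>w. (err_sum n N n w) ^ 4) \<le> C"
    using err_sum_fourth_moment by blast
  show thesis
  proof (rule that)
    show "27 * (C + 1) > 0" using C by simp
    fix n
    show "expectation (\<lambda>w. (nerr n w) ^ 4) \<le> 27 * (C + 1)"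
    proof (cases "n = 0")
      case False
      then have n: "1 \<le> n" by simp
      then have f: "refinement n > 0" using refinement(1)[OF n] by simp
      let ?N = "refinement n"
      have I: "integrable M (\<lambda>w. (err_sum n ?N n w) ^ 4)" "integrable M (\<lambda>w. (riemann (n * ?N) w - avg w) ^ 4)"
        "integrable M (\<lambda>w. (nerr n w) ^ 4)"
        using n f by (intro all_moments_integrable bounded_moments_power bounded_moments_diff sums_all_moments(1) all_moments_riemann
            all_moments_avg all_moments_nerr; simp)+
      have "expectation (\<lambda>w. (nerr n w) ^ 4) \<le> expectation (\<lambda>w. 27 * ((err_sum n ?N n w) ^ 4 + real n ^ 4 * (riemann (n * ?N) w - avg w) ^ 4))"
      proof (rule integral_mono)
        fix w
        show "(nerr n w) ^ 4 \<le> 27 * ((err_sum n ?N n w) ^ 4 + real n ^ 4 * (riemann (n * ?N) w - avg w) ^ 4)"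
          unfolding nerr_eq[OF n] using power4_sum3_le[of "- err_sum n ?N n w" "real n * (riemann (n * ?N) w - avg w)" 0]
          by (simp add: power_mult_distrib)
      qed (use I in auto)
      also have "\<dots> = 27 * (expectation (\<lambda>w. (err_sum n ?N n w) ^ 4) + real n ^ 4 * expectation (\<lambda>w. (riemann (n * ?N) w - avg w) ^ 4))"
        using I by simp
      also have "\<dots> \<le> 27 * (C + real n ^ 4 * (1 / real n ^ 8))"
        using C(2)[OF n refinement(1)[OF n]] refinement(2)[OF n] by (intro mult_left_mono add_mono) auto
      also have "real n ^ 4 * (1 / real n ^ 8) \<le> 1"
        using n by (simp add: power_increasing)
      finally show ?thesis by simp
    qed (use C in \<open>simp add: nerr_def\<close>)
  qed
qed

text \<open>\<open>nerr\<close> is \<open>- \<sigma> * bridge_sum\<close> up to a term that vanishes in $L^2$.\<close>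

definition lead :: "nat \<Rightarrow> 'a \<Rightarrow> real" where "lead n w = - \<sigma> * bridge_sum n (refinement n) n w"

lemma all_moments_lead: "all_moments (lead n)"
proof (cases "n = 0")
  case True
  then show ?thesis using bounded_moments_const by (simp add: lead_def[abs_def] bridge_sum_def)
next
  case False
  then have "refinement n > 0" using refinement(1)[of n] by simp
  then show ?thesis unfolding lead_def[abs_def]
    by (intro bounded_moments_intros sums_all_moments) auto
qed

lemma nerr_minus_lead: "(\<lambda>n. expectation (\<lambda>w. (nerr n w - lead n w)\<^sup>2)) \<longlonglongrightarrow> 0"
proof -
  obtain C K where C: "C > 0" "K > 0" "\<And>n N. 1 \<le> n \<Longrightarrow> n \<le> N \<Longrightarrow> expectation (\<lambda>w. (rem_sum n N n w)\<^sup>2) \<le> K * (exp (C / real n) - 1)"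
    using rem_sum_second_moment by blast
  have lim: "(\<lambda>n. 2 * (K * (exp (C / real n) - 1)) + 2 * (1 / real n + 1 / real n)) \<longlonglongrightarrow> 2 * (K * (exp 0 - 1)) + 2 * (0 + 0)"
    by (intro tendsto_add tendsto_diff tendsto_exp tendsto_mult tendsto_const lim_const_over_n)
  have "\<forall>\<^sub>F n in sequentially. norm (expectation (\<lambda>w. (nerr n w - lead n w)\<^sup>2)) \<le> 2 * (K * (exp (C / real n) - 1)) + 2 * (1 / real n + 1 / real n)"
    using eventually_ge_at_top[of 1]
  proof eventually_elim
    case (elim n)
    then have f: "refinement n > 0" using refinement(1)[of n] by simp
    let ?N = "refinement n" and ?R = "\<lambda>w. riemann (n * refinement n) w - avg w"
    have I: "integrable M (\<lambda>w. (rem_sum n ?N n w)\<^sup>2)" "integrable M (\<lambda>w. (?R w)\<^sup>2)" "integrable M (\<lambda>w. (?R w) ^ 4)"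
      "integrable M (\<lambda>w. (nerr n w - lead n w)\<^sup>2)"
      using elim f by (intro all_moments_integrable bounded_moments_power bounded_moments_diff sums_all_moments(2) all_moments_riemann
          all_moments_avg all_moments_nerr all_moments_lead; simp)+
    have sq: "(x + y)\<^sup>2 \<le> 2 * x\<^sup>2 + 2 * y\<^sup>2" for x y :: real
      using zero_le_power2[of "x - y"] by (simp add: power2_eq_square algebra_simps)
    have e: "nerr n w - lead n w = - rem_sum n ?N n w + real n * ?R w" for w
      unfolding nerr_eq[OF elim] err_sum_split lead_def by simp
    have "expectation (\<lambda>w. (nerr n w - lead n w)\<^sup>2) \<le> expectation (\<lambda>w. 2 * (rem_sum n ?N n w)\<^sup>2 + 2 * ((real n)\<^sup>2 * (?R w)\<^sup>2))"
    proof (rule integral_mono)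
      fix w
      show "(nerr n w - lead n w)\<^sup>2 \<le> 2 * (rem_sum n ?N n w)\<^sup>2 + 2 * ((real n)\<^sup>2 * (?R w)\<^sup>2)"
        unfolding e using sq[of "- rem_sum n ?N n w" "real n * ?R w"] by (simp add: power_mult_distrib)
    qed (use I in auto)
    also have "\<dots> = 2 * expectation (\<lambda>w. (rem_sum n ?N n w)\<^sup>2) + 2 * ((real n)\<^sup>2 * expectation (\<lambda>w. (?R w)\<^sup>2))"
      using I by simp
    also have "(real n)\<^sup>2 * expectation (\<lambda>w. (?R w)\<^sup>2) \<le> 1 / real n + 1 / real n"
    proof -
      have np: "real n > 0" using elim by simp
      \<comment> \<open>Young's inequality with weights chosen so that the second moment of the
        Riemann sum error is estimated by its fourth, the one that \<open>refinement\<close>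
        controls.\<close>
      have le: "n\<^sup>2 * y\<^sup>2 \<le> 1 / n + n ^ 5 * y ^ 4" if "n > 0" for n y :: real
      proof -
        have "n\<^sup>2 * y\<^sup>2 = (n\<^sup>2 * y\<^sup>2 * sqrt n) / sqrt n" using that by simp
        have "(1 / sqrt n) * (n\<^sup>2 * sqrt n * y\<^sup>2) \<le> (1 / sqrt n)\<^sup>2 + (n\<^sup>2 * sqrt n * y\<^sup>2)\<^sup>2"
          using abs_mult_le_squares[of "1 / sqrt n" "n\<^sup>2 * sqrt n * y\<^sup>2"] that by (simp add: abs_le_iff)
        also have "\<dots> = 1 / n + n ^ 5 * y ^ 4"
          using that by (simp add: power_divide power_mult_distrib flip: power_mult) (simp add: eval_nat_numeral)
        finally show ?thesis using that by simp
      qed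
      have "expectation (\<lambda>w. (real n)\<^sup>2 * (?R w)\<^sup>2) \<le> expectation (\<lambda>w. 1 / real n + real n ^ 5 * (?R w) ^ 4)"
        using I np by (intro integral_mono le) auto
      also have "\<dots> = 1 / real n + real n ^ 5 * expectation (\<lambda>w. (?R w) ^ 4)"
        using I by (simp add: prob_space)
      also have "\<dots> \<le> 1 / real n + real n ^ 5 * (1 / real n ^ 8)"
        using refinement(2)[OF elim] by (intro add_left_mono mult_left_mono) auto
      also have "real n ^ 5 * (1 / real n ^ 8) = 1 / real n ^ 3" using np by (simp add: eval_nat_numeral field_simps)
      also have "\<dots> \<le> 1 / real n" using elim self_le_power[of "real n" 3] by (intro divide_left_mono) auto
      finally show ?thesis using I by simp
    qed
    finally show ?case using C(3)[OF elim refinement(1)[OF elim]] by simp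
  qed
  from Lim_null_comparison[OF this] lim show ?thesis by simp
qed

end

section \<open>Exchangeability of the increments\<close>

context brownian
begin

lemma fine_incr_measurable: "i < K \<Longrightarrow> fine_incr K i \<in> borel_measurable M"
  by (intro all_moments_measurable all_moments_fine_incr)

text \<open>The filtration gives independence of one increment from the past. Joint independence
  follows by peeling off the latest increment, and for this the induction also records that the
  event formed so far is known at the current grid time.\<close>

lemma indep_fine_incr:
  assumes K: "K > 0"
  shows "indep_vars (\<lambda>_. borel) (fine_incr K) {..<K}"
proof -
  define E where "E i = {fine_incr K i -` A \<inter> space M | A. A \<in> sets borel}" for i
  have claim: "\<Inter> (A ` J) \<inter> space M \<in> sets (F (grid K m)) \<and> prob (\<Inter> (A ` J) \<inter> space M) = (\<Prod>j\<in>J. prob (A j))"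
    if "m \<le> K" "J \<subseteq> {..<m}" "\<forall>j\<in>J. A j \<in> E j" for m J A
    using that
  proof (induction m arbitrary: J)
    case 0
    have "space M \<in> sets (F (grid K 0))" using sets.top[of "F (grid K 0)"] space_F[OF grid_in[of 0 K]] by simp
    then show ?case using 0 by (simp add: prob_space)
  next
    case (Suc m)
    have mK: "m < K" using Suc by simp
    have t: "0 \<le> grid K m" "grid K m < grid K (Suc m)" "grid K (Suc m) \<le> T"
    proof -
      show "grid K (Suc m) \<le> T" using mK by (intro grid_le_T) simp
      have "grid K (Suc m) = grid K m + T / real K" by (simp add: grid_def distrib_right add_divide_distrib)
      then show "grid K m < grid K (Suc m)" using K T_pos by simp
    qed (rule grid_nonneg)
    have sub: "sets (F (grid K m)) \<subseteq> sets (F (grid K (Suc m)))"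
      using basis t unfolding stochastic_basis_def subalgebra_def by auto
    show ?case
    proof (cases "m \<in> J")
      case False
      then have "J \<subseteq> {..<m}" using Suc.prems(2) by (auto simp: less_Suc_eq)
      then show ?thesis using Suc.IH[of J] Suc.prems sub by auto
    next
      case True
      define J' where "J' = J - {m}"
      have J': "J' \<subseteq> {..<m}" "J = insert m J'" "m \<notin> J'" using Suc.prems(2) True by (auto simp: J'_def less_Suc_eq)
      then have fin: "finite J'" using finite_subset by blast
      have IH: "\<Inter> (A ` J') \<inter> space M \<in> sets (F (grid K m))" "prob (\<Inter> (A ` J') \<inter> space M) = (\<Prod>j\<in>J'. prob (A j))"
        using Suc.IH[OF _ J'(1)] Suc.prems J' by auto
      have Am: "A m \<in> E m" using Suc.prems True by auto
      then have Am': "A m \<subseteq> space M" by (auto simp: E_def)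
      have eq: "\<Inter> (A ` J) \<inter> space M = (\<Inter> (A ` J') \<inter> space M) \<inter> A m"
        unfolding J'(2) using Am' by auto
      have "prob ((\<Inter> (A ` J') \<inter> space M) \<inter> A m) = prob (\<Inter> (A ` J') \<inter> space M) * prob (A m)"
        by (rule indep_setD[OF increment_indep_set[OF t] IH(1)]) (use Am in \<open>auto simp: E_def fine_incr_def\<close>)
      moreover have "A m \<in> sets (F (grid K (Suc m)))"
      proof -
        from Am obtain B where B: "B \<in> sets borel" "A m = fine_incr K m -` B \<inter> space M" by (auto simp: E_def)
        have "fine_incr K m \<in> borel_measurable (F (grid K (Suc m)))" using mK by (intro fine_incr_measurable_F) auto
        from measurable_sets[OF this B(1)] show ?thesis using B(2) space_F[OF grid_in[of "Suc m" K]] mK by simp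
      qed
      ultimately show ?thesis unfolding eq using IH sub J'(2,3) fin by auto
    qed
  qed
  have "indep_sets E {..<K}"
  proof (rule indep_setsI)
    fix i assume "i \<in> {..<K}"
    then show "E i \<subseteq> events" unfolding E_def using fine_incr_measurable[of i K] by (auto intro: measurable_sets)
  next
    fix A J assume J: "J \<noteq> {}" "J \<subseteq> {..<K}" "finite J" "\<forall>j\<in>J. A j \<in> E j"
    then have "A j \<subseteq> space M" if "j \<in> J" for j using that by (auto simp: E_def)
    then have "\<Inter> (A ` J) \<inter> space M = \<Inter> (A ` J)" using J(1) by blast
    then show "prob (\<Inter> (A ` J)) = (\<Prod>j\<in>J. prob (A j))" using claim[OF order_refl J(2,4)] by simp
  qed
  then show ?thesis unfolding indep_vars_def2 E_def using fine_incr_measurable by auto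
qed

text \<open>Increments over equal lengths are independent and identically distributed, so their
  joint law is a power of one measure, which a permutation of the coordinates preserves.\<close>

lemma fine_incr_exchangeable:
  fixes \<Phi> :: "(nat \<Rightarrow> real) \<Rightarrow> real"
  assumes \<Phi>[measurable]: "\<Phi> \<in> borel_measurable (Pi\<^sub>M {..<K} (\<lambda>_. borel))"
    and \<pi>: "inj_on \<pi> {..<K}" "\<pi> \<in> {..<K} \<rightarrow> {..<K}" and K: "K > 0"
  shows "expectation (\<lambda>w. \<Phi> (\<lambda>i\<in>{..<K}. fine_incr K i w)) = expectation (\<lambda>w. \<Phi> (\<lambda>i\<in>{..<K}. fine_incr K (\<pi> i) w))"
proof -
  define D where "D = distr std_normal_distribution borel (\<lambda>z. sqrt (T / real K) * z)"
  define Q where "Q = Pi\<^sub>M {..<K} (\<lambda>_. D)"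
  have D: "distr M borel (fine_incr K i) = D" if "i < K" for i
  proof -
    have t: "0 \<le> grid K i" "grid K i \<le> grid K (Suc i)" "grid K (Suc i) \<le> T"
      using that by (auto intro: grid_nonneg grid_mono grid_le_T)
    have "grid K (Suc i) - grid K i = T / real K" by (simp add: grid_def distrib_right add_divide_distrib)
    then show ?thesis using increment_distr[OF t] unfolding fine_incr_def[abs_def] D_def by simp
  qed
  have [measurable]: "fine_incr K i \<in> borel_measurable M" if "i < K" for i using that by (rule fine_incr_measurable)
  interpret D: prob_space D unfolding D_def by (intro std_normal.prob_space_distr) simp
  have setsQ[measurable_cong]: "sets Q = sets (Pi\<^sub>M {..<K} (\<lambda>_. borel))"
    unfolding Q_def by (intro sets_PiM_cong) (auto simp: D_def)
  have X: "distr M (Pi\<^sub>M {..<K} (\<lambda>_. borel)) (\<lambda>w. \<lambda>i\<in>{..<K}. fine_incr K i w) = Q"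
  proof -
    have "distr M (Pi\<^sub>M {..<K} (\<lambda>_. borel)) (\<lambda>w. \<lambda>i\<in>{..<K}. fine_incr K i w) = Pi\<^sub>M {..<K} (\<lambda>i. distr M borel (fine_incr K i))"
      using indep_fine_incr[OF K] K by (subst (asm) indep_vars_iff_distr_eq_PiM') (auto intro: fine_incr_measurable)
    also have "\<dots> = Q" unfolding Q_def by (intro PiM_cong) (auto simp: D)
    finally show ?thesis .
  qed
  have Xm: "(\<lambda>w. \<lambda>i\<in>{..<K}. fine_incr K i w) \<in> measurable M (Pi\<^sub>M {..<K} (\<lambda>_. borel))"
    by (intro measurable_restrict) auto
  have \<pi>K: "\<pi> i < K" if "i < K" for i using \<pi>(2) that by auto
  have re: "distr Q Q (\<lambda>x. \<lambda>i\<in>{..<K}. x (\<pi> i)) = Q"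
    unfolding Q_def by (rule distr_PiM_reindex[where M="\<lambda>_. D"]) (use \<pi> in \<open>auto intro: D.prob_space_axioms\<close>)
  have rm: "(\<lambda>x. \<lambda>i\<in>{..<K}. x (\<pi> i)) \<in> measurable Q Q"
    unfolding Q_def using \<pi>K by (intro measurable_restrict measurable_component_singleton) auto
  have \<Phi>Q: "\<Phi> \<in> borel_measurable Q" by measurable
  have "expectation (\<lambda>w. \<Phi> (\<lambda>i\<in>{..<K}. fine_incr K i w)) = integral\<^sup>L Q \<Phi>"
    unfolding X[symmetric] by (rule integral_distr[OF Xm \<Phi>, symmetric])
  also have "\<dots> = integral\<^sup>L (distr Q Q (\<lambda>x. \<lambda>i\<in>{..<K}. x (\<pi> i))) \<Phi>" by (simp only: re)
  also have "\<dots> = integral\<^sup>L Q (\<lambda>x. \<Phi> (\<lambda>i\<in>{..<K}. x (\<pi> i)))" by (rule integral_distr[OF rm \<Phi>Q])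
  also have "\<dots> = expectation (\<lambda>w. \<Phi> (\<lambda>i\<in>{..<K}. (\<lambda>i\<in>{..<K}. fine_incr K i w) (\<pi> i)))"
    unfolding X[symmetric]
    by (rule integral_distr[OF Xm]) (use measurable_compose[OF rm \<Phi>Q] in \<open>simp add: measurable_cong_sets[OF setsQ refl]\<close>)
  also have "\<dots> = expectation (\<lambda>w. \<Phi> (\<lambda>i\<in>{..<K}. fine_incr K (\<pi> i) w))"
    using \<pi>K by (intro Bochner_Integration.integral_cong refl arg_cong[where f=\<Phi>] ext) auto
  finally show ?thesis .
qed

end

section \<open>Reversal of one block as a permutation of the fine increments\<close>

definition block_reversal :: "nat \<Rightarrow> nat \<Rightarrow> nat \<Rightarrow> nat" where
  "block_reversal N k i = (if k * N \<le> i \<and> i < k * N + N then k * N + (N - 1 - (i - k * N)) else i)"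

lemma block_reversal_invol: "block_reversal N k (block_reversal N k i) = i"
  by (auto simp: block_reversal_def)

lemma inj_block_reversal: "inj_on (block_reversal N k) A"
  by (metis block_reversal_invol inj_onI)

lemma block_reversal_in_block: "block_reversal N k (l * N + j) = (if l = k then k * N + (N - 1 - j) else l * N + j)" if "j < N"
proof (cases "l = k")
  case False
  then have "Suc l \<le> k \<or> Suc k \<le> l" by auto
  then have "Suc l * N \<le> k * N \<or> Suc k * N \<le> l * N" by (metis mult_le_mono1)
  then show ?thesis using that False by (auto simp: block_reversal_def)
qed (use that in \<open>simp add: block_reversal_def\<close>)

lemma block_reversal_less: "i < m * N \<Longrightarrow> block_reversal N k i < m * N"
proof (cases "k * N \<le> i \<and> i < k * N + N")
  case True
  assume "i < m * N"
  then have "k * N < m * N" using True by linarith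
  then have "k < m" by simp
  then have "Suc k * N \<le> m * N" by (intro mult_le_mono1) simp
  then show ?thesis using True by (auto simp: block_reversal_def)
qed (auto simp: block_reversal_def)

lemma sum_block_reversal:
  fixes x :: "nat \<Rightarrow> real"
  shows "(\<Sum>i<m * N. x (block_reversal N k i)) = (\<Sum>i<m * N. x i)"
  by (rule sum.reindex_bij_witness[of _ "block_reversal N k" "block_reversal N k"])
     (auto simp: block_reversal_invol block_reversal_less)

lemma sum_block_reversal_single:
  fixes x :: "nat \<Rightarrow> real"
  shows "(\<Sum>j<N. x (block_reversal N k (l * N + j))) = (\<Sum>j<N. x (l * N + j))"
proof (cases "l = k")
  case True
  have "(\<Sum>j<N. x (block_reversal N k (l * N + j))) = (\<Sum>j<N. x (k * N + (N - Suc j)))"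
    by (intro sum.cong) (auto simp: block_reversal_in_block True)
  also have "\<dots> = (\<Sum>j<N. x (k * N + j))" by (rule sum.nat_diff_reindex)
  finally show ?thesis using True by simp
qed (simp add: block_reversal_in_block)

text \<open>Reflecting the block changes the sign of every weight \<open>bridge_coeff\<close>, and
  the other blocks are left alone.\<close>

lemma bridge_sum_block_reversal:
  fixes x :: "nat \<Rightarrow> real"
  shows "(\<Sum>j<N. bridge_coeff N j * x (block_reversal N k (l * N + j)))
    = (if l = k then - 1 else 1) * (\<Sum>j<N. bridge_coeff N j * x (l * N + j))"
proof (cases "l = k")
  case True
  have c: "bridge_coeff N j = - bridge_coeff N (N - Suc j)" if "j < N" for j
  proof -
    have r: "real (N - Suc j) = real N - 1 - real j" using that by (simp add: of_nat_diff)
    show ?thesis unfolding bridge_coeff_def r minus_divide_left by (rule arg_cong2[where f="(/)"]) simp_all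
  qed
  have "(\<Sum>j<N. bridge_coeff N j * x (block_reversal N k (l * N + j))) = (\<Sum>j<N. - (bridge_coeff N (N - Suc j) * x (k * N + (N - Suc j))))"
  proof (intro sum.cong refl)
    fix j assume "j \<in> {..<N}"
    then have j: "j < N" by simp
    have "block_reversal N k (l * N + j) = k * N + (N - Suc j)" using block_reversal_in_block[OF j, of k l] True by simp
    then show "bridge_coeff N j * x (block_reversal N k (l * N + j)) = - (bridge_coeff N (N - Suc j) * x (k * N + (N - Suc j)))"
      using c[OF j] by simp
  qed
  also have "\<dots> = (\<Sum>j<N. - (bridge_coeff N j * x (k * N + j)))"
    by (rule sum.nat_diff_reindex)
  finally show ?thesis using True by (simp add: sum_negf)
qed (simp add: block_reversal_in_block)

section \<open>Path functionals of the increments and their behaviour under reversal\<close>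

context black_scholes
begin

text \<open>Price, scheme and bridge are rewritten as functions of the vector of fine increments, on
  which a permutation can act. The sum of the first \<open>l * N\<close> entries stands for the
  Brownian path at a coarse node.\<close>

definition path_S :: "nat \<Rightarrow> nat \<Rightarrow> nat \<Rightarrow> (nat \<Rightarrow> real) \<Rightarrow> real" where
  "path_S n N l x = S0 * exp (drift * grid n l + \<sigma> * (\<Sum>i<l * N. x i))"

definition path_trap :: "nat \<Rightarrow> nat \<Rightarrow> (nat \<Rightarrow> real) \<Rightarrow> real" where
  "path_trap n N x = (\<Sum>l<n. path_S n N l x * (1 + r * (T / real n) / 2 + \<sigma> * (\<Sum>j<N. x (l * N + j)) / 2)) / real n"

definition path_bridge :: "nat \<Rightarrow> nat \<Rightarrow> (nat \<Rightarrow> real) \<Rightarrow> real" where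
  "path_bridge N l x = (\<Sum>j<N. bridge_coeff N j * x (l * N + j))"

lemma path_reversal:
  "path_S n N l (\<lambda>i. x (block_reversal N k i)) = path_S n N l x"
  "path_trap n N (\<lambda>i. x (block_reversal N k i)) = path_trap n N x"
  "path_bridge N l (\<lambda>i. x (block_reversal N k i)) = (if l = k then - 1 else 1) * path_bridge N l x"
  unfolding path_S_def path_trap_def path_bridge_def
  by (simp_all only: sum_block_reversal sum_block_reversal_single bridge_sum_block_reversal)

text \<open>The functionals read only the first \<open>n * N\<close> coordinates. This allows
  passing between a vector and its restriction, which is what lives in the product space.\<close>

lemma path_cong:
  assumes "\<And>i. i < n * N \<Longrightarrow> x i = y i"
  shows "l \<le> n \<Longrightarrow> path_S n N l x = path_S n N l y" "path_trap n N x = path_trap n N y"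
    "l < n \<Longrightarrow> path_bridge N l x = path_bridge N l y"
proof -
  have S: "path_S n N l x = path_S n N l y" if "l \<le> n" for l
  proof -
    have "(\<Sum>i<l * N. x i) = (\<Sum>i<l * N. y i)"
      by (intro sum.cong refl assms) (use less_le_trans[OF _ mult_le_mono1[OF that, of N]] in simp)
    then show ?thesis by (simp add: path_S_def)
  qed
  then show "l \<le> n \<Longrightarrow> path_S n N l x = path_S n N l y" .
  have b: "x (l * N + j) = y (l * N + j)" if "l < n" "j < N" for l j
    using block_index[of l n "Suc j" N] that by (intro assms) auto
  then show "l < n \<Longrightarrow> path_bridge N l x = path_bridge N l y" by (simp add: path_bridge_def)
  show "path_trap n N x = path_trap n N y" using S b by (simp add: path_trap_def)
qed

lemma path_measurable:
  shows "l \<le> n \<Longrightarrow> path_S n N l \<in> borel_measurable (Pi\<^sub>M {..<n * N} (\<lambda>_. borel))"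
    "path_trap n N \<in> borel_measurable (Pi\<^sub>M {..<n * N} (\<lambda>_. borel))"
    "l < n \<Longrightarrow> path_bridge N l \<in> borel_measurable (Pi\<^sub>M {..<n * N} (\<lambda>_. borel))"
proof -
  let ?P = "Pi\<^sub>M {..<n * N} (\<lambda>_. borel :: real measure)"
  have S: "path_S n N l \<in> borel_measurable ?P" if "l \<le> n" for l
  proof -
    have "(\<lambda>x. x i) \<in> borel_measurable ?P" if "i < l * N" for i
      using less_le_trans[OF that mult_le_mono1[OF \<open>l \<le> n\<close>, of N]] by (intro measurable_component_singleton) (simp only: lessThan_iff)
    then have [measurable]: "(\<lambda>x. \<Sum>i<l * N. x i) \<in> borel_measurable ?P" by (intro borel_measurable_sum) auto
    show ?thesis unfolding path_S_def[abs_def] by measurable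
  qed
  then show "l \<le> n \<Longrightarrow> path_S n N l \<in> borel_measurable ?P" .
  have c: "(\<lambda>x. x (l * N + j)) \<in> borel_measurable ?P" if "l < n" "j < N" for l j
    using block_index[of l n "Suc j" N] that by (intro measurable_component_singleton) simp
  then show "l < n \<Longrightarrow> path_bridge N l \<in> borel_measurable ?P"
    unfolding path_bridge_def[abs_def] by (intro borel_measurable_sum borel_measurable_times borel_measurable_const) auto
  show "path_trap n N \<in> borel_measurable ?P"
    unfolding path_trap_def[abs_def] using S c
    by (intro borel_measurable_divide borel_measurable_sum borel_measurable_times borel_measurable_add borel_measurable_const) auto
qed

text \<open>The increments sum up to \<open>W\<close> only where the path starts at 0, hence the
  identities hold almost everywhere.\<close>

lemma path_of_increments:
  assumes n: "1 \<le> n" "N > 0"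
  shows "AE w in M. (\<forall>l\<le>n. path_S n N l (\<lambda>i\<in>{..<n * N}. fine_incr (n * N) i w) = S (grid n l) w) \<and>
    path_trap n N (\<lambda>i\<in>{..<n * N}. fine_incr (n * N) i w) = trap n w \<and>
    (\<forall>l<n. path_bridge N l (\<lambda>i\<in>{..<n * N}. fine_incr (n * N) i w) = bridge n N l w)"
  using W_zero
proof eventually_elim
  case (elim w)
  let ?x = "\<lambda>i. fine_incr (n * N) i w"
  have W: "(\<Sum>i<m. ?x i) = W (grid (n * N) m) w" for m
    using elim by (induction m) (auto simp: fine_incr_def grid_0)
  have S: "path_S n N l ?x = S (grid n l) w" for l
    unfolding path_S_def W grid_refine[OF n(2)] by (simp add: asset_price_def drift_def)
  have B: "(\<Sum>j<N. ?x (l * N + j)) = W (grid n (Suc l)) w - W (grid n l) w" for l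
    using block_incr_sum[OF n(2), of n l N w] grid_refine[OF n(2), of n "Suc l"]
    unfolding block_incr_def by (simp add: add.commute)
  have t: "path_trap n N ?x = trap n w" unfolding path_trap_def S B trap_eq ..
  have b: "path_bridge N l ?x = bridge n N l w" for l
    unfolding path_bridge_def bridge_eq_sum[OF n(2)] ..
  have c: "(\<lambda>i\<in>{..<n * N}. ?x i) i = ?x i" if "i < n * N" for i using that by simp
  note pc = path_cong[where x="\<lambda>i\<in>{..<n * N}. ?x i" and y="?x" and n=n and N=N, OF c]
  show ?case
    using pc(1) pc(2) pc(3) unfolding S t b by blast
qed

text \<open>Reversing block \<open>k\<close> preserves the joint law of the increments and every quantity that depends
  on the coarse grid only, but changes the sign of \<open>bridge n N k\<close>.\<close>

lemma grid_bridge_uncorrelated: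
  assumes n: "1 \<le> n" "N > 0" and k: "k < n" and j: "j < n"
    and h[measurable]: "h \<in> borel_measurable borel"
  shows "expectation (\<lambda>w. h (S T w, trap n w) * (S (grid n k) w * bridge n N k w)) = 0"
    and "j \<noteq> k \<Longrightarrow> expectation (\<lambda>w. h (S T w, trap n w) * ((S (grid n j) w * bridge n N j w) * (S (grid n k) w * bridge n N k w))) = 0"
proof -
  let ?X = "\<lambda>w. \<lambda>i\<in>{..<n * N}. fine_incr (n * N) i w"
  let ?P = "Pi\<^sub>M {..<n * N} (\<lambda>_. borel :: real measure)"
  note [measurable] = path_measurable(1)[OF order_refl[of n], of N] path_measurable(1)[OF less_imp_le[OF k], of N]
    path_measurable(1)[OF less_imp_le[OF j], of N] path_measurable(2)[of n N] path_measurable(3)[OF k, of N] path_measurable(3)[OF j, of N]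
  have K: "n * N > 0" using n by simp
  have anti: "expectation (\<lambda>w. \<Phi> (?X w)) = 0"
    if [measurable]: "\<Phi> \<in> borel_measurable ?P" and a: "\<And>x. \<Phi> (\<lambda>i\<in>{..<n * N}. x (block_reversal N k i)) = - \<Phi> (\<lambda>i\<in>{..<n * N}. x i)" for \<Phi> :: "(nat \<Rightarrow> real) \<Rightarrow> real"
  proof -
    have "expectation (\<lambda>w. \<Phi> (?X w)) = expectation (\<lambda>w. \<Phi> (\<lambda>i\<in>{..<n * N}. fine_incr (n * N) (block_reversal N k i) w))"
      by (rule fine_incr_exchangeable[where \<Phi>=\<Phi> and \<pi>="block_reversal N k"]) (use K in \<open>auto intro: inj_block_reversal block_reversal_less\<close>)
    also have "\<dots> = - expectation (\<lambda>w. \<Phi> (?X w))" 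
      unfolding a[of "\<lambda>i. fine_incr (n * N) i w" for w] by simp
    finally show ?thesis by simp
  qed
  have c: "path_S n N l (\<lambda>i\<in>{..<n * N}. x i) = path_S n N l x" if "l \<le> n" for l x
    by (rule path_cong(1)) (use that in auto)
  have c2: "path_trap n N (\<lambda>i\<in>{..<n * N}. x i) = path_trap n N x" for x by (rule path_cong(2)) auto
  have c3: "path_bridge N l (\<lambda>i\<in>{..<n * N}. x i) = path_bridge N l x" if "l < n" for l x
    by (rule path_cong(3)) (use that in auto)
  have Tn: "grid n n = T" using n by (simp add: grid_n)
  have [measurable]: "S T \<in> borel_measurable M" "trap n \<in> borel_measurable M" "S (grid n k) \<in> borel_measurable M"
    "S (grid n j) \<in> borel_measurable M" "bridge n N k \<in> borel_measurable M" "bridge n N j \<in> borel_measurable M"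
    using k j n(2) T_pos
    by (simp_all add: S_measurable trap_measurable grid_nonneg grid_le_T all_moments_measurable all_moments_bridge)
  have "expectation (\<lambda>w. h (S T w, trap n w) * (S (grid n k) w * bridge n N k w))
    = expectation (\<lambda>w. (\<lambda>x. h (path_S n N n x, path_trap n N x) * (path_S n N k x * path_bridge N k x)) (?X w))"
  proof (rule integral_cong_AE)
    have [measurable]: "?X \<in> measurable M ?P" by (intro measurable_restrict fine_incr_measurable) auto
    show "(\<lambda>w. (\<lambda>x. h (path_S n N n x, path_trap n N x) * (path_S n N k x * path_bridge N k x)) (?X w)) \<in> borel_measurable M"
      by (rule measurable_compose[of ?X M ?P]) measurable
    show "(\<lambda>w. h (S T w, trap n w) * (S (grid n k) w * bridge n N k w)) \<in> borel_measurable M"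
      by measurable
    show "AE w in M. h (S T w, trap n w) * (S (grid n k) w * bridge n N k w) =
      (\<lambda>x. h (path_S n N n x, path_trap n N x) * (path_S n N k x * path_bridge N k x)) (?X w)"
      using path_of_increments[OF n] by eventually_elim (use k Tn in auto)
  qed
  also have "\<dots> = 0"
  proof (rule anti)
    show "(\<lambda>x. h (path_S n N n x, path_trap n N x) * (path_S n N k x * path_bridge N k x)) \<in> borel_measurable ?P" by measurable
  qed (unfold c[OF order_refl] c[OF less_imp_le[OF k]] c2 c3[OF k] path_reversal, simp)
  finally show "expectation (\<lambda>w. h (S T w, trap n w) * (S (grid n k) w * bridge n N k w)) = 0" .
  \<comment> \<open>For \<open>j \<noteq> k\<close> the reversal of block \<open>k\<close> flips
    exactly one of the two bridges. The diagonal terms are even and survive as the quadratic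
    variation.\<close>
  assume jk: "j \<noteq> k"
  have "expectation (\<lambda>w. h (S T w, trap n w) * ((S (grid n j) w * bridge n N j w) * (S (grid n k) w * bridge n N k w)))
    = expectation (\<lambda>w. (\<lambda>x. h (path_S n N n x, path_trap n N x) * ((path_S n N j x * path_bridge N j x) * (path_S n N k x * path_bridge N k x))) (?X w))"
  proof (rule integral_cong_AE)
    have [measurable]: "?X \<in> measurable M ?P" by (intro measurable_restrict fine_incr_measurable) auto
    show "(\<lambda>w. (\<lambda>x. h (path_S n N n x, path_trap n N x) * ((path_S n N j x * path_bridge N j x) * (path_S n N k x * path_bridge N k x))) (?X w)) \<in> borel_measurable M"
      by (rule measurable_compose[of ?X M ?P]) measurable
    show "(\<lambda>w. h (S T w, trap n w) * ((S (grid n j) w * bridge n N j w) * (S (grid n k) w * bridge n N k w))) \<in> borel_measurable M"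
      by measurable
    show "AE w in M. h (S T w, trap n w) * ((S (grid n j) w * bridge n N j w) * (S (grid n k) w * bridge n N k w)) =
      (\<lambda>x. h (path_S n N n x, path_trap n N x) * ((path_S n N j x * path_bridge N j x) * (path_S n N k x * path_bridge N k x))) (?X w)"
      using path_of_increments[OF n] by eventually_elim (use k j Tn in auto)
  qed
  also have "\<dots> = 0"
  proof (rule anti)
    show "(\<lambda>x. h (path_S n N n x, path_trap n N x) * ((path_S n N j x * path_bridge N j x) * (path_S n N k x * path_bridge N k x))) \<in> borel_measurable ?P"
      by measurable
  qed (unfold c[OF order_refl] c[OF less_imp_le[OF k]] c[OF less_imp_le[OF j]] c2 c3[OF k] c3[OF j] path_reversal, simp add: jk)
  finally show "expectation (\<lambda>w. h (S T w, trap n w) * ((S (grid n j) w * bridge n N j w) * (S (grid n k) w * bridge n N k w))) = 0" .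
qed

section \<open>Limits of weighted moments of the normalised error\<close>

text \<open>The conditional variance of \<open>chi\<close> given the path of \<open>W\<close>: 1/12
  is the square of \<open>1 / (2 * sqrt 3)\<close>.\<close>

definition limit_var :: "'a \<Rightarrow> real" where
  "limit_var w = \<sigma>\<^sup>2 / 12 * (LINT u:{0..T}|lborel. (S u w)\<^sup>2)"

definition square_avg :: "nat \<Rightarrow> 'a \<Rightarrow> real" where
  "square_avg n w = (\<Sum>k<n. (S (grid n k) w)\<^sup>2) / real n"

lemma bounded_moments_square_avg: "bounded_moments UNIV square_avg"
proof -
  have "bounded_moments {1..} square_avg"
    unfolding square_avg_def[abs_def]
  proof (rule bounded_moments_average)
    have "bounded_moments (Sigma {1..} (\<lambda>n. {..<n})) (\<lambda>p w. (S (grid (fst p) (snd p)) w)\<^sup>2)"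
      by (intro bounded_moments_power bounded_moments_subfamily[OF bounded_moments_S]) (auto intro: grid_nonneg grid_le_T)
    then show "bounded_moments (Sigma {1..} (\<lambda>n. {..<n})) (\<lambda>(n, k) w. (S (grid n k) w)\<^sup>2)"
      by (simp add: case_prod_unfold)
  qed auto
  moreover have "square_avg 0 = (\<lambda>w. 0)" by (simp add: square_avg_def[abs_def])
  then have "all_moments (square_avg 0)" using bounded_moments_const by simp
  ultimately have "bounded_moments (insert 0 {1..}) square_avg" by (rule bounded_moments_insert)
  then show ?thesis by (rule bounded_moments_subfamily[where g="\<lambda>n. n"]) (auto simp: Suc_le_eq)
qed

lemma square_avg_tendsto: "w \<in> space M \<Longrightarrow> (\<lambda>n. square_avg n w) \<longlonglongrightarrow> (1 / T) * (LINT u:{0..T}|lborel. (S u w)\<^sup>2)"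
  using riemann_square_tendsto unfolding square_avg_def .

lemma all_moments_square_integral: "all_moments (\<lambda>w. LINT u:{0..T}|lborel. (S u w)\<^sup>2)"
proof -
  have m: "(\<lambda>w. (1 / T) * (LINT u:{0..T}|lborel. (S u w)\<^sup>2)) \<in> borel_measurable M"
    by (rule borel_measurable_LIMSEQ_real[OF square_avg_tendsto]) (use bounded_moments_measurable[OF bounded_moments_square_avg] in auto)
  have "all_moments (\<lambda>w. (1 / T) * (LINT u:{0..T}|lborel. (S u w)\<^sup>2))"
    by (rule all_moments_limit[OF bounded_moments_square_avg m]) (intro AE_I2 square_avg_tendsto)
  then have "all_moments (\<lambda>w. T * ((1 / T) * (LINT u:{0..T}|lborel. (S u w)\<^sup>2)))"
    by (rule bounded_moments_mult[OF bounded_moments_const])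
  moreover have "T * ((1 / T) * x) = x" for x using T_pos by simp
  ultimately show ?thesis by (simp only:)
qed

lemma all_moments_limit_var: "all_moments limit_var"
  unfolding limit_var_def[abs_def] by (intro bounded_moments_mult bounded_moments_const all_moments_square_integral)

text \<open>Since \<open>n \<le> refinement n\<close>, the correction factor
  \<open>1 - 1 / N^2\<close> in the variance of the discrete bridge tends to 1.\<close>

lemma scaled_bridge_var_tendsto: "(\<lambda>n. real n * bridge_var n (refinement n)) \<longlonglongrightarrow> T / 12"
proof -
  have "(\<lambda>n. T / 12 * (1 - 1 / (real (refinement n))\<^sup>2)) \<longlonglongrightarrow> T / 12 * (1 - 0)"
  proof (intro tendsto_mult tendsto_diff tendsto_const)
    have "\<forall>\<^sub>F n in sequentially. norm (1 / (real (refinement n))\<^sup>2) \<le> 1 / real n"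
      using eventually_ge_at_top[of 1]
    proof eventually_elim
      case (elim n)
      then have "real n \<le> real (refinement n)" "1 \<le> real (refinement n)" using refinement(1)[OF elim] by auto
      then have "real n * 1 \<le> real (refinement n) * real (refinement n)" by (intro mult_mono) auto
      then show ?case using elim by (simp add: power2_eq_square frac_le)
    qed
    from Lim_null_comparison[OF this] show "(\<lambda>n. 1 / (real (refinement n))\<^sup>2) \<longlonglongrightarrow> 0"
      by (simp add: lim_1_over_n)
  qed
  then have "(\<lambda>n. T / 12 * (1 - 1 / (real (refinement n))\<^sup>2)) \<longlonglongrightarrow> T / 12" by simp
  moreover have "\<forall>\<^sub>F n in sequentially. T / 12 * (1 - 1 / (real (refinement n))\<^sup>2) = real n * bridge_var n (refinement n)"
    using eventually_ge_at_top[of 1]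
  proof eventually_elim
    case (elim n)
    then have "real (refinement n) > 0" "real n > 0" using refinement(1)[OF elim] by auto
    then show ?case by (simp add: bridge_var_def field_simps)
  qed
  ultimately show ?thesis by (rule Lim_transform_eventually)
qed

lemma nerr_second_moment:
  obtains B where "B > 0" "\<And>n. expectation (\<lambda>w. (nerr n w)\<^sup>2) \<le> B"
proof -
  obtain B where B: "B > 0" "\<And>n. expectation (\<lambda>w. (nerr n w) ^ 4) \<le> B" using nerr_fourth_moment by blast
  have I: "integrable M (\<lambda>w. (nerr n w)\<^sup>2)" "integrable M (\<lambda>w. (nerr n w) ^ 4)" for n
    by (intro all_moments_integrable bounded_moments_power all_moments_nerr)+
  have le: "x\<^sup>2 \<le> 1 + x ^ 4" for x :: real
    using abs_mult_le_squares[of 1 "x\<^sup>2"] by (simp flip: power_mult)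
  have "expectation (\<lambda>w. (nerr n w)\<^sup>2) \<le> B + 1" for n
  proof -
    have "expectation (\<lambda>w. (nerr n w)\<^sup>2) \<le> expectation (\<lambda>w. 1 + (nerr n w) ^ 4)"
      by (intro integral_mono le) (use I in auto)
    also have "\<dots> = 1 + expectation (\<lambda>w. (nerr n w) ^ 4)" using I by (simp add: prob_space)
    finally show ?thesis using B(2)[of n] by simp
  qed
  then show thesis using that[of "B + 1"] B(1) by simp
qed

text \<open>Both identities are exact for fixed \<open>n\<close>, because the weight depends on the
  coarse grid only, through \<open>S T\<close> and \<open>trap n\<close>. In the second one the
  off-diagonal products vanish, and the diagonal is split into the martingale \<open>qv_err\<close>
  and its compensator.\<close>

lemma lead_test_functions:
  assumes n: "1 \<le> n" and h[measurable]: "h \<in> borel_measurable borel" and h1: "\<And>z. \<bar>h z\<bar> \<le> (1::real)"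
  shows "expectation (\<lambda>w. h (S T w, trap n w) * lead n w) = 0"
    and "expectation (\<lambda>w. h (S T w, trap n w) * (lead n w)\<^sup>2) = \<sigma>\<^sup>2 * (expectation (\<lambda>w. h (S T w, trap n w) * qv_err n (refinement n) n w)
       + expectation (\<lambda>w. h (S T w, trap n w) * ((real n * bridge_var n (refinement n)) * square_avg n w)))"
proof -
  let ?N = "refinement n" and ?h = "\<lambda>w. h (S T w, trap n w)"
  have N: "?N > 0" using refinement(1)[OF n] n by simp
  have [measurable]: "S T \<in> borel_measurable M" "trap n \<in> borel_measurable M"
    using T_pos by (auto intro: S_measurable trap_measurable)
  have hm: "all_moments ?h" by (rule bounded_moments_bounded[of _ _ 1]) (use h1 in auto)
  let ?Y = "\<lambda>k w. S (grid n k) w * bridge n ?N k w"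
  have Y: "all_moments (?Y k)" if "k < n" for k
    using that by (intro bounded_moments_mult all_moments_S_grid all_moments_bridge N) auto
  have iY: "integrable M (\<lambda>w. ?h w * ?Y k w)" if "k < n" for k
    by (intro all_moments_integrable bounded_moments_mult[OF hm] Y that)
  have iYY: "integrable M (\<lambda>w. ?h w * (?Y j w * ?Y k w))" if "j < n" "k < n" for j k
    by (intro all_moments_integrable bounded_moments_mult[OF hm] bounded_moments_mult[OF Y Y] that)
  have "expectation (\<lambda>w. ?h w * lead n w) = expectation (\<lambda>w. - \<sigma> * (\<Sum>k<n. ?h w * ?Y k w))"
    by (intro Bochner_Integration.integral_cong) (auto simp: lead_def bridge_sum_def sum_distrib_left mult_ac)
  also have "\<dots> = - \<sigma> * (\<Sum>k<n. expectation (\<lambda>w. ?h w * ?Y k w))"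
    using iY by (simp add: Bochner_Integration.integral_sum)
  also have "(\<Sum>k<n. expectation (\<lambda>w. ?h w * ?Y k w)) = 0"
    using grid_bridge_uncorrelated(1)[OF n N _ _ h] by (intro sum.neutral) auto
  finally show "expectation (\<lambda>w. ?h w * lead n w) = 0" by simp
  have "expectation (\<lambda>w. ?h w * (lead n w)\<^sup>2) = expectation (\<lambda>w. \<sigma>\<^sup>2 * (\<Sum>j<n. \<Sum>k<n. ?h w * (?Y j w * ?Y k w)))"
  proof (intro Bochner_Integration.integral_cong refl)
    fix w
    have "(lead n w)\<^sup>2 = \<sigma>\<^sup>2 * ((\<Sum>j<n. ?Y j w) * (\<Sum>k<n. ?Y k w))"
      by (simp add: lead_def bridge_sum_def power2_eq_square)
    then show "?h w * (lead n w)\<^sup>2 = \<sigma>\<^sup>2 * (\<Sum>j<n. \<Sum>k<n. ?h w * (?Y j w * ?Y k w))"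
      unfolding sum_product by (simp add: sum_distrib_left mult.left_commute)
  qed
  also have "\<dots> = \<sigma>\<^sup>2 * (\<Sum>j<n. \<Sum>k<n. expectation (\<lambda>w. ?h w * (?Y j w * ?Y k w)))"
  proof -
    have "expectation (\<lambda>w. \<Sum>j<n. \<Sum>k<n. ?h w * (?Y j w * ?Y k w)) = (\<Sum>j<n. expectation (\<lambda>w. \<Sum>k<n. ?h w * (?Y j w * ?Y k w)))"
      by (intro Bochner_Integration.integral_sum Bochner_Integration.integrable_sum iYY) auto
    also have "\<dots> = (\<Sum>j<n. \<Sum>k<n. expectation (\<lambda>w. ?h w * (?Y j w * ?Y k w)))"
      by (intro sum.cong refl Bochner_Integration.integral_sum iYY) auto
    finally show ?thesis by simp
  qed
  also have "(\<Sum>j<n. \<Sum>k<n. expectation (\<lambda>w. ?h w * (?Y j w * ?Y k w))) = (\<Sum>j<n. expectation (\<lambda>w. ?h w * (?Y j w * ?Y j w)))"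
  proof (intro sum.cong refl)
    fix j assume "j \<in> {..<n}"
    then have j: "j < n" by simp
    have "(\<Sum>k<n. expectation (\<lambda>w. ?h w * (?Y j w * ?Y k w))) = (\<Sum>k<n. if k = j then expectation (\<lambda>w. ?h w * (?Y j w * ?Y j w)) else 0)"
      using grid_bridge_uncorrelated(2)[OF n N _ j h] by (intro sum.cong) auto
    also have "\<dots> = expectation (\<lambda>w. ?h w * (?Y j w * ?Y j w))" using j by simp
    finally show "(\<Sum>k<n. expectation (\<lambda>w. ?h w * (?Y j w * ?Y k w))) = expectation (\<lambda>w. ?h w * (?Y j w * ?Y j w))" .
  qed
  also have "\<dots> = expectation (\<lambda>w. \<Sum>j<n. ?h w * (?Y j w * ?Y j w))"
    by (intro Bochner_Integration.integral_sum[symmetric] iYY) auto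
  also have "\<dots> = expectation (\<lambda>w. ?h w * qv_err n ?N n w + ?h w * ((real n * bridge_var n ?N) * square_avg n w))"
  proof (intro Bochner_Integration.integral_cong refl)
    fix w
    have "(\<Sum>j<n. ?Y j w * ?Y j w) = qv_err n ?N n w + bridge_var n ?N * (\<Sum>j<n. (S (grid n j) w)\<^sup>2)"
      unfolding qv_err_def sum_distrib_left sum.distrib[symmetric]
      by (intro sum.cong) (auto simp: power2_eq_square algebra_simps)
    also have "bridge_var n ?N * (\<Sum>j<n. (S (grid n j) w)\<^sup>2) = (real n * bridge_var n ?N) * square_avg n w"
      using n by (simp add: square_avg_def)
    finally show "(\<Sum>j<n. ?h w * (?Y j w * ?Y j w)) = ?h w * qv_err n ?N n w + ?h w * ((real n * bridge_var n ?N) * square_avg n w)"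
      unfolding sum_distrib_left[symmetric] by (simp add: distrib_left)
  qed
  also have "\<dots> = expectation (\<lambda>w. ?h w * qv_err n ?N n w) + expectation (\<lambda>w. ?h w * ((real n * bridge_var n ?N) * square_avg n w))"
  proof (rule Bochner_Integration.integral_add)
    show "integrable M (\<lambda>w. ?h w * qv_err n ?N n w)"
      by (intro all_moments_integrable bounded_moments_mult[OF hm] sums_all_moments N) simp
    show "integrable M (\<lambda>w. ?h w * ((real n * bridge_var n ?N) * square_avg n w))"
      by (intro all_moments_integrable bounded_moments_mult[OF hm] bounded_moments_mult[OF bounded_moments_const]
          bounded_moments_member[OF bounded_moments_square_avg]) simp
  qed
  finally show "expectation (\<lambda>w. ?h w * (lead n w)\<^sup>2) = \<sigma>\<^sup>2 * (expectation (\<lambda>w. ?h w * qv_err n ?N n w)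
       + expectation (\<lambda>w. ?h w * ((real n * bridge_var n ?N) * square_avg n w)))" .
qed

text \<open>The exact identities concern weights in \<open>S T\<close> and \<open>trap n\<close> and
  the variable \<open>lead n\<close>. Three replacements lead from there to the claim: continuity
  moves the argument of the weight from \<open>trap n\<close> to \<open>avg\<close>, closeness in
  L^2 exchanges \<open>lead\<close> for \<open>nerr\<close>, and the compensator is exchanged for
  its limit.\<close>

lemma nerr_test_functions:
  assumes hc: "continuous_on UNIV h" and h1: "\<And>z. \<bar>h z\<bar> \<le> (1::real)"
  shows "(\<lambda>n. expectation (\<lambda>w. h (S T w, avg w) * nerr n w)) \<longlonglongrightarrow> 0"
    and "(\<lambda>n. expectation (\<lambda>w. h (S T w, avg w) * ((nerr n w)\<^sup>2 - limit_var w))) \<longlonglongrightarrow> 0"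
proof -
  have h[measurable]: "h \<in> borel_measurable borel" by (rule borel_measurable_continuous_onI[OF hc])
  have [measurable]: "S T \<in> borel_measurable M" "trap n \<in> borel_measurable M" "avg \<in> borel_measurable M"
    "nerr n \<in> borel_measurable M" "lead n \<in> borel_measurable M" "limit_var \<in> borel_measurable M" for n
    using T_pos by (auto intro: S_measurable trap_measurable avg_measurable all_moments_measurable all_moments_nerr all_moments_lead all_moments_limit_var)
  let ?h = "\<lambda>w. h (S T w, avg w)" and ?hn = "\<lambda>n w. h (S T w, trap n w)"
  have hlim: "(\<lambda>n. ?hn n w) \<longlonglongrightarrow> ?h w" if "w \<in> space M" for w
    by (rule continuous_on_tendsto_compose[OF hc]) (auto intro!: tendsto_Pair trap_tendsto that)
  have bm_hn: "bounded_moments UNIV ?hn" by (rule bounded_moments_bounded[of _ _ 1]) (use h1 in auto)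
  have am_h: "all_moments ?h" by (rule bounded_moments_bounded[of _ _ 1]) (use h1 in auto)
  have am_hn: "all_moments (?hn n)" for n by (rule bounded_moments_member[OF bm_hn]) simp
  obtain B2 where B2: "B2 > 0" "\<And>n. expectation (\<lambda>w. (nerr n w)\<^sup>2) \<le> B2" using nerr_second_moment by blast
  obtain B4 where B4: "B4 > 0" "\<And>n. expectation (\<lambda>w. (nerr n w) ^ 4) \<le> B4" using nerr_fourth_moment by blast
  define D where "D n w = ?h w - ?hn n w" for n w
  have [measurable]: "D n \<in> borel_measurable M" for n unfolding D_def[abs_def] by measurable
  have amD: "all_moments (D n)" for n unfolding D_def[abs_def] by (intro bounded_moments_diff am_h am_hn)
  have Dlim: "(\<lambda>n. expectation (\<lambda>w. (D n w)\<^sup>2)) \<longlonglongrightarrow> 0"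
  proof -
    have "bounded_moments UNIV D"
      unfolding D_def[abs_def]
      by (intro bounded_moments_diff bm_hn bounded_moments_subfamily[OF am_h, where g="\<lambda>_. ()"]) auto
    moreover have "(\<lambda>n. D n w) \<longlonglongrightarrow> 0" if "w \<in> space M" for w
      unfolding D_def using tendsto_diff[OF tendsto_const hlim[OF that], of "?h w"] by simp
    ultimately have "(\<lambda>n. expectation (\<lambda>w. \<bar>D n w\<bar> ^ 2)) \<longlonglongrightarrow> 0" by (intro bounded_moments_tendsto) auto
    then show ?thesis by simp
  qed
  note am = all_moments_nerr all_moments_lead all_moments_limit_var am_h am_hn amD
  define R where "R n w = nerr n w - lead n w" for n w
  have [measurable]: "R n \<in> borel_measurable M" for n unfolding R_def[abs_def] by measurable
  have amR: "all_moments (R n)" for n unfolding R_def[abs_def] by (intro bounded_moments_diff am)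
  have Rlim: "(\<lambda>n. expectation (\<lambda>w. (R n w)\<^sup>2)) \<longlonglongrightarrow> 0" using nerr_minus_lead unfolding R_def .
  have t1: "(\<lambda>n. expectation (\<lambda>w. D n w * nerr n w)) \<longlonglongrightarrow> 0"
    by (rule tendsto_expectation_mult(2)[where B=B2]) (auto intro!: all_moments_integrable bounded_moments_power am Dlim B2)
  have hn2: "expectation (\<lambda>w. (?hn n w)\<^sup>2) \<le> 1" for n
  proof -
    have "expectation (\<lambda>w. (?hn n w)\<^sup>2) \<le> expectation (\<lambda>w. 1)"
      by (intro integral_mono all_moments_integrable bounded_moments_power bounded_moments_const am) (use h1 in \<open>auto simp: abs_square_le_1\<close>)
    then show ?thesis by (simp add: prob_space)
  qed
  have t2: "(\<lambda>n. expectation (\<lambda>w. R n w * ?hn n w)) \<longlonglongrightarrow> 0"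
    by (rule tendsto_expectation_mult(2)[where B=1]) (auto intro!: all_moments_integrable bounded_moments_power am amR Rlim hn2)
  have t3: "(\<lambda>n. expectation (\<lambda>w. ?hn n w * lead n w)) \<longlonglongrightarrow> 0"
    by (rule tendsto_eventually, rule eventually_mono[OF eventually_ge_at_top[of 1]]) (rule lead_test_functions(1)[OF _ h h1])
  have "expectation (\<lambda>w. ?h w * nerr n w) = expectation (\<lambda>w. D n w * nerr n w) + expectation (\<lambda>w. R n w * ?hn n w) + expectation (\<lambda>w. ?hn n w * lead n w)" for n
  proof -
    have "expectation (\<lambda>w. ?h w * nerr n w) = expectation (\<lambda>w. D n w * nerr n w + R n w * ?hn n w + ?hn n w * lead n w)"
      by (intro Bochner_Integration.integral_cong) (auto simp: D_def R_def algebra_simps)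
    also have "\<dots> = expectation (\<lambda>w. D n w * nerr n w) + expectation (\<lambda>w. R n w * ?hn n w) + expectation (\<lambda>w. ?hn n w * lead n w)"
      by (subst Bochner_Integration.integral_add | intro Bochner_Integration.integrable_add all_moments_integrable bounded_moments_mult am amR)+ simp
    finally show ?thesis .
  qed
  with tendsto_add[OF tendsto_add[OF t1 t2] t3] show "(\<lambda>n. expectation (\<lambda>w. ?h w * nerr n w)) \<longlonglongrightarrow> 0" by simp

  have u1: "(\<lambda>n. expectation (\<lambda>w. D n w * (nerr n w)\<^sup>2)) \<longlonglongrightarrow> 0"
  proof (rule tendsto_expectation_mult(2)[where B=B4])
    show "expectation (\<lambda>w. ((nerr n w)\<^sup>2)\<^sup>2) \<le> B4" for n using B4(2)[of n] by (simp flip: power_mult)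
  qed (auto intro!: all_moments_integrable bounded_moments_power am Dlim)
  \<comment> \<open>\<open>2 * nerr - R\<close> is \<open>nerr + lead\<close>: the difference of the
    squares of \<open>nerr\<close> and \<open>lead\<close> is factored, so that the vanishing
    \<open>R\<close> meets a factor bounded in L^2.\<close>
  define Q where "Q n w = ?hn n w * (2 * nerr n w - R n w)" for n w
  have [measurable]: "Q n \<in> borel_measurable M" for n unfolding Q_def[abs_def] by measurable
  have amQ: "all_moments (Q n)" for n unfolding Q_def[abs_def] by (intro bounded_moments_mult bounded_moments_diff bounded_moments_const am amR)
  obtain BR where BR: "\<And>n. expectation (\<lambda>w. (R n w)\<^sup>2) \<le> BR"
    using convergent_imp_bounded[OF Rlim] by (auto simp: bounded_iff intro: order_trans[OF abs_ge_self])
  have u2: "(\<lambda>n. expectation (\<lambda>w. R n w * Q n w)) \<longlonglongrightarrow> 0"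
  proof (rule tendsto_expectation_mult(2)[where B="8 * B2 + 2 * BR"])
    fix n
    have le: "(a * (2 * x - y))\<^sup>2 \<le> 8 * x\<^sup>2 + 2 * y\<^sup>2" if "\<bar>a\<bar> \<le> 1" for a x y :: real
    proof -
      have "(a * (2 * x - y))\<^sup>2 \<le> 1 * (2 * x - y)\<^sup>2"
        unfolding power_mult_distrib using that by (intro mult_right_mono) (auto simp: abs_square_le_1)
      also have "\<dots> \<le> 8 * x\<^sup>2 + 2 * y\<^sup>2"
        using zero_le_power2[of "2 * x + y"] by (simp add: power2_eq_square algebra_simps)
      finally show ?thesis .
    qed
    have I: "integrable M (\<lambda>w. (nerr n w)\<^sup>2)" "integrable M (\<lambda>w. (R n w)\<^sup>2)" "integrable M (\<lambda>w. (Q n w)\<^sup>2)"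
      by (intro all_moments_integrable bounded_moments_power am amR amQ)+
    have "expectation (\<lambda>w. (Q n w)\<^sup>2) \<le> expectation (\<lambda>w. 8 * (nerr n w)\<^sup>2 + 2 * (R n w)\<^sup>2)"
      unfolding Q_def by (intro integral_mono le h1 I(3)[unfolded Q_def]) (use I in auto)
    also have "\<dots> = 8 * expectation (\<lambda>w. (nerr n w)\<^sup>2) + 2 * expectation (\<lambda>w. (R n w)\<^sup>2)" using I by simp
    also have "\<dots> \<le> 8 * B2 + 2 * BR" using B2(2)[of n] BR[of n] by simp
    finally show "expectation (\<lambda>w. (Q n w)\<^sup>2) \<le> 8 * B2 + 2 * BR" .
  qed (auto intro!: all_moments_integrable bounded_moments_power amR amQ Rlim)
  let ?v = "\<lambda>n. real n * bridge_var n (refinement n)"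
  have u3: "(\<lambda>n. expectation (\<lambda>w. ?hn n w * (lead n w)\<^sup>2) - expectation (\<lambda>w. ?h w * limit_var w)) \<longlonglongrightarrow> 0"
  proof -
    obtain C where C: "C > 0" "\<And>n N. 1 \<le> n \<Longrightarrow> n \<le> N \<Longrightarrow> expectation (\<lambda>w. (qv_err n N n w)\<^sup>2) \<le> C / real n"
      using qv_err_second_moment by blast
    \<comment> \<open>The value 0 at \<open>n = 0\<close> gives a sequence with all moments for
      every index, while \<open>refinement\<close> is controlled from \<open>n = 1\<close>
      on.\<close>
    define q where "q n w = (if n = 0 then 0 else qv_err n (refinement n) n w)" for n w
    have amq: "all_moments (q n)" for n
    proof (cases "n = 0")
      case False
      then have "refinement n > 0" using refinement(1)[of n] by simp
      then show ?thesis using False sums_all_moments(4)[of n n "refinement n"] unfolding q_def[abs_def] by simp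
    qed (use bounded_moments_const in \<open>simp add: q_def[abs_def]\<close>)
    have "(\<lambda>n. expectation (\<lambda>w. (q n w)\<^sup>2)) \<longlonglongrightarrow> 0"
    proof (rule Lim_null_comparison)
      show "\<forall>\<^sub>F n in sequentially. norm (expectation (\<lambda>w. (q n w)\<^sup>2)) \<le> C / real n"
        using eventually_ge_at_top[of 1]
        by eventually_elim (use C(2) refinement(1) in \<open>auto simp: q_def\<close>)
    qed (rule lim_const_over_n)
    then have "(\<lambda>n. expectation (\<lambda>w. q n w * ?hn n w)) \<longlonglongrightarrow> 0"
      by (intro tendsto_expectation_mult(2)[where B=1])
         (auto intro!: all_moments_integrable bounded_moments_power am amq hn2 all_moments_measurable)
    then have q0: "(\<lambda>n. expectation (\<lambda>w. ?hn n w * q n w)) \<longlonglongrightarrow> 0" by (simp add: mult.commute)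
    define I where "I w = (1 / T) * (LINT u:{0..T}|lborel. (S u w)\<^sup>2)" for w
    have amI: "all_moments I" unfolding I_def[abs_def] by (intro bounded_moments_mult bounded_moments_const all_moments_square_integral)
    have amsq: "all_moments (square_avg n)" for n by (rule bounded_moments_member[OF bounded_moments_square_avg]) simp
    have "(\<lambda>n. expectation (\<lambda>w. \<bar>?hn n w * (?v n * square_avg n w) - ?h w * (T / 12 * I w)\<bar> ^ 1)) \<longlonglongrightarrow> 0"
    proof (rule bounded_moments_tendsto)
      obtain bv where bv: "\<And>n. \<bar>?v n\<bar> \<le> bv"
        using convergent_imp_bounded[OF scaled_bridge_var_tendsto] by (auto simp: bounded_iff)
      have bmv: "bounded_moments UNIV (\<lambda>n w. ?v n)" by (rule bounded_moments_bounded[of _ _ bv]) (use bv in auto)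
      have bmh: "bounded_moments UNIV (\<lambda>n. ?h)" by (rule bounded_moments_subfamily[OF am_h, where g="\<lambda>_. ()"]) auto
      have bmI: "bounded_moments UNIV (\<lambda>n. I)" by (rule bounded_moments_subfamily[OF amI, where g="\<lambda>_. ()"]) auto
      show "bounded_moments UNIV (\<lambda>n w. ?hn n w * (?v n * square_avg n w) - ?h w * (T / 12 * I w))"
        by (rule bounded_moments_diff[OF bounded_moments_mult[OF bm_hn bounded_moments_mult[OF bmv bounded_moments_square_avg]]
              bounded_moments_mult[OF bmh bounded_moments_mult[OF bounded_moments_const bmI]]])
      have "(\<lambda>n. ?hn n w * (?v n * square_avg n w) - ?h w * (T / 12 * I w)) \<longlonglongrightarrow> ?h w * (T / 12 * I w) - ?h w * (T / 12 * I w)" if "w \<in> space M" for w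
        unfolding I_def by (intro tendsto_diff tendsto_mult hlim that scaled_bridge_var_tendsto square_avg_tendsto tendsto_const)
      then show "AE w in M. (\<lambda>n. ?hn n w * (?v n * square_avg n w) - ?h w * (T / 12 * I w)) \<longlonglongrightarrow> 0" by simp
    qed simp
    then have "(\<lambda>n. expectation (\<lambda>w. ?hn n w * (?v n * square_avg n w) - ?h w * (T / 12 * I w))) \<longlonglongrightarrow> 0"
    proof (rule Lim_null_comparison[rotated], intro always_eventually allI)
      fix n
      show "norm (expectation (\<lambda>w. ?hn n w * (?v n * square_avg n w) - ?h w * (T / 12 * I w)))
          \<le> expectation (\<lambda>w. \<bar>?hn n w * (?v n * square_avg n w) - ?h w * (T / 12 * I w)\<bar> ^ 1)"
        unfolding power_one_right real_norm_def by (rule integral_abs_bound)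
    qed
    moreover have "expectation (\<lambda>w. ?hn n w * (?v n * square_avg n w) - ?h w * (T / 12 * I w))
       = expectation (\<lambda>w. ?hn n w * (?v n * square_avg n w)) - expectation (\<lambda>w. ?h w * (T / 12 * I w))" for n
      by (intro Bochner_Integration.integral_diff all_moments_integrable bounded_moments_mult bounded_moments_const am amsq amI)
    ultimately have s0: "(\<lambda>n. expectation (\<lambda>w. ?hn n w * (?v n * square_avg n w)) - expectation (\<lambda>w. ?h w * (T / 12 * I w))) \<longlonglongrightarrow> 0" by simp
    have lv: "\<sigma>\<^sup>2 * expectation (\<lambda>w. ?h w * (T / 12 * I w)) = expectation (\<lambda>w. ?h w * limit_var w)"
      unfolding integral_mult_right_zero[symmetric]
      by (intro Bochner_Integration.integral_cong) (use T_pos in \<open>auto simp: I_def limit_var_def\<close>)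
    have "(\<lambda>n. \<sigma>\<^sup>2 * (expectation (\<lambda>w. ?hn n w * q n w) + (expectation (\<lambda>w. ?hn n w * (?v n * square_avg n w)) - expectation (\<lambda>w. ?h w * (T / 12 * I w))))) \<longlonglongrightarrow> \<sigma>\<^sup>2 * (0 + 0)"
      by (intro tendsto_mult tendsto_add tendsto_const q0 s0)
    then have lim: "(\<lambda>n. \<sigma>\<^sup>2 * (expectation (\<lambda>w. ?hn n w * q n w) + (expectation (\<lambda>w. ?hn n w * (?v n * square_avg n w)) - expectation (\<lambda>w. ?h w * (T / 12 * I w))))) \<longlonglongrightarrow> 0" by simp
    show ?thesis
    proof (rule Lim_transform_eventually[OF lim], rule eventually_mono[OF eventually_ge_at_top[of 1]])
      fix n :: nat assume n: "1 \<le> n"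
      then have "q n = qv_err n (refinement n) n" by (auto simp: q_def)
      then show "\<sigma>\<^sup>2 * (expectation (\<lambda>w. ?hn n w * q n w) + (expectation (\<lambda>w. ?hn n w * (?v n * square_avg n w)) - expectation (\<lambda>w. ?h w * (T / 12 * I w))))
        = expectation (\<lambda>w. ?hn n w * (lead n w)\<^sup>2) - expectation (\<lambda>w. ?h w * limit_var w)"
        unfolding lead_test_functions(2)[OF n h h1] lv[symmetric] by (simp add: algebra_simps)
    qed
  qed
  have "expectation (\<lambda>w. ?h w * ((nerr n w)\<^sup>2 - limit_var w)) = expectation (\<lambda>w. D n w * (nerr n w)\<^sup>2)
      + expectation (\<lambda>w. R n w * Q n w) + (expectation (\<lambda>w. ?hn n w * (lead n w)\<^sup>2) - expectation (\<lambda>w. ?h w * limit_var w))" for n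
  proof -
    have I: "integrable M (\<lambda>w. D n w * (nerr n w)\<^sup>2)" "integrable M (\<lambda>w. R n w * Q n w)" "integrable M (\<lambda>w. ?hn n w * (lead n w)\<^sup>2)"
      "integrable M (\<lambda>w. ?h w * limit_var w)"
      by (intro all_moments_integrable bounded_moments_mult bounded_moments_power am amR amQ)+
    have "expectation (\<lambda>w. ?h w * ((nerr n w)\<^sup>2 - limit_var w)) = expectation (\<lambda>w. D n w * (nerr n w)\<^sup>2 + R n w * Q n w + (?hn n w * (lead n w)\<^sup>2 - ?h w * limit_var w))"
      by (intro Bochner_Integration.integral_cong) (auto simp: D_def R_def Q_def power2_eq_square algebra_simps)
    then show ?thesis using I by simp
  qed
  with tendsto_add[OF tendsto_add[OF u1 u2] u3] show "(\<lambda>n. expectation (\<lambda>w. ?h w * ((nerr n w)\<^sup>2 - limit_var w))) \<longlonglongrightarrow> 0" by simp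
qed

text \<open>This replaces the stable convergence of \<open>nerr\<close> in the proof: only first and second
  moments weighted by functions of \<open>(S T, avg)\<close> are needed.\<close>

proposition nerr_weighted_moments:
  fixes h :: "real \<times> real \<Rightarrow> real"
  assumes h[measurable]: "h \<in> borel_measurable borel" and h2: "integrable M (\<lambda>w. (h (S T w, avg w))\<^sup>2)"
  shows "(\<lambda>n. expectation (\<lambda>w. h (S T w, avg w) * nerr n w)) \<longlonglongrightarrow> 0"
    and "(\<lambda>n. expectation (\<lambda>w. h (S T w, avg w) * (nerr n w)\<^sup>2)) \<longlonglongrightarrow> expectation (\<lambda>w. h (S T w, avg w) * limit_var w)"
proof -
  have [measurable]: "S T \<in> borel_measurable M" "avg \<in> borel_measurable M" "nerr n \<in> borel_measurable M" "limit_var \<in> borel_measurable M" for n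
    using T_pos by (auto intro: S_measurable avg_measurable all_moments_measurable all_moments_nerr all_moments_limit_var)
  obtain B2 where B2: "\<And>n. expectation (\<lambda>w. (nerr n w)\<^sup>2) \<le> B2" using nerr_second_moment by blast
  obtain B4 where B4: "\<And>n. expectation (\<lambda>w. (nerr n w) ^ 4) \<le> B4" using nerr_fourth_moment by blast
  show "(\<lambda>n. expectation (\<lambda>w. h (S T w, avg w) * nerr n w)) \<longlonglongrightarrow> 0"
    by (rule weak_L2_tendsto[where Z="\<lambda>w. (S T w, avg w)" and B=B2])
       (auto intro!: all_moments_integrable bounded_moments_power all_moments_nerr B2 nerr_test_functions h h2)
  \<comment> \<open>The squared error minus its limit is itself bounded in L^2, by the fourth moment
    of \<open>nerr\<close>; weak convergence to 0 of this sequence is the second claim.\<close>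
  define U where "U n w = (nerr n w)\<^sup>2 - limit_var w" for n w
  have amU: "all_moments (U n)" for n
    unfolding U_def[abs_def] by (intro bounded_moments_diff bounded_moments_power all_moments_nerr all_moments_limit_var)
  have "(\<lambda>n. expectation (\<lambda>w. h (S T w, avg w) * U n w)) \<longlonglongrightarrow> 0"
  proof (rule weak_L2_tendsto[where Z="\<lambda>w. (S T w, avg w)" and B="2 * B4 + 2 * expectation (\<lambda>w. (limit_var w)\<^sup>2)"])
    fix n
    have I: "integrable M (\<lambda>w. (nerr n w) ^ 4)" "integrable M (\<lambda>w. (limit_var w)\<^sup>2)"
      by (intro all_moments_integrable bounded_moments_power all_moments_nerr all_moments_limit_var)+
    show I2: "integrable M (\<lambda>w. (U n w)\<^sup>2)" by (intro all_moments_integrable bounded_moments_power amU)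
    have le: "(x\<^sup>2 - y)\<^sup>2 \<le> 2 * x ^ 4 + 2 * y\<^sup>2" for x y :: real
      using zero_le_power2[of "x\<^sup>2 + y"] by (simp add: power2_eq_square power4_eq_xxxx algebra_simps)
    have "expectation (\<lambda>w. (U n w)\<^sup>2) \<le> expectation (\<lambda>w. 2 * (nerr n w) ^ 4 + 2 * (limit_var w)\<^sup>2)"
      by (rule integral_mono[OF I2]) (use I le in \<open>auto simp: U_def\<close>)
    also have "\<dots> = 2 * expectation (\<lambda>w. (nerr n w) ^ 4) + 2 * expectation (\<lambda>w. (limit_var w)\<^sup>2)" using I by simp
    finally show "expectation (\<lambda>w. (U n w)\<^sup>2) \<le> 2 * B4 + 2 * expectation (\<lambda>w. (limit_var w)\<^sup>2)" using B4[of n] by simp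
  qed (auto simp: U_def[abs_def] intro!: nerr_test_functions h h2)
  moreover have "expectation (\<lambda>w. h (S T w, avg w) * U n w) = expectation (\<lambda>w. h (S T w, avg w) * (nerr n w)\<^sup>2) - expectation (\<lambda>w. h (S T w, avg w) * limit_var w)" for n
  proof -
    have "integrable M (\<lambda>w. ((nerr n w)\<^sup>2)\<^sup>2)" "integrable M (\<lambda>w. (limit_var w)\<^sup>2)"
      by (intro all_moments_integrable bounded_moments_power all_moments_nerr all_moments_limit_var)+
    then have "integrable M (\<lambda>w. h (S T w, avg w) * (nerr n w)\<^sup>2)" "integrable M (\<lambda>w. h (S T w, avg w) * limit_var w)"
      by (intro integrable_mult_of_squares h2; measurable)+
    then show ?thesis by (simp add: U_def right_diff_distrib)
  qed
  ultimately have "(\<lambda>n. expectation (\<lambda>w. h (S T w, avg w) * (nerr n w)\<^sup>2) - expectation (\<lambda>w. h (S T w, avg w) * limit_var w)) \<longlonglongrightarrow> 0" by simp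
  then show "(\<lambda>n. expectation (\<lambda>w. h (S T w, avg w) * (nerr n w)\<^sup>2)) \<longlonglongrightarrow> expectation (\<lambda>w. h (S T w, avg w) * limit_var w)"
    by (rule LIM_zero_cancel)
qed

end

section \<open>The Ito isometry for step integrands\<close>

context brownian
begin

lemma step_integral_square_integrable:
  assumes st: "0 \<le> s" "s \<le> t" "t \<le> T" and \<xi>: "\<xi> \<in> borel_measurable (F s)" "integrable M (\<lambda>w. (\<xi> w)\<^sup>2)"
  shows "integrable M (\<lambda>w. (\<xi> w * (W t w - W s w))\<^sup>2)"
  using increment_product_square(1)[OF st, of "\<lambda>w. (\<xi> w)\<^sup>2"] \<xi> by (simp add: power_mult_distrib)

text \<open>The increment from \<open>s\<close> to \<open>t\<close> is cut at \<open>a\<close>. Its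
  part before \<open>a\<close> is known at time \<open>a\<close>, so the centred increment from
  \<open>a\<close> to \<open>b\<close> cancels it. Of the rest only the common stretch from
  \<open>a\<close> to \<open>min t b\<close> contributes, the remainder being centred and
  independent of it.\<close>

lemma step_covariance_aux:
  assumes st: "0 \<le> s" "s \<le> t" "t \<le> T" and ab: "s \<le> a" "a \<le> b" "b \<le> T"
    and \<xi>: "\<xi> \<in> borel_measurable (F s)" "integrable M (\<lambda>w. (\<xi> w)\<^sup>2)"
    and \<eta>: "\<eta> \<in> borel_measurable (F a)" "integrable M (\<lambda>w. (\<eta> w)\<^sup>2)"
  shows "expectation (\<lambda>w. (\<xi> w * (W t w - W s w)) * (\<eta> w * (W b w - W a w))) = expectation (\<lambda>w. \<xi> w * \<eta> w) * max 0 (min t b - a)"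
proof -
  have a: "0 \<le> a" "a \<le> T" using st ab by auto
  have meas: "\<xi> \<in> borel_measurable M" "\<eta> \<in> borel_measurable M"
    by (rule measurable_F_M[OF \<xi>(1)], use st in simp, rule measurable_F_M[OF \<eta>(1)], use a in simp)
  have \<xi>a: "\<xi> \<in> borel_measurable (F a)" by (rule measurable_F_mono[OF \<xi>(1) st(1) ab(1) a(2)])
  have P: "(\<lambda>w. \<xi> w * \<eta> w) \<in> borel_measurable (F a)" using \<xi>a \<eta>(1) by measurable
  have iP: "integrable M (\<lambda>w. \<xi> w * \<eta> w)" by (intro integrable_mult_of_squares meas \<xi>(2) \<eta>(2))
  have Q: "integrable M (\<lambda>w. (\<xi> w * (W u w - W s w)) * \<eta> w)" if "s \<le> u" "u \<le> a" for u
    using that st ab a meas increment_measurable[of s u]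
    by (intro integrable_mult_of_squares step_integral_square_integrable \<xi> \<eta>(2)) auto
  have first: "integrable M (\<lambda>w. ((\<xi> w * (W u w - W s w)) * \<eta> w) * (W b w - W a w))"
    "expectation (\<lambda>w. ((\<xi> w * (W u w - W s w)) * \<eta> w) * (W b w - W a w)) = 0" if "s \<le> u" "u \<le> a" for u
  proof -
    have "W u \<in> borel_measurable (F a)" "W s \<in> borel_measurable (F a)"
      by (rule W_measurable_F; use that st ab a in auto)+
    then have "(\<lambda>w. (\<xi> w * (W u w - W s w)) * \<eta> w) \<in> borel_measurable (F a)"
      using \<xi>a \<eta>(1) by measurable
    then show "integrable M (\<lambda>w. ((\<xi> w * (W u w - W s w)) * \<eta> w) * (W b w - W a w))"
      "expectation (\<lambda>w. ((\<xi> w * (W u w - W s w)) * \<eta> w) * (W b w - W a w)) = 0"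
      using increment_product_mean[OF a(1) ab(2,3)] Q[OF that] by auto
  qed
  show ?thesis
  proof (cases "t \<le> a")
    case True
    then show ?thesis using first[of t] st ab by (simp add: mult_ac max_def)
  next
    case False
    \<comment> \<open>Working with the smaller and the larger of the two end points treats both
      orders of \<open>t\<close> and \<open>b\<close> by one formula.\<close>
    define c d where "c = min t b" and "d = max t b"
    have cd: "a \<le> c" "c \<le> d" "d \<le> T" "0 \<le> c" using False ab a st by (auto simp: c_def d_def)
    have prod: "(W t w - W a w) * (W b w - W a w) = (W c w - W a w)\<^sup>2 + (W c w - W a w) * (W d w - W c w)" for w
      by (cases "t \<le> b") (auto simp: c_def d_def power2_eq_square algebra_simps)
    have s1: "integrable M (\<lambda>w. (\<xi> w * \<eta> w) * (W c w - W a w)\<^sup>2)" "expectation (\<lambda>w. (\<xi> w * \<eta> w) * (W c w - W a w)\<^sup>2) = expectation (\<lambda>w. \<xi> w * \<eta> w) * (c - a)"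
      using increment_product_square[OF a(1) cd(1) _ P iP] cd by auto
    have cT: "c \<le> T" using cd by simp
    have "W c \<in> borel_measurable (F c)" "W a \<in> borel_measurable (F c)"
      by (rule W_measurable_F; use cd a cT in auto)+
    then have P2: "(\<lambda>w. (\<xi> w * \<eta> w) * (W c w - W a w)) \<in> borel_measurable (F c)"
      using measurable_F_mono[OF P a(1) cd(1) cT] by measurable
    have iP2: "integrable M (\<lambda>w. (\<xi> w * \<eta> w) * (W c w - W a w))"
      using increment_product_mean(1)[OF a(1) cd(1) _ P iP] cd by auto
    have s2: "integrable M (\<lambda>w. ((\<xi> w * \<eta> w) * (W c w - W a w)) * (W d w - W c w))"
      "expectation (\<lambda>w. ((\<xi> w * \<eta> w) * (W c w - W a w)) * (W d w - W c w)) = 0"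
      using increment_product_mean[OF cd(4,2,3) P2 iP2] by auto
    note f = first[OF ab(1) order_refl]
    have "expectation (\<lambda>w. (\<xi> w * (W t w - W s w)) * (\<eta> w * (W b w - W a w)))
      = expectation (\<lambda>w. ((\<xi> w * (W a w - W s w)) * \<eta> w) * (W b w - W a w)
          + ((\<xi> w * \<eta> w) * (W c w - W a w)\<^sup>2 + ((\<xi> w * \<eta> w) * (W c w - W a w)) * (W d w - W c w)))"
    proof (intro Bochner_Integration.integral_cong refl)
      fix w
      have "(\<xi> w * (W t w - W s w)) * (\<eta> w * (W b w - W a w)) = ((\<xi> w * (W a w - W s w)) * \<eta> w) * (W b w - W a w)
          + (\<xi> w * \<eta> w) * ((W t w - W a w) * (W b w - W a w))" by (simp add: algebra_simps)
      then show "(\<xi> w * (W t w - W s w)) * (\<eta> w * (W b w - W a w)) = ((\<xi> w * (W a w - W s w)) * \<eta> w) * (W b w - W a w)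
          + ((\<xi> w * \<eta> w) * (W c w - W a w)\<^sup>2 + ((\<xi> w * \<eta> w) * (W c w - W a w)) * (W d w - W c w))"
        unfolding prod by (simp add: distrib_left mult.assoc)
    qed
    also have "\<dots> = expectation (\<lambda>w. \<xi> w * \<eta> w) * (c - a)"
      using f s1 s2 by simp
    finally show ?thesis using cd by (simp add: c_def max_def)
  qed
qed

lemma step_covariance:
  assumes st: "0 \<le> s" "s \<le> t" "t \<le> T" and ab: "0 \<le> a" "a \<le> b" "b \<le> T"
    and \<xi>: "\<xi> \<in> borel_measurable (F s)" "integrable M (\<lambda>w. (\<xi> w)\<^sup>2)"
    and \<eta>: "\<eta> \<in> borel_measurable (F a)" "integrable M (\<lambda>w. (\<eta> w)\<^sup>2)"
  shows "expectation (\<lambda>w. (\<xi> w * (W t w - W s w)) * (\<eta> w * (W b w - W a w)))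
    = expectation (\<lambda>w. \<xi> w * \<eta> w) * measure lborel ({s<..t} \<inter> {a<..b})"
proof -
  have m: "measure lborel ({s<..t} \<inter> {a<..b}) = max 0 (min t b - max s a)"
  proof -
    have "{s<..t} \<inter> {a<..b} = {max s a<..min t b}" by auto
    then show ?thesis by (cases "max s a \<le> min t b") (auto simp: max_def)
  qed
  show ?thesis
  proof (cases "s \<le> a")
    case True
    then show ?thesis using step_covariance_aux[OF st True ab(2,3) \<xi> \<eta>] unfolding m by (simp add: max_absorb2)
  next
    case False
    then have as: "a \<le> s" by simp
    show ?thesis using step_covariance_aux[OF ab as st(2,3) \<eta> \<xi>] as unfolding m by (simp add: max_absorb1 min.commute mult.commute)
  qed
qed

text \<open>The intervals may overlap in any way, and this is the purpose: the difference of two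
  step integrands on unrelated partitions is again one such family, so no common refinement has to
  be formed.\<close>

lemma step_isometry:
  fixes A :: "'i set"
  assumes A: "finite A" and st: "\<And>i. i \<in> A \<Longrightarrow> 0 \<le> s i \<and> s i \<le> t i \<and> t i \<le> T"
    and \<xi>: "\<And>i. i \<in> A \<Longrightarrow> \<xi> i \<in> borel_measurable (F (s i))" "\<And>i. i \<in> A \<Longrightarrow> integrable M (\<lambda>w. (\<xi> i w)\<^sup>2)"
  shows "(\<integral>\<^sup>+w. ennreal ((\<Sum>i\<in>A. \<xi> i w * (W (t i) w - W (s i) w))\<^sup>2) \<partial>M)
    = (\<integral>\<^sup>+w. (\<integral>\<^sup>+u. ennreal ((\<Sum>i\<in>A. \<xi> i w * indicator {s i<..t i} u)\<^sup>2) \<partial>lborel) \<partial>M)"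
proof -
  have \<xi>m: "\<xi> i \<in> borel_measurable M" if "i \<in> A" for i using measurable_F_M[OF \<xi>(1)[OF that]] st[OF that] by auto
  have i1: "integrable M (\<lambda>w. (\<xi> i w * (W (t i) w - W (s i) w)) * (\<xi> j w * (W (t j) w - W (s j) w)))" if "i \<in> A" "j \<in> A" for i j
    using that st \<xi> \<xi>m increment_measurable
    by (intro integrable_mult_of_squares step_integral_square_integrable borel_measurable_times) auto
  have i2: "integrable M (\<lambda>w. \<xi> i w * \<xi> j w)" if "i \<in> A" "j \<in> A" for i j
    using that by (intro integrable_mult_of_squares \<xi> \<xi>m)
  have sq: "(\<Sum>i\<in>A. f i)\<^sup>2 = (\<Sum>i\<in>A. \<Sum>j\<in>A. f i * f j)" for f :: "'i \<Rightarrow> real"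
    by (simp add: power2_eq_square sum_product)
  define V where "V = (\<Sum>i\<in>A. \<Sum>j\<in>A. expectation (\<lambda>w. \<xi> i w * \<xi> j w) * measure lborel ({s i<..t i} \<inter> {s j<..t j}))"
  have iL: "integrable M (\<lambda>w. (\<Sum>i\<in>A. \<xi> i w * (W (t i) w - W (s i) w))\<^sup>2)"
    unfolding sq by (intro Bochner_Integration.integrable_sum i1)
  have "expectation (\<lambda>w. (\<Sum>i\<in>A. \<xi> i w * (W (t i) w - W (s i) w))\<^sup>2)
    = (\<Sum>i\<in>A. \<Sum>j\<in>A. expectation (\<lambda>w. (\<xi> i w * (W (t i) w - W (s i) w)) * (\<xi> j w * (W (t j) w - W (s j) w))))"
    unfolding sq
    by (subst Bochner_Integration.integral_sum, intro Bochner_Integration.integrable_sum i1, assumption+)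
       (intro sum.cong refl Bochner_Integration.integral_sum i1)
  also have "\<dots> = V"
    unfolding V_def by (intro sum.cong refl step_covariance) (use st \<xi> in auto)
  finally have L: "(\<integral>\<^sup>+w. ennreal ((\<Sum>i\<in>A. \<xi> i w * (W (t i) w - W (s i) w))\<^sup>2) \<partial>M) = ennreal V"
    by (subst nn_integral_eq_integral[OF iL]) auto
  define G where "G w = (\<Sum>i\<in>A. \<Sum>j\<in>A. (\<xi> i w * \<xi> j w) * measure lborel ({s i<..t i} \<inter> {s j<..t j}))" for w
  have inner: "(\<integral>\<^sup>+u. ennreal ((\<Sum>i\<in>A. \<xi> i w * indicator {s i<..t i} u)\<^sup>2) \<partial>lborel) = ennreal (G w) \<and> 0 \<le> G w" for w
  proof -
    have eq: "(\<Sum>i\<in>A. \<xi> i w * indicator {s i<..t i} u)\<^sup>2 = (\<Sum>i\<in>A. \<Sum>j\<in>A. (\<xi> i w * \<xi> j w) * indicator ({s i<..t i} \<inter> {s j<..t j}) u)" for u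
      unfolding sq 
      by (intro sum.cong refl) (auto simp: indicator_def)
    have ii: "integrable lborel (\<lambda>u. (\<xi> i w * \<xi> j w) * indicator ({s i<..t i} \<inter> {s j<..t j}) u)" for i j
    proof (intro integrable_mult_right integrable_real_indicator)
      have "emeasure lborel ({s i<..t i} \<inter> {s j<..t j}) \<le> emeasure lborel {s i..t i}" by (intro emeasure_mono) auto
      also have "\<dots> < \<infinity>" by (simp add: emeasure_lborel_Icc_eq)
      finally show "emeasure lborel ({s i<..t i} \<inter> {s j<..t j}) < \<infinity>" .
    qed simp
    have iI: "integrable lborel (\<lambda>u. (\<Sum>i\<in>A. \<xi> i w * indicator {s i<..t i} u)\<^sup>2)"
      unfolding eq by (intro Bochner_Integration.integrable_sum ii)
    have "integral\<^sup>L lborel (\<lambda>u. (\<Sum>i\<in>A. \<xi> i w * indicator {s i<..t i} u)\<^sup>2) = (\<Sum>i\<in>A. \<Sum>j\<in>A. integral\<^sup>L lborel (\<lambda>u. (\<xi> i w * \<xi> j w) * indicator ({s i<..t i} \<inter> {s j<..t j}) u))"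
      unfolding eq
      by (subst Bochner_Integration.integral_sum, intro Bochner_Integration.integrable_sum ii)
         (intro sum.cong refl Bochner_Integration.integral_sum ii)
    also have "\<dots> = G w" unfolding G_def by (intro sum.cong refl) simp
    finally have g: "integral\<^sup>L lborel (\<lambda>u. (\<Sum>i\<in>A. \<xi> i w * indicator {s i<..t i} u)\<^sup>2) = G w" .
    have "0 \<le> G w" unfolding g[symmetric] by (rule Bochner_Integration.integral_nonneg) simp
    then show ?thesis using nn_integral_eq_integral[OF iI] g by simp
  qed
  have iG: "integrable M G" unfolding G_def[abs_def]
    by (intro Bochner_Integration.integrable_sum integrable_mult_left i2)
  have "expectation G = V"
    unfolding G_def[abs_def] V_def
    by (subst Bochner_Integration.integral_sum, intro Bochner_Integration.integrable_sum integrable_mult_left i2, assumption+)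
       (intro sum.cong refl, subst Bochner_Integration.integral_sum, auto intro: i2)
  then have "(\<integral>\<^sup>+w. ennreal (G w) \<partial>M) = ennreal V"
    using inner by (subst nn_integral_eq_integral[OF iG]) auto
  then show ?thesis using L inner by simp
qed

end

section \<open>Joint measurability and step approximation of the price process\<close>

context black_scholes
begin

definition S_step :: "nat \<Rightarrow> real \<Rightarrow> 'a \<Rightarrow> real" where
  "S_step n u w = (\<Sum>k<n. S (grid n k) w * indicator {grid n k<..grid n (Suc k)} u)"

lemma S_step_eq:
  assumes n: "n > 0" and u: "0 < u" "u \<le> T"
  obtains k where "k < n" "grid n k < u" "u \<le> grid n (Suc k)" "\<And>w. S_step n u w = S (grid n k) w"
proof -
  \<comment> \<open>The intervals are open on the left and closed on the right, hence a ceiling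
    minus one and not a floor.\<close>
  define k where "k = nat (\<lceil>u * real n / T\<rceil> - 1)"
  have pos: "u * real n / T > 0" using n u T_pos by simp
  have "u * real n \<le> T * real n" using u by (intro mult_right_mono) auto
  then have le: "u * real n / T \<le> real n" using T_pos by (simp add: field_simps)
  have rk: "real k = of_int \<lceil>u * real n / T\<rceil> - 1" using pos unfolding k_def by (simp add: of_nat_nat)
  have k1: "real k < u * real n / T" "u * real n / T \<le> real (Suc k)" using rk by linarith+
  have kn: "k < n" using k1 le by linarith
  have g1: "grid n k < u" using k1(1) n T_pos by (simp add: grid_def field_simps)
  have g2: "u \<le> grid n (Suc k)" using k1(2) n T_pos by (simp add: grid_def field_simps)
  have "S_step n u w = S (grid n k) w" for w
  proof -
    have "S_step n u w = (\<Sum>j<n. if j = k then S (grid n k) w else 0)"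
      unfolding S_step_def
    proof (intro sum.cong refl)
      fix j
      show "S (grid n j) w * indicator {grid n j<..grid n (Suc j)} u = (if j = k then S (grid n k) w else 0)"
      proof (cases "j = k")
        case False
        then have "Suc j \<le> k \<or> Suc k \<le> j" by auto
        then have "grid n (Suc j) \<le> grid n k \<or> grid n (Suc k) \<le> grid n j" using grid_mono by blast
        then show ?thesis using False g1 g2 by (auto simp: indicator_def)
      qed (use g1 g2 in simp)
    qed
    also have "\<dots> = S (grid n k) w" using kn by simp
    finally show ?thesis .
  qed
  with kn g1 g2 show thesis by (rule that)
qed

lemma S_step_tendsto:
  assumes w: "w \<in> space M" and u: "0 < u" "u \<le> T"
  shows "(\<lambda>n. S_step n u w) \<longlonglongrightarrow> S u w"
proof (rule LIMSEQ_I)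
  fix e :: real assume e: "e > 0"
  have "continuous (at u within {0..T}) (\<lambda>t. S t w)"
    using S_continuous[OF w] u by (auto simp: continuous_on_eq_continuous_within)
  then obtain d where d: "d > 0" "\<And>x. x \<in> {0..T} \<Longrightarrow> \<bar>x - u\<bar> < d \<Longrightarrow> \<bar>S x w - S u w\<bar> < e"
    using e unfolding continuous_within_eps_delta dist_real_def by blast
  obtain n0 where n0: "T / d < real n0" using reals_Archimedean2 by blast
  show "\<exists>n0. \<forall>n\<ge>n0. norm (S_step n u w - S u w) < e"
  proof (intro exI allI impI)
    fix n assume n: "n \<ge> max n0 1"
    then have np: "n > 0" by simp
    have "T / d < real n" using n n0 by simp
    then have Tn: "T / real n < d" using np d(1) T_pos by (simp add: field_simps)
    obtain k where k: "k < n" "grid n k < u" "u \<le> grid n (Suc k)" "\<And>w. S_step n u w = S (grid n k) w"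
      using S_step_eq[OF np u] by blast
    have "grid n (Suc k) = grid n k + T / real n" by (simp add: grid_def distrib_right add_divide_distrib)
    then have "\<bar>grid n k - u\<bar> < d" using k Tn by simp
    then show "norm (S_step n u w - S u w) < e" unfolding k(4) real_norm_def using k(1) by (intro d(2) grid_in) auto
  qed
qed

lemma S_step_joint_measurable: "(\<lambda>x. S_step n (snd x) (fst x)) \<in> borel_measurable (M \<Otimes>\<^sub>M (lborel :: real measure))"
proof -
  have [measurable]: "S (grid n k) \<in> borel_measurable M" if "k < n" for k using that by (intro S_measurable grid_in) auto
  show ?thesis unfolding S_step_def[abs_def] by (intro borel_measurable_sum) measurable
qed

text \<open>A limit of jointly measurable step processes. These vanish outside the half-open
  interval, so the price is cut off there as well.\<close>

lemma S_joint_measurable: "(\<lambda>x. S (snd x) (fst x) * indicator {0<..T} (snd x)) \<in> borel_measurable (M \<Otimes>\<^sub>M (lborel :: real measure))"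
proof (rule borel_measurable_LIMSEQ_real)
  show "(\<lambda>x. S_step n (snd x) (fst x) * indicator {0<..T} (snd x)) \<in> borel_measurable (M \<Otimes>\<^sub>M (lborel :: real measure))" for n
    using S_step_joint_measurable[of n] by measurable
  fix x assume "x \<in> space (M \<Otimes>\<^sub>M (lborel :: real measure))"
  then have "fst x \<in> space M" by (auto simp: space_pair_measure)
  then show "(\<lambda>n. S_step n (snd x) (fst x) * indicator {0<..T} (snd x)) \<longlonglongrightarrow> S (snd x) (fst x) * indicator {0<..T} (snd x)"
    using S_step_tendsto[of "fst x" "snd x"] by (auto simp: indicator_def)
qed

definition step_error :: "nat \<Rightarrow> 'a \<Rightarrow> ennreal" where
  "step_error n w = (\<integral>\<^sup>+u. ennreal ((S u w * indicator {0<..T} u - S_step n u w)\<^sup>2) \<partial>lborel)"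

lemma step_error_measurable: "step_error n \<in> borel_measurable M"
proof -
  have "(\<lambda>x. ennreal ((S (snd x) (fst x) * indicator {0<..T} (snd x) - S_step n (snd x) (fst x))\<^sup>2)) \<in> borel_measurable (M \<Otimes>\<^sub>M (lborel :: real measure))"
    using S_joint_measurable S_step_joint_measurable[of n] by measurable
  from sigma_finite_measure.borel_measurable_nn_integral_fst[OF sigma_finite_lborel this]
  show ?thesis unfolding step_error_def[abs_def] by simp
qed

text \<open>After exchanging the integrals the time is fixed. The price is then the preceding grid
  value times an independent factor whose mean squared distance from 1 is at most
  \<open>C * T / n\<close>.\<close>

lemma step_error_tendsto: "(\<lambda>n. \<integral>\<^sup>+w. step_error n w \<partial>M) \<longlonglongrightarrow> 0"
proof -
  obtain C where C: "C > 0" "\<And>s t. 0 \<le> s \<Longrightarrow> s \<le> t \<Longrightarrow> t \<le> T \<Longrightarrow>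
      expectation (\<lambda>w. (exp (drift * (t - s) + \<sigma> * (W t w - W s w)) - 1)\<^sup>2) \<le> C * (t - s)"
    "\<And>s t. 0 \<le> s \<Longrightarrow> s \<le> t \<Longrightarrow> t \<le> T \<Longrightarrow>
      expectation (\<lambda>w. (exp (drift * (t - s) + \<sigma> * (W t w - W s w)) - 1) ^ 4) \<le> C * (t - s)\<^sup>2"
    "\<And>s t. 0 \<le> s \<Longrightarrow> s \<le> t \<Longrightarrow> t \<le> T \<Longrightarrow>
      expectation (\<lambda>w. (exp (drift * (t - s) + \<sigma> * (W t w - W s w)) - 1 - \<sigma> * (W t w - W s w))\<^sup>2) \<le> C * (t - s)\<^sup>2"
    by (rule growth_estimates, rule that, assumption+)
  obtain K where K: "K > 0" "\<And>n k. k \<le> n \<Longrightarrow> expectation (\<lambda>w. (S (grid n k) w)\<^sup>2) \<le> K"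
    using S_power_bound[of 2] by blast
  interpret L: sigma_finite_measure "lborel :: real measure" by (rule sigma_finite_lborel)
  interpret P: pair_sigma_finite M "lborel :: real measure" ..
  have bound: "(\<integral>\<^sup>+w. step_error n w \<partial>M) \<le> ennreal (K * C * T * T / real n)" if n: "n > 0" for n
  proof -
    have jm: "(\<lambda>x. ennreal ((S (snd x) (fst x) * indicator {0<..T} (snd x) - S_step n (snd x) (fst x))\<^sup>2)) \<in> borel_measurable (M \<Otimes>\<^sub>M (lborel :: real measure))"
      using S_joint_measurable S_step_joint_measurable[of n] by measurable
    have "(\<integral>\<^sup>+w. step_error n w \<partial>M) = (\<integral>\<^sup>+u. (\<integral>\<^sup>+w. ennreal ((S u w * indicator {0<..T} u - S_step n u w)\<^sup>2) \<partial>M) \<partial>lborel)"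
      unfolding step_error_def using P.Fubini'[of "\<lambda>w u. ennreal ((S u w * indicator {0<..T} u - S_step n u w)\<^sup>2)"] jm
      by (simp add: case_prod_unfold)
    also have "\<dots> \<le> (\<integral>\<^sup>+u. ennreal (K * C * T / real n) * indicator {0<..T} u \<partial>lborel)"
    proof (rule nn_integral_mono)
      fix u :: real
      show "(\<integral>\<^sup>+w. ennreal ((S u w * indicator {0<..T} u - S_step n u w)\<^sup>2) \<partial>M) \<le> ennreal (K * C * T / real n) * indicator {0<..T} u"
      proof (cases "0 < u \<and> u \<le> T")
        case False
        have "S_step n u w = 0" for w
          unfolding S_step_def
        proof (intro sum.neutral ballI)
          fix k assume "k \<in> {..<n}"
          then have "grid n (Suc k) \<le> T" "0 \<le> grid n k" by (auto intro: grid_le_T grid_nonneg)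
          then show "S (grid n k) w * indicator {grid n k<..grid n (Suc k)} u = 0" using False by (auto simp: indicator_def)
        qed
        then show ?thesis using False by (auto simp: indicator_def)
      next
        case True
        then have u: "0 < u" "u \<le> T" by auto
        obtain k where k: "k < n" "grid n k < u" "u \<le> grid n (Suc k)" "\<And>w. S_step n u w = S (grid n k) w"
          using S_step_eq[OF n u] by blast
        let ?s = "grid n k"
        have "grid n (Suc k) = grid n k + T / real n" by (simp add: grid_def distrib_right add_divide_distrib)
        then have us: "u - ?s \<le> T / real n" using k by simp
        have t: "0 \<le> ?s" "?s \<le> u" "u \<le> T" using k u grid_nonneg by auto
        let ?g = "\<lambda>x. (exp (drift * (u - ?s) + \<sigma> * x) - 1)\<^sup>2"
        have eq: "(S u w - S ?s w)\<^sup>2 = (S ?s w)\<^sup>2 * ?g (W u w - W ?s w)" for w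
          unfolding S_increment[of u w ?s] by (simp add: power2_eq_square algebra_simps)
        have "all_moments (\<lambda>w. exp (drift * (u - ?s) + \<sigma> * (W u w - W ?s w)))"
          using bounded_moments_member[OF bounded_moments_exp_growth, of "(?s, u)"] t by (simp add: time_pairs_def)
        then have ig: "integrable M (\<lambda>w. ?g (W u w - W ?s w))"
          by (intro all_moments_integrable bounded_moments_power bounded_moments_diff bounded_moments_const)
        have amS: "all_moments (S ?s)" using k by (intro all_moments_S_grid) simp
        have iS: "integrable M (\<lambda>w. (S ?s w)\<^sup>2)" by (intro all_moments_integrable bounded_moments_power amS)
        have mS: "(\<lambda>w. (S ?s w)\<^sup>2) \<in> borel_measurable (F ?s)" using S_measurable_F[of ?s ?s] t u by (intro borel_measurable_power) auto
        note pr = increment_product[OF t mS iS, of ?g, OF _ ig]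
        have "expectation (\<lambda>w. (S u w - S ?s w)\<^sup>2) = expectation (\<lambda>w. (S ?s w)\<^sup>2) * expectation (\<lambda>w. ?g (W u w - W ?s w))"
          unfolding eq by (rule pr(2)) measurable
        also have "\<dots> \<le> K * (C * (u - ?s))" using K(2)[of k n] k(1) C(2)[OF t] K(1) by (intro mult_mono) auto
        also have "\<dots> \<le> K * (C * (T / real n))" using us K(1) C(1) by (intro mult_left_mono) auto
        finally have le: "expectation (\<lambda>w. (S u w - S ?s w)\<^sup>2) \<le> K * C * T / real n" by simp
        have "integrable M (\<lambda>w. (S u w - S ?s w)\<^sup>2)" unfolding eq by (rule pr(1)) measurable
        then have "(\<integral>\<^sup>+w. ennreal ((S u w - S ?s w)\<^sup>2) \<partial>M) \<le> ennreal (K * C * T / real n)"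
          using le by (subst nn_integral_eq_integral) (auto intro: ennreal_leI)
        then show ?thesis using True k(4) by (simp add: indicator_def)
      qed
    qed
    also have "\<dots> = ennreal (K * C * T / real n) * ennreal T"
      using T_pos by (subst nn_integral_cmult_indicator) auto
    also have "\<dots> = ennreal (K * C * T * T / real n)"
      using K C T_pos by (subst ennreal_mult[symmetric]) auto
    finally show ?thesis .
  qed
  have lim: "(\<lambda>n. ennreal (K * C * T * T / real n)) \<longlonglongrightarrow> ennreal 0" by (intro tendsto_ennrealI lim_const_over_n)
  show ?thesis
  proof (rule tendsto_sandwich[OF _ _ tendsto_const])
    show "\<forall>\<^sub>F n in sequentially. (\<integral>\<^sup>+w. step_error n w \<partial>M) \<le> ennreal (K * C * T * T / real n)"
      using eventually_gt_at_top[of 0] by eventually_elim (rule bound)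
    show "(\<lambda>n. ennreal (K * C * T * T / real n)) \<longlonglongrightarrow> 0" using lim by simp
  qed simp
qed

end

section \<open>The mixed normal limit on the extension\<close>

text \<open>The structures \<open>V1\<close> and \<open>V2\<close> merely carry sigma-algebras on
  \<open>space M\<close>; variables measurable for them inherit their independence.\<close>

lemma (in prob_space) indep_var_of_indep_set:
  assumes ind: "indep_set (sets V1) (sets V2)" and sp: "space V1 = space M" "space V2 = space M"
    and X: "X \<in> borel_measurable V1" and Y: "Y \<in> borel_measurable V2"
  shows "indep_var borel X borel Y"
  unfolding indep_var_eq
proof (intro conjI)
  have ev: "sets V1 \<subseteq> events" "sets V2 \<subseteq> events"
    using indep_setD_ev1[OF ind] indep_setD_ev2[OF ind] .
  show "random_variable borel X" using measurable_sets[OF X] ev(1) sp(1) measurable_space[OF X] by (auto intro!: measurableI)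
  show "random_variable borel Y" using measurable_sets[OF Y] ev(2) sp(2) measurable_space[OF Y] by (auto intro!: measurableI)
  have 1: "sigma_sets (space M) {X -` A \<inter> space M |A. A \<in> sets borel} \<subseteq> sets V1"
    using measurable_sets[OF X] unfolding sp(1)[symmetric] by (intro sets.sigma_sets_subset) auto
  have 2: "sigma_sets (space M) {Y -` A \<inter> space M |A. A \<in> sets borel} \<subseteq> sets V2"
    using measurable_sets[OF Y] unfolding sp(2)[symmetric] by (intro sets.sigma_sets_subset) auto
  show "indep_set (sigma_sets (space M) {X -` A \<inter> space M |A. A \<in> sets borel})
      (sigma_sets (space M) {Y -` A \<inter> space M |A. A \<in> sets borel})"
    using ind 1 2 unfolding indep_sets2_eq by (meson subset_eq)
qed

locale black_scholes_extension = black_scholes M F T W S0 r \<sigma> + hat: brownian Mh Fh T B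
  for M :: "'a measure" and F :: "real \<Rightarrow> 'a measure" and T :: real and W :: "real \<Rightarrow> 'a \<Rightarrow> real"
    and S0 r \<sigma> :: real and Mh :: "'b measure" and Fh :: "real \<Rightarrow> 'b measure" and B :: "real \<Rightarrow> 'b \<Rightarrow> real" +
  fixes \<pi> :: "'b \<Rightarrow> 'a" and J :: "'b \<Rightarrow> real"
  assumes ext: "basis_extension M F Mh Fh T \<pi>"
    and indep: "indep_processes Mh {0..T} (\<lambda>t w. W t (\<pi> w)) B"
    and ito: "has_ito_integral Mh Fh T B (\<lambda>t w. asset_price S0 r \<sigma> W t (\<pi> w)) J"
begin

lemma \<pi>_measurable: "\<pi> \<in> measurable Mh M" and \<pi>_distr: "distr Mh M \<pi> = M"
  using ext by (auto simp: basis_extension_def)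

lemma \<pi>_measurable_F: "t \<in> {0..T} \<Longrightarrow> \<pi> \<in> measurable (Fh t) (F t)"
  using ext by (auto simp: basis_extension_def)

lemma lift_expectation:
  fixes X :: "'a \<Rightarrow> real"
  assumes "X \<in> borel_measurable M"
  shows "hat.expectation (\<lambda>w. X (\<pi> w)) = expectation X" "integrable Mh (\<lambda>w. X (\<pi> w)) \<longleftrightarrow> integrable M X"
  using integral_distr[OF \<pi>_measurable assms] integrable_distr_eq[OF \<pi>_measurable assms] by (auto simp: \<pi>_distr)

lemma lift_integrable: "integrable M X \<Longrightarrow> integrable Mh (\<lambda>w. X (\<pi> w) :: real)"
  using lift_expectation(2) by blast

lemma lift_nn_integral: "X \<in> borel_measurable M \<Longrightarrow> (\<integral>\<^sup>+w. X (\<pi> w) \<partial>Mh) = (\<integral>\<^sup>+w. X w \<partial>M)"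
  using nn_integral_distr[OF \<pi>_measurable, of X] by (simp add: \<pi>_distr)

text \<open>The sigma-algebra generated by the path of \<open>W\<close> on the extension, with
  \<open>VB\<close> as its counterpart for \<open>B\<close>. Weights depending on \<open>W\<close>
  are measurable for the one, increments of \<open>B\<close> for the other, and products of the two
  factor under the expectation.\<close>

definition VW :: "'b measure" where
  "VW = vimage_algebra (space Mh) (\<lambda>w. \<lambda>t\<in>{0..T}. W t (\<pi> w)) (PiM {0..T} (\<lambda>_. borel))"

definition VB :: "'b measure" where
  "VB = vimage_algebra (space Mh) (\<lambda>w. \<lambda>t\<in>{0..T}. B t w) (PiM {0..T} (\<lambda>_. borel))"

lemma space_V[simp]: "space VW = space Mh" "space VB = space Mh"
  by (auto simp: VW_def VB_def)

lemma indep_V: "hat.indep_set (sets VW) (sets VB)"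
  using indep unfolding indep_processes_def VW_def VB_def .

lemma W_measurable_VW: "t \<in> {0..T} \<Longrightarrow> (\<lambda>w. W t (\<pi> w)) \<in> borel_measurable VW"
proof -
  assume t: "t \<in> {0..T}"
  have "(\<lambda>w. \<lambda>t\<in>{0..T}. W t (\<pi> w)) \<in> measurable VW (PiM {0..T} (\<lambda>_. borel))"
    unfolding VW_def by (rule measurable_vimage_algebra1) (auto simp: space_PiM)
  from measurable_compose[OF this measurable_component_singleton[OF t]]
  show ?thesis using t by (simp cong: measurable_cong)
qed

lemma B_measurable_VB: "t \<in> {0..T} \<Longrightarrow> B t \<in> borel_measurable VB"
proof -
  assume t: "t \<in> {0..T}"
  have "(\<lambda>w. \<lambda>t\<in>{0..T}. B t w) \<in> measurable VB (PiM {0..T} (\<lambda>_. borel))"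
    unfolding VB_def by (rule measurable_vimage_algebra1) (auto simp: space_PiM)
  from measurable_compose[OF this measurable_component_singleton[OF t]]
  show ?thesis using t by (simp cong: measurable_cong)
qed

lemma S_measurable_VW: "t \<in> {0..T} \<Longrightarrow> (\<lambda>w. S t (\<pi> w)) \<in> borel_measurable VW"
  using W_measurable_VW[of t] unfolding asset_price_def by measurable

text \<open>A set of the cylinder sigma-algebra depends on countably many times only, so the time
  integral is reached as a limit of Riemann sums along each continuous path.\<close>

lemma avg_measurable_VW: "(\<lambda>w. avg (\<pi> w)) \<in> borel_measurable VW"
proof (rule borel_measurable_LIMSEQ_real)
  show "(\<lambda>w. riemann n (\<pi> w)) \<in> borel_measurable VW" for n
    unfolding riemann_def by (intro borel_measurable_divide borel_measurable_sum S_measurable_VW grid_in borel_measurable_const) auto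
  show "(\<lambda>n. riemann n (\<pi> w)) \<longlonglongrightarrow> avg (\<pi> w)" if "w \<in> space VW" for w
    using that measurable_space[OF \<pi>_measurable] by (intro riemann_tendsto) auto
qed

lemma V_product:
  fixes X Y :: "'b \<Rightarrow> real"
  assumes X: "X \<in> borel_measurable VW" "integrable Mh X" and Y: "Y \<in> borel_measurable VB" "integrable Mh Y"
  shows "integrable Mh (\<lambda>w. X w * Y w)" "hat.expectation (\<lambda>w. X w * Y w) = hat.expectation X * hat.expectation Y"
proof -
  have "hat.indep_var borel X borel Y"
    by (rule hat.indep_var_of_indep_set[OF indep_V _ _ X(1) Y(1)]) simp_all
  then show "integrable Mh (\<lambda>w. X w * Y w)" "hat.expectation (\<lambda>w. X w * Y w) = hat.expectation X * hat.expectation Y"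
    using hat.indep_var_integrable[OF _ X(2) Y(2)] hat.indep_var_lebesgue_integral[OF _ X(2) Y(2)] by auto
qed

section \<open>Grid approximation of the Ito integral\<close>

definition B_incr :: "nat \<Rightarrow> nat \<Rightarrow> 'b \<Rightarrow> real" where
  "B_incr n k w = B (grid n (Suc k)) w - B (grid n k) w"

definition J_step :: "nat \<Rightarrow> 'b \<Rightarrow> real" where
  "J_step n w = (\<Sum>k<n. S (grid n k) (\<pi> w) * B_incr n k w)"

lemma grid_times: "k < n \<Longrightarrow> 0 \<le> grid n k" "k < n \<Longrightarrow> grid n k \<le> grid n (Suc k)" "k < n \<Longrightarrow> grid n (Suc k) \<le> T"
  by (auto intro: grid_nonneg grid_mono grid_le_T)

lemma S_lift_measurable_F: "k < n \<Longrightarrow> (\<lambda>w. S (grid n k) (\<pi> w)) \<in> borel_measurable (Fh (grid n k))"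
  using measurable_compose[OF \<pi>_measurable_F[OF grid_in[of k n]] S_measurable_F[of "grid n k" "grid n k"]] grid_times[of k n] by auto

lemma S_lift_square_integrable: "k < n \<Longrightarrow> integrable Mh (\<lambda>w. (S (grid n k) (\<pi> w))\<^sup>2)"
  by (rule lift_integrable) (intro all_moments_integrable bounded_moments_power all_moments_S_grid, simp)

lemma J_step_square_integrable: "integrable Mh (\<lambda>w. (J_step n w)\<^sup>2)" and J_step_measurable: "J_step n \<in> borel_measurable Mh"
proof -
  have i: "integrable Mh (\<lambda>w. (S (grid n k) (\<pi> w) * B_incr n k w)\<^sup>2)" if "k < n" for k
    unfolding B_incr_def using hat.step_integral_square_integrable[OF grid_times[OF that] S_lift_measurable_F[OF that] S_lift_square_integrable[OF that]] .
  have m: "(\<lambda>w. S (grid n k) (\<pi> w) * B_incr n k w) \<in> borel_measurable Mh" if "k < n" for k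
  proof -
    have "(\<lambda>w. S (grid n k) (\<pi> w)) \<in> borel_measurable Mh"
      using measurable_compose[OF \<pi>_measurable S_measurable[OF grid_in[of k n]]] that by simp
    then show ?thesis unfolding B_incr_def using hat.increment_measurable[OF grid_times[OF that]] by measurable
  qed
  show "J_step n \<in> borel_measurable Mh" unfolding J_step_def[abs_def] by (intro borel_measurable_sum m) simp
  have "(\<lambda>w. (J_step n w)\<^sup>2) = (\<lambda>w. \<Sum>j<n. \<Sum>k<n. (S (grid n j) (\<pi> w) * B_incr n j w) * (S (grid n k) (\<pi> w) * B_incr n k w))"
    by (simp add: J_step_def power2_eq_square sum_product)
  then show "integrable Mh (\<lambda>w. (J_step n w)\<^sup>2)"
    by (simp only:) (intro Bochner_Integration.integrable_sum hat.integrable_mult_of_squares i m; simp)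
qed

lemma sq_sum_le_ennreal: "ennreal ((x - z)\<^sup>2) \<le> 2 * ennreal ((x - y)\<^sup>2) + 2 * ennreal ((y - z)\<^sup>2)"
proof -
  have "(x - z)\<^sup>2 \<le> 2 * (x - y)\<^sup>2 + 2 * (y - z)\<^sup>2"
    using zero_le_power2[of "(x - y) - (y - z)"] by (simp add: power2_eq_square algebra_simps)
  then have "ennreal ((x - z)\<^sup>2) \<le> ennreal (2 * (x - y)\<^sup>2 + 2 * (y - z)\<^sup>2)" by (rule ennreal_leI)
  also have "\<dots> = 2 * ennreal ((x - y)\<^sup>2) + 2 * ennreal ((y - z)\<^sup>2)"
    by (simp add: ennreal_plus ennreal_mult)
  finally show ?thesis .
qed

text \<open>\<open>J\<close> comes with some unspecified approximation. The isometry is applied to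
  the difference between its \<open>m\<close>-th approximant and the grid approximation, the two
  integrands are compared through the price process, and \<open>m\<close> tends to infinity. The
  factor 4 stems from splitting a square twice.\<close>

lemma J_step_error: "(\<integral>\<^sup>+w. ennreal ((J w - J_step n w)\<^sup>2) \<partial>Mh) \<le> 4 * (\<integral>\<^sup>+w. step_error n w \<partial>M)"
proof -
  have [measurable]: "J \<in> borel_measurable Mh" using ito by (simp add: has_ito_integral_def)
  note [measurable] = J_step_measurable[of n]
  obtain k \<tau> \<xi> where simp: "\<And>m. simple_integrand Fh T (k m) (\<tau> m) (\<xi> m)"
    and l1: "(\<lambda>m. \<integral>\<^sup>+w. (\<integral>\<^sup>+t\<in>{0..T}. ennreal ((simple_process (k m) (\<tau> m) (\<xi> m) t w - S t (\<pi> w))\<^sup>2) \<partial>lborel) \<partial>Mh) \<longlonglongrightarrow> 0"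
    and l2: "(\<lambda>m. \<integral>\<^sup>+w. ennreal ((simple_ito_integral (k m) (\<tau> m) (\<xi> m) B w - J w)\<^sup>2) \<partial>Mh) \<longlonglongrightarrow> 0"
    using ito unfolding has_ito_integral_def by blast
  let ?E = "\<integral>\<^sup>+w. step_error n w \<partial>M"
  have bound: "(\<integral>\<^sup>+w. ennreal ((J w - J_step n w)\<^sup>2) \<partial>Mh)
     \<le> 2 * (\<integral>\<^sup>+w. ennreal ((simple_ito_integral (k m) (\<tau> m) (\<xi> m) B w - J w)\<^sup>2) \<partial>Mh)
      + (4 * (\<integral>\<^sup>+w. (\<integral>\<^sup>+t\<in>{0..T}. ennreal ((simple_process (k m) (\<tau> m) (\<xi> m) t w - S t (\<pi> w))\<^sup>2) \<partial>lborel) \<partial>Mh) + 4 * ?E)" for m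
  proof -
    define K where "K = k m"
    define t where "t = \<tau> m"
    define x where "x = \<xi> m"
    have si: "0 \<le> t 0" "t K \<le> T" "\<And>j. j < K \<Longrightarrow> t j \<le> t (Suc j)" "\<And>j. j < K \<Longrightarrow> x j \<in> borel_measurable (Fh (t j))"
      "\<And>j. j < K \<Longrightarrow> \<exists>b. \<forall>w\<in>space (Fh (t j)). \<bar>x j w\<bar> \<le> b"
      using simp[of m] unfolding simple_integrand_def K_def t_def x_def by auto
    have t0: "0 \<le> t j" if "j \<le> K" for j using that si(1,3) by (induction j) (auto intro: order_trans)
    have tT: "t j \<le> T" if "j \<le> K" for j
      using that
    proof (induction rule: inc_induct)
      case (step j) then show ?case using si(3)[of j] by simp
    qed (rule si(2))
    have xm: "x j \<in> borel_measurable Mh" if "j < K" for j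
      by (rule hat.measurable_F_M[OF si(4)[OF that]]) (use t0[of j] tT[of j] that in simp)
    have x2: "integrable Mh (\<lambda>w. (x j w)\<^sup>2)" if "j < K" for j
    proof -
      note jK = that
      have "space (Fh (t j)) = space Mh" using hat.space_F[of "t j"] t0[of j] tT[of j] that by auto
      then obtain b where b: "\<And>w. w \<in> space Mh \<Longrightarrow> \<bar>x j w\<bar> \<le> b"
        using si(5)[OF jK] by auto
      show ?thesis
      proof (rule hat.integrable_const_bound[where B="b\<^sup>2"])
        show "AE w in Mh. norm ((x j w)\<^sup>2) \<le> b\<^sup>2"
        proof (rule AE_I2)
          fix w assume "w \<in> space Mh"
          from power_mono[OF b[OF this], of 2] show "norm ((x j w)\<^sup>2) \<le> b\<^sup>2" by simp
        qed
      qed (use xm[OF that] in measurable)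
    qed
    define P where "P u w = simple_process K t x u w" for u w
    define I where "I w = simple_ito_integral K t x B w" for w
    have Im[measurable]: "I \<in> borel_measurable Mh"
      unfolding I_def[abs_def] simple_ito_integral_def
      by (intro borel_measurable_sum borel_measurable_times xm hat.increment_measurable t0 tT si(3)) auto
    \<comment> \<open>The steps of the approximant and the negated grid steps form one family over a
      disjoint sum, to which the isometry for overlapping intervals applies.\<close>
    define s' where "s' = case_sum t (grid n)"
    define t' where "t' = case_sum (\<lambda>j. t (Suc j)) (\<lambda>j. grid n (Suc j))"
    define x' where "x' = case_sum x (\<lambda>j w. - S (grid n j) (\<pi> w))"
    let ?A = "{..<K} <+> {..<n}"
    have iso: "(\<integral>\<^sup>+w. ennreal ((\<Sum>i\<in>?A. x' i w * (B (t' i) w - B (s' i) w))\<^sup>2) \<partial>Mh)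
      = (\<integral>\<^sup>+w. (\<integral>\<^sup>+u. ennreal ((\<Sum>i\<in>?A. x' i w * indicator {s' i<..t' i} u)\<^sup>2) \<partial>lborel) \<partial>Mh)"
    proof (rule hat.step_isometry)
      fix i assume "i \<in> ?A"
      then show "0 \<le> s' i \<and> s' i \<le> t' i \<and> t' i \<le> T"
        using t0 tT si(3) grid_times by (auto simp: s'_def t'_def)
      show "x' i \<in> borel_measurable (Fh (s' i))"
        using \<open>i \<in> ?A\<close> si(4) S_lift_measurable_F by (auto simp: x'_def s'_def)
      show "integrable Mh (\<lambda>w. (x' i w)\<^sup>2)"
        using \<open>i \<in> ?A\<close> x2 S_lift_square_integrable by (auto simp: x'_def)
    qed simp
    have e1: "(\<Sum>i\<in>?A. x' i w * (B (t' i) w - B (s' i) w)) = I w - J_step n w" for w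
      by (subst sum.Plus) (auto simp: x'_def s'_def t'_def I_def simple_ito_integral_def J_step_def B_incr_def sum_negf)
    have e2: "(\<Sum>i\<in>?A. x' i w * indicator {s' i<..t' i} u) = P u w - S_step n u (\<pi> w)" for u w
      by (subst sum.Plus) (auto simp: x'_def s'_def t'_def P_def simple_process_def S_step_def sum_negf)
    \<comment> \<open>Restricted to the half-open interval, outside of which both step integrands
      vanish; passing to the closed interval used in the definition of the Ito integral only
      enlarges the bound.\<close>
    define A' where "A' w = (\<integral>\<^sup>+u. ennreal ((P u w - S u (\<pi> w) * indicator {0<..T} u)\<^sup>2) * indicator {0<..T} u \<partial>lborel)" for w
    have P0: "P u w = 0" if "\<not> (0 < u \<and> u \<le> T)" for u w
      unfolding P_def simple_process_def
    proof (intro sum.neutral ballI)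
      fix j assume "j \<in> {..<K}"
      then have "0 \<le> t j" "t (Suc j) \<le> T" using t0 tT by auto
      then show "x j w * indicator {t j<..t (Suc j)} u = 0" using that by (auto simp: indicator_def)
    qed
    have S0': "S_step n u w = 0" if "\<not> (0 < u \<and> u \<le> T)" for u w
      unfolding S_step_def
    proof (intro sum.neutral ballI)
      fix k assume "k \<in> {..<n}"
      then have "grid n (Suc k) \<le> T" "0 \<le> grid n k" using grid_times by auto
      then show "S (grid n k) w * indicator {grid n k<..grid n (Suc k)} u = 0" using that by (auto simp: indicator_def)
    qed
    have Pjm: "(\<lambda>z. P (snd z) (fst z)) \<in> borel_measurable (Mh \<Otimes>\<^sub>M (lborel :: real measure))"
    proof -
      have "(\<lambda>z. x j (fst z)) \<in> borel_measurable (Mh \<Otimes>\<^sub>M (lborel :: real measure))" if "j < K" for j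
        using measurable_compose[OF measurable_fst xm[OF that]] .
      then show ?thesis unfolding P_def simple_process_def
        by (intro borel_measurable_sum borel_measurable_times) auto
    qed
    have Sjm: "(\<lambda>z. S (snd z) (\<pi> (fst z)) * indicator {0<..T} (snd z)) \<in> borel_measurable (Mh \<Otimes>\<^sub>M (lborel :: real measure))"
    proof -
      have "(\<lambda>z. (\<pi> (fst z), snd z)) \<in> measurable (Mh \<Otimes>\<^sub>M (lborel :: real measure)) (M \<Otimes>\<^sub>M lborel)"
        using \<pi>_measurable by (intro measurable_Pair measurable_compose[OF measurable_fst] measurable_snd)
      from measurable_compose[OF this S_joint_measurable] show ?thesis by simp
    qed
    have A'm[measurable]: "A' \<in> borel_measurable Mh"
    proof -
      have "(\<lambda>z. ennreal ((P (snd z) (fst z) - S (snd z) (\<pi> (fst z)) * indicator {0<..T} (snd z))\<^sup>2) * indicator {0<..T} (snd z))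
          \<in> borel_measurable (Mh \<Otimes>\<^sub>M (lborel :: real measure))"
        using Pjm Sjm by measurable
      from sigma_finite_measure.borel_measurable_nn_integral_fst[OF sigma_finite_lborel this]
      show ?thesis unfolding A'_def[abs_def] by simp
    qed
    have inner: "(\<integral>\<^sup>+u. ennreal ((P u w - S_step n u (\<pi> w))\<^sup>2) \<partial>lborel) \<le> 2 * A' w + 2 * step_error n (\<pi> w)" if w: "w \<in> space Mh" for w
    proof -
      have \<pi>w: "\<pi> w \<in> space M" using measurable_space[OF \<pi>_measurable w] .
      have m1: "(\<lambda>u. P u w) \<in> borel_measurable lborel" using measurable_compose[OF measurable_Pair1'[OF w] Pjm] by simp
      have m2: "(\<lambda>u. S u (\<pi> w) * indicator {0<..T} u) \<in> borel_measurable lborel" using measurable_compose[OF measurable_Pair1'[OF w] Sjm] by simp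
      have m3: "(\<lambda>u. S_step n u (\<pi> w)) \<in> borel_measurable lborel" using measurable_compose[OF measurable_Pair1'[OF \<pi>w] S_step_joint_measurable[of n]] by simp
      have "(\<integral>\<^sup>+u. ennreal ((P u w - S_step n u (\<pi> w))\<^sup>2) \<partial>lborel)
        \<le> (\<integral>\<^sup>+u. 2 * (ennreal ((P u w - S u (\<pi> w) * indicator {0<..T} u)\<^sup>2) * indicator {0<..T} u)
            + 2 * ennreal ((S u (\<pi> w) * indicator {0<..T} u - S_step n u (\<pi> w))\<^sup>2) \<partial>lborel)"
      proof (rule nn_integral_mono)
        fix u :: real
        show "ennreal ((P u w - S_step n u (\<pi> w))\<^sup>2) \<le> 2 * (ennreal ((P u w - S u (\<pi> w) * indicator {0<..T} u)\<^sup>2) * indicator {0<..T} u)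
            + 2 * ennreal ((S u (\<pi> w) * indicator {0<..T} u - S_step n u (\<pi> w))\<^sup>2)"
        proof (cases "0 < u \<and> u \<le> T")
          case True
          then show ?thesis using sq_sum_le_ennreal[of "P u w" "S_step n u (\<pi> w)" "S u (\<pi> w)"] by (simp add: indicator_def)
        qed (simp add: P0 S0')
      qed
      also have "\<dots> = 2 * A' w + 2 * step_error n (\<pi> w)"
        unfolding A'_def step_error_def using m1 m2 m3
        by (subst nn_integral_add) (auto simp: nn_integral_cmult)
      finally show ?thesis .
    qed
    have se[measurable]: "(\<lambda>w. step_error n (\<pi> w)) \<in> borel_measurable Mh"
      by (rule measurable_compose[OF \<pi>_measurable step_error_measurable])
    have "(\<integral>\<^sup>+w. ennreal ((I w - J_step n w)\<^sup>2) \<partial>Mh) = (\<integral>\<^sup>+w. (\<integral>\<^sup>+u. ennreal ((P u w - S_step n u (\<pi> w))\<^sup>2) \<partial>lborel) \<partial>Mh)"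
      using iso unfolding e1 e2 .
    also have "\<dots> \<le> (\<integral>\<^sup>+w. 2 * A' w + 2 * step_error n (\<pi> w) \<partial>Mh)" by (intro nn_integral_mono inner)
    also have "\<dots> = 2 * (\<integral>\<^sup>+w. A' w \<partial>Mh) + 2 * (\<integral>\<^sup>+w. step_error n (\<pi> w) \<partial>Mh)"
      by (subst nn_integral_add) (auto simp: nn_integral_cmult)
    also have "(\<integral>\<^sup>+w. step_error n (\<pi> w) \<partial>Mh) = ?E" by (rule lift_nn_integral[OF step_error_measurable])
    also have "(\<integral>\<^sup>+w. A' w \<partial>Mh) \<le> (\<integral>\<^sup>+w. (\<integral>\<^sup>+t\<in>{0..T}. ennreal ((P t w - S t (\<pi> w))\<^sup>2) \<partial>lborel) \<partial>Mh)"
      unfolding A'_def by (intro nn_integral_mono) (auto simp: indicator_def)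
    finally have IJ: "(\<integral>\<^sup>+w. ennreal ((I w - J_step n w)\<^sup>2) \<partial>Mh)
        \<le> 2 * (\<integral>\<^sup>+w. (\<integral>\<^sup>+t\<in>{0..T}. ennreal ((P t w - S t (\<pi> w))\<^sup>2) \<partial>lborel) \<partial>Mh) + 2 * ?E"
      by (simp add: mult_left_mono)
    have "(\<integral>\<^sup>+w. ennreal ((J w - J_step n w)\<^sup>2) \<partial>Mh) \<le> (\<integral>\<^sup>+w. 2 * ennreal ((I w - J w)\<^sup>2) + 2 * ennreal ((I w - J_step n w)\<^sup>2) \<partial>Mh)"
      using sq_sum_le_ennreal by (intro nn_integral_mono) (metis power2_commute)
    also have "\<dots> = 2 * (\<integral>\<^sup>+w. ennreal ((I w - J w)\<^sup>2) \<partial>Mh) + 2 * (\<integral>\<^sup>+w. ennreal ((I w - J_step n w)\<^sup>2) \<partial>Mh)"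
      by (subst nn_integral_add) (auto simp: nn_integral_cmult)
    also have "\<dots> \<le> 2 * (\<integral>\<^sup>+w. ennreal ((I w - J w)\<^sup>2) \<partial>Mh) + 2 * (2 * (\<integral>\<^sup>+w. (\<integral>\<^sup>+t\<in>{0..T}. ennreal ((P t w - S t (\<pi> w))\<^sup>2) \<partial>lborel) \<partial>Mh) + 2 * ?E)"
      by (intro add_left_mono mult_left_mono IJ) simp
    finally show ?thesis unfolding P_def I_def K_def t_def x_def
      by (simp add: distrib_left mult.assoc[symmetric])
  qed
  have "(\<lambda>m. 2 * (\<integral>\<^sup>+w. ennreal ((simple_ito_integral (k m) (\<tau> m) (\<xi> m) B w - J w)\<^sup>2) \<partial>Mh)
      + (4 * (\<integral>\<^sup>+w. (\<integral>\<^sup>+t\<in>{0..T}. ennreal ((simple_process (k m) (\<tau> m) (\<xi> m) t w - S t (\<pi> w))\<^sup>2) \<partial>lborel) \<partial>Mh) + 4 * ?E))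
     \<longlonglongrightarrow> 2 * 0 + (4 * 0 + 4 * ?E)"
    by (intro tendsto_add tendsto_const ennreal_tendsto_cmult l1 l2) auto
  from LIMSEQ_le_const[OF this] bound show ?thesis by auto
qed

lemma J_measurable: "J \<in> borel_measurable Mh"
  using ito by (simp add: has_ito_integral_def)

lemma J_square_integrable: "integrable Mh (\<lambda>w. (J w)\<^sup>2)"
  and J_step_tendsto: "(\<lambda>n. hat.expectation (\<lambda>w. (J_step n w - J w)\<^sup>2)) \<longlonglongrightarrow> 0"
  and J_step_diff_integrable: "integrable Mh (\<lambda>w. (J_step n w - J w)\<^sup>2)"
proof -
  note [measurable] = J_measurable J_step_measurable
  have l4: "(\<lambda>n. 4 * (\<integral>\<^sup>+w. step_error n w \<partial>M)) \<longlonglongrightarrow> 4 * 0"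
    by (intro ennreal_tendsto_cmult step_error_tendsto) simp
  have lim: "(\<lambda>n. \<integral>\<^sup>+w. ennreal ((J_step n w - J w)\<^sup>2) \<partial>Mh) \<longlonglongrightarrow> 0"
  proof (rule tendsto_sandwich[OF _ _ tendsto_const])
    show "\<forall>\<^sub>F n in sequentially. (\<integral>\<^sup>+w. ennreal ((J_step n w - J w)\<^sup>2) \<partial>Mh) \<le> 4 * (\<integral>\<^sup>+w. step_error n w \<partial>M)"
      using J_step_error by (intro always_eventually allI) (simp only: power2_commute[of "J_step _ _"])
    show "\<forall>\<^sub>F n in sequentially. 0 \<le> (\<integral>\<^sup>+w. ennreal ((J_step n w - J w)\<^sup>2) \<partial>Mh)" by simp
    show "(\<lambda>n. 4 * (\<integral>\<^sup>+w. step_error n w \<partial>M)) \<longlonglongrightarrow> 0" using l4 by simp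
  qed
  then have "\<forall>\<^sub>F n in sequentially. (\<integral>\<^sup>+w. ennreal ((J_step n w - J w)\<^sup>2) \<partial>Mh) < 1"
    by (intro order_tendstoD) auto
  then obtain n0 where "(\<integral>\<^sup>+w. ennreal ((J_step n0 w - J w)\<^sup>2) \<partial>Mh) < 1" by (auto simp: eventually_sequentially)
  \<comment> \<open>One grid approximation at finite distance is enough for the square integrability
    of \<open>J\<close>, because it is square integrable itself.\<close>
  then have i0: "integrable Mh (\<lambda>w. (J_step n0 w - J w)\<^sup>2)"
    by (intro integrableI_bounded) (auto intro: less_trans)
  have sq: "(x - y)\<^sup>2 \<le> 2 * x\<^sup>2 + 2 * y\<^sup>2" for x y :: real
    using zero_le_power2[of "x + y"] by (simp add: power2_eq_square algebra_simps)
  show J2: "integrable Mh (\<lambda>w. (J w)\<^sup>2)"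
  proof (rule Bochner_Integration.integrable_bound)
    show "integrable Mh (\<lambda>w. 2 * (J_step n0 w)\<^sup>2 + 2 * (J_step n0 w - J w)\<^sup>2)" using i0 J_step_square_integrable by simp
    show "AE w in Mh. norm ((J w)\<^sup>2) \<le> norm (2 * (J_step n0 w)\<^sup>2 + 2 * (J_step n0 w - J w)\<^sup>2)"
    proof (intro AE_I2)
      fix w
      show "norm ((J w)\<^sup>2) \<le> norm (2 * (J_step n0 w)\<^sup>2 + 2 * (J_step n0 w - J w)\<^sup>2)"
        using sq[of "J_step n0 w" "J_step n0 w - J w"] by simp
    qed
  qed measurable
  show i: "integrable Mh (\<lambda>w. (J_step n w - J w)\<^sup>2)" for n
  proof (rule Bochner_Integration.integrable_bound)
    show "integrable Mh (\<lambda>w. 2 * (J_step n w)\<^sup>2 + 2 * (J w)\<^sup>2)" using J2 J_step_square_integrable by simp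
  qed (use sq in auto)
  have "(\<lambda>n. ennreal (hat.expectation (\<lambda>w. (J_step n w - J w)\<^sup>2))) \<longlonglongrightarrow> ennreal 0"
    using lim by (subst (asm) nn_integral_eq_integral[OF i]) auto
  then show "(\<lambda>n. hat.expectation (\<lambda>w. (J_step n w - J w)\<^sup>2)) \<longlonglongrightarrow> 0"
    by (subst (asm) tendsto_ennreal_iff) auto
qed

section \<open>Moments of the Ito integral weighted by functions of the price path\<close>

lemma B_incr_covariance:
  assumes "j < n" "k < n"
  shows "integrable Mh (\<lambda>w. B_incr n j w * B_incr n k w)"
    "hat.expectation (\<lambda>w. B_incr n j w * B_incr n k w) = (if j = k then T / real n else 0)"
proof -
  have one: "(\<lambda>w. 1 :: real) \<in> borel_measurable (Fh s)" for s by simp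
  have i: "integrable Mh (\<lambda>w. (B_incr n j w)\<^sup>2)" if "j < n" for j
    using hat.step_integral_square_integrable[OF grid_times[OF that] one] by (simp add: B_incr_def)
  show "integrable Mh (\<lambda>w. B_incr n j w * B_incr n k w)"
    using assms hat.increment_measurable[OF grid_times] by (intro hat.integrable_mult_of_squares i) (auto simp: B_incr_def[abs_def])
  have "hat.expectation (\<lambda>w. B_incr n j w * B_incr n k w) = measure lborel ({grid n j<..grid n (Suc j)} \<inter> {grid n k<..grid n (Suc k)})"
    using hat.step_covariance[OF grid_times[OF assms(1)] grid_times[OF assms(2)] one _ one] by (simp add: B_incr_def hat.prob_space)
  also have "\<dots> = (if j = k then T / real n else 0)"
  proof (cases "j = k")
    case True
    have "grid n (Suc k) - grid n k = T / real n" by (simp add: grid_def distrib_right add_divide_distrib)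
    then show ?thesis using True grid_times(2)[OF assms(2)] by simp
  next
    case False
    then have "Suc j \<le> k \<or> Suc k \<le> j" by auto
    then have "grid n (Suc j) \<le> grid n k \<or> grid n (Suc k) \<le> grid n j" using grid_mono by blast
    then have "{grid n j<..grid n (Suc j)} \<inter> {grid n k<..grid n (Suc k)} = {}" by auto
    then show ?thesis using False by (simp only: measure_empty if_False)
  qed
  finally show "hat.expectation (\<lambda>w. B_incr n j w * B_incr n k w) = (if j = k then T / real n else 0)" .
qed

text \<open>For the grid approximation both moments follow from the independence of the two paths;
  they pass to \<open>J\<close> by convergence in L^2, which a bounded weight respects.\<close>

lemma J_bounded_weight:
  assumes g[measurable]: "g \<in> borel_measurable borel" and gb: "\<And>z. \<bar>g z\<bar> \<le> (c::real)"
  shows "hat.expectation (\<lambda>w. g (S T (\<pi> w), avg (\<pi> w)) * J w) = 0"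
    and "hat.expectation (\<lambda>w. g (S T (\<pi> w), avg (\<pi> w)) * (J w)\<^sup>2) = expectation (\<lambda>w. g (S T w, avg w) * (LINT u:{0..T}|lborel. (S u w)\<^sup>2))"
proof -
  define G where "G w = g (S T w, avg w)" for w
  have ST[measurable]: "S T \<in> borel_measurable M" using T_pos by (auto intro: S_measurable)
  note [measurable] = avg_measurable J_measurable J_step_measurable \<pi>_measurable
  have Gm[measurable]: "G \<in> borel_measurable M" unfolding G_def[abs_def] by measurable
  have Gb: "\<bar>G w\<bar> \<le> c" for w by (simp add: G_def gb)
  have c0: "0 \<le> c" using order_trans[OF abs_ge_zero gb] by simp
  have GV: "(\<lambda>w. G (\<pi> w)) \<in> borel_measurable VW"
  proof -
    note [measurable] = avg_measurable_VW
    have [measurable]: "(\<lambda>w. S T (\<pi> w)) \<in> borel_measurable VW" using S_measurable_VW[of T] T_pos by auto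
    show ?thesis unfolding G_def by measurable
  qed
  have amG: "all_moments G" by (rule bounded_moments_bounded[of _ _ c]) (use Gb in auto)
  have GS: "(\<lambda>w. G (\<pi> w) * S (grid n k) (\<pi> w)) \<in> borel_measurable VW" "integrable Mh (\<lambda>w. G (\<pi> w) * S (grid n k) (\<pi> w))" if "k < n" for n k
  proof -
    show "(\<lambda>w. G (\<pi> w) * S (grid n k) (\<pi> w)) \<in> borel_measurable VW"
      using that by (intro borel_measurable_times GV S_measurable_VW grid_in) simp
    show "integrable Mh (\<lambda>w. G (\<pi> w) * S (grid n k) (\<pi> w))"
      using that by (intro lift_integrable[of "\<lambda>w. G w * S (grid n k) w"] all_moments_integrable bounded_moments_mult amG all_moments_S_grid) simp
  qed
  have GSS: "(\<lambda>w. G (\<pi> w) * S (grid n j) (\<pi> w) * S (grid n k) (\<pi> w)) \<in> borel_measurable VW"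
    "integrable Mh (\<lambda>w. G (\<pi> w) * S (grid n j) (\<pi> w) * S (grid n k) (\<pi> w))" if "j < n" "k < n" for n j k
  proof -
    show "(\<lambda>w. G (\<pi> w) * S (grid n j) (\<pi> w) * S (grid n k) (\<pi> w)) \<in> borel_measurable VW"
      using that by (intro borel_measurable_times GV S_measurable_VW grid_in) simp_all
    show "integrable Mh (\<lambda>w. G (\<pi> w) * S (grid n j) (\<pi> w) * S (grid n k) (\<pi> w))"
      using that by (intro lift_integrable[of "\<lambda>w. G w * S (grid n j) w * S (grid n k) w"] all_moments_integrable bounded_moments_mult amG all_moments_S_grid) simp_all
  qed
  have BV: "B_incr n k \<in> borel_measurable VB" if "k < n" for n k
    unfolding B_incr_def[abs_def] using that by (intro borel_measurable_diff B_measurable_VB grid_in) auto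
  have Bi: "integrable Mh (B_incr n k)" "hat.expectation (B_incr n k) = 0" if "k < n" for n k
    using hat.increment_mean[OF grid_times[OF that]] hat.all_moments_integrable[OF hat.all_moments_increment[OF grid_times[OF that]]]
    unfolding B_incr_def[abs_def] by auto
  have m1: "hat.expectation (\<lambda>w. G (\<pi> w) * J_step n w) = 0" for n
  proof -
    have "hat.expectation (\<lambda>w. G (\<pi> w) * J_step n w) = hat.expectation (\<lambda>w. \<Sum>k<n. (G (\<pi> w) * S (grid n k) (\<pi> w)) * B_incr n k w)"
      by (simp add: J_step_def sum_distrib_left mult.assoc)
    also have "\<dots> = (\<Sum>k<n. hat.expectation (\<lambda>w. (G (\<pi> w) * S (grid n k) (\<pi> w)) * B_incr n k w))"
      by (intro Bochner_Integration.integral_sum V_product(1) GS BV Bi) simp_all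
    also have "\<dots> = 0"
      by (intro sum.neutral ballI, subst V_product(2)) (simp_all add: GS BV Bi)
    finally show ?thesis .
  qed
  have m2: "hat.expectation (\<lambda>w. G (\<pi> w) * (J_step n w)\<^sup>2) = expectation (\<lambda>w. G w * (T * square_avg n w))" for n
  proof -
    have "hat.expectation (\<lambda>w. G (\<pi> w) * (J_step n w)\<^sup>2)
       = hat.expectation (\<lambda>w. \<Sum>j<n. \<Sum>k<n. (G (\<pi> w) * S (grid n j) (\<pi> w) * S (grid n k) (\<pi> w)) * (B_incr n j w * B_incr n k w))"
      unfolding J_step_def power2_eq_square sum_product by (simp add: sum_distrib_left mult_ac)
    also have "\<dots> = (\<Sum>j<n. \<Sum>k<n. hat.expectation (\<lambda>w. (G (\<pi> w) * S (grid n j) (\<pi> w) * S (grid n k) (\<pi> w)) * (B_incr n j w * B_incr n k w)))"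
    proof -
      have I: "integrable Mh (\<lambda>w. (G (\<pi> w) * S (grid n j) (\<pi> w) * S (grid n k) (\<pi> w)) * (B_incr n j w * B_incr n k w))" if "j < n" "k < n" for j k
        by (intro V_product(1) GSS borel_measurable_times BV B_incr_covariance that)
      have "hat.expectation (\<lambda>w. \<Sum>j<n. \<Sum>k<n. (G (\<pi> w) * S (grid n j) (\<pi> w) * S (grid n k) (\<pi> w)) * (B_incr n j w * B_incr n k w))
        = (\<Sum>j<n. hat.expectation (\<lambda>w. \<Sum>k<n. (G (\<pi> w) * S (grid n j) (\<pi> w) * S (grid n k) (\<pi> w)) * (B_incr n j w * B_incr n k w)))"
        by (intro Bochner_Integration.integral_sum Bochner_Integration.integrable_sum I) simp_all
      also have "\<dots> = (\<Sum>j<n. \<Sum>k<n. hat.expectation (\<lambda>w. (G (\<pi> w) * S (grid n j) (\<pi> w) * S (grid n k) (\<pi> w)) * (B_incr n j w * B_incr n k w)))"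
        by (intro sum.cong refl Bochner_Integration.integral_sum I) simp_all
      finally show ?thesis .
    qed
    also have "\<dots> = (\<Sum>j<n. \<Sum>k<n. hat.expectation (\<lambda>w. G (\<pi> w) * S (grid n j) (\<pi> w) * S (grid n k) (\<pi> w)) * (if j = k then T / real n else 0))"
      by (intro sum.cong refl, subst V_product(2)) (simp_all add: GSS BV B_incr_covariance borel_measurable_times)
    also have "\<dots> = (\<Sum>j<n. hat.expectation (\<lambda>w. G (\<pi> w) * S (grid n j) (\<pi> w) * S (grid n j) (\<pi> w)) * (T / real n))"
      by (intro sum.cong refl) (simp add: if_distrib cong: if_cong)
    also have "\<dots> = (\<Sum>j<n. expectation (\<lambda>w. G w * S (grid n j) w * S (grid n j) w * (T / real n)))"
    proof (intro sum.cong refl)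
      fix j assume "j \<in> {..<n}"
      then have [measurable]: "S (grid n j) \<in> borel_measurable M" by (intro S_measurable grid_in) simp
      show "hat.expectation (\<lambda>w. G (\<pi> w) * S (grid n j) (\<pi> w) * S (grid n j) (\<pi> w)) * (T / real n) = expectation (\<lambda>w. G w * S (grid n j) w * S (grid n j) w * (T / real n))"
        using lift_expectation(1)[of "\<lambda>w. G w * S (grid n j) w * S (grid n j) w"] by simp
    qed
    also have "\<dots> = expectation (\<lambda>w. \<Sum>j<n. G w * S (grid n j) w * S (grid n j) w * (T / real n))"
      by (intro Bochner_Integration.integral_sum[symmetric] integrable_mult_left all_moments_integrable bounded_moments_mult amG all_moments_S_grid) simp_all
    also have "\<dots> = expectation (\<lambda>w. G w * (T * square_avg n w))"
      by (intro Bochner_Integration.integral_cong refl)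
         (simp add: square_avg_def sum_distrib_left sum_divide_distrib power2_eq_square mult_ac)
    finally show ?thesis .
  qed
  have G2: "integrable Mh (\<lambda>w. (G (\<pi> w))\<^sup>2)"
    by (intro lift_integrable[of "\<lambda>w. (G w)\<^sup>2"] all_moments_integrable bounded_moments_power amG)
  have iGJ: "integrable Mh (\<lambda>w. G (\<pi> w) * J w)" by (intro hat.integrable_mult_of_squares G2 J_square_integrable) measurable
  have iGJs: "integrable Mh (\<lambda>w. G (\<pi> w) * J_step n w)" for n by (intro hat.integrable_mult_of_squares G2 J_step_square_integrable) measurable
  have "(\<lambda>n. hat.expectation (\<lambda>w. (J_step n w - J w) * G (\<pi> w))) \<longlonglongrightarrow> 0"
    by (rule hat.tendsto_expectation_mult(2)[where B="hat.expectation (\<lambda>w. (G (\<pi> w))\<^sup>2)"])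
       (auto intro!: J_step_diff_integrable J_step_tendsto G2)
  moreover have "hat.expectation (\<lambda>w. (J_step n w - J w) * G (\<pi> w)) = - hat.expectation (\<lambda>w. G (\<pi> w) * J w)" for n
  proof -
    have "hat.expectation (\<lambda>w. (J_step n w - J w) * G (\<pi> w)) = hat.expectation (\<lambda>w. G (\<pi> w) * J_step n w - G (\<pi> w) * J w)"
      by (simp add: algebra_simps)
    then show ?thesis using iGJ iGJs m1 by simp
  qed
  ultimately show "hat.expectation (\<lambda>w. g (S T (\<pi> w), avg (\<pi> w)) * J w) = 0"
    using LIMSEQ_unique[OF tendsto_const] unfolding G_def by fastforce
  \<comment> \<open>\<open>(J_step n w - J w) * R n w\<close> is the weighted difference of the
    squares of \<open>J_step n\<close> and \<open>J\<close>; the sum of the two is written as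
    \<open>(J_step n w - J w) + 2 * J w\<close> because both parts are bounded in L^2.\<close>
  define R where "R n w = G (\<pi> w) * ((J_step n w - J w) + 2 * J w)" for n w
  have [measurable]: "R n \<in> borel_measurable Mh" for n unfolding R_def[abs_def] by measurable
  obtain BD where BD: "\<And>n. hat.expectation (\<lambda>w. (J_step n w - J w)\<^sup>2) \<le> BD"
    using convergent_imp_bounded[OF J_step_tendsto] by (auto simp: bounded_iff intro: order_trans[OF abs_ge_self])
  have Rle: "(R n w)\<^sup>2 \<le> c\<^sup>2 * (2 * (J_step n w - J w)\<^sup>2 + 8 * (J w)\<^sup>2)" for n w
  proof -
    have "(x + 2 * y)\<^sup>2 \<le> 2 * x\<^sup>2 + 8 * y\<^sup>2" for x y :: real
      using zero_le_power2[of "x - 2 * y"] by (simp add: power2_eq_square algebra_simps)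
    note le = this[of "J_step n w - J w" "J w"]
    have "(G (\<pi> w))\<^sup>2 \<le> c\<^sup>2" using power_mono[OF Gb[of "\<pi> w"], of 2] by simp
    then show ?thesis unfolding R_def power_mult_distrib using le by (intro mult_mono zero_le_power2)
  qed
  have iR0: "integrable Mh (\<lambda>w. c\<^sup>2 * (2 * (J_step n w - J w)\<^sup>2 + 8 * (J w)\<^sup>2))" for n
    using J_step_diff_integrable J_square_integrable by simp
  have iR: "integrable Mh (\<lambda>w. (R n w)\<^sup>2)" for n
    by (rule Bochner_Integration.integrable_bound[OF iR0[of n]]) (use Rle in auto)
  have "(\<lambda>n. hat.expectation (\<lambda>w. (J_step n w - J w) * R n w)) \<longlonglongrightarrow> 0"
  proof (rule hat.tendsto_expectation_mult(2)[where B="c\<^sup>2 * (2 * BD + 8 * hat.expectation (\<lambda>w. (J w)\<^sup>2))"])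
    fix n
    have "hat.expectation (\<lambda>w. (R n w)\<^sup>2) \<le> hat.expectation (\<lambda>w. c\<^sup>2 * (2 * (J_step n w - J w)\<^sup>2 + 8 * (J w)\<^sup>2))"
      by (intro integral_mono iR iR0 Rle)
    also have "\<dots> = c\<^sup>2 * (2 * hat.expectation (\<lambda>w. (J_step n w - J w)\<^sup>2) + 8 * hat.expectation (\<lambda>w. (J w)\<^sup>2))"
      using J_step_diff_integrable[of n] J_square_integrable by simp
    also have "\<dots> \<le> c\<^sup>2 * (2 * BD + 8 * hat.expectation (\<lambda>w. (J w)\<^sup>2))"
      using BD[of n] by (intro mult_left_mono) auto
    finally show "hat.expectation (\<lambda>w. (R n w)\<^sup>2) \<le> c\<^sup>2 * (2 * BD + 8 * hat.expectation (\<lambda>w. (J w)\<^sup>2))" .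
  qed (auto intro!: J_step_diff_integrable J_step_tendsto iR)
  moreover have "hat.expectation (\<lambda>w. (J_step n w - J w) * R n w) = expectation (\<lambda>w. G w * (T * square_avg n w)) - hat.expectation (\<lambda>w. G (\<pi> w) * (J w)\<^sup>2)" for n
  proof -
    have b: "integrable Mh (\<lambda>w. G (\<pi> w) * X w)" if "integrable Mh X" for X
    proof (rule Bochner_Integration.integrable_bound)
      show "integrable Mh (\<lambda>w. c * X w)" using that by simp
      show "AE w in Mh. norm (G (\<pi> w) * X w) \<le> norm (c * X w)"
        using Gb c0 by (intro AE_I2) (auto simp: abs_mult intro!: mult_right_mono)
      have [measurable]: "X \<in> borel_measurable Mh" using that by auto
      show "(\<lambda>w. G (\<pi> w) * X w) \<in> borel_measurable Mh" by measurable
    qed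
    have "hat.expectation (\<lambda>w. (J_step n w - J w) * R n w) = hat.expectation (\<lambda>w. G (\<pi> w) * (J_step n w)\<^sup>2 - G (\<pi> w) * (J w)\<^sup>2)"
      by (intro Bochner_Integration.integral_cong) (auto simp: R_def power2_eq_square algebra_simps)
    also have "\<dots> = hat.expectation (\<lambda>w. G (\<pi> w) * (J_step n w)\<^sup>2) - hat.expectation (\<lambda>w. G (\<pi> w) * (J w)\<^sup>2)"
      by (intro Bochner_Integration.integral_diff b J_step_square_integrable J_square_integrable)
    finally show ?thesis unfolding m2 .
  qed
  ultimately have "(\<lambda>n. expectation (\<lambda>w. G w * (T * square_avg n w)) - hat.expectation (\<lambda>w. G (\<pi> w) * (J w)\<^sup>2)) \<longlonglongrightarrow> 0" by simp
  then have L1: "(\<lambda>n. expectation (\<lambda>w. G w * (T * square_avg n w))) \<longlonglongrightarrow> hat.expectation (\<lambda>w. G (\<pi> w) * (J w)\<^sup>2)" by (rule LIM_zero_cancel)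
  let ?I = "\<lambda>w. LINT u:{0..T}|lborel. (S u w)\<^sup>2"
  have amsq: "all_moments (square_avg n)" for n by (rule bounded_moments_member[OF bounded_moments_square_avg]) simp
  have "(\<lambda>n. expectation (\<lambda>w. \<bar>G w * (T * square_avg n w) - G w * ?I w\<bar> ^ 1)) \<longlonglongrightarrow> 0"
  proof (rule bounded_moments_tendsto)
    have "bounded_moments UNIV (\<lambda>n::nat. G)" "bounded_moments UNIV (\<lambda>n::nat. ?I)"
      using bounded_moments_subfamily[OF amG, where g="\<lambda>_. ()"] bounded_moments_subfamily[OF all_moments_square_integral, where g="\<lambda>_. ()"] by auto
    then show "bounded_moments UNIV (\<lambda>n w. G w * (T * square_avg n w) - G w * ?I w)"
      by (intro bounded_moments_diff bounded_moments_mult bounded_moments_square_avg bounded_moments_const)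
    have "(\<lambda>n. G w * (T * square_avg n w) - G w * ?I w) \<longlonglongrightarrow> G w * (T * ((1 / T) * ?I w)) - G w * ?I w" if "w \<in> space M" for w
      by (intro tendsto_diff tendsto_mult tendsto_const square_avg_tendsto that)
    then show "AE w in M. (\<lambda>n. G w * (T * square_avg n w) - G w * ?I w) \<longlonglongrightarrow> 0" using T_pos by simp
  qed simp
  then have "(\<lambda>n. expectation (\<lambda>w. G w * (T * square_avg n w) - G w * ?I w)) \<longlonglongrightarrow> 0"
  proof (rule Lim_null_comparison[rotated], intro always_eventually allI)
    show "norm (expectation (\<lambda>w. G w * (T * square_avg n w) - G w * ?I w)) \<le> expectation (\<lambda>w. \<bar>G w * (T * square_avg n w) - G w * ?I w\<bar> ^ 1)" for n
      unfolding power_one_right real_norm_def by (rule integral_abs_bound)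
  qed
  moreover have "expectation (\<lambda>w. G w * (T * square_avg n w) - G w * ?I w) = expectation (\<lambda>w. G w * (T * square_avg n w)) - expectation (\<lambda>w. G w * ?I w)" for n
    by (rule Bochner_Integration.integral_diff; rule all_moments_integrable, rule bounded_moments_mult[OF amG])
       (rule bounded_moments_mult[OF bounded_moments_const amsq] all_moments_square_integral)+
  ultimately have "(\<lambda>n. expectation (\<lambda>w. G w * (T * square_avg n w)) - expectation (\<lambda>w. G w * ?I w)) \<longlonglongrightarrow> 0" by simp
  then have "(\<lambda>n. expectation (\<lambda>w. G w * (T * square_avg n w))) \<longlonglongrightarrow> expectation (\<lambda>w. G w * ?I w)" by (rule LIM_zero_cancel)
  from LIMSEQ_unique[OF L1 this] show "hat.expectation (\<lambda>w. g (S T (\<pi> w), avg (\<pi> w)) * (J w)\<^sup>2) = expectation (\<lambda>w. g (S T w, avg w) * ?I w)"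
    unfolding G_def .
qed

text \<open>Truncating the weight reduces to the bounded case. The first moment passes to the limit
  by domination; the second is approached monotonically from below, which yields integrability
  together with the value.\<close>

proposition J_weighted_moments:
  assumes g[measurable]: "g \<in> borel_measurable borel" and gm: "all_moments (\<lambda>w. g (S T w, avg w))"
  shows "hat.expectation (\<lambda>w. g (S T (\<pi> w), avg (\<pi> w)) * J w) = 0"
    and "integrable Mh (\<lambda>w. (g (S T (\<pi> w), avg (\<pi> w)) * J w)\<^sup>2)"
    and "hat.expectation (\<lambda>w. (g (S T (\<pi> w), avg (\<pi> w)) * J w)\<^sup>2) = expectation (\<lambda>w. (g (S T w, avg w))\<^sup>2 * (LINT u:{0..T}|lborel. (S u w)\<^sup>2))"
proof -
  have ST[measurable]: "S T \<in> borel_measurable M" using T_pos by (auto intro: S_measurable)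
  note [measurable] = avg_measurable J_measurable \<pi>_measurable
  let ?Z = "\<lambda>w. (S T w, avg w)" and ?I = "\<lambda>w. LINT u:{0..T}|lborel. (S u w)\<^sup>2"
  have g2: "integrable Mh (\<lambda>w. (g (?Z (\<pi> w)))\<^sup>2)"
    by (intro lift_integrable[of "\<lambda>w. (g (?Z w))\<^sup>2"] all_moments_integrable bounded_moments_power gm)
  have igJ: "integrable Mh (\<lambda>w. g (?Z (\<pi> w)) * J w)"
    by (intro hat.integrable_mult_of_squares g2 J_square_integrable) measurable
  define t where "t m z = max (- real m) (min (real m) (g z))" for m z
  have [measurable]: "t m \<in> borel_measurable borel" for m unfolding t_def[abs_def] by measurable
  have tb: "\<bar>t m z\<bar> \<le> real m" "\<bar>t m z\<bar> \<le> \<bar>g z\<bar>" for m z by (auto simp: t_def)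
  have tlim: "(\<lambda>m. t m z) \<longlonglongrightarrow> g z" for z
  proof (rule tendsto_eventually)
    obtain m0 where "\<bar>g z\<bar> \<le> real m0" using real_arch_simple by blast
    then have "t m z = g z" if "m \<ge> m0" for m
    proof -
      have "real m0 \<le> real m" using that by simp
      then show ?thesis using \<open>\<bar>g z\<bar> \<le> real m0\<close> unfolding t_def by linarith
    qed
    then show "\<forall>\<^sub>F m in sequentially. t m z = g z" by (auto simp: eventually_sequentially)
  qed
  have "(\<lambda>m. hat.expectation (\<lambda>w. t m (?Z (\<pi> w)) * J w)) \<longlonglongrightarrow> hat.expectation (\<lambda>w. g (?Z (\<pi> w)) * J w)"
  proof (rule integral_dominated_convergence[where w="\<lambda>w. \<bar>g (?Z (\<pi> w)) * J w\<bar>"])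
    show "AE w in Mh. (\<lambda>m. t m (?Z (\<pi> w)) * J w) \<longlonglongrightarrow> g (?Z (\<pi> w)) * J w"
      by (intro AE_I2 tendsto_mult tlim tendsto_const)
    show "AE w in Mh. norm (t m (?Z (\<pi> w)) * J w) \<le> \<bar>g (?Z (\<pi> w)) * J w\<bar>" for m
      by (intro AE_I2) (simp add: abs_mult mult_right_mono tb)
  qed (use igJ in auto)
  moreover have "hat.expectation (\<lambda>w. t m (?Z (\<pi> w)) * J w) = 0" for m
    by (rule J_bounded_weight(1)[of "t m" "real m"]) (auto simp: tb)
  ultimately show "hat.expectation (\<lambda>w. g (?Z (\<pi> w)) * J w) = 0"
    using LIMSEQ_unique[OF tendsto_const] by fastforce
  define q where "q m z = min (real m) ((g z)\<^sup>2)" for m z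
  have [measurable]: "q m \<in> borel_measurable borel" for m unfolding q_def[abs_def] by measurable
  have qb: "\<bar>q m z\<bar> \<le> real m" "0 \<le> q m z" "q m z \<le> (g z)\<^sup>2" for m z by (auto simp: q_def)
  have qlim: "(\<lambda>m. q m z) \<longlonglongrightarrow> (g z)\<^sup>2" for z
  proof (rule tendsto_eventually)
    obtain m0 where "(g z)\<^sup>2 \<le> real m0" using real_arch_simple by blast
    then have "q m z = (g z)\<^sup>2" if "m \<ge> m0" for m
    proof -
      have "real m0 \<le> real m" using that by simp
      then show ?thesis using \<open>(g z)\<^sup>2 \<le> real m0\<close> unfolding q_def by linarith
    qed
    then show "\<forall>\<^sub>F m in sequentially. q m z = (g z)\<^sup>2" by (auto simp: eventually_sequentially)
  qed
  have iqJ: "integrable Mh (\<lambda>w. q m (?Z (\<pi> w)) * (J w)\<^sup>2)" for m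
  proof (rule Bochner_Integration.integrable_bound)
    show "integrable Mh (\<lambda>w. real m * (J w)\<^sup>2)" using J_square_integrable by simp
    show "AE w in Mh. norm (q m (?Z (\<pi> w)) * (J w)\<^sup>2) \<le> norm (real m * (J w)\<^sup>2)"
      by (intro AE_I2) (auto simp: abs_mult intro!: mult_right_mono qb)
  qed measurable
  have igI: "integrable M (\<lambda>w. (g (?Z w))\<^sup>2 * ?I w)"
    by (intro all_moments_integrable bounded_moments_mult bounded_moments_power gm all_moments_square_integral)
  have [measurable]: "?I \<in> borel_measurable M" by (rule all_moments_measurable[OF all_moments_square_integral])
  have "(\<lambda>m. expectation (\<lambda>w. q m (?Z w) * ?I w)) \<longlonglongrightarrow> expectation (\<lambda>w. (g (?Z w))\<^sup>2 * ?I w)"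
  proof (rule integral_dominated_convergence[where w="\<lambda>w. \<bar>(g (?Z w))\<^sup>2 * ?I w\<bar>"])
    show "AE w in M. (\<lambda>m. q m (?Z w) * ?I w) \<longlonglongrightarrow> (g (?Z w))\<^sup>2 * ?I w"
      by (intro AE_I2 tendsto_mult qlim tendsto_const)
    show "AE w in M. norm (q m (?Z w) * ?I w) \<le> \<bar>(g (?Z w))\<^sup>2 * ?I w\<bar>" for m
      by (intro AE_I2) (auto simp: abs_mult qb intro!: mult_right_mono)
  qed (use igI in auto)
  moreover have "hat.expectation (\<lambda>w. q m (?Z (\<pi> w)) * (J w)\<^sup>2) = expectation (\<lambda>w. q m (?Z w) * ?I w)" for m
    by (rule J_bounded_weight(2)[OF _ qb(1)]) measurable
  ultimately have lim: "(\<lambda>m. hat.expectation (\<lambda>w. q m (?Z (\<pi> w)) * (J w)\<^sup>2)) \<longlonglongrightarrow> expectation (\<lambda>w. (g (?Z w))\<^sup>2 * ?I w)" by simp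
  have mono: "AE w in Mh. incseq (\<lambda>m. q m (?Z (\<pi> w)) * (J w)\<^sup>2)"
    by (intro AE_I2 incseq_SucI mult_right_mono) (auto simp: q_def)
  have pt: "AE w in Mh. (\<lambda>m. q m (?Z (\<pi> w)) * (J w)\<^sup>2) \<longlonglongrightarrow> (g (?Z (\<pi> w)) * J w)\<^sup>2"
    unfolding power_mult_distrib by (intro AE_I2 tendsto_mult qlim tendsto_const)
  have m: "(\<lambda>w. (g (?Z (\<pi> w)) * J w)\<^sup>2) \<in> borel_measurable Mh" by measurable
  have "has_bochner_integral Mh (\<lambda>w. (g (?Z (\<pi> w)) * J w)\<^sup>2) (expectation (\<lambda>w. (g (?Z w))\<^sup>2 * ?I w))"
  proof (rule has_bochner_integral_monotone_convergence[OF iqJ _ pt lim m])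
    show "AE w in Mh. mono (\<lambda>m. q m (?Z (\<pi> w)) * (J w)\<^sup>2)" using mono by simp
  qed
  then show "integrable Mh (\<lambda>w. (g (?Z (\<pi> w)) * J w)\<^sup>2)"
    "hat.expectation (\<lambda>w. (g (?Z (\<pi> w)) * J w)\<^sup>2) = expectation (\<lambda>w. (g (?Z w))\<^sup>2 * ?I w)"
    by (auto simp: has_bochner_integral_iff)
qed

end

section \<open>Measurability of the partial derivative\<close>

text \<open>Where \<open>f\<close> is not differentiable, \<^const>\<open>partial2\<close> takes one and the same arbitrary value.
  The set of differentiability is measurable because, by continuity, rational increments suffice in
  the Cauchy criterion for the difference quotients.\<close>

lemma differentiable_iff_rational_Cauchy:
  fixes f :: "real \<Rightarrow> real" and y :: real
  assumes cont: "continuous_on UNIV f"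
  defines "q \<equiv> \<lambda>h. (f (y + h) - f y) / h"
  shows "f field_differentiable (at y) \<longleftrightarrow>
    (\<forall>k::nat. \<exists>j::nat. \<forall>a\<in>\<rat>. \<forall>b\<in>\<rat>. 0 < \<bar>a\<bar> \<and> \<bar>a\<bar> < 1 / real (Suc j) \<and> 0 < \<bar>b\<bar> \<and> \<bar>b\<bar> < 1 / real (Suc j) \<longrightarrow>
      \<bar>q a - q b\<bar> \<le> 1 / real (Suc k))" (is "_ \<longleftrightarrow> ?C")
proof
  assume "f field_differentiable (at y)"
  then obtain L where "(f has_field_derivative L) (at y)" by (auto simp: field_differentiable_def)
  then have L: "q \<midarrow>0\<rightarrow> L" by (simp add: DERIV_def q_def)
  show ?C
  proof
    fix k :: nat
    have "0 < 1 / (2 * real (Suc k))" by simp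
    from LIM_D[OF L this] obtain s where s: "s > 0" "\<And>x. x \<noteq> 0 \<Longrightarrow> \<bar>x\<bar> < s \<Longrightarrow> \<bar>q x - L\<bar> < 1 / (2 * real (Suc k))" by auto
    obtain j where j: "1 / real (Suc j) < s" using nat_approx_posE[OF s(1)] by blast
    have "\<bar>q a - q b\<bar> \<le> 1 / real (Suc k)" if "0 < \<bar>a\<bar>" "\<bar>a\<bar> < 1 / real (Suc j)" "0 < \<bar>b\<bar>" "\<bar>b\<bar> < 1 / real (Suc j)" for a b
    proof -
      have "\<bar>q a - L\<bar> < 1 / (2 * real (Suc k))" "\<bar>q b - L\<bar> < 1 / (2 * real (Suc k))"
        using s(2)[of a] s(2)[of b] that j by auto
      moreover have "2 * (1 / (2 * real (Suc k))) = 1 / real (Suc k)" by (simp only: mult_divide_mult_cancel_left_if times_divide_eq_right) simp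
      ultimately show ?thesis unfolding abs_less_iff abs_le_iff by argo
    qed
    then show "\<exists>j::nat. \<forall>a\<in>\<rat>. \<forall>b\<in>\<rat>. 0 < \<bar>a\<bar> \<and> \<bar>a\<bar> < 1 / real (Suc j) \<and> 0 < \<bar>b\<bar> \<and> \<bar>b\<bar> < 1 / real (Suc j) \<longrightarrow> \<bar>q a - q b\<bar> \<le> 1 / real (Suc k)"
      by blast
  qed
next
  assume C: ?C
  have qc: "isCont q h" if "h \<noteq> 0" for h
  proof -
    have "isCont f x" for x using cont by (simp add: continuous_on_eq_continuous_at)
    then have "isCont (\<lambda>h. f (y + h)) h" by (intro isCont_o2[where f="\<lambda>h. y + h" and g=f]) simp_all
    then show ?thesis unfolding q_def using that by simp
  qed
  have ext: "\<bar>q h - q b\<bar> \<le> e"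
    if e: "\<And>a. a \<in> \<rat> \<Longrightarrow> 0 < \<bar>a\<bar> \<Longrightarrow> \<bar>a\<bar> < r \<Longrightarrow> \<bar>q a - q b\<bar> \<le> e" and h: "0 < \<bar>h\<bar>" "\<bar>h\<bar> < r" for h b r e
  proof (rule ccontr)
    assume "\<not> \<bar>q h - q b\<bar> \<le> e"
    then have gt: "e < \<bar>q h - q b\<bar>" by simp
    have c1: "((\<lambda>x. \<bar>q x - q b\<bar>) \<longlongrightarrow> \<bar>q h - q b\<bar>) (at h)"
      using qc[of h] h by (intro tendsto_rabs tendsto_diff tendsto_const) (auto simp: isCont_def)
    have c2: "((\<lambda>x. \<bar>x\<bar>) \<longlongrightarrow> \<bar>h\<bar>) (at h)" by (intro tendsto_rabs tendsto_ident_at)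
    have "\<forall>\<^sub>F x in at h. e < \<bar>q x - q b\<bar> \<and> 0 < \<bar>x\<bar> \<and> \<bar>x\<bar> < r"
      using order_tendstoD(1)[OF c1 gt] order_tendstoD(1)[OF c2 h(1)] order_tendstoD(2)[OF c2 h(2)] by eventually_elim auto
    then obtain d where d: "d > 0" "\<And>x. x \<noteq> h \<Longrightarrow> dist x h < d \<Longrightarrow> e < \<bar>q x - q b\<bar> \<and> 0 < \<bar>x\<bar> \<and> \<bar>x\<bar> < r"
      by (auto simp: eventually_at)
    obtain a where a: "a \<in> \<rat>" "h < a" "a < h + d" using Rats_dense_in_real[of h "h + d"] d(1) by auto
    then have "dist a h < d" by (simp add: dist_real_def)
    then show False using d(2)[of a] e[of a] a by auto
  qed
  \<comment> \<open>A rational null sequence; the double \<open>Suc\<close> makes \<open>s n\<close>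
    strictly smaller than \<open>1 / real (Suc n)\<close>.\<close>
  define s where "s n = 1 / real (Suc (Suc n))" for n
  have s: "s n \<in> \<rat>" "0 < s n" "s n < 1 / real (Suc n)" for n by (auto simp: s_def field_simps)
  have s0: "\<bar>s n\<bar> = s n" for n using s(2)[of n] by simp
  have smono: "s n < 1 / real (Suc j)" if "j \<le> n" for n j
  proof -
    have "s n < 1 / real (Suc n)" by (rule s(3))
    also have "\<dots> \<le> 1 / real (Suc j)" using that by (simp add: frac_le)
    finally show ?thesis .
  qed
  have "Cauchy (\<lambda>n. q (s n))"
  proof (rule metric_CauchyI)
    fix e :: real assume "e > 0"
    then obtain k where k: "1 / real (Suc k) < e" using nat_approx_posE by blast
    obtain j where j: "\<And>a b. a \<in> \<rat> \<Longrightarrow> b \<in> \<rat> \<Longrightarrow> 0 < \<bar>a\<bar> \<Longrightarrow> \<bar>a\<bar> < 1 / real (Suc j) \<Longrightarrow> 0 < \<bar>b\<bar> \<Longrightarrow> \<bar>b\<bar> < 1 / real (Suc j) \<Longrightarrow> \<bar>q a - q b\<bar> \<le> 1 / real (Suc k)"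
      using C by meson
    show "\<exists>M. \<forall>m\<ge>M. \<forall>n\<ge>M. dist (q (s m)) (q (s n)) < e"
    proof (intro exI allI impI)
      fix m n assume "j \<le> m" "j \<le> n"
      then have "\<bar>q (s m) - q (s n)\<bar> \<le> 1 / real (Suc k)" using smono s by (intro j) (auto simp: s0)
      then show "dist (q (s m)) (q (s n)) < e" using k by (simp add: dist_real_def)
    qed
  qed
  then obtain L where L: "(\<lambda>n. q (s n)) \<longlonglongrightarrow> L" by (auto simp: Cauchy_convergent_iff convergent_def)
  have "q \<midarrow>0\<rightarrow> L"
  proof (rule LIM_I)
    fix e :: real assume "e > 0"
    then obtain k where k: "1 / real (Suc k) < e" using nat_approx_posE by blast
    obtain j where j: "\<And>a b. a \<in> \<rat> \<Longrightarrow> b \<in> \<rat> \<Longrightarrow> 0 < \<bar>a\<bar> \<Longrightarrow> \<bar>a\<bar> < 1 / real (Suc j) \<Longrightarrow> 0 < \<bar>b\<bar> \<Longrightarrow> \<bar>b\<bar> < 1 / real (Suc j) \<Longrightarrow> \<bar>q a - q b\<bar> \<le> 1 / real (Suc k)"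
      using C by meson
    show "\<exists>d>0. \<forall>x. x \<noteq> 0 \<and> norm (x - 0) < d \<longrightarrow> norm (q x - L) < e"
    proof (intro exI conjI allI impI)
      fix h :: real assume h: "h \<noteq> 0 \<and> norm (h - 0) < 1 / real (Suc j)"
      have "\<bar>q h - q (s n)\<bar> \<le> 1 / real (Suc k)" if "j \<le> n" for n
      proof (rule ext[where r="1 / real (Suc j)"])
        show "\<bar>q a - q (s n)\<bar> \<le> 1 / real (Suc k)" if "a \<in> \<rat>" "0 < \<bar>a\<bar>" "\<bar>a\<bar> < 1 / real (Suc j)" for a
          by (rule j) (use that s(1,2)[of n] smono[OF \<open>j \<le> n\<close>] in \<open>simp_all add: s0\<close>)
      qed (use h in simp_all)
      moreover have "(\<lambda>n. \<bar>q h - q (s n)\<bar>) \<longlonglongrightarrow> \<bar>q h - L\<bar>" by (intro tendsto_rabs tendsto_diff tendsto_const L)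
      ultimately have "\<bar>q h - L\<bar> \<le> 1 / real (Suc k)" by (intro LIMSEQ_le_const2) auto
      then show "norm (q h - L) < e" using k by simp
    qed simp
  qed
  then show "f field_differentiable (at y)" unfolding field_differentiable_def DERIV_def q_def by blast
qed

lemma partial2_measurable:
  assumes f[measurable]: "f \<in> borel_measurable borel" and cont: "\<And>x. continuous_on UNIV (\<lambda>y. f (x, y))"
  shows "partial2 f \<in> borel_measurable borel"
proof -
  define q where "q h z = (f (fst z, snd z + h) - f z) / h" for h :: real and z :: "real \<times> real"
  have qm[measurable]: "q h \<in> borel_measurable borel" for h
  proof -
    have "(\<lambda>z :: real \<times> real. f (fst z, snd z + h)) \<in> borel_measurable borel"
      by (rule measurable_compose[OF _ f]) (simp add: borel_prod[symmetric])
    then show ?thesis unfolding q_def[abs_def] by measurable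
  qed
  define D where "D z \<longleftrightarrow> (\<lambda>y. f (fst z, y)) field_differentiable (at (snd z))" for z
  have D_eq: "D z \<longleftrightarrow> (\<forall>k::nat. \<exists>j::nat. \<forall>a\<in>\<rat>. \<forall>b\<in>\<rat>. 0 < \<bar>a\<bar> \<and> \<bar>a\<bar> < 1 / real (Suc j) \<and> 0 < \<bar>b\<bar> \<and> \<bar>b\<bar> < 1 / real (Suc j) \<longrightarrow>
      \<bar>q a z - q b z\<bar> \<le> 1 / real (Suc k))" for z
    unfolding D_def differentiable_iff_rational_Cauchy[OF cont] q_def by simp
  have Dm: "Measurable.pred borel D"
    unfolding D_eq[abs_def]
    by (intro pred_intros_countable measurable_pred_countable countable_rat pred_intros_logic) measurable
  have "partial2 f z = (if D z then lim (\<lambda>n. q (1 / real (Suc n)) z) else (SOME d. False))" for z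
  proof (cases "D z")
    case True
    then have "((\<lambda>y. f (fst z, y)) has_field_derivative partial2 f z) (at (snd z))"
      unfolding partial2_def D_def by (simp add: DERIV_deriv_iff_field_differentiable)
    then have "(\<lambda>h. q h z) \<midarrow>0\<rightarrow> partial2 f z" by (simp add: DERIV_def q_def)
    moreover have "filterlim (\<lambda>n. 1 / real (Suc n)) (at 0) sequentially"
      using LIMSEQ_inverse_real_of_nat by (auto simp: filterlim_at inverse_eq_divide)
    ultimately have "(\<lambda>n. q (1 / real (Suc n)) z) \<longlonglongrightarrow> partial2 f z" by (rule filterlim_compose)
    then show ?thesis using True by (simp add: limI)
  next
    case False
    then have "\<not> ((\<lambda>y. f (fst z, y)) has_field_derivative d) (at (snd z))" for d
      by (auto simp: D_def field_differentiable_def)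
    then show ?thesis using False by (simp add: partial2_def deriv_def)
  qed
  then have "partial2 f = (\<lambda>z. if D z then lim (\<lambda>n. q (1 / real (Suc n)) z) else (SOME d. False))" by (rule ext)
  also have "\<dots> \<in> borel_measurable borel"
    using Dm by measurable
  finally show ?thesis .
qed

section \<open>Payoff functions of polynomial growth\<close>

locale payoff = black_scholes M F T W S0 r \<sigma>
  for M :: "'a measure" and F :: "real \<Rightarrow> 'a measure" and T :: real and W :: "real \<Rightarrow> 'a \<Rightarrow> real" and S0 r \<sigma> :: real +
  fixes f :: "real \<times> real \<Rightarrow> real" and C p :: real
  assumes f_measurable[measurable]: "f \<in> borel_measurable borel"
    and f_square: "integrable M (\<lambda>w. (f (asset_price S0 r \<sigma> W T w, average_price T S0 r \<sigma> W w))\<^sup>2)"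
    and C_pos: "C > 0" and p_pos: "p > 0"
    and f_lipschitz: "\<And>x y1 y2. \<bar>f (x, y1) - f (x, y2)\<bar> \<le> C * (1 + \<bar>x\<bar> powr p + \<bar>y1\<bar> powr p + \<bar>y2\<bar> powr p) * \<bar>y1 - y2\<bar>"
    and f_domain: "AE w in M. (asset_price S0 r \<sigma> W T w, average_price T S0 r \<sigma> W w) \<in> partial2_domain f"
begin

text \<open>The Lipschitz factor grows with the arguments, so the comparison is confined to distance
  1 from \<open>y\<close>, where it is uniform. Measurability of the derivative rests on this
  continuity.\<close>

lemma f_continuous: "continuous_on UNIV (\<lambda>y. f (x, y))"
  unfolding continuous_on_eq_continuous_at[OF open_UNIV]
proof
  fix y
  have "((\<lambda>y'. f (x, y') - f (x, y)) \<longlongrightarrow> 0) (at y)"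
  proof (rule Lim_null_comparison)
    have "((\<lambda>y'. C * (1 + \<bar>x\<bar> powr p + (\<bar>y\<bar> + 1) powr p + \<bar>y\<bar> powr p) * \<bar>y' - y\<bar>) \<longlongrightarrow> C * (1 + \<bar>x\<bar> powr p + (\<bar>y\<bar> + 1) powr p + \<bar>y\<bar> powr p) * \<bar>y - y\<bar>) (at y)"
      by (intro tendsto_mult tendsto_const tendsto_rabs tendsto_diff tendsto_ident_at)
    then show "((\<lambda>y'. C * (1 + \<bar>x\<bar> powr p + (\<bar>y\<bar> + 1) powr p + \<bar>y\<bar> powr p) * \<bar>y' - y\<bar>) \<longlongrightarrow> 0) (at y)" by simp
    have "\<forall>\<^sub>F y' in at y. dist y' y < 1" by (auto simp: eventually_at intro: exI[of _ 1])
    then show "\<forall>\<^sub>F y' in at y. norm (f (x, y') - f (x, y)) \<le> C * (1 + \<bar>x\<bar> powr p + (\<bar>y\<bar> + 1) powr p + \<bar>y\<bar> powr p) * \<bar>y' - y\<bar>"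
    proof eventually_elim
      case (elim y')
      then have "\<bar>y'\<bar> \<le> \<bar>y\<bar> + 1" by (auto simp: dist_real_def)
      then have "\<bar>y'\<bar> powr p \<le> (\<bar>y\<bar> + 1) powr p" using p_pos by (intro powr_mono2) auto
      then have "C * (1 + \<bar>x\<bar> powr p + \<bar>y'\<bar> powr p + \<bar>y\<bar> powr p) * \<bar>y' - y\<bar> \<le> C * (1 + \<bar>x\<bar> powr p + (\<bar>y\<bar> + 1) powr p + \<bar>y\<bar> powr p) * \<bar>y' - y\<bar>"
        using C_pos by (intro mult_right_mono mult_left_mono) auto
      then show ?case using f_lipschitz[of x y' y] by simp
    qed
  qed
  then show "isCont (\<lambda>y. f (x, y)) y" unfolding isCont_def by (rule LIM_zero_cancel)
qed

abbreviation Z :: "'a \<Rightarrow> real \<times> real" where "Z w \<equiv> (S T w, avg w)"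
abbreviation Zn :: "nat \<Rightarrow> 'a \<Rightarrow> real \<times> real" where "Zn n w \<equiv> (S T w, trap n w)"

lemma partial2_f_measurable[measurable]: "partial2 f \<in> borel_measurable borel"
  by (rule partial2_measurable[OF f_measurable f_continuous])

lemma ST_measurable[measurable]: "S T \<in> borel_measurable M"
  using T_pos by (intro S_measurable) auto

declare avg_measurable[measurable] trap_measurable[measurable]

lemma all_moments_ST: "all_moments (S T)"
  using T_pos by (intro all_moments_S) auto

text \<open>Difference quotients with increments shorter than 1 obey the growth condition, and so
  does their limit; this is the origin of \<open>\<bar>y\<bar> + 1\<close>. The outer absolute value
  around it matches the form of \<open>bounded_moments_powr\<close>.\<close>

lemma partial2_bound:
  assumes "(x, y) \<in> partial2_domain f"
  shows "\<bar>partial2 f (x, y)\<bar> \<le> C * (1 + \<bar>x\<bar> powr p + \<bar>\<bar>y\<bar> + 1\<bar> powr p + \<bar>y\<bar> powr p)"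
proof -
  have "((\<lambda>y'. f (x, y')) has_field_derivative partial2 f (x, y)) (at y)"
    using assms by (simp add: partial2_def partial2_domain_def DERIV_deriv_iff_field_differentiable)
  then have "((\<lambda>h. \<bar>(f (x, y + h) - f (x, y)) / h\<bar>) \<longlongrightarrow> \<bar>partial2 f (x, y)\<bar>) (at 0)"
    by (intro tendsto_rabs) (simp add: DERIV_def)
  then show ?thesis
  proof (rule tendsto_upperbound)
    have "\<forall>\<^sub>F h in at (0::real). dist h 0 < 1 \<and> h \<noteq> 0" by (auto simp: eventually_at intro: exI[of _ 1])
    then show "\<forall>\<^sub>F h in at 0. \<bar>(f (x, y + h) - f (x, y)) / h\<bar> \<le> C * (1 + \<bar>x\<bar> powr p + \<bar>\<bar>y\<bar> + 1\<bar> powr p + \<bar>y\<bar> powr p)"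
    proof eventually_elim
      case (elim h)
      then have "\<bar>y + h\<bar> \<le> \<bar>\<bar>y\<bar> + 1\<bar>" by (auto simp: dist_real_def)
      then have "\<bar>y + h\<bar> powr p \<le> \<bar>\<bar>y\<bar> + 1\<bar> powr p" using p_pos by (intro powr_mono2) auto
      then have "C * (1 + \<bar>x\<bar> powr p + \<bar>y + h\<bar> powr p + \<bar>y\<bar> powr p) * \<bar>h\<bar> \<le> C * (1 + \<bar>x\<bar> powr p + \<bar>\<bar>y\<bar> + 1\<bar> powr p + \<bar>y\<bar> powr p) * \<bar>h\<bar>"
        using C_pos by (intro mult_right_mono mult_left_mono) auto
      then have "\<bar>f (x, y + h) - f (x, y)\<bar> \<le> C * (1 + \<bar>x\<bar> powr p + \<bar>\<bar>y\<bar> + 1\<bar> powr p + \<bar>y\<bar> powr p) * \<bar>h\<bar>"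
        using f_lipschitz[of x "y + h" y] by simp
      then show ?case using elim by (simp add: abs_divide divide_le_eq)
    qed
  qed simp
qed

lemma all_moments_partial2: "all_moments (\<lambda>w. partial2 f (Z w))"
proof (rule bounded_moments_mono)
  show "all_moments (\<lambda>w. C * (1 + \<bar>S T w\<bar> powr p + \<bar>\<bar>avg w\<bar> + 1\<bar> powr p + \<bar>avg w\<bar> powr p))"
    by (intro bounded_moments_mult bounded_moments_add bounded_moments_const bounded_moments_powr bounded_moments_abs
        all_moments_ST all_moments_avg p_pos)
  show "AE w in M. \<bar>partial2 f (Z w)\<bar> \<le> \<bar>C * (1 + \<bar>S T w\<bar> powr p + \<bar>\<bar>avg w\<bar> + 1\<bar> powr p + \<bar>avg w\<bar> powr p)\<bar>"
    using f_domain by eventually_elim (rule order_trans[OF partial2_bound abs_ge_self])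
qed measurable

definition quot :: "nat \<Rightarrow> 'a \<Rightarrow> real" where
  "quot n w = (if trap n w = avg w then partial2 f (Z w) else (f (Zn n w) - f (Z w)) / (trap n w - avg w))"

definition ferr :: "nat \<Rightarrow> 'a \<Rightarrow> real" where
  "ferr n w = real n * (f (Zn n w) - f (Z w))"

lemma ferr_eq: "ferr n w = quot n w * nerr n w"
  by (simp add: ferr_def quot_def nerr_def)

lemma quot_measurable[measurable]: "quot n \<in> borel_measurable M"
  unfolding quot_def[abs_def] by measurable

lemma bounded_moments_const_family: "all_moments X \<Longrightarrow> bounded_moments UNIV (\<lambda>n::nat. X)"
  using bounded_moments_subfamily[of UNIV "\<lambda>_. X" UNIV "\<lambda>_. ()"] by auto

lemma bounded_moments_quot: "bounded_moments UNIV quot"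
proof (rule bounded_moments_mono)
  let ?b = "\<lambda>n w. \<bar>partial2 f (Z w)\<bar> + C * (1 + \<bar>S T w\<bar> powr p + \<bar>trap n w\<bar> powr p + \<bar>avg w\<bar> powr p)"
  show "bounded_moments UNIV ?b"
    by (intro bounded_moments_add bounded_moments_mult bounded_moments_const bounded_moments_powr bounded_moments_abs
        bounded_moments_const_family all_moments_partial2 all_moments_ST all_moments_avg bounded_moments_trap p_pos)
  fix n
  have "\<bar>quot n w\<bar> \<le> ?b n w" for w
  proof (cases "trap n w = avg w")
    case True
    have "0 \<le> C * (1 + \<bar>S T w\<bar> powr p + \<bar>trap n w\<bar> powr p + \<bar>avg w\<bar> powr p)"
      using C_pos by (intro mult_nonneg_nonneg add_nonneg_nonneg) auto
    then show ?thesis using True by (simp add: quot_def)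
  next
    case False
    then have "\<bar>quot n w\<bar> \<le> C * (1 + \<bar>S T w\<bar> powr p + \<bar>trap n w\<bar> powr p + \<bar>avg w\<bar> powr p)"
      using f_lipschitz[of "S T w" "trap n w" "avg w"] by (simp add: quot_def abs_divide divide_le_eq)
    then show ?thesis using abs_ge_zero[of "partial2 f (Z w)"] by linarith
  qed
  then show "AE w in M. \<bar>quot n w\<bar> \<le> \<bar>?b n w\<bar>" by (intro AE_I2 order_trans[OF _ abs_ge_self])
qed measurable

text \<open>Caratheodory's form of differentiability: the quotient is a function \<open>g\<close>
  that is continuous at \<open>avg w\<close>, and \<open>quot n w\<close> is \<open>g\<close>
  evaluated at \<open>trap n w\<close>.\<close>

lemma quot_tendsto: "AE w in M. (\<lambda>n. quot n w) \<longlonglongrightarrow> partial2 f (Z w)"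
  using f_domain AE_space
proof eventually_elim
  case (elim w)
  let ?d = "partial2 f (Z w)"
  have "((\<lambda>y'. f (S T w, y')) has_field_derivative ?d) (at (avg w))"
    using elim(1) by (simp add: partial2_def partial2_domain_def DERIV_deriv_iff_field_differentiable)
  then obtain g where g: "\<And>z. f (S T w, z) - f (S T w, avg w) = g z * (z - avg w)" "isCont g (avg w)" "g (avg w) = ?d"
    unfolding CARAT_DERIV by blast
  have "quot n w = g (trap n w)" for n
    using g(1)[of "trap n w"] g(3) by (simp add: quot_def)
  moreover have "(\<lambda>n. g (trap n w)) \<longlonglongrightarrow> g (avg w)"
    by (rule isCont_tendsto_compose[OF g(2) trap_tendsto[OF elim(2)]])
  ultimately show ?case using g(3) by simp
qed

lemma all_moments_quot: "all_moments (quot n)"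
  by (rule bounded_moments_member[OF bounded_moments_quot]) simp

lemma all_moments_ferr: "all_moments (ferr n)"
  unfolding ferr_eq[abs_def] by (intro bounded_moments_mult all_moments_quot all_moments_nerr)

text \<open>The quotient is replaced by its limit, since the difference vanishes in L^2 and
  \<open>nerr\<close> is bounded there; what remains is a moment of \<open>nerr\<close> with one
  fixed Borel weight.\<close>

lemma ferr_mean: "(\<lambda>n. expectation (ferr n)) \<longlonglongrightarrow> 0"
proof -
  obtain B2 where B2: "\<And>n. expectation (\<lambda>w. (nerr n w)\<^sup>2) \<le> B2" using nerr_second_moment by blast
  let ?D = "\<lambda>n w. quot n w - partial2 f (Z w)"
  have D: "bounded_moments UNIV ?D"
    by (intro bounded_moments_diff bounded_moments_quot bounded_moments_const_family all_moments_partial2)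
  have "(\<lambda>n. expectation (\<lambda>w. \<bar>?D n w\<bar> ^ 2)) \<longlonglongrightarrow> 0"
  proof (rule bounded_moments_tendsto[OF D])
    show "AE w in M. (\<lambda>n. ?D n w) \<longlonglongrightarrow> 0"
      using quot_tendsto by eventually_elim (rule LIM_zero)
  qed simp
  then have "(\<lambda>n. expectation (\<lambda>w. ?D n w * nerr n w)) \<longlonglongrightarrow> 0"
    by (intro tendsto_expectation_mult(2)[where B=B2])
       (auto intro!: B2 all_moments_integrable bounded_moments_power bounded_moments_diff all_moments_quot all_moments_partial2 all_moments_nerr
        intro: all_moments_measurable)
  moreover have "(\<lambda>n. expectation (\<lambda>w. partial2 f (Z w) * nerr n w)) \<longlonglongrightarrow> 0"
    by (rule nerr_weighted_moments(1)) (auto intro!: all_moments_integrable bounded_moments_power all_moments_partial2)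
  ultimately have "(\<lambda>n. expectation (\<lambda>w. ?D n w * nerr n w) + expectation (\<lambda>w. partial2 f (Z w) * nerr n w)) \<longlonglongrightarrow> 0 + 0"
    by (rule tendsto_add)
  moreover have "expectation (ferr n) = expectation (\<lambda>w. ?D n w * nerr n w) + expectation (\<lambda>w. partial2 f (Z w) * nerr n w)" for n
  proof -
    have "expectation (ferr n) = expectation (\<lambda>w. ?D n w * nerr n w + partial2 f (Z w) * nerr n w)"
      unfolding ferr_eq[abs_def] by (simp add: algebra_simps)
    also have "\<dots> = expectation (\<lambda>w. ?D n w * nerr n w) + expectation (\<lambda>w. partial2 f (Z w) * nerr n w)"
      by (intro Bochner_Integration.integral_add all_moments_integrable bounded_moments_mult bounded_moments_diff
          all_moments_quot all_moments_partial2 all_moments_nerr)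
    finally show ?thesis .
  qed
  ultimately show ?thesis by simp
qed

text \<open>As for the mean, now with squares: the fourth moment of \<open>nerr\<close> bounds the
  factor beside the vanishing difference.\<close>

lemma ferr_square: "(\<lambda>n. expectation (\<lambda>w. (ferr n w)\<^sup>2)) \<longlonglongrightarrow> expectation (\<lambda>w. (partial2 f (Z w))\<^sup>2 * limit_var w)"
proof -
  obtain B4 where B4: "\<And>n. expectation (\<lambda>w. (nerr n w) ^ 4) \<le> B4" using nerr_fourth_moment by blast
  let ?D = "\<lambda>n w. (quot n w)\<^sup>2 - (partial2 f (Z w))\<^sup>2"
  have D: "bounded_moments UNIV ?D"
    by (intro bounded_moments_diff bounded_moments_power bounded_moments_quot bounded_moments_const_family all_moments_partial2)
  have "(\<lambda>n. expectation (\<lambda>w. \<bar>?D n w\<bar> ^ 2)) \<longlonglongrightarrow> 0"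
  proof (rule bounded_moments_tendsto[OF D])
    show "AE w in M. (\<lambda>n. ?D n w) \<longlonglongrightarrow> 0"
      using quot_tendsto by eventually_elim (intro LIM_zero tendsto_power)
  qed simp
  then have "(\<lambda>n. expectation (\<lambda>w. ?D n w * (nerr n w)\<^sup>2)) \<longlonglongrightarrow> 0"
  proof (intro tendsto_expectation_mult(2)[where B=B4])
    show "expectation (\<lambda>w. ((nerr n w)\<^sup>2)\<^sup>2) \<le> B4" for n using B4[of n] by (simp flip: power_mult)
  qed (auto intro!: all_moments_integrable bounded_moments_power bounded_moments_diff all_moments_quot all_moments_partial2 all_moments_nerr
        intro: all_moments_measurable)
  moreover have "(\<lambda>n. expectation (\<lambda>w. (partial2 f (Z w))\<^sup>2 * (nerr n w)\<^sup>2)) \<longlonglongrightarrow> expectation (\<lambda>w. (partial2 f (Z w))\<^sup>2 * limit_var w)"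
    by (rule nerr_weighted_moments(2)[of "\<lambda>z. (partial2 f z)\<^sup>2"]) (measurable, intro all_moments_integrable bounded_moments_power all_moments_partial2)
  ultimately have "(\<lambda>n. expectation (\<lambda>w. ?D n w * (nerr n w)\<^sup>2) + expectation (\<lambda>w. (partial2 f (Z w))\<^sup>2 * (nerr n w)\<^sup>2))
      \<longlonglongrightarrow> 0 + expectation (\<lambda>w. (partial2 f (Z w))\<^sup>2 * limit_var w)" by (rule tendsto_add)
  moreover have "expectation (\<lambda>w. (ferr n w)\<^sup>2) = expectation (\<lambda>w. ?D n w * (nerr n w)\<^sup>2) + expectation (\<lambda>w. (partial2 f (Z w))\<^sup>2 * (nerr n w)\<^sup>2)" for n
  proof -
    have "expectation (\<lambda>w. (ferr n w)\<^sup>2) = expectation (\<lambda>w. ?D n w * (nerr n w)\<^sup>2 + (partial2 f (Z w))\<^sup>2 * (nerr n w)\<^sup>2)"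
      unfolding ferr_eq by (simp add: algebra_simps power_mult_distrib)
    also have "\<dots> = expectation (\<lambda>w. ?D n w * (nerr n w)\<^sup>2) + expectation (\<lambda>w. (partial2 f (Z w))\<^sup>2 * (nerr n w)\<^sup>2)"
      by (intro Bochner_Integration.integral_add all_moments_integrable bounded_moments_mult bounded_moments_diff bounded_moments_power
          all_moments_quot all_moments_partial2 all_moments_nerr)
    finally show ?thesis .
  qed
  ultimately show ?thesis by simp
qed

text \<open>Serves the Lindeberg condition on the fine level. Since \<open>nerr\<close> is
  controlled up to order 4 uniformly in \<open>n\<close>, the third power of the product is split
  unevenly, and order 12 falls on \<open>quot\<close>.\<close>

lemma ferr_third_moment:
  obtains B where "B > 0" "\<And>n. expectation (\<lambda>w. \<bar>ferr n w\<bar> ^ 3) \<le> B"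
proof -
  obtain B4 where B4: "B4 > 0" "\<And>n. expectation (\<lambda>w. (nerr n w) ^ 4) \<le> B4" using nerr_fourth_moment by blast
  obtain Bq where Bq: "Bq > 0" "\<And>n. expectation (\<lambda>w. \<bar>quot n w\<bar> ^ 12) \<le> Bq"
    using bounded_moments_bound[OF bounded_moments_quot, of 12] by auto
  have "expectation (\<lambda>w. \<bar>ferr n w\<bar> ^ 3) \<le> B4 + Bq" for n
  proof -
    have I: "integrable M (\<lambda>w. (nerr n w) ^ 4)" "integrable M (\<lambda>w. \<bar>quot n w\<bar> ^ 12)" "integrable M (\<lambda>w. \<bar>ferr n w\<bar> ^ 3)"
      by (intro all_moments_integrable bounded_moments_power bounded_moments_abs all_moments_nerr all_moments_quot all_moments_ferr)+
    have le: "\<bar>q * v\<bar> ^ 3 \<le> v ^ 4 + \<bar>q\<bar> ^ 12" for q v :: real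
    proof -
      let ?a = "\<bar>q\<bar> ^ 3" and ?m = "max \<bar>v\<bar> (\<bar>q\<bar> ^ 3)"
      have "\<bar>q * v\<bar> ^ 3 = ?a * \<bar>v\<bar> ^ 3" by (simp add: abs_mult power_mult_distrib)
      also have "\<dots> \<le> ?m * ?m ^ 3" by (intro mult_mono power_mono) auto
      also have "\<dots> = ?m ^ 4" by (simp add: power4_eq_xxxx power3_eq_cube)
      also have "\<dots> \<le> \<bar>v\<bar> ^ 4 + ?a ^ 4" by (auto simp: max_def)
      also have "?a ^ 4 = \<bar>q\<bar> ^ 12" by (simp flip: power_mult)
      finally show ?thesis by simp
    qed
    have "expectation (\<lambda>w. \<bar>ferr n w\<bar> ^ 3) \<le> expectation (\<lambda>w. (nerr n w) ^ 4 + \<bar>quot n w\<bar> ^ 12)"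
      by (intro integral_mono I Bochner_Integration.integrable_add) (simp only: ferr_eq le)
    also have "\<dots> = expectation (\<lambda>w. (nerr n w) ^ 4) + expectation (\<lambda>w. \<bar>quot n w\<bar> ^ 12)" using I by simp
    finally show ?thesis using B4(2)[of n] Bq(2)[of n] by linarith
  qed
  then show thesis using that[of "B4 + Bq"] B4 Bq by simp
qed

end

section \<open>Sums over independent copies\<close>

text \<open>Independence turns the characteristic function of the sum into a power, and equality in
  law moves the single factor to the space of the model.\<close>

lemma (in prob_space) char_scaled_sum_iid:
  fixes \<phi> :: "'z::topological_space \<Rightarrow> real"
  assumes iid: "iid_copies M X M' V" and V: "V \<in> measurable M' borel" and \<phi>[measurable]: "\<phi> \<in> borel_measurable borel"
  shows "char (distr M borel (\<lambda>w. c * (\<Sum>i=1..n. \<phi> (X i w)))) t = char (distr M' borel (\<lambda>w. \<phi> (V w))) (t * c) ^ n"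
proof -
  have iv: "indep_vars (\<lambda>_. borel) X {1..}" and law: "\<And>i. i \<ge> 1 \<Longrightarrow> distr M borel (X i) = distr M' borel V"
    using iid by (auto simp: iid_copies_def)
  have X[measurable]: "i \<ge> 1 \<Longrightarrow> X i \<in> measurable M borel" for i using iv by (auto simp: indep_vars_def)
  have "indep_vars (\<lambda>_. borel) (\<lambda>i w. c * \<phi> (X i w)) {1..n}"
    by (rule indep_vars_compose2[OF indep_vars_subset[OF iv]]) auto
  from char_distr_sum[OF this]
  have "char (distr M borel (\<lambda>w. c * (\<Sum>i=1..n. \<phi> (X i w)))) t = (\<Prod>i=1..n. char (distr M borel (\<lambda>w. c * \<phi> (X i w))) t)"
    by (simp add: sum_distrib_left)
  also have "\<dots> = (\<Prod>i=1..n. char (distr M' borel (\<lambda>w. \<phi> (V w))) (t * c))"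
  proof (rule prod.cong[OF refl])
    fix i assume "i \<in> {1..n}"
    then have i: "i \<ge> 1" by simp
    have m: "(\<lambda>x. iexp (t * (c * \<phi> x))) \<in> borel_measurable borel" by measurable
    have "char (distr M borel (\<lambda>w. c * \<phi> (X i w))) t = (CLINT w|M. iexp (t * (c * \<phi> (X i w))))"
      unfolding char_def using X[OF i] by (subst integral_distr) auto
    also have "\<dots> = (CLINT x|distr M borel (X i). iexp (t * (c * \<phi> x)))" by (rule integral_distr[OF X[OF i] m, symmetric])
    also have "\<dots> = (CLINT w|M'. iexp (t * (c * \<phi> (V w))))" unfolding law[OF i] by (rule integral_distr[OF V m])
    also have "\<dots> = char (distr M' borel (\<lambda>w. \<phi> (V w))) (t * c)"
      unfolding char_def using V by (subst integral_distr) (auto simp: mult.assoc)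
    finally show "char (distr M borel (\<lambda>w. c * \<phi> (X i w))) t = char (distr M' borel (\<lambda>w. \<phi> (V w))) (t * c)" .
  qed
  finally show ?thesis by simp
qed

text \<open>Each sum is measurable for the sigma-algebra generated by its whole sequence of samples,
  and those two sigma-algebras are independent.\<close>

lemma (in prob_space) indep_var_sums:
  fixes X :: "nat \<Rightarrow> 'a \<Rightarrow> 'x::topological_space" and Y :: "nat \<Rightarrow> 'a \<Rightarrow> 'y::topological_space"
    and \<phi> :: "'x \<Rightarrow> real" and \<psi> :: "'y \<Rightarrow> real"
  assumes ind: "indep_processes M {1..} X Y" and "\<phi> \<in> borel_measurable borel" "\<psi> \<in> borel_measurable borel"
  shows "indep_var borel (\<lambda>w. c * (\<Sum>i=1..n. \<phi> (X i w))) borel (\<lambda>w. b * (\<Sum>i=1..k. \<psi> (Y i w)))"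
proof -
  have V: "(\<lambda>w. a * (\<Sum>i=1..j. \<theta> (U i w))) \<in> borel_measurable (vimage_algebra (space M) (\<lambda>w. \<lambda>i\<in>{1..}. U i w) (PiM {1..} (\<lambda>_. borel)))"
    if [measurable]: "\<theta> \<in> borel_measurable borel" for a :: real and j :: nat and \<theta> :: "'u::topological_space \<Rightarrow> real" and U :: "nat \<Rightarrow> 'a \<Rightarrow> 'u"
  proof -
    let ?V = "vimage_algebra (space M) (\<lambda>w. \<lambda>i\<in>{1..}. U i w) (PiM {1..} (\<lambda>_. borel))"
    have "(\<lambda>w. \<lambda>i\<in>{1..}. U i w) \<in> measurable ?V (PiM {1..} (\<lambda>_. borel))"
      by (rule measurable_vimage_algebra1) (auto simp: space_PiM)
    from measurable_compose[OF this measurable_component_singleton]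
    have "U i \<in> measurable ?V borel" if "i \<ge> 1" for i using that by (auto cong: measurable_cong)
    then show ?thesis by (intro borel_measurable_times borel_measurable_sum measurable_compose[OF _ that]) auto
  qed
  from ind have "indep_set (sets (vimage_algebra (space M) (\<lambda>w. \<lambda>i\<in>{1..}. X i w) (PiM {1..} (\<lambda>_. borel))))
      (sets (vimage_algebra (space M) (\<lambda>w. \<lambda>i\<in>{1..}. Y i w) (PiM {1..} (\<lambda>_. borel))))"
    unfolding indep_processes_def .
  then show ?thesis
    by (rule indep_var_of_indep_set) (use assms in \<open>auto intro!: V simp del: One_nat_def\<close>)
qed

lemma (in prob_space) char_distr_add_const:
  fixes U :: "'a \<Rightarrow> real"
  assumes [measurable]: "U \<in> borel_measurable M"
  shows "char (distr M borel (\<lambda>w. U w + c)) t = char (distr M borel U) t * iexp (t * c)"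
  unfolding char_def by (simp add: integral_distr distrib_left exp_add)

text \<open>Splitting on \<open>\<bar>U - X\<bar> \<le> \<bar>X\<bar>\<close> reduces the Lindeberg condition for \<open>U\<close> to the one for \<open>X\<close>.\<close>

lemma min_Lindeberg_le:
  fixes u x a :: real
  assumes "a \<ge> 0"
  shows "min (6 * u\<^sup>2) (a * \<bar>u\<bar> ^ 3) \<le> 24 * (u - x)\<^sup>2 + min (24 * x\<^sup>2) (8 * a * \<bar>x\<bar> ^ 3)"
proof (cases "\<bar>u - x\<bar> \<le> \<bar>x\<bar>")
  case True
  then have u: "\<bar>u\<bar> \<le> 2 * \<bar>x\<bar>" by linarith
  have "u\<^sup>2 \<le> (2 * \<bar>x\<bar>)\<^sup>2" using power_mono[OF u, of 2] by simp
  then have "6 * u\<^sup>2 \<le> 24 * x\<^sup>2" by (simp add: power_mult_distrib)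
  moreover have "a * \<bar>u\<bar> ^ 3 \<le> a * (2 * \<bar>x\<bar>) ^ 3" using assms by (intro mult_left_mono power_mono u) auto
  then have "a * \<bar>u\<bar> ^ 3 \<le> 8 * a * \<bar>x\<bar> ^ 3" by (simp add: power_mult_distrib)
  ultimately have "min (6 * u\<^sup>2) (a * \<bar>u\<bar> ^ 3) \<le> min (24 * x\<^sup>2) (8 * a * \<bar>x\<bar> ^ 3)" by (rule min.mono)
  then show ?thesis using zero_le_power2[of "u - x"] by linarith
next
  case False
  then have u: "\<bar>u\<bar> \<le> 2 * \<bar>u - x\<bar>" using abs_triangle_ineq4[of u x] abs_triangle_ineq[of "u - x" x] by simp
  have "u\<^sup>2 \<le> (2 * \<bar>u - x\<bar>)\<^sup>2" using power_mono[OF u, of 2] by simp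
  then have "6 * u\<^sup>2 \<le> 24 * (u - x)\<^sup>2" by (simp add: power_mult_distrib)
  moreover have "0 \<le> min (24 * x\<^sup>2) (8 * a * \<bar>x\<bar> ^ 3)" using assms by simp
  ultimately show ?thesis using min.cobounded1[of "6 * u\<^sup>2" "a * \<bar>u\<bar> ^ 3"] by linarith
qed

text \<open>Transfers the limit theorem to a centred array that is close in L^2 to an array
  \<open>X\<close> with known limit variance and small tails. The means of \<open>X\<close> are left
  free: on the fine level they only tend to 0.\<close>

lemma (in prob_space) char_power_tendsto_perturbed:
  fixes U X :: "nat \<Rightarrow> 'a \<Rightarrow> real" and R :: "nat \<Rightarrow> nat"
  assumes [measurable]: "\<And>n. U n \<in> borel_measurable M" "\<And>n. X n \<in> borel_measurable M"
    and I: "\<And>n. integrable M (\<lambda>w. (U n w)\<^sup>2)" "\<And>n. integrable M (\<lambda>w. (X n w)\<^sup>2)"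
    and mean: "\<And>n. expectation (U n) = 0"
    and var: "(\<lambda>n. expectation (\<lambda>w. (X n w)\<^sup>2)) \<longlonglongrightarrow> s"
    and R: "filterlim R at_top sequentially"
    and diff: "(\<lambda>n. expectation (\<lambda>w. (U n w - X n w)\<^sup>2)) \<longlonglongrightarrow> 0"
    and lind: "(\<lambda>n. expectation (\<lambda>w. min (24 * (X n w)\<^sup>2) (8 * \<bar>t / sqrt (R n)\<bar> * \<bar>X n w\<bar> ^ 3))) \<longlonglongrightarrow> 0"
  shows "(\<lambda>n. char (distr M borel (U n)) (t / sqrt (R n)) ^ R n) \<longlonglongrightarrow> exp (- (t\<^sup>2 * s / 2))"
proof (rule char_power_tendsto)
  have UX: "integrable M (\<lambda>w. U n w * X n w)" for n by (intro integrable_mult_of_squares I) measurable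
  have D: "integrable M (\<lambda>w. (U n w - X n w)\<^sup>2)" for n
    using I(1)[of n] I(2)[of n] UX[of n] by (simp add: power2_diff mult.assoc)
  obtain B where B: "\<And>n. expectation (\<lambda>w. (X n w)\<^sup>2) \<le> B"
    using convergent_imp_Bseq[OF convergentI[OF var]] by (auto simp: Bseq_def intro: order_trans[OF abs_ge_self])
  have "(\<lambda>n. expectation (\<lambda>w. (U n w - X n w) * X n w)) \<longlonglongrightarrow> 0"
    by (rule tendsto_expectation_mult(2)[OF _ _ D I(2) diff B]) measurable
  then have "(\<lambda>n. expectation (\<lambda>w. (X n w)\<^sup>2) + 2 * expectation (\<lambda>w. (U n w - X n w) * X n w) + expectation (\<lambda>w. (U n w - X n w)\<^sup>2)) \<longlonglongrightarrow> s + 2 * 0 + 0"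
    by (intro tendsto_add tendsto_mult tendsto_const var diff)
  moreover have "expectation (\<lambda>w. (U n w)\<^sup>2) = expectation (\<lambda>w. (X n w)\<^sup>2) + 2 * expectation (\<lambda>w. (U n w - X n w) * X n w) + expectation (\<lambda>w. (U n w - X n w)\<^sup>2)" for n
  proof -
    have UX': "integrable M (\<lambda>w. (U n w - X n w) * X n w)" by (intro integrable_mult_of_squares I D) measurable
    have "expectation (\<lambda>w. (U n w)\<^sup>2) = expectation (\<lambda>w. (X n w)\<^sup>2 + 2 * ((U n w - X n w) * X n w) + (U n w - X n w)\<^sup>2)"
      by (intro Bochner_Integration.integral_cong refl) (simp add: power2_eq_square algebra_simps)
    also have "\<dots> = expectation (\<lambda>w. (X n w)\<^sup>2) + 2 * expectation (\<lambda>w. (U n w - X n w) * X n w) + expectation (\<lambda>w. (U n w - X n w)\<^sup>2)"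
      using I(2)[of n] UX' D[of n] by simp
    finally show ?thesis .
  qed
  ultimately show "(\<lambda>n. expectation (\<lambda>w. (U n w)\<^sup>2)) \<longlonglongrightarrow> s" by simp
  have IL: "integrable M (\<lambda>w. min (24 * (X n w)\<^sup>2) (8 * \<bar>t / sqrt (R n)\<bar> * \<bar>X n w\<bar> ^ 3))" for n
    by (rule Bochner_Integration.integrable_bound[OF integrable_mult_right[OF I(2)[of n], of 24]]) auto
  show "(\<lambda>n. expectation (\<lambda>w. min (6 * (U n w)\<^sup>2) (\<bar>t / sqrt (R n)\<bar> * \<bar>U n w\<bar> ^ 3))) \<longlonglongrightarrow> 0"
  proof (rule tendsto_sandwich[OF _ _ tendsto_const])
    let ?L = "\<lambda>n. expectation (\<lambda>w. min (24 * (X n w)\<^sup>2) (8 * \<bar>t / sqrt (R n)\<bar> * \<bar>X n w\<bar> ^ 3))"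
    show "(\<lambda>n. 24 * expectation (\<lambda>w. (U n w - X n w)\<^sup>2) + ?L n) \<longlonglongrightarrow> 0"
      using tendsto_add[OF tendsto_mult[OF tendsto_const[of 24] diff] lind] by simp
    have "expectation (\<lambda>w. min (6 * (U n w)\<^sup>2) (\<bar>t / sqrt (R n)\<bar> * \<bar>U n w\<bar> ^ 3)) \<le> 24 * expectation (\<lambda>w. (U n w - X n w)\<^sup>2) + ?L n" for n
    proof -
      have "expectation (\<lambda>w. min (6 * (U n w)\<^sup>2) (\<bar>t / sqrt (R n)\<bar> * \<bar>U n w\<bar> ^ 3))
          \<le> expectation (\<lambda>w. 24 * (U n w - X n w)\<^sup>2 + min (24 * (X n w)\<^sup>2) (8 * \<bar>t / sqrt (R n)\<bar> * \<bar>X n w\<bar> ^ 3))"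
      proof (rule integral_mono)
        show "integrable M (\<lambda>w. min (6 * (U n w)\<^sup>2) (\<bar>t / sqrt (R n)\<bar> * \<bar>U n w\<bar> ^ 3))"
          by (rule Bochner_Integration.integrable_bound[OF integrable_mult_right[OF I(1)[of n], of 6]]) auto
        show "integrable M (\<lambda>w. 24 * (U n w - X n w)\<^sup>2 + min (24 * (X n w)\<^sup>2) (8 * \<bar>t / sqrt (R n)\<bar> * \<bar>X n w\<bar> ^ 3))"
          by (intro Bochner_Integration.integrable_add integrable_mult_right D IL)
      qed (rule min_Lindeberg_le, simp)
      also have "\<dots> = 24 * expectation (\<lambda>w. (U n w - X n w)\<^sup>2) + ?L n" using D[of n] IL[of n] by simp
      finally show ?thesis .
    qed
    then show "\<forall>\<^sub>F n in sequentially. expectation (\<lambda>w. min (6 * (U n w)\<^sup>2) (\<bar>t / sqrt (R n)\<bar> * \<bar>U n w\<bar> ^ 3)) \<le> 24 * expectation (\<lambda>w. (U n w - X n w)\<^sup>2) + ?L n" by simp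
  qed (auto intro!: always_eventually integral_nonneg_AE AE_I2)
qed (use I mean R in auto)

section \<open>Integer parts of powers\<close>

lemma floor_powr_le: "real (floor_powr n a) \<le> real n powr a"
  unfolding floor_powr_def by (simp add: of_nat_nat)

lemma floor_powr_ge: "real n powr a - 1 \<le> real (floor_powr n a)"
  unfolding floor_powr_def using real_of_int_floor_gt_diff_one[of "real n powr a"] by simp

lemma floor_powr_at_top:
  assumes "a > 0"
  shows "filterlim (\<lambda>n. floor_powr n a) at_top sequentially"
proof -
  have "filterlim (\<lambda>n. exp (a * ln (real n))) at_top sequentially"
    using assms by (intro filterlim_compose[OF exp_at_top] filterlim_tendsto_pos_mult_at_top[OF tendsto_const]
        filterlim_compose[OF ln_at_top] filterlim_real_sequentially) auto
  moreover have "\<forall>\<^sub>F n in sequentially. exp (a * ln (real n)) = real n powr a"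
    using eventually_gt_at_top[of 0] by eventually_elim (simp add: powr_def)
  ultimately have "filterlim (\<lambda>n. real n powr a) at_top sequentially" by (simp cong: filterlim_cong)
  then show ?thesis unfolding floor_powr_def
    by (intro filterlim_compose[OF filterlim_nat_sequentially] filterlim_compose[OF filterlim_floor_sequentially])
qed

lemma floor_powr_asymp:
  assumes "a > 0"
  shows "(\<lambda>n. real (floor_powr n a) / real n powr a) \<longlonglongrightarrow> 1"
proof (rule tendsto_sandwich[OF _ _ _ tendsto_const])
  have "(\<lambda>n. 1 - real n powr - a) \<longlonglongrightarrow> 1 - 0"
    using assms by (intro tendsto_diff tendsto_const tendsto_neg_powr filterlim_real_sequentially) auto
  then show "(\<lambda>n. 1 - real n powr - a) \<longlonglongrightarrow> 1" by simp
  show "\<forall>\<^sub>F n in sequentially. 1 - real n powr - a \<le> real (floor_powr n a) / real n powr a"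
    using eventually_gt_at_top[of 0]
  proof eventually_elim
    case (elim n)
    then have "(real n powr a - 1) / real n powr a = 1 - real n powr - a" by (simp add: powr_minus diff_divide_distrib inverse_eq_divide)
    then show ?case using divide_right_mono[OF floor_powr_ge[of n a], of "real n powr a"] by simp
  qed
  show "\<forall>\<^sub>F n in sequentially. real (floor_powr n a) / real n powr a \<le> 1"
    using eventually_gt_at_top[of 0] by eventually_elim (simp add: divide_le_eq_1_pos floor_powr_le)
qed

lemma floor_powr_pos: "n \<ge> 1 \<Longrightarrow> a \<ge> 0 \<Longrightarrow> floor_powr n a > 0"
  using ge_one_powr_ge_zero[of "real n" a] by (simp add: floor_powr_def)

context
  fixes \<beta> :: real
  assumes \<beta>: "0 < \<beta>" "\<beta> < 1"
begin

lemma coarse_over_fine: "(\<lambda>n. real (floor_powr n \<beta>) / real n) \<longlonglongrightarrow> 0"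
proof (rule tendsto_sandwich[OF _ _ tendsto_const])
  show "(\<lambda>n. real n powr (\<beta> - 1)) \<longlonglongrightarrow> 0"
    using \<beta> by (intro tendsto_neg_powr filterlim_real_sequentially) auto
  have "real (floor_powr n \<beta>) / real n \<le> real n powr (\<beta> - 1)" for n
    using divide_right_mono[OF floor_powr_le[of n \<beta>], of "real n"] by (simp add: powr_diff)
  then show "\<forall>\<^sub>F n in sequentially. real (floor_powr n \<beta>) / real n \<le> real n powr (\<beta> - 1)" by simp
qed simp

text \<open>The purpose of the exponent \<open>2 - 2 * \<beta>\<close>: the exponents
  \<open>\<beta>\<close> of the coarse step number and \<open>1 - \<beta>\<close> of the root of the
  sample size add up to 1, and taking integer parts does not change the limit.\<close>

lemma normalisation_tendsto:
  "(\<lambda>n. real n / (real (floor_powr n \<beta>) * sqrt (real (floor_powr n (2 - 2 * \<beta>))))) \<longlonglongrightarrow> 1"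
proof -
  let ?m = "\<lambda>n. real (floor_powr n \<beta>)" and ?R = "\<lambda>n. real (floor_powr n (2 - 2 * \<beta>))"
  have "(\<lambda>n. 1 / (?m n / real n powr \<beta> * sqrt (?R n / real n powr (2 - 2 * \<beta>)))) \<longlonglongrightarrow> 1 / (1 * sqrt 1)"
    using \<beta> by (intro tendsto_divide tendsto_mult tendsto_real_sqrt floor_powr_asymp tendsto_const) auto
  moreover have "\<forall>\<^sub>F n in sequentially. 1 / (?m n / real n powr \<beta> * sqrt (?R n / real n powr (2 - 2 * \<beta>))) = real n / (?m n * sqrt (?R n))"
    using eventually_gt_at_top[of 0]
  proof eventually_elim
    case (elim n)
    have "sqrt (real n powr (2 - 2 * \<beta>)) = real n powr (1 - \<beta>)" using elim by (simp add: powr_half_sqrt[symmetric] powr_powr diff_divide_distrib)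
    moreover have "real n powr \<beta> * real n powr (1 - \<beta>) = real n" using elim by (simp add: powr_add[symmetric])
    ultimately show ?case by (simp add: real_sqrt_divide)
  qed
  ultimately show ?thesis using Lim_transform_eventually by fastforce
qed

end

section \<open>The central limit theorem for the two levels\<close>

context payoff begin

lemma f_Z_integrable: "integrable M (\<lambda>w. f (Z w))"
  by (rule square_integrable_imp_integrable[OF _ f_square]) measurable

lemma f_Zn_eq: "f (Zn n w) = f (Z w) + quot n w * (trap n w - avg w)"
  by (simp add: quot_def)

lemma all_moments_increment: "bounded_moments UNIV (\<lambda>n w. quot n w * (trap n w - avg w))"
  by (intro bounded_moments_mult bounded_moments_diff bounded_moments_quot bounded_moments_trap bounded_moments_const_family all_moments_avg)

lemma increment_tendsto: "(\<lambda>n. expectation (\<lambda>w. (quot n w * (trap n w - avg w))\<^sup>2)) \<longlonglongrightarrow> 0"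
proof -
  have "(\<lambda>n. expectation (\<lambda>w. \<bar>quot n w * (trap n w - avg w)\<bar> ^ 2)) \<longlonglongrightarrow> 0"
  proof (rule bounded_moments_tendsto[OF all_moments_increment])
    show "AE w in M. (\<lambda>n. quot n w * (trap n w - avg w)) \<longlonglongrightarrow> 0"
      using quot_tendsto AE_space
    proof eventually_elim
      case (elim w)
      show ?case using tendsto_mult[OF elim(1) LIM_zero[OF trap_tendsto[OF elim(2)]]] by simp
    qed
  qed simp
  then show ?thesis by simp
qed

lemma all_moments_increment_n: "all_moments (\<lambda>w. quot n w * (trap n w - avg w))"
  by (rule bounded_moments_member[OF all_moments_increment, of n]) simp

lemma f_Zn_integrable: "integrable M (\<lambda>w. f (Zn n w))"
  unfolding f_Zn_eq by (intro Bochner_Integration.integrable_add f_Z_integrable all_moments_integrable all_moments_increment_n)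

lemma square_integrable_add:
  assumes [measurable]: "X \<in> borel_measurable M" "Y \<in> borel_measurable M"
    and "integrable M (\<lambda>w. (X w)\<^sup>2)" "integrable M (\<lambda>w. (Y w)\<^sup>2 :: real)"
  shows "integrable M (\<lambda>w. (X w + Y w)\<^sup>2)"
  using assms integrable_mult_of_squares[OF assms] by (simp add: power2_sum mult.assoc)

text \<open>On the coarse level the summands converge in \<open>L\<^sup>2\<close> to the payoff itself.\<close>

lemma coarse_level_char:
  fixes R m :: "nat \<Rightarrow> nat"
  assumes R: "filterlim R at_top sequentially" and m: "filterlim m at_top sequentially"
  shows "(\<lambda>n. char (distr M borel (\<lambda>w. f (Zn (m n) w) - expectation (\<lambda>w. f (Zn (m n) w)))) (t / sqrt (R n)) ^ R n)
    \<longlonglongrightarrow> exp (- (t\<^sup>2 * variance (\<lambda>w. f (Z w)) / 2))"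
proof (rule char_power_tendsto_perturbed[where X="\<lambda>n w. f (Z w) - expectation (\<lambda>w. f (Z w))"])
  let ?X = "\<lambda>w. f (Z w) - expectation (\<lambda>w. f (Z w))" and ?V = "\<lambda>n w. quot n w * (trap n w - avg w)"
  have IX: "integrable M (\<lambda>w. (?X w)\<^sup>2)" using f_square f_Z_integrable by (simp add: power2_diff)
  then show "integrable M (\<lambda>w. (?X w)\<^sup>2)" .
  have IV: "integrable M (?V n)" "integrable M (\<lambda>w. (?V n w)\<^sup>2)" for n
    by (intro all_moments_integrable bounded_moments_power all_moments_increment_n)+
  have EV: "expectation (\<lambda>w. f (Zn n w)) = expectation (\<lambda>w. f (Z w)) + expectation (?V n)" for n
    unfolding f_Zn_eq using f_Z_integrable IV(1)[of n] by simp
  \<comment> \<open>The centred summand is the centred payoff plus a centred error, so its squared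
    distance from the former is a variance, which is at most a second moment.\<close>
  have U: "f (Zn n w) - expectation (\<lambda>w. f (Zn n w)) = ?X w + (?V n w - expectation (?V n))" for n w
    unfolding EV by (simp add: f_Zn_eq)
  have IV': "integrable M (\<lambda>w. (?V n w - expectation (?V n))\<^sup>2)" for n
    using IV[of n] by (simp add: power2_diff)
  show "integrable M (\<lambda>w. (f (Zn (m n) w) - expectation (\<lambda>w. f (Zn (m n) w)))\<^sup>2)" for n
    unfolding U by (intro square_integrable_add IX IV') measurable
  show "expectation (\<lambda>w. f (Zn (m n) w) - expectation (\<lambda>w. f (Zn (m n) w))) = 0" for n
    using f_Zn_integrable[of "m n"] by (simp add: prob_space)
  show "(\<lambda>n. variance (\<lambda>w. f (Z w))) \<longlonglongrightarrow> variance (\<lambda>w. f (Z w))" by simp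
  show "(\<lambda>n. expectation (\<lambda>w. (f (Zn (m n) w) - expectation (\<lambda>w. f (Zn (m n) w)) - ?X w)\<^sup>2)) \<longlonglongrightarrow> 0"
  proof (rule tendsto_sandwich[OF _ _ tendsto_const])
    show "(\<lambda>n. expectation (\<lambda>w. (?V (m n) w)\<^sup>2)) \<longlonglongrightarrow> 0" by (rule filterlim_compose[OF increment_tendsto m])
    show "\<forall>\<^sub>F n in sequentially. expectation (\<lambda>w. (f (Zn (m n) w) - expectation (\<lambda>w. f (Zn (m n) w)) - ?X w)\<^sup>2)
        \<le> expectation (\<lambda>w. (?V (m n) w)\<^sup>2)"
      unfolding U using variance_eq[OF IV] by simp
  qed simp
  show "(\<lambda>n. expectation (\<lambda>w. min (24 * (?X w)\<^sup>2) (8 * \<bar>t / sqrt (R n)\<bar> * \<bar>?X w\<bar> ^ 3))) \<longlonglongrightarrow> 0"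
  proof -
    \<comment> \<open>Only second moments of the payoff are assumed, so the Lindeberg term is
      treated by domination with \<open>24 * (?X w)\<^sup>2\<close> and not by a third
      moment.\<close>
    have "(\<lambda>n. expectation (\<lambda>w. min (24 * (?X w)\<^sup>2) (8 * \<bar>t / sqrt (R n)\<bar> * \<bar>?X w\<bar> ^ 3))) \<longlonglongrightarrow> expectation (\<lambda>w. min (24 * (?X w)\<^sup>2) (8 * 0 * \<bar>?X w\<bar> ^ 3))"
    proof (rule integral_dominated_convergence[where w="\<lambda>w. 24 * (?X w)\<^sup>2"])
      show "AE w in M. (\<lambda>n. min (24 * (?X w)\<^sup>2) (8 * \<bar>t / sqrt (R n)\<bar> * \<bar>?X w\<bar> ^ 3)) \<longlonglongrightarrow> min (24 * (?X w)\<^sup>2) (8 * 0 * \<bar>?X w\<bar> ^ 3)"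
        by (intro AE_I2 tendsto_min tendsto_mult tendsto_const tendsto_rabs_zero real_tendsto_divide_at_top[OF tendsto_const]
            filterlim_compose[OF sqrt_at_top] filterlim_compose[OF filterlim_real_sequentially R])
    qed (use IX in auto)
    then show ?thesis by simp
  qed
qed (use R in measurable)

text \<open>On the fine level, the coarse error \<open>f (S\<^sub>T, I\<^sup>m) - f (S\<^sub>T, I)\<close> dominates, and \<open>\<surd>R\<close> matches \<open>n / m\<close>.\<close>

lemma fine_level_char:
  fixes R m :: "nat \<Rightarrow> nat"
  assumes R: "filterlim R at_top sequentially" and m: "filterlim m at_top sequentially"
    and mn: "(\<lambda>n. real (m n) / real n) \<longlonglongrightarrow> 0" and norm: "(\<lambda>n. real n / (real (m n) * sqrt (R n))) \<longlonglongrightarrow> 1"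
    and m_pos: "\<And>n. n > 0 \<Longrightarrow> m n > 0"
  defines "\<Delta> \<equiv> \<lambda>n w. f (Zn n w) - f (Zn (m n) w)"
  shows "(\<lambda>n. char (distr M borel (\<lambda>w. real n / sqrt (R n) * (\<Delta> n w - expectation (\<Delta> n)))) (t / sqrt (R n)) ^ R n)
    \<longlonglongrightarrow> exp (- (t\<^sup>2 * expectation (\<lambda>w. (partial2 f (Z w))\<^sup>2 * limit_var w) / 2))"
proof (rule char_power_tendsto_perturbed[where X="\<lambda>n w. - ferr (m n) w"])
  \<comment> \<open>After normalisation \<open>\<kappa>\<close> is the weight of the coarse error
    and \<open>\<rho>\<close> that of the fine one. The first tends to 1, the second to 0 because
    the coarse step number is negligible against \<open>n\<close>.\<close>
  define \<kappa> where "\<kappa> n = real n / (real (m n) * sqrt (R n))" for n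
  define \<rho> where "\<rho> n = \<kappa> n * (real (m n) / real n)" for n
  have \<kappa>: "\<kappa> \<longlonglongrightarrow> 1" unfolding \<kappa>_def[abs_def] by (rule norm)
  have \<rho>: "\<rho> \<longlonglongrightarrow> 0" unfolding \<rho>_def[abs_def] using tendsto_mult[OF \<kappa> mn] by simp
  note int = all_moments_integrable bounded_moments_power bounded_moments_diff bounded_moments_add bounded_moments_uminus bounded_moments_const all_moments_ferr
  have ferrm[measurable]: "ferr n \<in> borel_measurable M" for n by (rule all_moments_measurable[OF all_moments_ferr])
  have I\<Delta>: "integrable M (\<Delta> n)" for n unfolding \<Delta>_def by (intro Bochner_Integration.integrable_diff f_Zn_integrable)
  define A where "A n w = real n / sqrt (R n) * \<Delta> n w" for n w
  have A: "A n w = \<rho> n * ferr n w - \<kappa> n * ferr (m n) w" for n w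
  proof (cases "n = 0")
    case False
    with m_pos[of n] have "\<rho> n * real n = real n / sqrt (R n)" "\<kappa> n * real (m n) = real n / sqrt (R n)"
      by (simp_all add: \<rho>_def \<kappa>_def)
    then show ?thesis unfolding A_def \<Delta>_def ferr_def mult.assoc[symmetric] by (simp only: right_diff_distrib)
  qed (simp add: A_def \<rho>_def \<kappa>_def)
  have IA: "all_moments (A n)" for n
    unfolding A[abs_def] by (intro bounded_moments_diff bounded_moments_mult bounded_moments_const all_moments_ferr)
  have U: "real n / sqrt (R n) * (\<Delta> n w - expectation (\<Delta> n)) = A n w - expectation (A n)" for n w
    unfolding A_def using I\<Delta>[of n] by (simp add: right_diff_distrib)
  have "all_moments (\<lambda>w. real n / sqrt (R n) * (\<Delta> n w - expectation (\<Delta> n)))" for n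
    unfolding U by (intro bounded_moments_diff IA bounded_moments_const)
  then show "integrable M (\<lambda>w. (real n / sqrt (R n) * (\<Delta> n w - expectation (\<Delta> n)))\<^sup>2)"
    and "(\<lambda>w. real n / sqrt (R n) * (\<Delta> n w - expectation (\<Delta> n))) \<in> borel_measurable M" for n
    by (rule all_moments_integrable[OF bounded_moments_power], rule all_moments_measurable)
  show "expectation (\<lambda>w. real n / sqrt (R n) * (\<Delta> n w - expectation (\<Delta> n))) = 0" for n
    using I\<Delta>[of n] by (simp add: prob_space)
  show "integrable M (\<lambda>w. (- ferr (m n) w)\<^sup>2)" for n by (intro int)
  show "(\<lambda>n. expectation (\<lambda>w. (- ferr (m n) w)\<^sup>2)) \<longlonglongrightarrow> expectation (\<lambda>w. (partial2 f (Z w))\<^sup>2 * limit_var w)"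
    using filterlim_compose[OF ferr_square m] by simp
  have EA: "(\<lambda>n. expectation (A n)) \<longlonglongrightarrow> 0"
  proof -
    have "expectation (A n) = \<rho> n * expectation (ferr n) - \<kappa> n * expectation (ferr (m n))" for n
      unfolding A[abs_def] using all_moments_integrable[OF all_moments_ferr] by simp
    moreover have "(\<lambda>n. \<rho> n * expectation (ferr n) - \<kappa> n * expectation (ferr (m n))) \<longlonglongrightarrow> 0 * 0 - 1 * 0"
      by (intro tendsto_diff tendsto_mult \<rho> \<kappa> ferr_mean filterlim_compose[OF ferr_mean m])
    ultimately show ?thesis by simp
  qed
  show "(\<lambda>n. expectation (\<lambda>w. (real n / sqrt (R n) * (\<Delta> n w - expectation (\<Delta> n)) - - ferr (m n) w)\<^sup>2)) \<longlonglongrightarrow> 0"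
  proof (rule tendsto_sandwich[OF _ _ tendsto_const])
    \<comment> \<open>Three contributions: the fine error with its weight \<open>\<rho>\<close>, the
      deviation of \<open>\<kappa>\<close> from 1, and the centring.\<close>
    let ?b = "\<lambda>n. 3 * ((\<rho> n)\<^sup>2 * expectation (\<lambda>w. (ferr n w)\<^sup>2) + (1 - \<kappa> n)\<^sup>2 * expectation (\<lambda>w. (ferr (m n) w)\<^sup>2) + (expectation (A n))\<^sup>2)"
    have "?b \<longlonglongrightarrow> 3 * (0\<^sup>2 * expectation (\<lambda>w. (partial2 f (Z w))\<^sup>2 * limit_var w) + (1 - 1)\<^sup>2 * expectation (\<lambda>w. (partial2 f (Z w))\<^sup>2 * limit_var w) + 0\<^sup>2)"
      by (intro tendsto_mult tendsto_add tendsto_power tendsto_const \<rho> \<kappa> tendsto_diff ferr_square filterlim_compose[OF ferr_square m] EA)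
    then show "?b \<longlonglongrightarrow> 0" by simp
    have "expectation (\<lambda>w. (real n / sqrt (R n) * (\<Delta> n w - expectation (\<Delta> n)) - - ferr (m n) w)\<^sup>2) \<le> ?b n" for n
    proof -
      have sq: "(a + b - c)\<^sup>2 \<le> 3 * (a\<^sup>2 + b\<^sup>2 + c\<^sup>2)" for a b c :: real
      proof -
        have "3 * (a\<^sup>2 + b\<^sup>2 + c\<^sup>2) - (a + b - c)\<^sup>2 = (a - b)\<^sup>2 + (a + c)\<^sup>2 + (b + c)\<^sup>2" by (simp add: power2_eq_square algebra_simps)
        moreover have "0 \<le> (a - b)\<^sup>2 + (a + c)\<^sup>2 + (b + c)\<^sup>2" by simp
        ultimately show ?thesis by linarith
      qed
      have I: "integrable M (\<lambda>w. (ferr n w)\<^sup>2)" "integrable M (\<lambda>w. (ferr (m n) w)\<^sup>2)" by (intro int)+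
      have "expectation (\<lambda>w. (real n / sqrt (R n) * (\<Delta> n w - expectation (\<Delta> n)) - - ferr (m n) w)\<^sup>2)
          = expectation (\<lambda>w. (\<rho> n * ferr n w + (1 - \<kappa> n) * ferr (m n) w - expectation (A n))\<^sup>2)"
        unfolding U unfolding A by (simp add: algebra_simps)
      also have "\<dots> \<le> expectation (\<lambda>w. 3 * ((\<rho> n * ferr n w)\<^sup>2 + ((1 - \<kappa> n) * ferr (m n) w)\<^sup>2 + (expectation (A n))\<^sup>2))"
      proof (rule integral_mono[OF _ _ sq])
        show "integrable M (\<lambda>w. (\<rho> n * ferr n w + (1 - \<kappa> n) * ferr (m n) w - expectation (A n))\<^sup>2)"
          by (intro all_moments_integrable bounded_moments_power bounded_moments_diff bounded_moments_add bounded_moments_mult bounded_moments_const all_moments_ferr)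
        show "integrable M (\<lambda>w. 3 * ((\<rho> n * ferr n w)\<^sup>2 + ((1 - \<kappa> n) * ferr (m n) w)\<^sup>2 + (expectation (A n))\<^sup>2))"
          using I by (simp add: power_mult_distrib)
      qed
      also have "\<dots> = ?b n" using I by (simp add: power_mult_distrib prob_space)
      finally show ?thesis .
    qed
    then show "\<forall>\<^sub>F n in sequentially. expectation (\<lambda>w. (real n / sqrt (R n) * (\<Delta> n w - expectation (\<Delta> n)) - - ferr (m n) w)\<^sup>2) \<le> ?b n" by simp
  qed simp
  obtain B where B: "B > 0" "\<And>n. expectation (\<lambda>w. \<bar>ferr n w\<bar> ^ 3) \<le> B" using ferr_third_moment by blast
  show "(\<lambda>n. expectation (\<lambda>w. min (24 * (- ferr (m n) w)\<^sup>2) (8 * \<bar>t / sqrt (R n)\<bar> * \<bar>- ferr (m n) w\<bar> ^ 3))) \<longlonglongrightarrow> 0"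
  proof (rule tendsto_sandwich[OF _ _ tendsto_const])
    have "(\<lambda>n. 8 * \<bar>t / sqrt (R n)\<bar> * B) \<longlonglongrightarrow> 8 * 0 * B"
      by (intro tendsto_mult tendsto_const tendsto_rabs_zero real_tendsto_divide_at_top[OF tendsto_const]
          filterlim_compose[OF sqrt_at_top] filterlim_compose[OF filterlim_real_sequentially R])
    then show "(\<lambda>n. 8 * \<bar>t / sqrt (R n)\<bar> * B) \<longlonglongrightarrow> 0" by simp
    have "expectation (\<lambda>w. min (24 * (- ferr (m n) w)\<^sup>2) (8 * \<bar>t / sqrt (R n)\<bar> * \<bar>- ferr (m n) w\<bar> ^ 3)) \<le> 8 * \<bar>t / sqrt (R n)\<bar> * B" for n
    proof -
      have I3: "integrable M (\<lambda>w. \<bar>- ferr (m n) w\<bar> ^ 3)" and I2: "integrable M (\<lambda>w. (- ferr (m n) w)\<^sup>2)"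
        by (intro all_moments_integrable bounded_moments_power bounded_moments_abs bounded_moments_uminus all_moments_ferr)+
      have "expectation (\<lambda>w. min (24 * (- ferr (m n) w)\<^sup>2) (8 * \<bar>t / sqrt (R n)\<bar> * \<bar>- ferr (m n) w\<bar> ^ 3))
          \<le> expectation (\<lambda>w. 8 * \<bar>t / sqrt (R n)\<bar> * \<bar>- ferr (m n) w\<bar> ^ 3)"
        by (rule integral_mono[OF Bochner_Integration.integrable_bound[OF integrable_mult_right[OF I2, of 24]] integrable_mult_right[OF I3]]) auto
      also have "\<dots> = 8 * \<bar>t / sqrt (R n)\<bar> * expectation (\<lambda>w. \<bar>ferr (m n) w\<bar> ^ 3)" by simp
      also have "\<dots> \<le> 8 * \<bar>t / sqrt (R n)\<bar> * B" by (intro mult_left_mono B(2)) simp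
      finally show ?thesis .
    qed
    then show "\<forall>\<^sub>F n in sequentially. expectation (\<lambda>w. min (24 * (- ferr (m n) w)\<^sup>2) (8 * \<bar>t / sqrt (R n)\<bar> * \<bar>- ferr (m n) w\<bar> ^ 3))
        \<le> 8 * \<bar>t / sqrt (R n)\<bar> * B" by simp
  qed (auto intro!: always_eventually integral_nonneg_AE AE_I2)
  show "(\<lambda>w. - ferr (m n) w) \<in> borel_measurable M" for n by measurable
qed (rule R)

text \<open>The centring constants telescope: the coarse mean plus the mean correction is the mean
  on the fine level. Subtracting the true expectation therefore leaves the bias
  \<open>expectation (ferr n)\<close> as a deterministic shift beside two independent centred
  sums.\<close>

proposition estimator_char_tendsto:
  fixes X :: "nat \<Rightarrow> nat \<Rightarrow> 'c \<Rightarrow> real \<times> real \<times> real" and Y :: "nat \<Rightarrow> nat \<Rightarrow> 'c \<Rightarrow> real \<times> real"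
  assumes \<beta>: "0 < \<beta>" "\<beta> < 1" and N: "prob_space N"
    and X: "\<And>n. n \<ge> 1 \<Longrightarrow> iid_copies N (X n) M (\<lambda>w. (S T w, trap n w, trap (floor_powr n \<beta>) w))"
    and Y: "\<And>n. n \<ge> 1 \<Longrightarrow> iid_copies N (Y n) M (\<lambda>w. (S T w, trap (floor_powr n \<beta>) w))"
    and XY: "\<And>n. n \<ge> 1 \<Longrightarrow> indep_processes N {1..} (X n) (Y n)"
  defines "Q \<equiv> \<lambda>n w. real n * (two_level_estimator f (floor_powr n 2) (floor_powr n (2 - 2 * \<beta>)) (Y n) (X n) w - expectation (\<lambda>w. f (Z w)))"
  shows "Q n \<in> borel_measurable N"
    and "(\<lambda>n. char (distr N borel (Q n)) t) \<longlonglongrightarrow>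
      exp (- (t\<^sup>2 * (variance (\<lambda>w. f (Z w)) + expectation (\<lambda>w. (partial2 f (Z w))\<^sup>2 * limit_var w)) / 2))"
proof -
  interpret N: prob_space N by (rule N)
  define m R where "m n = floor_powr n \<beta>" and "R n = floor_powr n (2 - 2 * \<beta>)" for n
  \<comment> \<open>For the exponent 2 the integer part is exact, so the coarse sum has
    \<open>n\<^sup>2\<close> terms and its factor \<open>n / n\<^sup>2\<close> equals
    \<open>1 / sqrt (n\<^sup>2)\<close>.\<close>
  have R1: "floor_powr n 2 = n\<^sup>2" for n
  proof -
    have "real n powr 2 = of_int (int (n\<^sup>2))" by (cases "n = 0") (simp_all add: powr_numeral)
    then show ?thesis unfolding floor_powr_def by (simp only: floor_of_int nat_int)
  qed
  have R1_top: "filterlim (\<lambda>n::nat. n\<^sup>2) at_top sequentially" using floor_powr_at_top[of 2] by (simp add: R1)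
  have m_top: "filterlim m at_top sequentially" and R_top: "filterlim R at_top sequentially"
    unfolding m_def[abs_def] R_def[abs_def] using \<beta> by (auto intro!: floor_powr_at_top)
  have m_pos: "n > 0 \<Longrightarrow> m n > 0" and R_pos: "n > 0 \<Longrightarrow> R n > 0" for n
    unfolding m_def R_def using \<beta> by (auto intro!: floor_powr_pos)
  let ?\<mu> = "expectation (\<lambda>w. f (Z w))"
  define \<Delta> where "\<Delta> n w = f (Zn n w) - f (Zn (m n) w)" for n w
  define a b where "a n = expectation (\<lambda>w. f (Zn (m n) w))" and "b n = expectation (\<Delta> n)" for n
  \<comment> \<open>The factor \<open>n / R n\<close> of the correction sum is written as
    \<open>1 / sqrt (R n)\<close> times \<open>n / sqrt (R n)\<close>, the latter being part of the
    summand; this is the form in which the fine level has been treated.\<close>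
  define \<phi> where "\<phi> n z = real n / sqrt (R n) * (f (fst z, fst (snd z)) - f (fst z, snd (snd z)) - b n)" for n and z :: "real \<times> real \<times> real"
  define A where "A n w = 1 / sqrt (R n) * (\<Sum>i=1..R n. \<phi> n (X n i w))" for n w
  define D where "D n w = 1 / sqrt (real (n\<^sup>2)) * (\<Sum>i=1..n\<^sup>2. f (Y n i w) - a n)" for n w
  have \<phi>m[measurable]: "\<phi> n \<in> borel_measurable borel" for n
  proof -
    have "(\<lambda>z :: real \<times> real \<times> real. f (fst z, fst (snd z))) \<in> borel_measurable borel" "(\<lambda>z :: real \<times> real \<times> real. f (fst z, snd (snd z))) \<in> borel_measurable borel"
      by (intro measurable_compose[OF borel_measurable_continuous_onI f_measurable] continuous_intros)+
    then show ?thesis unfolding \<phi>_def[abs_def] by measurable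
  qed
  have ind: "N.indep_var borel (A n) borel (D n)" if "n \<ge> 1" for n
    unfolding A_def[abs_def] D_def[abs_def] by (rule N.indep_var_sums[OF XY[OF that]]) measurable
  have Q: "Q n w = A n w + D n w + expectation (ferr n)" if n: "n \<ge> 1" for n w
  proof -
    have "expectation (ferr n) = real n * (expectation (\<lambda>w. f (Zn n w)) - ?\<mu>)"
      unfolding ferr_def[abs_def] using f_Zn_integrable[of n] f_Z_integrable by simp
    also have "expectation (\<lambda>w. f (Zn n w)) = a n + b n"
      unfolding a_def b_def \<Delta>_def[abs_def] using f_Zn_integrable by simp
    finally have e: "expectation (ferr n) = real n * (a n + b n - ?\<mu>)" .
    have "A n w = real n / real (R n) * (\<Sum>i=1..R n. case X n i w of (x, y1, y2) \<Rightarrow> f (x, y1) - f (x, y2)) - real n * b n"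
    proof -
      have "A n w = real n / (sqrt (R n) * sqrt (R n)) * (\<Sum>i=1..R n. (case X n i w of (x, y1, y2) \<Rightarrow> f (x, y1) - f (x, y2)) - b n)"
        by (simp add: A_def \<phi>_def sum_distrib_left case_prod_unfold)
      also have "\<dots> = real n / real (R n) * (\<Sum>i=1..R n. case X n i w of (x, y1, y2) \<Rightarrow> f (x, y1) - f (x, y2)) - real n * b n"
        using R_pos[of n] n by (simp add: sum_subtractf right_diff_distrib)
      finally show ?thesis .
    qed
    moreover have "D n w = real n / real (n\<^sup>2) * (\<Sum>i=1..n\<^sup>2. f (Y n i w)) - real n * a n"
      using n by (simp add: D_def sum_subtractf right_diff_distrib power2_eq_square)
    ultimately show ?thesis
      unfolding Q_def two_level_estimator_def e R1 R_def[symmetric] by (simp add: algebra_simps)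
  qed
  have QM: "Q n \<in> borel_measurable N" for n
  proof (cases "n = 0")
    case False
    then have n: "n \<ge> 1" by simp
    then have [measurable]: "A n \<in> borel_measurable N" "D n \<in> borel_measurable N"
      using N.indep_var_rv1[OF ind] N.indep_var_rv2[OF ind] by auto
    show ?thesis unfolding Q[OF n, abs_def] by measurable
  qed (simp add: Q_def)
  show "Q n \<in> borel_measurable N" by (rule QM)
  have ch: "char (distr N borel (Q n)) t =
      char (distr M borel (\<lambda>w. real n / sqrt (R n) * (\<Delta> n w - expectation (\<Delta> n)))) (t / sqrt (R n)) ^ R n *
      char (distr M borel (\<lambda>w. f (Zn (m n) w) - expectation (\<lambda>w. f (Zn (m n) w)))) (t / sqrt (real (n\<^sup>2))) ^ n\<^sup>2 *
      iexp (t * expectation (ferr n))" if n: "n \<ge> 1" for n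
  proof -
    have [measurable]: "A n \<in> borel_measurable N" "D n \<in> borel_measurable N"
      using N.indep_var_rv1[OF ind[OF n]] N.indep_var_rv2[OF ind[OF n]] by auto
    have "char (distr N borel (Q n)) t = char (distr N borel (A n)) t * char (distr N borel (D n)) t * iexp (t * expectation (ferr n))"
      unfolding Q[OF n, abs_def] by (subst N.char_distr_add_const) (measurable, simp add: N.char_distr_add[OF ind[OF n]])
    also have "char (distr N borel (A n)) t = char (distr M borel (\<lambda>w. \<phi> n (S T w, trap n w, trap (m n) w))) (t * (1 / sqrt (R n))) ^ R n"
      unfolding A_def[abs_def] by (rule N.char_scaled_sum_iid[OF X[OF n, folded m_def]]) measurable
    also have "char (distr N borel (D n)) t = char (distr M borel (\<lambda>w. f (Zn (m n) w) - a n)) (t * (1 / sqrt (real (n\<^sup>2)))) ^ n\<^sup>2"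
      unfolding D_def[abs_def] by (rule N.char_scaled_sum_iid[OF Y[OF n, folded m_def]]) measurable
    finally show ?thesis by (simp add: \<phi>_def \<Delta>_def a_def b_def)
  qed
  have "(\<lambda>n. char (distr M borel (\<lambda>w. real n / sqrt (R n) * (\<Delta> n w - expectation (\<Delta> n)))) (t / sqrt (R n)) ^ R n *
      char (distr M borel (\<lambda>w. f (Zn (m n) w) - expectation (\<lambda>w. f (Zn (m n) w)))) (t / sqrt (real (n\<^sup>2))) ^ n\<^sup>2 *
      iexp (t * expectation (ferr n)))
    \<longlonglongrightarrow> complex_of_real (exp (- (t\<^sup>2 * expectation (\<lambda>w. (partial2 f (Z w))\<^sup>2 * limit_var w) / 2))) * complex_of_real (exp (- (t\<^sup>2 * variance (\<lambda>w. f (Z w)) / 2))) * iexp (t * 0)"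
  proof (intro tendsto_mult)
    show "(\<lambda>n. char (distr M borel (\<lambda>w. real n / sqrt (R n) * (\<Delta> n w - expectation (\<Delta> n)))) (t / sqrt (R n)) ^ R n)
      \<longlonglongrightarrow> exp (- (t\<^sup>2 * expectation (\<lambda>w. (partial2 f (Z w))\<^sup>2 * limit_var w) / 2))"
      unfolding \<Delta>_def[abs_def] using coarse_over_fine[OF \<beta>] normalisation_tendsto[OF \<beta>]
      by (intro fine_level_char R_top m_top m_pos) (auto simp: m_def R_def)
    show "(\<lambda>n. char (distr M borel (\<lambda>w. f (Zn (m n) w) - expectation (\<lambda>w. f (Zn (m n) w)))) (t / sqrt (real (n\<^sup>2))) ^ n\<^sup>2)
      \<longlonglongrightarrow> exp (- (t\<^sup>2 * variance (\<lambda>w. f (Z w)) / 2))"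
      by (rule coarse_level_char[OF R1_top m_top])
    show "(\<lambda>n. iexp (t * expectation (ferr n))) \<longlonglongrightarrow> iexp (t * 0)"
      by (intro tendsto_exp tendsto_mult tendsto_of_real tendsto_const ferr_mean)
  qed
  moreover have "\<forall>\<^sub>F n in sequentially. char (distr M borel (\<lambda>w. real n / sqrt (R n) * (\<Delta> n w - expectation (\<Delta> n)))) (t / sqrt (R n)) ^ R n *
      char (distr M borel (\<lambda>w. f (Zn (m n) w) - expectation (\<lambda>w. f (Zn (m n) w)))) (t / sqrt (real (n\<^sup>2))) ^ n\<^sup>2 *
      iexp (t * expectation (ferr n)) = char (distr N borel (Q n)) t"
    using eventually_ge_at_top[of 1] by eventually_elim (rule ch[symmetric])
  ultimately have "(\<lambda>n. char (distr N borel (Q n)) t) \<longlonglongrightarrow>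
      complex_of_real (exp (- (t\<^sup>2 * expectation (\<lambda>w. (partial2 f (Z w))\<^sup>2 * limit_var w) / 2))) * complex_of_real (exp (- (t\<^sup>2 * variance (\<lambda>w. f (Z w)) / 2))) * iexp (t * 0)"
    by (rule Lim_transform_eventually)
  moreover have "exp (- (t\<^sup>2 * x / 2)) * exp (- (t\<^sup>2 * y / 2)) = exp (- (t\<^sup>2 * (y + x) / 2))" for x y :: real
    unfolding exp_add[symmetric] by (simp add: field_simps)
  ultimately show "(\<lambda>n. char (distr N borel (Q n)) t) \<longlonglongrightarrow>
      exp (- (t\<^sup>2 * (variance (\<lambda>w. f (Z w)) + expectation (\<lambda>w. (partial2 f (Z w))\<^sup>2 * limit_var w)) / 2))"
    by (simp flip: of_real_mult del: of_real_exp)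
qed

end

theorem theorem4p2:
  fixes T S0 r \<sigma> :: real
    and M :: "'a measure" and F :: "real \<Rightarrow> 'a measure" and W :: "real \<Rightarrow> 'a \<Rightarrow> real"
    and Mh :: "'b measure" and Fh :: "real \<Rightarrow> 'b measure" and \<pi> :: "'b \<Rightarrow> 'a"
    and B' :: "real \<Rightarrow> 'b \<Rightarrow> real" and J chi :: "'b \<Rightarrow> real"
    and ST IT :: "'a \<Rightarrow> real" and In :: "nat \<Rightarrow> 'a \<Rightarrow> real"
    and f :: "real \<times> real \<Rightarrow> real" and C p \<beta> \<gamma>1 \<gamma>2 :: real
    and N :: "'c measure"
    and X :: "nat \<Rightarrow> nat \<Rightarrow> 'c \<Rightarrow> real \<times> real \<times> real"
    and Y :: "nat \<Rightarrow> nat \<Rightarrow> 'c \<Rightarrow> real \<times> real"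
    and E :: "nat \<Rightarrow> 'c \<Rightarrow> real"
    and L :: "'d measure" and G :: "'d \<Rightarrow> real" and \<sigma>2 :: real
  assumes "T > 0" and "S0 > 0" and "\<sigma> > 0"
    and "stochastic_basis M F T"
    and "standard_brownian_motion M F T W"
    and ST_def: "ST = asset_price S0 r \<sigma> W T"
    and IT_def: "IT = average_price T S0 r \<sigma> W"
    and In_def: "In = trapezoidal_scheme T S0 r \<sigma> W"
    \<comment> \<open>the extension of the basis and the limit variable \<open>chi\<close>\<close>
    and "basis_extension M F Mh Fh T \<pi>"
    and "standard_brownian_motion Mh Fh T B'"
    and "indep_processes Mh {0..T} (\<lambda>t \<omega>. W t (\<pi> \<omega>)) B'"
    and "has_ito_integral Mh Fh T B' (\<lambda>t \<omega>. asset_price S0 r \<sigma> W t (\<pi> \<omega>)) J"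
    and chi_def: "chi = (\<lambda>\<omega>. \<sigma> / (2 * sqrt 3) * J \<omega>)"
    \<comment> \<open>the payoff\<close>
    and "f \<in> borel_measurable borel"
    and "integrable M (\<lambda>\<omega>. \<bar>f (ST \<omega>, IT \<omega>)\<bar>\<^sup>2)"
    and "C > 0" and "p > 0"
    and "\<And>x y1 y2. \<bar>f (x, y1) - f (x, y2)\<bar>
           \<le> C * (1 + \<bar>x\<bar> powr p + \<bar>y1\<bar> powr p + \<bar>y2\<bar> powr p) * \<bar>y1 - y2\<bar>"
    and "AE \<omega> in M. (ST \<omega>, IT \<omega>) \<in> partial2_domain f"
    and "0 < \<beta>" and "\<beta> < 1" and "\<gamma>1 = 2" and "\<gamma>2 = 2 - 2 * \<beta>"
    \<comment> \<open>the samples\<close>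
    and "prob_space N"
    and "\<And>n. n \<ge> 1 \<Longrightarrow>
           iid_copies N (X n) M (\<lambda>\<omega>. (ST \<omega>, In n \<omega>, In (floor_powr n \<beta>) \<omega>))"
    and "\<And>n. n \<ge> 1 \<Longrightarrow>
           iid_copies N (Y n) M (\<lambda>\<omega>. (ST \<omega>, In (floor_powr n \<beta>) \<omega>))"
    and "\<And>n. n \<ge> 1 \<Longrightarrow> indep_processes N {1..} (X n) (Y n)"
    and E_def: "E = (\<lambda>n. two_level_estimator f (floor_powr n \<gamma>1) (floor_powr n \<gamma>2) (Y n) (X n))"
    \<comment> \<open>the limit law\<close>
    and "prob_space L" and "distributed L lborel G std_normal_density"
    and "\<sigma>2\<^sup>2 = prob_space.variance M (\<lambda>\<omega>. f (ST \<omega>, IT \<omega>)) +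
                prob_space.variance Mh (\<lambda>\<omega>. partial2 f (ST (\<pi> \<omega>), IT (\<pi> \<omega>)) * chi \<omega>)"
  shows "weak_conv_m
           (\<lambda>n. distr N borel (\<lambda>\<omega>. real n * (E n \<omega> - prob_space.expectation M (\<lambda>\<omega>. f (ST \<omega>, IT \<omega>)))))
           (distr L borel (\<lambda>\<omega>. \<sigma>2 * G \<omega> +
              prob_space.expectation Mh (\<lambda>\<omega>. partial2 f (ST (\<pi> \<omega>), IT (\<pi> \<omega>)) * chi \<omega>)))"
proof -
  have "prob_space M" "prob_space Mh" using assms(4,9) by (auto simp: stochastic_basis_def basis_extension_def)
  have bM: "brownian M F T W"
    by (intro brownian.intro brownian_axioms.intro \<open>prob_space M\<close> assms(1,4,5))
  have bMh: "brownian Mh Fh T B'"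
    using assms(9) by (intro brownian.intro brownian_axioms.intro \<open>prob_space Mh\<close> assms(1,10)) (simp add: basis_extension_def)
  interpret ext: black_scholes_extension M F T W S0 r \<sigma> Mh Fh B' \<pi> J
    by (intro black_scholes_extension.intro black_scholes.intro black_scholes_extension_axioms.intro bM bMh assms(9,11,12))
  interpret pay: payoff M F T W S0 r \<sigma> f C p
    using assms(14-19) by (intro payoff.intro payoff_axioms.intro ext.black_scholes_axioms) (simp_all add: ST_def IT_def)
  interpret L: prob_space L by (rule \<open>prob_space L\<close>)
  interpret N: prob_space N by (rule \<open>prob_space N\<close>)
  let ?g = "\<lambda>w. partial2 f (ST (\<pi> w), IT (\<pi> w))"
  note J = ext.J_weighted_moments[OF pay.partial2_f_measurable pay.all_moments_partial2, folded ST_def IT_def]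
  have gchi: "?g w * chi w = \<sigma> / (2 * sqrt 3) * (?g w * J w)" for w by (simp add: chi_def)
  \<comment> \<open>Given \<open>W\<close> the Ito integral is centred, so the shift in the limit
    law is 0; it corresponds to the vanishing bias of the estimator.\<close>
  have mean: "ext.hat.expectation (\<lambda>w. ?g w * chi w) = 0" unfolding gchi using J(1) by simp
  \<comment> \<open>The square of \<open>\<sigma> / (2 * sqrt 3)\<close> is the factor
    \<open>\<sigma>\<^sup>2 / 12\<close> of \<open>limit_var\<close>; in this way the variance on
    the extension becomes a moment on the original basis.\<close>
  have "ext.hat.variance (\<lambda>w. ?g w * chi w) = ext.hat.expectation (\<lambda>w. \<sigma>\<^sup>2 / 12 * (?g w * J w)\<^sup>2)"
    unfolding mean unfolding gchi by (simp add: power_mult_distrib power_divide)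
  also have "\<dots> = ext.expectation (\<lambda>w. (partial2 f (ST w, IT w))\<^sup>2 * ext.limit_var w)"
    unfolding integral_mult_right_zero J(3) unfolding integral_mult_right_zero[symmetric] ext.limit_var_def by (simp add: mult_ac)
  finally have var: "\<sigma>2\<^sup>2 = ext.variance (\<lambda>w. f (ST w, IT w)) + ext.expectation (\<lambda>w. (partial2 f (ST w, IT w))\<^sup>2 * ext.limit_var w)"
    using assms(31) by simp
  have E: "E n = two_level_estimator f (floor_powr n 2) (floor_powr n (2 - 2 * \<beta>)) (Y n) (X n)" for n
    by (simp add: E_def assms(22,23))
  let ?Q = "\<lambda>n w. real n * (E n w - ext.expectation (\<lambda>w. f (ST w, IT w)))"
  note Q = pay.estimator_char_tendsto[OF assms(20,21,24), where X=X and Y=Y, folded ST_def IT_def In_def, OF assms(25,26,27), folded E]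
  have G[measurable]: "G \<in> borel_measurable L" using assms(30) by (auto simp: distributed_def)
  \<comment> \<open>The characteristic function involves \<open>\<sigma>2\<close> only through its
    square, and it is the square that the hypothesis determines.\<close>
  have lim: "char (distr L borel (\<lambda>w. \<sigma>2 * G w)) t = exp (- (t\<^sup>2 * \<sigma>2\<^sup>2 / 2))" for t
  proof -
    have "char (distr L borel (\<lambda>w. \<sigma>2 * G w)) t = char (distr L lborel G) (t * \<sigma>2)"
      unfolding char_def by (simp add: integral_distr mult.assoc)
    also have "distr L lborel G = std_normal_distribution" using distributed_distr_eq_density[OF assms(30)] by simp
    finally show ?thesis by (simp add: char_std_normal_distribution power_mult_distrib)
  qed
  have "weak_conv_m (\<lambda>n. distr N borel (?Q n)) (distr L borel (\<lambda>w. \<sigma>2 * G w))"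
  proof (rule levy_continuity)
    show "real_distribution (distr N borel (?Q n))" for n by (rule N.real_distribution_distr[OF Q(1)])
    show "real_distribution (distr L borel (\<lambda>w. \<sigma>2 * G w))" by (rule L.real_distribution_distr) measurable
    show "(\<lambda>n. char (distr N borel (?Q n)) t) \<longlonglongrightarrow> char (distr L borel (\<lambda>w. \<sigma>2 * G w)) t" for t
      unfolding lim var by (rule Q(2))
  qed
  then show ?thesis unfolding mean by simp
qed

end
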